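(* In the setting described in the context, let $(U_n)_{n\in\mathbb{N}}$ be a sequence of nonzero finite dimensional subspaces of $U$ with $\lim_{n\to\infty}U_n=U$, and let $f\in V'$ and $\xi_0\in H$. Then there is a unique $u\in W$ such that $u'+\mathcal{A}u=f$ and $u(0)-\Phi u(T)=\xi_0$. Let $\theta\in[0,1]$ and let $(N_n)_{n\in\mathbb{N}}$ be a sequence of positive integers tending to infinity, and put $k_n=T/N_n$. Assume: - if $\theta\in[0,\frac12)$: $k_n\le\dfrac{\alpha^2}{24\,\mu_n^2M^3(\frac12-\theta)}$ for all $n$; - if $\theta=\frac12$ and $\|\Phi\|=1$: $\sup_{n\in\mathbb{N}}\frac{\mu_n}{N_n}<\infty$; - if $\theta=\frac12$ and $\|\Phi\|<1$, or if $\theta\in(\frac12,1]$: no additional condition. Then for every $n$ the Euler $\theta$-scheme $$\langle w^{(0)}-\Phi w^{(N_n)},v\rangle_H=\langle\xi_0,v\rangle_H\quad\text{for all }v\in U_n,$$ $$\Big\langle\frac{w^{(m+1)}-w^{(m)}}{k_n},v\Big\rangle_H+\frac1{k_n}\int_{mk_n}^{(m+1)k_n}a\big(t,\theta w^{(m+1)}+(1-\theta)w^{(m)},v\big)dt=\frac1{k_n}\int_{mk_n}^{(m+1)k_n}\langle f(t),v\rangle_{U',U}\,dt$$ for all $m=0,\dots,N_n-1$ and $v\in U_n$, has a unique solution $(w^{(m)})_{m=0,\dots,N_n}$ in $U_n$; and, if $w_n\in W_n$ is the associated step function, then $$\lim_{n\to\infty}\Big(\|u'-\widehat{\partial}w_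n\|_{V'}+\|u-w_n\|_V+\sup_{t\in[0,T]}\|u(t)-w_n(t)\|_H\Big)=0.$$
   Context: All vector spaces are real. Let $T>0$ and let $U,H$ be Hilbert spaces with $U$ continuously and densely embedded in $H$. $H$ is identified with a subspace of $U'$ by $\langle y,u\rangle_{U',U}=\langle y,u\rangle_H$. Put $V=L^2(0,T;U)$, $V'=L^2(0,T;U')$, $\mathbb{H}=L^2(0,T;H)$. $W=H^1(0,T;U')\cap L^2(0,T;U)$ is the space of $u\in V$ having a weak derivative $u'\in V'$, i.e. $\langle u',v\rangle_{V',V}=-\langle u,v'\rangle_{\mathbb{H}}$ for all $v\in C^1_c((0,T);U)$; elements of $W$ are identified with their continuous representatives in $C([0,T];H)$. Let $a:[0,T]\times U\times U\to\mathbb{R}$ be such that $a(t,\cdot,\cdot)$ is bilinear for all $t$, $a(\cdot,v,w)$ is measurable for all $v,w\in U$, $|a(t,v,w)|\le M\|v\|_U\|w\|_U$ for a.e. $t$ and all $v,w\in U$, with $M\ge1$, and $a(t,v,v)\ge\alpha\|v\|_U^2$ for all $t\in[0,T]$, $v\in U$, with $\alpha>0$. Define $\mathcal{A}\in\mathcal{L}(V,V')$ by $\langle\mathcal{A}v,w\rangle_{V',V}=\int_0^Ta(t,v(t),w(t))\,dt$. Let $\Phi:H\to H$ be linear with $\|\Phi\|\le1$. $\lim_{n\to\infty}U_n=U$ means that every $u\in U$ is the norm limit in $U$ of some sequence $u_n\in U_n$. $\mu_n=\max\{\|u\|_U/\|u\|_H:u\in U_n\setminus\{0\}\}$. For each $n$: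 $W_n$ is the space of functions $w:[0,T]\to U_n$ for which there are $w^{(0)},\dots,w^{(N_n)}\in U_n$ with $w(mk_n)=w^{(m)}$ for $m=0,\dots,N_n$ and $w(t)=\theta w^{(m+1)}+(1-\theta)w^{(m)}$ for $t\in(mk_n,(m+1)k_n)$, $m=0,\dots,N_n-1$ (this $w$ is the step function associated with the family $(w^{(m)})$). $V_n\subset V$ is the space of functions $(0,T)\to U_n$ constant on each $(mk_n,(m+1)k_n)$, $m=0,\dots,N_n-1$, and $P^V_n$ is the orthogonal projection of $V$ onto $V_n$. For $w\in W_n$ put $\partial w(t)=\frac{w^{(m+1)}-w^{(m)}}{k_n}$ for $t\in(mk_n,(m+1)k_n)$, and define $\widehat{\partial}w\in V'$ by $\langle\widehat{\partial}w,v\rangle_{V',V}=\langle\partial w,P^V_nv\rangle_{\mathbb{H}}$ for all $v\in V$. *)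

theory Defs
  imports "HOL-Analysis.Analysis" "HOL-Library.FuncSet"
begin

section \<open>Bochner spaces on an interval\<close>

text \<open>
  Elements of Lebesgue spaces are represented by functions on the reals, of which only the values
  almost everywhere on \<open>{0..T}\<close> matter. Strong measurability is used instead of Borel
  measurability so that no separability assumption on the range type is needed.
\<close>

definition strongly_measurable :: "'a measure \<Rightarrow> ('a \<Rightarrow> 'b::topological_space) \<Rightarrow> bool" where
  "strongly_measurable M f \<longleftrightarrow>
    (\<exists>s. (\<forall>i. simple_function M (s i)) \<and> (AE t in M. (\<lambda>i::nat. s i t) \<longlonglongrightarrow> f t))"

definition bochner_L2 :: "real \<Rightarrow> (real \<Rightarrow> 'b::real_normed_vector) set" where
  "bochner_L2 T = {f. strongly_measurable (lebesgue_on {0..T}) f \<and>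
                      integrable (lebesgue_on {0..T}) (\<lambda>t. (norm (f t))\<^sup>2)}"

definition bochner_L2_norm :: "real \<Rightarrow> (real \<Rightarrow> 'b::real_normed_vector) \<Rightarrow> real" where
  "bochner_L2_norm T f = sqrt (LINT t|lebesgue_on {0..T}. (norm (f t))\<^sup>2)"

definition bochner_L2_inner :: "real \<Rightarrow> (real \<Rightarrow> 'b::real_inner) \<Rightarrow> (real \<Rightarrow> 'b) \<Rightarrow> real" where
  "bochner_L2_inner T f g = (LINT t|lebesgue_on {0..T}. f t \<bullet> g t)"

text \<open>
  The dual space \<open>U'\<close> is the type \<open>'u \<Rightarrow>\<^sub>L real\<close>, and \<open>V' = L\<^sup>2(0,T;U')\<close> pairs with
  \<open>V = L\<^sup>2(0,T;U)\<close> by integration.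
\<close>

definition dual_pairing ::
    "real \<Rightarrow> (real \<Rightarrow> 'u::real_normed_vector \<Rightarrow>\<^sub>L real) \<Rightarrow> (real \<Rightarrow> 'u) \<Rightarrow> real" where
  "dual_pairing T g v = (LINT t|lebesgue_on {0..T}. blinfun_apply (g t) (v t))"

section \<open>The space \<open>W\<close> and the operator \<open>\<A>\<close>\<close>

text \<open>
  The embedding of \<open>U\<close> into \<open>H\<close> is an injective map \<open>\<iota>\<close>. The functions in \<open>C1c T\<close> are
  those in \<open>C\<^sup>1\<^sub>c((0,T);U)\<close>, extended by zero.
\<close>

definition C1c :: "real \<Rightarrow> (real \<Rightarrow> 'u::real_normed_vector) set" where
  "C1c T = {v. v C1_differentiable_on UNIV \<and>
               (\<exists>K. compact K \<and> K \<subseteq> {0<..<T} \<and> (\<forall>t. t \<notin> K \<longrightarrow> v t = 0))}"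

definition is_weak_derivative ::
    "real \<Rightarrow> ('u::real_normed_vector \<Rightarrow> 'h::real_inner) \<Rightarrow> (real \<Rightarrow> 'u) \<Rightarrow> (real \<Rightarrow> 'u \<Rightarrow>\<^sub>L real) \<Rightarrow> bool"
  where
  "is_weak_derivative T \<iota> u g \<longleftrightarrow> g \<in> bochner_L2 T \<and>
    (\<forall>v\<in>C1c T. dual_pairing T g v =
       - bochner_L2_inner T (\<lambda>t. \<iota> (u t)) (\<lambda>t. \<iota> (vector_derivative v (at t))))"

text \<open>
  An element of \<open>W\<close> is given by its continuous \<open>H\<close>-valued representative on \<open>{0..T}\<close>, which takes
  values in \<open>U\<close> only almost everywhere; \<open>U_part\<close> recovers the corresponding element of
  \<open>L\<^sup>2(0,T;U)\<close>. Extensionality makes equality in \<open>W_space T \<iota>\<close> equality on \<open>{0..T}\<close>.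
\<close>

definition U_part :: "('u \<Rightarrow> 'h) \<Rightarrow> (real \<Rightarrow> 'h) \<Rightarrow> real \<Rightarrow> 'u" where
  "U_part \<iota> u t = inv \<iota> (u t)"

definition W_space ::
    "real \<Rightarrow> ('u::real_normed_vector \<Rightarrow> 'h::real_inner) \<Rightarrow> (real \<Rightarrow> 'h) set" where
  "W_space T \<iota> = {u \<in> extensional {0..T}. continuous_on {0..T} u \<and>
     (AE t in lebesgue_on {0..T}. u t \<in> range \<iota>) \<and> U_part \<iota> u \<in> bochner_L2 T \<and>
     (\<exists>g. is_weak_derivative T \<iota> (U_part \<iota> u) g)}"

text \<open>The elements of \<open>V'\<close> chosen below are determined up to equality almost everywhere.\<close>

definition weak_deriv ::
    "real \<Rightarrow> ('u::real_normed_vector \<Rightarrow> 'h::real_inner) \<Rightarrow> (real \<Rightarrow> 'h) \<Rightarrow> real \<Rightarrow> 'u \<Rightarrow>\<^sub>L real" where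
  "weak_deriv T \<iota> u = (SOME g. is_weak_derivative T \<iota> (U_part \<iota> u) g)"

definition form_op ::
    "real \<Rightarrow> (real \<Rightarrow> 'u \<Rightarrow> 'u \<Rightarrow> real) \<Rightarrow> (real \<Rightarrow> 'u) \<Rightarrow> real \<Rightarrow> 'u::real_normed_vector \<Rightarrow>\<^sub>L real" where
  "form_op T a v = (SOME g. g \<in> bochner_L2 T \<and>
     (\<forall>w\<in>bochner_L2 T. dual_pairing T g w = (LINT t|lebesgue_on {0..T}. a t (v t) (w t))))"

definition evolution_solution ::
    "real \<Rightarrow> ('u::real_normed_vector \<Rightarrow> 'h::real_inner) \<Rightarrow> (real \<Rightarrow> 'u \<Rightarrow> 'u \<Rightarrow> real) \<Rightarrow> ('h \<Rightarrow>\<^sub>L 'h) \<Rightarrow>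
      (real \<Rightarrow> 'u \<Rightarrow>\<^sub>L real) \<Rightarrow> 'h \<Rightarrow> (real \<Rightarrow> 'h) \<Rightarrow> bool" where
  "evolution_solution T \<iota> a \<Phi> f \<xi>\<^sub>0 u \<longleftrightarrow> u \<in> W_space T \<iota> \<and>
     (AE t in lebesgue_on {0..T}. weak_deriv T \<iota> u t + form_op T a (U_part \<iota> u) t = f t) \<and>
     u 0 - blinfun_apply \<Phi> (u T) = \<xi>\<^sub>0"

section \<open>Discretization\<close>

definition lim_subspaces :: "(nat \<Rightarrow> 'u::real_normed_vector set) \<Rightarrow> bool" where
  "lim_subspaces U \<longleftrightarrow> (\<forall>u. \<exists>x. (\<forall>n. x n \<in> U n) \<and> x \<longlonglongrightarrow> u)"

definition inverse_const ::
    "('u::real_normed_vector \<Rightarrow> 'h::real_normed_vector) \<Rightarrow> 'u set \<Rightarrow> real" where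
  "inverse_const \<iota> S = (GREATEST r. \<exists>u\<in>S - {0}. r = norm u / norm (\<iota> u))"

definition step_fun ::
    "real \<Rightarrow> real \<Rightarrow> (nat \<Rightarrow> 'u::real_vector) \<Rightarrow> real \<Rightarrow> 'u" where
  "step_fun \<theta> k w t = (let m = nat \<lfloor>t / k\<rfloor> in
     if t = real m * k then w m else \<theta> *\<^sub>R w (Suc m) + (1 - \<theta>) *\<^sub>R w m)"

lemma step_fun_node: "k > 0 \<Longrightarrow> step_fun \<theta> k w (real m * k) = w m"
  by (simp add: step_fun_def)

lemma nat_floor_in_cell:
  fixes k :: real
  assumes "k > 0" "real m * k < t" "t < real (Suc m) * k"
  shows "nat \<lfloor>t / k\<rfloor> = m"
proof -
  have "real m < t / k" "t / k < real m + 1"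
    using assms by (simp_all add: field_simps)
  then have "\<lfloor>t / k\<rfloor> = int m" by linarith
  then show ?thesis by simp
qed

lemma step_fun_interval:
  assumes "k > 0" "real m * k < t" "t < real (Suc m) * k"
  shows "step_fun \<theta> k w t = \<theta> *\<^sub>R w (Suc m) + (1 - \<theta>) *\<^sub>R w m"
  using assms nat_floor_in_cell[OF assms] by (simp add: step_fun_def)

text \<open>
  The discrete derivative of the step function with nodal values \<open>w\<close>. At the nodes its value is
  irrelevant (at the last one it even involves a value of \<open>w\<close> beyond the last node).
\<close>

definition disc_deriv :: "real \<Rightarrow> (nat \<Rightarrow> 'u::real_vector) \<Rightarrow> real \<Rightarrow> 'u" where
  "disc_deriv k w t = (let m = nat \<lfloor>t / k\<rfloor> in (w (Suc m) - w m) /\<^sub>R k)"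

lemma disc_deriv_interval:
  assumes "k > 0" "real m * k < t" "t < real (Suc m) * k"
  shows "disc_deriv k w t = (w (Suc m) - w m) /\<^sub>R k"
  using nat_floor_in_cell[OF assms] by (simp add: disc_deriv_def)

definition V_step :: "real \<Rightarrow> nat \<Rightarrow> 'u set \<Rightarrow> (real \<Rightarrow> 'u) set" where
  "V_step T N S = {v. (\<forall>t\<in>{0<..<T}. v t \<in> S) \<and>
     (\<forall>m<N. v constant_on {real m * (T / real N)<..<real (Suc m) * (T / real N)})}"

definition V_proj :: "real \<Rightarrow> nat \<Rightarrow> 'u::real_inner set \<Rightarrow> (real \<Rightarrow> 'u) \<Rightarrow> real \<Rightarrow> 'u" where
  "V_proj T N S v = (SOME p. p \<in> V_step T N S \<and>
     (\<forall>q\<in>V_step T N S. bochner_L2_inner T (\<lambda>t. v t - p t) q = 0))"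

definition disc_deriv_hat ::
    "real \<Rightarrow> ('u::real_inner \<Rightarrow> 'h::real_inner) \<Rightarrow> nat \<Rightarrow> 'u set \<Rightarrow> (nat \<Rightarrow> 'u) \<Rightarrow> real \<Rightarrow> 'u \<Rightarrow>\<^sub>L real"
  where
  "disc_deriv_hat T \<iota> N S w = (SOME g. g \<in> bochner_L2 T \<and>
     (\<forall>v\<in>bochner_L2 T. dual_pairing T g v =
        bochner_L2_inner T (\<lambda>t. \<iota> (disc_deriv (T / real N) w t)) (\<lambda>t. \<iota> (V_proj T N S v t))))"

text \<open>
  A solution of the scheme is a family \<open>w\<close> indexed by \<open>{..N}\<close>; being extensional, families are
  equal iff they agree on \<open>{..N}\<close>.
\<close>

definition theta_scheme ::
    "real \<Rightarrow> ('u::real_normed_vector \<Rightarrow> 'h::real_inner) \<Rightarrow> (real \<Rightarrow> 'u \<Rightarrow> 'u \<Rightarrow> real) \<Rightarrow> ('h \<Rightarrow>\<^sub>L 'h) \<Rightarrow>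
      (real \<Rightarrow> 'u \<Rightarrow>\<^sub>L real) \<Rightarrow> 'h \<Rightarrow> real \<Rightarrow> nat \<Rightarrow> 'u set \<Rightarrow> (nat \<Rightarrow> 'u) \<Rightarrow> bool" where
  "theta_scheme T \<iota> a \<Phi> f \<xi>\<^sub>0 \<theta> N S w \<longleftrightarrow> (let k = T / real N in
     w \<in> {..N} \<rightarrow>\<^sub>E S \<and>
     (\<forall>v\<in>S. (\<iota> (w 0) - blinfun_apply \<Phi> (\<iota> (w N))) \<bullet> \<iota> v = \<xi>\<^sub>0 \<bullet> \<iota> v) \<and>
     (\<forall>m<N. \<forall>v\<in>S.
        \<iota> ((w (Suc m) - w m) /\<^sub>R k) \<bullet> \<iota> v
        + 1 / k * (LINT t|lebesgue_on {real m * k..real (Suc m) * k}.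
                     a t (\<theta> *\<^sub>R w (Suc m) + (1 - \<theta>) *\<^sub>R w m) v)
        = 1 / k * (LINT t|lebesgue_on {real m * k..real (Suc m) * k}. blinfun_apply (f t) v)))"

end

theory Submission
  imports Defs
begin

text \<open>
  The error between the discrete solution and a nodal interpolant of an approximation of the solution
  that is piecewise linear in time satisfies the scheme with a small right-hand side, so convergence
  reduces to consistency and to a stability estimate uniform in \<open>n\<close>. Stability is obtained by testing
  with the intermediate value \<open>\<theta> w\<^sup>(\<^sup>m\<^sup>+\<^sup>1\<^sup>) + (1 - \<theta>) w\<^sup>(\<^sup>m\<^sup>)\<close>. When \<open>\<parallel>\<Phi>\<parallel> = 1\<close> the boundary
  condition alone gives no control, but the energy inequality bounds the \<open>H\<close>-norm at some node by the
  \<open>V\<close>-norm of the error, and the total variation of the squared \<open>H\<close>-norms is bounded as well.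

  Existence for the initial value problem avoids compactness: the set of data admitting a solution is
  closed by the energy estimate; for \<open>u' + c \<Lambda> u = c \<Lambda> F\<close> with the Riesz map \<open>\<Lambda>\<close> and Lipschitz \<open>F\<close>
  implicit Euler steps are almost solutions; and the general form is reached by the contractive
  iteration \<open>u\<^sub>i\<^sub>+\<^sub>1' + c \<Lambda> u\<^sub>i\<^sub>+\<^sub>1 = f - (\<A> - c \<Lambda>) u\<^sub>i\<close> with \<open>c = M\<^sup>2 / \<alpha>\<close>. Since \<open>u(0) \<mapsto> u(T)\<close> is a strict
  contraction of \<open>H\<close>, the boundary condition is a fixed point equation.
\<close>

text \<open>The \<open>U\<close>-orthogonal projections \<open>P n\<close> onto the discrete spaces
  come with a bound in the norm of \<open>U\<close> only; in the norm of \<open>H\<close> nothing is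
  known about them. Hence the solution is not projected directly. It is first replaced by a
  piecewise linear function with values in \<open>U\<close> on a partition independent of
  \<open>n\<close>; then only finitely many vectors remain to be projected, and strong convergence
  of \<open>P n\<close> suffices. The nodes avoid the null set where the continuous representative
  differs from its \<open>U\<close>-valued version, so that interior slopes are averages of the
  derivative. The same approximation carries the energy identity from piecewise linear functions to
  \<open>W\<close>. In the stability estimate, testing leaves the squared \<open>H\<close>-norms of
  the increments with the factor 2 \<theta> - 1. For \<theta> > 1/2 this is extra dissipation; for
  \<theta> < 1/2 it is absorbed by the inverse inequality and the step size condition. For \<theta>
  = 1/2 it vanishes, and the bound on \<open>\<mu>\<^sub>n / N\<^sub>n\<close> allows a nodal value
  to be compared with an intermediate one when \<Phi> has norm 1.\<close>

abbreviation I_on :: "real \<Rightarrow> real measure" where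
  "I_on T \<equiv> lebesgue_on {0..T}"

section \<open>Strong measurability on Lebesgue measurable subsets of the line\<close>

lemma complete_measure_lebesgue_on:
  assumes "S \<in> sets lebesgue"
  shows "complete_measure (lebesgue_on S)"
proof
  fix A B assume "B \<subseteq> A" "A \<in> null_sets (lebesgue_on S)"
  then have "A \<subseteq> S" "A \<in> null_sets lebesgue"
    using assms by (auto simp: null_sets_restrict_space)
  then have "B \<in> null_sets lebesgue" using \<open>B \<subseteq> A\<close>
    by (meson completion.complete2)
  then show "B \<in> sets (lebesgue_on S)"
    using \<open>B \<subseteq> A\<close> \<open>A \<subseteq> S\<close> assms by (auto simp: sets_restrict_space_iff)
qed

text \<open>Preimages under the two functions differ inside a null set, and completeness of Lebesgue
  measure makes every subset of a null set measurable.\<close>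

lemma measurable_cong_AE_lebesgue_on:
  assumes "S \<in> sets lebesgue" and f: "f \<in> measurable (lebesgue_on S) N"
    and "AE t in lebesgue_on S. f t = g t" "\<And>t. t \<in> S \<Longrightarrow> g t \<in> space N"
  shows "g \<in> measurable (lebesgue_on S) N"
proof (rule measurableI)
  fix t assume "t \<in> space (lebesgue_on S)" then show "g t \<in> space N" using assms(4) by auto
next
  interpret complete_measure "lebesgue_on S" by (rule complete_measure_lebesgue_on[OF assms(1)])
  fix B assume B: "B \<in> sets N"
  show "g -` B \<inter> space (lebesgue_on S) \<in> sets (lebesgue_on S)"
  proof (rule in_sets_AE)
    show "f -` B \<inter> space (lebesgue_on S) \<in> sets (lebesgue_on S)" using f B by (rule measurable_sets)
    show "AE x in lebesgue_on S. (x \<in> f -` B \<inter> space (lebesgue_on S)) = (x \<in> g -` B \<inter> space (lebesgue_on S))"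
      using assms(3) by eventually_elim auto
  qed auto
qed

lemma integral_cong_AE_lebesgue_on:
  fixes f g :: "real \<Rightarrow> real"
  assumes "S \<in> sets lebesgue" "f \<in> borel_measurable (lebesgue_on S)" "AE t in lebesgue_on S. f t = g t"
  shows "(LINT t|lebesgue_on S. f t) = (LINT t|lebesgue_on S. g t)"
  by (rule integral_cong_AE[OF assms(2) measurable_cong_AE_lebesgue_on[OF assms] assms(3)]) simp

lemma borel_measurable_AE_limit:
  fixes f :: "real \<Rightarrow> real"
  assumes "S \<in> sets lebesgue" "\<And>i::nat. s i \<in> borel_measurable (lebesgue_on S)"
    and "AE t in lebesgue_on S. (\<lambda>i. s i t) \<longlonglongrightarrow> f t"
  shows "f \<in> borel_measurable (lebesgue_on S)"
proof -
  have 1: "(\<lambda>t. lim (\<lambda>i. s i t)) \<in> borel_measurable (lebesgue_on S)"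
    by (rule borel_measurable_lim_metric) (rule assms(2))
  have 2: "AE t in lebesgue_on S. lim (\<lambda>i. s i t) = f t"
    using assms(3) by eventually_elim (rule limI)
  show ?thesis by (rule measurable_cong_AE_lebesgue_on[OF assms(1) 1 2]) auto
qed

lemma strongly_measurable_Pair:
  assumes "strongly_measurable M f" "strongly_measurable M g"
  shows "strongly_measurable M (\<lambda>t. (f t, g t))"
proof -
  obtain r s where r: "\<And>i. simple_function M (r i)" "AE t in M. (\<lambda>i::nat. r i t) \<longlonglongrightarrow> f t"
    and s: "\<And>i. simple_function M (s i)" "AE t in M. (\<lambda>i::nat. s i t) \<longlonglongrightarrow> g t"
    using assms unfolding strongly_measurable_def by blast
  have "AE t in M. (\<lambda>i. (r i t, s i t)) \<longlonglongrightarrow> (f t, g t)"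
    using r(2) s(2) by eventually_elim (rule tendsto_Pair)
  moreover have "\<And>i. simple_function M (\<lambda>t. (r i t, s i t))" using r(1) s(1) by auto
  ultimately show ?thesis unfolding strongly_measurable_def
    by (intro exI[of _ "\<lambda>i t. (r i t, s i t)"]) auto
qed

lemma strongly_measurable_continuous:
  assumes "strongly_measurable M f" "continuous_on UNIV h"
  shows "strongly_measurable M (\<lambda>t. h (f t))"
proof -
  obtain s where s: "\<And>i. simple_function M (s i)" "AE t in M. (\<lambda>i::nat. s i t) \<longlonglongrightarrow> f t"
    using assms unfolding strongly_measurable_def by blast
  have "AE t in M. (\<lambda>i. h (s i t)) \<longlonglongrightarrow> h (f t)"
    using s(2)
  proof eventually_elim
    case (elim t)
    show ?case using continuous_on_tendsto_compose[OF assms(2) elim] by simp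
  qed
  then show ?thesis unfolding strongly_measurable_def using s(1)
    by (intro exI[of _ "\<lambda>i t. h (s i t)"]) (auto intro: simple_function_compose1)
qed

lemma strongly_measurable_const [simp]: "strongly_measurable M (\<lambda>t. c)"
  unfolding strongly_measurable_def by (intro exI[of _ "\<lambda>i t. c"]) auto

lemma strongly_measurable_cong_AE:
  assumes "strongly_measurable M f" "AE t in M. f t = g t"
  shows "strongly_measurable M g"
proof -
  obtain s where s: "\<And>i. simple_function M (s i)" "AE t in M. (\<lambda>i::nat. s i t) \<longlonglongrightarrow> f t"
    using assms unfolding strongly_measurable_def by blast
  have "AE t in M. (\<lambda>i. s i t) \<longlonglongrightarrow> g t" using s(2) assms(2) by eventually_elim auto
  then show ?thesis unfolding strongly_measurable_def using s(1) by blast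
qed

lemma strongly_measurable_add:
  fixes f g :: "'a \<Rightarrow> 'b::real_normed_vector"
  assumes "strongly_measurable M f" "strongly_measurable M g"
  shows "strongly_measurable M (\<lambda>t. f t + g t)"
  using strongly_measurable_continuous[OF strongly_measurable_Pair[OF assms], of "\<lambda>z. fst z + snd z"]
  by (simp add: continuous_intros)

lemma strongly_measurable_diff:
  fixes f g :: "'a \<Rightarrow> 'b::real_normed_vector"
  assumes "strongly_measurable M f" "strongly_measurable M g"
  shows "strongly_measurable M (\<lambda>t. f t - g t)"
  using strongly_measurable_continuous[OF strongly_measurable_Pair[OF assms], of "\<lambda>z. fst z - snd z"]
  by (simp add: continuous_intros)

lemma strongly_measurable_bounded_linear:
  assumes "strongly_measurable M f" "bounded_linear h"
  shows "strongly_measurable M (\<lambda>t. h (f t))"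
  using strongly_measurable_continuous[OF assms(1), of h] assms(2)
  by (simp add: linear_continuous_on)

lemma strongly_measurable_inner:
  assumes "strongly_measurable M g" "strongly_measurable M f"
  shows "strongly_measurable M (\<lambda>t. g t \<bullet> f t)"
  using strongly_measurable_continuous[OF strongly_measurable_Pair[OF assms], of "\<lambda>z. fst z \<bullet> snd z"]
  by (simp add: continuous_intros)

lemma strongly_measurable_norm:
  fixes f :: "'a \<Rightarrow> 'b::real_normed_vector"
  assumes "strongly_measurable M f"
  shows "strongly_measurable M (\<lambda>t. norm (f t))"
  using strongly_measurable_continuous[OF assms, of norm]
  by (simp add: continuous_intros)

text \<open>For real functions the almost everywhere limit in \<open>strongly_measurable\<close>
  gives nothing beyond Borel measurability, because completeness absorbs the exceptional
  set.\<close>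

lemma strongly_measurable_real_iff:
  fixes f :: "real \<Rightarrow> real"
  assumes "S \<in> sets lebesgue"
  shows "strongly_measurable (lebesgue_on S) f \<longleftrightarrow> f \<in> borel_measurable (lebesgue_on S)"
proof
  assume "strongly_measurable (lebesgue_on S) f"
  then obtain s where s: "\<And>i. simple_function (lebesgue_on S) (s i)"
    "AE t in lebesgue_on S. (\<lambda>i::nat. s i t) \<longlonglongrightarrow> f t"
    unfolding strongly_measurable_def by blast
  show "f \<in> borel_measurable (lebesgue_on S)"
    using borel_measurable_simple_function[OF s(1)] by (rule borel_measurable_AE_limit[OF assms _ s(2)])
next
  assume "f \<in> borel_measurable (lebesgue_on S)"
  from borel_measurable_implies_sequence_metric[OF this, of 0]
  obtain s where s: "\<And>i. simple_function (lebesgue_on S) (s i)"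
    "\<And>t. t \<in> space (lebesgue_on S) \<Longrightarrow> (\<lambda>i. s i t) \<longlonglongrightarrow> f t" by blast
  from s(2) have "AE t in lebesgue_on S. (\<lambda>i. s i t) \<longlonglongrightarrow> f t" by (rule AE_I2)
  with s(1) show "strongly_measurable (lebesgue_on S) f"
    unfolding strongly_measurable_def by blast
qed

lemma I_sets [simp, measurable]: "{a..b::real} \<in> sets lebesgue" "{a<..<b::real} \<in> sets lebesgue"
  by auto

lemma strongly_measurable_norm_borel:
  fixes f :: "real \<Rightarrow> 'b::real_normed_vector"
  assumes "strongly_measurable (I_on T) f"
  shows "(\<lambda>t. norm (f t)) \<in> borel_measurable (I_on T)"
  using strongly_measurable_norm[OF assms] by (simp add: strongly_measurable_real_iff)

section \<open>The Riesz representation\<close>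

text \<open>Every minimising sequence of \<open>b x x - 2 l x\<close> is Cauchy, by the parallelogram identity.\<close>

lemma symmetric_Lax_Milgram:
  fixes b :: "'a::{real_inner,banach} \<Rightarrow> 'a \<Rightarrow> real" and l :: "'a \<Rightarrow> real"
  assumes b: "bounded_bilinear b" and sym: "\<And>x y. b x y = b y x"
    and c: "c > 0" and coercive: "\<And>x. c * (norm x)\<^sup>2 \<le> b x x" and l: "bounded_linear l"
  shows "\<exists>x. \<forall>v. b x v = l v"
proof -
  interpret b: bounded_bilinear b by (rule b)
  interpret l: bounded_linear l by (rule l)
  define Q where "Q x = b x x - 2 * l x" for x
  obtain K where K: "\<And>x. norm (l x) \<le> norm x * K" using l.bounded by blast
  have lower: "- (K\<^sup>2 / c) \<le> Q x" for x
  proof -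
    have "2 * l x \<le> 2 * (norm x * K)" using K[of x] by simp
    also have "\<dots> \<le> c * (norm x)\<^sup>2 + K\<^sup>2 / c"
    proof -
      have "0 \<le> (c * norm x - K)\<^sup>2 / c" using c by simp
      also have "\<dots> = c * (norm x)\<^sup>2 + K\<^sup>2 / c - 2 * (norm x * K)"
        using c by (simp add: field_simps power2_eq_square)
      finally show ?thesis by simp
    qed
    finally show ?thesis using coercive[of x] unfolding Q_def by linarith
  qed
  define m where "m = Inf (range Q)"
  have bdd: "bdd_below (range Q)" using lower by (intro bdd_belowI[of _ "- (K\<^sup>2 / c)"]) auto
  have m: "m \<le> Q x" for x unfolding m_def by (rule cInf_lower[OF _ bdd]) auto
  have "\<exists>x. Q x < m + inverse (real (Suc n))" for n
    using cInf_lessD[of "range Q" "m + inverse (real (Suc n))"] unfolding m_def by auto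
  then obtain X where X: "\<And>n. Q (X n) < m + inverse (real (Suc n))" by metis
  have par: "b (x - y) (x - y) = 2 * Q x + 2 * Q y - 4 * Q ((1/2) *\<^sub>R (x + y))" for x y
    unfolding Q_def by (simp add: b.diff_left b.diff_right b.add_left b.add_right b.scaleR_left
        b.scaleR_right l.scaleR l.add sym[of y x] algebra_simps)
  have close: "c * (norm (X i - X j))\<^sup>2 \<le> 2 * inverse (real (Suc i)) + 2 * inverse (real (Suc j))" for i j
    using coercive[of "X i - X j"] par[of "X i" "X j"] X[of i] X[of j] m[of "(1/2) *\<^sub>R (X i + X j)"]
    by linarith
  have "Cauchy X"
  proof (rule CauchyI)
    fix e :: real assume "e > 0"
    then have "c * e\<^sup>2 / 4 > 0" using c by simp
    then obtain M where M: "inverse (real (Suc M)) < c * e\<^sup>2 / 4" using reals_Archimedean by blast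
    have "norm (X i - X j) < e" if "i \<ge> M" "j \<ge> M" for i j
    proof -
      have "inverse (real (Suc i)) \<le> inverse (real (Suc M))" "inverse (real (Suc j)) \<le> inverse (real (Suc M))"
        using that by (auto intro: le_imp_inverse_le)
      then have "c * (norm (X i - X j))\<^sup>2 < c * e\<^sup>2" using close[of i j] M by linarith
      then show ?thesis using c \<open>e > 0\<close> by (simp add: power_less_imp_less_base)
    qed
    then show "\<exists>M. \<forall>m\<ge>M. \<forall>n\<ge>M. norm (X m - X n) < e" by blast
  qed
  then obtain x where x: "X \<longlonglongrightarrow> x" using Cauchy_convergent_iff convergent_def by blast
  have "(\<lambda>n. Q (X n)) \<longlonglongrightarrow> Q x" unfolding Q_def
    by (intro tendsto_intros b.tendsto l.tendsto x)
  moreover have "(\<lambda>n. m + inverse (real (Suc n))) \<longlonglongrightarrow> m + 0"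
    by (intro tendsto_intros LIMSEQ_inverse_real_of_nat)
  ultimately have "Q x \<le> m + 0" using X by (intro LIMSEQ_le) (auto intro: less_imp_le)
  then have min: "Q x \<le> Q y" for y using m[of y] by simp
  have "b x v = l v" for v
  proof -
    define d where "d = b x v - l v"
    have "0 \<le> 2 * s * d + s\<^sup>2 * b v v" for s
      using min[of "x + s *\<^sub>R v"] unfolding Q_def d_def
      by (simp add: b.add_left b.add_right b.scaleR_left b.scaleR_right l.add l.scaleR sym[of v x]
          algebra_simps power2_eq_square)
    note pos = this
    have "d = 0"
    proof (rule ccontr)
      assume "d \<noteq> 0"
      \<comment> \<open>At s = -d/B the linear term of the variation outweighs the quadratic one;
        the added 1 keeps \<open>B\<close> positive even if v = 0.\<close>
      define B where "B = \<bar>b v v\<bar> + 1"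
      have B: "B > 0" "b v v \<le> B" unfolding B_def by auto
      have "0 \<le> 2 * (- d / B) * d + (- d / B)\<^sup>2 * b v v" by (rule pos)
      also have "\<dots> \<le> 2 * (- d / B) * d + (- d / B)\<^sup>2 * B"
        using B(2) by (simp add: mult_left_mono)
      also have "\<dots> = - (d\<^sup>2 / B)" using B by (simp add: field_simps power2_eq_square)
      also have "\<dots> < 0" using B \<open>d \<noteq> 0\<close> by simp
      finally show False by simp
    qed
    then show ?thesis unfolding d_def by simp
  qed
  then show ?thesis by blast
qed

definition riesz :: "('a::{real_inner,banach} \<Rightarrow>\<^sub>L real) \<Rightarrow> 'a" where
  "riesz g = (SOME x. \<forall>v. x \<bullet> v = blinfun_apply g v)"

lemma riesz_inner [simp]: "riesz g \<bullet> v = blinfun_apply g v"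
proof -
  have "\<exists>x. \<forall>v. x \<bullet> v = g v"
    by (rule symmetric_Lax_Milgram[where c=1])
      (auto simp: bounded_bilinear_inner inner_commute power2_norm_eq_inner blinfun.bounded_linear_right)
  from someI_ex[OF this] show ?thesis unfolding riesz_def by blast
qed

lemma blinfun_inner_right_riesz [simp]: "blinfun_inner_right (riesz g) = g"
  by (rule blinfun_eqI) simp

lemma norm_blinfun_inner_right [simp]: "norm (blinfun_inner_right x) = norm x"
proof (rule antisym)
  show "norm (blinfun_inner_right x) \<le> norm x"
    by (rule norm_blinfun_bound) (auto simp: Cauchy_Schwarz_ineq2)
  show "norm x \<le> norm (blinfun_inner_right x)"
  proof (cases "x = 0")
    case False
    have "(norm x)\<^sup>2 \<le> norm (blinfun_inner_right x) * norm x"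
      using norm_blinfun[of "blinfun_inner_right x" x] by (simp add: power2_norm_eq_inner)
    then show ?thesis using False by (simp add: power2_eq_square)
  qed simp
qed

lemma norm_riesz [simp]: "norm (riesz g) = norm g"
  by (metis blinfun_inner_right_riesz norm_blinfun_inner_right)

section \<open>Square integrable functions\<close>

text \<open>Squared norms split over subintervals without taking roots; the triangle inequality with
  factor 2 then takes the place of Minkowski's inequality.\<close>

definition L2sq :: "real \<Rightarrow> (real \<Rightarrow> 'b::real_normed_vector) \<Rightarrow> real" where
  "L2sq T f = (LINT t|I_on T. (norm (f t))\<^sup>2)"

lemma L2sq_nonneg [simp]: "0 \<le> L2sq T f"
  unfolding L2sq_def by (rule integral_nonneg_AE) auto

lemma L2_norm_sqrt: "bochner_L2_norm T f = sqrt (L2sq T f)"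
  unfolding bochner_L2_norm_def L2sq_def ..

lemma L2_sm: "f \<in> bochner_L2 T \<Longrightarrow> strongly_measurable (I_on T) f"
  unfolding bochner_L2_def by simp

lemma L2_integrable: "f \<in> bochner_L2 T \<Longrightarrow> integrable (I_on T) (\<lambda>t. (norm (f t))\<^sup>2)"
  unfolding bochner_L2_def by simp

lemma sum_sq_le: "((x::real) + y)\<^sup>2 \<le> 2 * x\<^sup>2 + 2 * y\<^sup>2"
  using zero_le_power2[of "x - y"] unfolding power2_sum power2_diff by linarith

lemma norm_add_sq_le: "(norm (x + y))\<^sup>2 \<le> 2 * (norm x)\<^sup>2 + 2 * (norm y)\<^sup>2"
  by (rule order_trans[OF power_mono[OF norm_triangle_ineq] sum_sq_le]) simp

lemma norm_diff_sq_le: "(norm (x - y))\<^sup>2 \<le> 2 * (norm x)\<^sup>2 + 2 * (norm y)\<^sup>2"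
  using norm_add_sq_le[of x "- y"] by simp

lemma L2_dominated:
  fixes f :: "real \<Rightarrow> 'b::real_normed_vector"
  assumes "strongly_measurable (I_on T) f" "integrable (I_on T) h" "AE t in I_on T. (norm (f t))\<^sup>2 \<le> h t"
  shows "f \<in> bochner_L2 T"
proof -
  have "(\<lambda>t. (norm (f t))\<^sup>2) \<in> borel_measurable (I_on T)"
    using strongly_measurable_norm_borel[OF assms(1)] by measurable
  then have "integrable (I_on T) (\<lambda>t. (norm (f t))\<^sup>2)"
    by (rule Bochner_Integration.integrable_bound[OF assms(2)]) (use assms(3) in eventually_elim, auto)
  then show ?thesis using assms(1) unfolding bochner_L2_def by simp
qed

lemma finite_measure_I_on [simp]: "finite_measure (I_on T)"
  by (rule finite_measure_lebesgue_on) simp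

lemma lebesgue_on_const_integrable [simp]: "integrable (lebesgue_on {a..b::real}) (\<lambda>t. c::real)"
  by (rule finite_measure.integrable_const, rule finite_measure_lebesgue_on) simp

lemma measure_lebesgue_on_interval [simp]: "a \<le> b \<Longrightarrow> measure (lebesgue_on {a..b::real}) {a..b} = b - a"
  by (simp add: measure_restrict_space)

lemma integral_lebesgue_on_real_const [simp]: "a \<le> b \<Longrightarrow> (LINT t|lebesgue_on {a..b::real}. c::real) = (b - a) * c"
  by (simp add: measure_restrict_space)

lemma L2_add:
  fixes f g :: "real \<Rightarrow> 'b::real_normed_vector"
  assumes "f \<in> bochner_L2 T" "g \<in> bochner_L2 T" shows "(\<lambda>t. f t + g t) \<in> bochner_L2 T"
  by (rule L2_dominated[where h="\<lambda>t. 2 * (norm (f t))\<^sup>2 + 2 * (norm (g t))\<^sup>2"])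
    (use assms norm_add_sq_le in \<open>auto simp: strongly_measurable_add L2_sm L2_integrable\<close>)

lemma L2_diff:
  fixes f g :: "real \<Rightarrow> 'b::real_normed_vector"
  assumes "f \<in> bochner_L2 T" "g \<in> bochner_L2 T" shows "(\<lambda>t. f t - g t) \<in> bochner_L2 T"
  by (rule L2_dominated[where h="\<lambda>t. 2 * (norm (f t))\<^sup>2 + 2 * (norm (g t))\<^sup>2"])
    (use assms norm_diff_sq_le in \<open>auto simp: strongly_measurable_diff L2_sm L2_integrable\<close>)

lemma L2_bounded:
  fixes f :: "real \<Rightarrow> 'b::real_normed_vector"
  assumes "strongly_measurable (I_on T) f" "AE t in I_on T. norm (f t) \<le> B"
  shows "f \<in> bochner_L2 T"
proof (rule L2_dominated[where h="\<lambda>t. B\<^sup>2"])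
  show "AE t in I_on T. (norm (f t))\<^sup>2 \<le> B\<^sup>2" using assms(2) by eventually_elim (simp add: power_mono)
qed (use assms(1) in auto)

lemma L2_cong_AE:
  fixes f g :: "real \<Rightarrow> 'b::real_normed_vector"
  assumes "f \<in> bochner_L2 T" "AE t in I_on T. f t = g t"
  shows "g \<in> bochner_L2 T"
proof (rule L2_dominated[OF strongly_measurable_cong_AE[OF L2_sm[OF assms(1)] assms(2)] L2_integrable[OF assms(1)]])
  show "AE t in I_on T. (norm (g t))\<^sup>2 \<le> (norm (f t))\<^sup>2" using assms(2) by eventually_elim auto
qed

lemma L2_bounded_linear:
  assumes "f \<in> bochner_L2 T" "bounded_linear h"
  shows "(\<lambda>t. h (f t)) \<in> bochner_L2 T"
proof -
  obtain K where K: "\<And>x. norm (h x) \<le> norm x * K" using bounded_linear.bounded[OF assms(2)] by blast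
  show ?thesis
  proof (rule L2_dominated[where h="\<lambda>t. K\<^sup>2 * (norm (f t))\<^sup>2"])
    show "AE t in I_on T. (norm (h (f t)))\<^sup>2 \<le> K\<^sup>2 * (norm (f t))\<^sup>2"
      using power_mono[OF K norm_ge_zero, of _ 2] by (simp add: power_mult_distrib mult.commute)
  qed (use assms in \<open>auto simp: L2_sm L2_integrable strongly_measurable_bounded_linear\<close>)
qed

lemma L2_scaleR:
  fixes f :: "real \<Rightarrow> 'b::real_normed_vector"
  assumes "f \<in> bochner_L2 T" shows "(\<lambda>t. c *\<^sub>R f t) \<in> bochner_L2 T"
  using assms by (rule L2_bounded_linear) (rule bounded_linear_scaleR_right)

lemma L2_const [simp]: "(\<lambda>t. c::'b::real_normed_vector) \<in> bochner_L2 T"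
  by (rule L2_bounded[where B="norm c"]) auto

lemma L2_integrable_bilinear:
  fixes h :: "'a::real_normed_vector \<Rightarrow> 'b::real_normed_vector \<Rightarrow> real"
  assumes h: "bounded_bilinear h" and "f \<in> bochner_L2 T" "g \<in> bochner_L2 T"
  shows "integrable (I_on T) (\<lambda>t. h (f t) (g t))"
proof -
  interpret h: bounded_bilinear h by (rule h)
  obtain K where K: "K \<ge> 0" "\<And>x y. norm (h x y) \<le> norm x * norm y * K" using h.nonneg_bounded by blast
  have "continuous_on UNIV (\<lambda>z. h (fst z) (snd z))"
    by (intro h.continuous_on continuous_intros)
  from strongly_measurable_continuous[OF strongly_measurable_Pair[OF assms(2,3)[THEN L2_sm]] this]
  have "(\<lambda>t. h (f t) (g t)) \<in> borel_measurable (I_on T)" by (simp add: strongly_measurable_real_iff)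
  then show ?thesis
  proof (rule Bochner_Integration.integrable_bound[where f="\<lambda>t. K * ((norm (f t))\<^sup>2 + (norm (g t))\<^sup>2)", rotated])
    have "norm (h x y) \<le> norm (K * ((norm x)\<^sup>2 + (norm y)\<^sup>2))" for x y
    proof -
      have "norm x * norm y \<le> (norm x)\<^sup>2 + (norm y)\<^sup>2"
        using zero_le_power2[of "norm x - norm y"] zero_le_power2[of "norm x"] zero_le_power2[of "norm y"]
        unfolding power2_diff by linarith
      then have "norm x * norm y * K \<le> K * ((norm x)\<^sup>2 + (norm y)\<^sup>2)"
        using K(1) by (simp add: mult.commute mult_left_mono)
      then show ?thesis using K(2)[of x y] K(1) by simp
    qed
    then show "AE t in I_on T. norm (h (f t) (g t)) \<le> norm (K * ((norm (f t))\<^sup>2 + (norm (g t))\<^sup>2))"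
      by simp
  qed (use assms in \<open>auto simp: L2_integrable\<close>)
qed

lemma L2_integrable_pairing:
  assumes "g \<in> bochner_L2 T" "f \<in> bochner_L2 T"
  shows "integrable (I_on T) (\<lambda>t. blinfun_apply (g t) (f t) :: real)"
  by (rule L2_integrable_bilinear[OF _ assms]) (rule bounded_bilinear_blinfun_apply)

lemma L2_integrable_norm_mult:
  fixes f :: "real \<Rightarrow> 'b::real_normed_vector" and g :: "real \<Rightarrow> 'c::real_normed_vector"
  assumes "f \<in> bochner_L2 T" "g \<in> bochner_L2 T"
  shows "integrable (I_on T) (\<lambda>t. norm (f t) * norm (g t))"
proof -
  have "(\<lambda>t. norm (f t)) \<in> bochner_L2 T" "(\<lambda>t. norm (g t)) \<in> bochner_L2 T"
    using assms by (auto simp: bochner_L2_def intro: strongly_measurable_norm)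
  then show ?thesis by (rule L2_integrable_bilinear[OF bounded_bilinear_mult])
qed

lemma L2_integrable_norm:
  fixes f :: "real \<Rightarrow> 'b::real_normed_vector"
  assumes "f \<in> bochner_L2 T" shows "integrable (I_on T) (\<lambda>t. norm (f t))"
  using L2_integrable_norm_mult[OF assms L2_const[of "1::real"]] by simp

lemma L2sq_add_le:
  fixes f g :: "real \<Rightarrow> 'b::real_normed_vector"
  assumes "f \<in> bochner_L2 T" "g \<in> bochner_L2 T"
  shows "L2sq T (\<lambda>t. f t + g t) \<le> 2 * L2sq T f + 2 * L2sq T g"
proof -
  have "L2sq T (\<lambda>t. f t + g t) \<le> (LINT t|I_on T. 2 * (norm (f t))\<^sup>2 + 2 * (norm (g t))\<^sup>2)"
    unfolding L2sq_def by (rule integral_mono_AE') (use assms norm_add_sq_le in \<open>auto simp: L2_integrable\<close>)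
  then show ?thesis using assms unfolding L2sq_def by (simp add: L2_integrable)
qed

lemma L2sq_diff_le:
  fixes f g :: "real \<Rightarrow> 'b::real_normed_vector"
  assumes "f \<in> bochner_L2 T" "g \<in> bochner_L2 T"
  shows "L2sq T (\<lambda>t. f t - g t) \<le> 2 * L2sq T f + 2 * L2sq T g"
proof -
  have "L2sq T (\<lambda>t. f t - g t) \<le> (LINT t|I_on T. 2 * (norm (f t))\<^sup>2 + 2 * (norm (g t))\<^sup>2)"
    unfolding L2sq_def by (rule integral_mono_AE') (use assms norm_diff_sq_le in \<open>auto simp: L2_integrable\<close>)
  then show ?thesis using assms unfolding L2sq_def by (simp add: L2_integrable)
qed

lemma L2sq_triangle:
  fixes f g h :: "real \<Rightarrow> 'b::real_normed_vector"
  assumes "f \<in> bochner_L2 T" "g \<in> bochner_L2 T" "h \<in> bochner_L2 T"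
  shows "L2sq T (\<lambda>t. f t - h t) \<le> 2 * L2sq T (\<lambda>t. f t - g t) + 2 * L2sq T (\<lambda>t. g t - h t)"
  using L2sq_add_le[of "\<lambda>t. f t - g t" T "\<lambda>t. g t - h t"] assms by (simp add: L2_diff)

lemma L2sq_cong_AE:
  assumes "AE t in I_on T. norm (f t) = norm (g t)"
    and "strongly_measurable (I_on T) f" "strongly_measurable (I_on T) g"
  shows "L2sq T f = L2sq T g"
  unfolding L2sq_def
proof (rule integral_cong_AE)
  show "AE t in I_on T. (norm (f t))\<^sup>2 = (norm (g t))\<^sup>2" using assms(1) by eventually_elim simp
qed (use strongly_measurable_norm_borel[OF assms(2)] strongly_measurable_norm_borel[OF assms(3)] in measurable)

text \<open>The claim is the value at the minimiser s = c/b. For b = 0 the expression is affine in s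
  and would take the value -1 unless c vanished.\<close>

lemma quadratic_nonneg_discriminant:
  fixes a b c :: real
  assumes "0 \<le> b" "\<And>s. 0 \<le> a - 2 * s * c + s\<^sup>2 * b"
  shows "c\<^sup>2 \<le> a * b"
proof (cases "b = 0")
  case True
  have "c = 0"
  proof (rule ccontr)
    assume "c \<noteq> 0"
    then show False using assms(2)[of "(a + 1) / (2 * c)"] True by simp
  qed
  then show ?thesis using True by simp
next
  case False
  then have "b > 0" using assms(1) by simp
  then show ?thesis using assms(2)[of "c / b"] by (simp add: field_simps power2_eq_square)
qed

text \<open>Only the scalar functions given by the two norms enter, so the factors may take values
  in different spaces; this is what the pairing of a functional with its argument requires.\<close>

lemma L2_Cauchy_Schwarz:
  fixes f :: "real \<Rightarrow> 'b::real_normed_vector" and g :: "real \<Rightarrow> 'c::real_normed_vector"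
  assumes "f \<in> bochner_L2 T" "g \<in> bochner_L2 T"
  shows "(LINT t|I_on T. norm (f t) * norm (g t)) \<le> sqrt (L2sq T f) * sqrt (L2sq T g)"
proof -
  define c where "c = (LINT t|I_on T. norm (f t) * norm (g t))"
  have "0 \<le> L2sq T f - 2 * s * c + s\<^sup>2 * L2sq T g" for s
  proof -
    have "0 \<le> (LINT t|I_on T. (norm (f t) - s * norm (g t))\<^sup>2)" by (rule integral_nonneg_AE) auto
    also have "\<dots> = (LINT t|I_on T. (norm (f t))\<^sup>2 - 2 * s * (norm (f t) * norm (g t)) + s\<^sup>2 * (norm (g t))\<^sup>2)"
      by (simp add: power2_diff power_mult_distrib algebra_simps)
    also have "\<dots> = L2sq T f - 2 * s * c + s\<^sup>2 * L2sq T g"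
      unfolding L2sq_def c_def using assms
      by (simp add: L2_integrable L2_integrable_norm_mult)
    finally show ?thesis .
  qed
  from quadratic_nonneg_discriminant[OF L2sq_nonneg this] have "c\<^sup>2 \<le> L2sq T f * L2sq T g" .
  then show ?thesis unfolding c_def[symmetric] real_sqrt_mult[symmetric] by (rule real_le_rsqrt)
qed

lemma L2_pairing_bound:
  assumes "g \<in> bochner_L2 T" "f \<in> bochner_L2 T"
  shows "\<bar>LINT t|I_on T. blinfun_apply (g t) (f t)\<bar> \<le> sqrt (L2sq T g) * sqrt (L2sq T f)"
proof -
  have "\<bar>LINT t|I_on T. (g t) (f t)\<bar> \<le> (LINT t|I_on T. norm (g t) * norm (f t))"
    by (rule integral_abs_bound_integral)
      (use assms in \<open>auto simp: L2_integrable_pairing L2_integrable_norm_mult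
          norm_blinfun[of "_ :: _ \<Rightarrow>\<^sub>L real", simplified]\<close>)
  then show ?thesis using L2_Cauchy_Schwarz[OF assms] by simp
qed

lemma L2_pairing_tendsto:
  assumes L: "\<And>i. g i \<in> bochner_L2 T" "\<And>i. f i \<in> bochner_L2 T" and G: "G \<in> bochner_L2 T" and F: "F \<in> bochner_L2 T"
    and lim: "(\<lambda>i. L2sq T (\<lambda>t. g i t - G t)) \<longlonglongrightarrow> 0" "(\<lambda>i. L2sq T (\<lambda>t. f i t - F t)) \<longlonglongrightarrow> 0"
  shows "(\<lambda>i. LINT t|I_on T. blinfun_apply (g i t) (f i t)) \<longlonglongrightarrow> (LINT t|I_on T. blinfun_apply (G t) (F t) :: real)"
proof (rule LIM_zero_cancel, rule tendsto_rabs_zero_cancel, rule tendsto_sandwich[OF always_eventually always_eventually tendsto_const])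
  \<comment> \<open>The three summands belong to the splitting of the difference of pairings into (g
    - G)(f - F), (g - G)(F) and G(f - F).\<close>
  define b where "b i = sqrt (L2sq T (\<lambda>t. g i t - G t)) * sqrt (L2sq T (\<lambda>t. f i t - F t)) + sqrt (L2sq T (\<lambda>t. g i t - G t)) * sqrt (L2sq T F)
    + sqrt (L2sq T G) * sqrt (L2sq T (\<lambda>t. f i t - F t))" for i
  have "b \<longlonglongrightarrow> sqrt 0 * sqrt 0 + sqrt 0 * sqrt (L2sq T F) + sqrt (L2sq T G) * sqrt 0"
    unfolding b_def by (intro tendsto_intros lim)
  then show "b \<longlonglongrightarrow> 0" by simp
  show "\<forall>i. \<bar>(LINT t|I_on T. (g i t) (f i t)) - (LINT t|I_on T. (G t) (F t))\<bar> \<le> b i"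
  proof
    fix i
    have d: "(\<lambda>t. g i t - G t) \<in> bochner_L2 T" "(\<lambda>t. f i t - F t) \<in> bochner_L2 T" by (intro L2_diff L G F)+
    note int = L2_integrable_pairing[OF d(1) d(2)] L2_integrable_pairing[OF d(1) F] L2_integrable_pairing[OF G d(2)]
      L2_integrable_pairing[OF G F] L2_integrable_pairing[OF L]
    have "(LINT t|I_on T. (g i t) (f i t)) - (LINT t|I_on T. (G t) (F t))
      = (LINT t|I_on T. (g i t) (f i t) - (G t) (F t))" using int by simp
    also have "\<dots> = (LINT t|I_on T. (g i t - G t) (f i t - F t) + (g i t - G t) (F t) + (G t) (f i t - F t))"
      by (simp add: blinfun.diff_left blinfun.diff_right)
    also have "\<dots> = (LINT t|I_on T. (g i t - G t) (f i t - F t)) + (LINT t|I_on T. (g i t - G t) (F t))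
      + (LINT t|I_on T. (G t) (f i t - F t))" using int by simp
    also have "\<bar>\<dots>\<bar> \<le> b i" unfolding b_def
      using L2_pairing_bound[OF d(1) d(2)] L2_pairing_bound[OF d(1) F] L2_pairing_bound[OF G d(2)] by linarith
    finally show "\<bar>(LINT t|I_on T. (g i t) (f i t)) - (LINT t|I_on T. (G t) (F t))\<bar> \<le> b i" .
  qed
qed simp

text \<open>Fatou's lemma with integrability of the limit as part of the conclusion;
  \<open>L2_complete\<close> uses it to transfer the Cauchy estimate to the limit function.\<close>

lemma Fatou_bound:
  fixes h :: "nat \<Rightarrow> 'a \<Rightarrow> real"
  assumes "\<And>j. integrable M (h j)" "\<And>j t. 0 \<le> h j t" "\<And>j. (LINT t|M. h j t) \<le> c"
    and "AE t in M. (\<lambda>j. h j t) \<longlonglongrightarrow> g t" "g \<in> borel_measurable M"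
  shows "integrable M g" "(LINT t|M. g t) \<le> c"
proof -
  have c: "0 \<le> c" using assms(3)[of 0] integral_nonneg_AE[of "h 0" M] assms(2) by fastforce
  have pos: "AE t in M. 0 \<le> g t" using assms(4) by eventually_elim (rule LIMSEQ_le_const, auto intro: assms(2))
  have "(\<integral>\<^sup>+t. ennreal (g t) \<partial>M) = (\<integral>\<^sup>+t. liminf (\<lambda>j. ennreal (h j t)) \<partial>M)"
  proof (rule nn_integral_cong_AE, use assms(4) in eventually_elim)
    case (elim t)
    then have "(\<lambda>j. ennreal (h j t)) \<longlonglongrightarrow> ennreal (g t)" by (rule tendsto_ennrealI)
    then show ?case by (simp add: lim_imp_Liminf)
  qed
  also have "\<dots> \<le> liminf (\<lambda>j. \<integral>\<^sup>+t. ennreal (h j t) \<partial>M)"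
    by (rule nn_integral_liminf) (use assms(1) in measurable)
  also have "\<dots> \<le> liminf (\<lambda>j. ennreal c)"
  proof (rule Liminf_mono, rule always_eventually, rule allI)
    fix j show "(\<integral>\<^sup>+t. ennreal (h j t) \<partial>M) \<le> ennreal c"
      using nn_integral_eq_integral[OF assms(1)] assms(2,3) by (simp add: ennreal_leI)
  qed
  finally have le: "(\<integral>\<^sup>+t. ennreal (g t) \<partial>M) \<le> ennreal c" by (simp add: Liminf_const)
  show int: "integrable M g"
    by (rule integrableI_nonneg) (use assms(5) pos le in \<open>auto intro: le_less_trans\<close>)
  show "(LINT t|M. g t) \<le> c"
    using le nn_integral_eq_integral[OF int pos] c by simp
qed

section \<open>Density of continuous functions among square integrable ones\<close>

definition cont_approximable :: "real \<Rightarrow> (real \<Rightarrow> 'b::real_normed_vector) \<Rightarrow> bool" where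
  "cont_approximable T y \<longleftrightarrow> y \<in> bochner_L2 T \<and>
     (\<forall>e>0. \<exists>\<phi>. continuous_on UNIV \<phi> \<and> \<phi> \<in> bochner_L2 T \<and> L2sq T (\<lambda>t. y t - \<phi> t) < e)"

text \<open>Sampling at the largest grid point not exceeding t gives simple functions, which
  converge by continuity. The sampling point stays in \<open>{0..T}\<close>, where continuity is
  assumed.\<close>

lemma continuous_bochner_L2:
  fixes \<phi> :: "real \<Rightarrow> 'b::real_normed_vector"
  assumes "continuous_on {0..T} \<phi>"
  shows "\<phi> \<in> bochner_L2 T"
proof -
  define d where "d i t = \<phi> (real_of_int \<lfloor>t * real (Suc i)\<rfloor> / real (Suc i))" for i :: nat and t
  have "bounded (\<phi> ` {0..T})" by (intro compact_imp_bounded compact_continuous_image assms) auto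
  then obtain B where B: "\<And>t. t \<in> {0..T} \<Longrightarrow> norm (\<phi> t) \<le> B" unfolding bounded_iff by blast
  have simple: "simple_function (I_on T) (d i)" for i
  proof -
    have "simple_function (I_on T) (\<lambda>t. \<lfloor>t * real (Suc i)\<rfloor>)"
    proof (rule simple_function_eq_measurable[THEN iffD2], intro conjI)
      have "(\<lambda>t. \<lfloor>t * real (Suc i)\<rfloor>) ` space (I_on T) \<subseteq> {0..\<lfloor>T * real (Suc i)\<rfloor>}"
      proof (rule image_subsetI)
        fix t assume "t \<in> space (I_on T)"
        then have t: "0 \<le> t" "t \<le> T" by auto
        then have "0 \<le> t * real (Suc i)" by simp
        moreover have "\<lfloor>t * real (Suc i)\<rfloor> \<le> \<lfloor>T * real (Suc i)\<rfloor>"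
          using t by (intro floor_mono mult_right_mono) auto
        ultimately show "\<lfloor>t * real (Suc i)\<rfloor> \<in> {0..\<lfloor>T * real (Suc i)\<rfloor>}" by simp
      qed
      then show "finite ((\<lambda>t. \<lfloor>t * real (Suc i)\<rfloor>) ` space (I_on T))" by (rule finite_subset) simp
      have "(\<lambda>t::real. t * real (Suc i)) \<in> borel_measurable lborel" by simp
      from measurable_compose[OF this measurable_real_floor]
      have "(\<lambda>t. \<lfloor>t * real (Suc i)\<rfloor>) \<in> measurable lebesgue (count_space UNIV)"
        by (rule measurable_completion)
      then show "(\<lambda>t. \<lfloor>t * real (Suc i)\<rfloor>) \<in> measurable (I_on T) (count_space UNIV)"
        by (rule measurable_restrict_space1)
    qed
    then show ?thesis unfolding d_def by (rule simple_function_compose1)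
  qed
  have lim: "(\<lambda>i. d i t) \<longlonglongrightarrow> \<phi> t" if "t \<in> {0..T}" for t
  proof -
    define s where "s i = real_of_int \<lfloor>t * real (Suc i)\<rfloor> / real (Suc i)" for i
    have le: "s i \<le> t" for i
      unfolding s_def using of_int_floor_le[of "t * real (Suc i)"] by (simp add: divide_le_eq del: of_nat_Suc)
    have ge: "t - inverse (real (Suc i)) \<le> s i" for i
    proof -
      have "t - inverse (real (Suc i)) = (t * real (Suc i) - 1) / real (Suc i)" by (simp add: field_simps)
      also have "\<dots> \<le> s i" unfolding s_def by (rule divide_right_mono) linarith+
      finally show ?thesis .
    qed
    have "(\<lambda>i. t - inverse (real (Suc i))) \<longlonglongrightarrow> t - 0"
      by (intro tendsto_intros LIMSEQ_inverse_real_of_nat)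
    then have "s \<longlonglongrightarrow> t"
      by (intro tendsto_sandwich[of "\<lambda>i. t - inverse (real (Suc i))" s _ "\<lambda>i. t"]) (use le ge in auto)
    moreover have "s i \<in> {0..T}" for i
      using le[of i] that unfolding s_def by (auto simp: divide_nonneg_pos)
    ultimately have "(\<lambda>i. \<phi> (s i)) \<longlonglongrightarrow> \<phi> t"
      using continuous_on_tendsto_compose[OF assms, of s t] that by auto
    then show ?thesis unfolding d_def s_def .
  qed
  have "strongly_measurable (I_on T) \<phi>"
    unfolding strongly_measurable_def using simple lim by (intro exI[of _ d]) auto
  then show ?thesis by (rule L2_bounded[of _ _ B]) (use B in auto)
qed

lemma cont_approximable_add:
  assumes "cont_approximable T f" "cont_approximable T g"
  shows "cont_approximable T (\<lambda>t. f t + g t)"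
  unfolding cont_approximable_def
proof (intro conjI allI impI)
  show "(\<lambda>t. f t + g t) \<in> bochner_L2 T" using assms unfolding cont_approximable_def by (auto intro: L2_add)
  fix e :: real assume "e > 0"
  then have "e / 4 > 0" by simp
  then obtain \<phi> \<psi> where *: "continuous_on UNIV \<phi>" "\<phi> \<in> bochner_L2 T" "L2sq T (\<lambda>t. f t - \<phi> t) < e / 4"
    "continuous_on UNIV \<psi>" "\<psi> \<in> bochner_L2 T" "L2sq T (\<lambda>t. g t - \<psi> t) < e / 4"
    using assms unfolding cont_approximable_def by meson
  have "L2sq T (\<lambda>t. (f t - \<phi> t) + (g t - \<psi> t)) \<le> 2 * L2sq T (\<lambda>t. f t - \<phi> t) + 2 * L2sq T (\<lambda>t. g t - \<psi> t)"
    using assms * unfolding cont_approximable_def by (intro L2sq_add_le L2_diff) auto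
  also have "\<dots> < e" using * by simp
  finally have "L2sq T (\<lambda>t. (f t + g t) - (\<phi> t + \<psi> t)) < e" by (simp add: algebra_simps)
  then show "\<exists>\<phi>. continuous_on UNIV \<phi> \<and> \<phi> \<in> bochner_L2 T \<and> L2sq T (\<lambda>t. f t + g t - \<phi> t) < e"
    using * by (intro exI[of _ "\<lambda>t. \<phi> t + \<psi> t"]) (auto intro: continuous_intros L2_add)
qed

lemma cont_approximable_limit:
  assumes "y \<in> bochner_L2 T" "\<And>e. e > 0 \<Longrightarrow> \<exists>f. cont_approximable T f \<and> L2sq T (\<lambda>t. y t - f t) < e"
  shows "cont_approximable T y"
  unfolding cont_approximable_def
proof (intro conjI allI impI assms(1))
  fix e :: real assume "e > 0"
  then have e: "e / 4 > 0" by simp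
  then obtain f where f: "cont_approximable T f" "L2sq T (\<lambda>t. y t - f t) < e / 4" using assms(2) by blast
  then obtain \<phi> where *: "continuous_on UNIV \<phi>" "\<phi> \<in> bochner_L2 T" "L2sq T (\<lambda>t. f t - \<phi> t) < e / 4"
    using e unfolding cont_approximable_def by meson
  have "L2sq T (\<lambda>t. y t - \<phi> t) < e"
    using L2sq_triangle[OF assms(1) _ *(2), of f] f * unfolding cont_approximable_def by auto
  then show "\<exists>\<phi>. continuous_on UNIV \<phi> \<and> \<phi> \<in> bochner_L2 T \<and> L2sq T (\<lambda>t. y t - \<phi> t) < e"
    using * by blast
qed

text \<open>The indicator of a Lebesgue measurable set is a limit of continuous functions off a
  negligible set. Clipping these to the unit interval supplies the constant majorant for dominated
  convergence.\<close>

lemma cont_approximable_indicator: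
  fixes x :: "'b::real_normed_vector"
  assumes A: "A \<in> sets (I_on T)"
  shows "cont_approximable T (\<lambda>t. indicator A t *\<^sub>R x)"
  unfolding cont_approximable_def
proof (intro conjI allI impI)
  obtain B where B: "B \<in> sets lebesgue" "A = {0..T} \<inter> B"
    using A unfolding sets_restrict_space by blast
  have Aleb: "A \<in> sets lebesgue" unfolding B(2) by (rule sets.Int[OF I_sets(1) B(1)])
  have "simple_function (I_on T) (\<lambda>t. indicator A t *\<^sub>R x)"
    by (rule simple_function_compose1[where g="\<lambda>i. i *\<^sub>R x"], rule simple_function_indicator, rule A)
  then have "strongly_measurable (I_on T) (\<lambda>t. indicator A t *\<^sub>R x)"
    unfolding strongly_measurable_def by (intro exI[of _ "\<lambda>i t. indicator A t *\<^sub>R x"]) auto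
  then show L2: "(\<lambda>t. indicator A t *\<^sub>R x) \<in> bochner_L2 T"
    by (rule L2_bounded[of _ _ "norm x"]) (auto simp: indicator_def)
  fix e :: real assume e: "e > 0"
  obtain N g where N: "negligible N" and g: "\<And>n. continuous_on UNIV (g n)"
    "\<And>t. t \<notin> N \<Longrightarrow> (\<lambda>n. g n t) \<longlonglongrightarrow> indicat_real A t"
    using indicator_measurable_on[OF Aleb] unfolding measurable_on_def by auto
  define h where "h n t = max 0 (min 1 (g n t))" for n t
  have h_cont: "continuous_on UNIV (h n)" for n
    unfolding h_def using g(1)[of n] by (intro continuous_intros)
  have h_lim: "(\<lambda>n. h n t) \<longlonglongrightarrow> indicat_real A t" if "t \<notin> N" for t
  proof -
    have "(\<lambda>n. max 0 (min 1 (g n t))) \<longlonglongrightarrow> max 0 (min 1 (indicat_real A t))"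
      by (intro tendsto_intros g(2) that)
    then show ?thesis unfolding h_def by (simp add: indicator_def split: if_splits)
  qed
  have h_bd: "0 \<le> h n t" "h n t \<le> 1" for n t unfolding h_def by auto
  have AE_N: "AE t in I_on T. t \<notin> N"
  proof -
    have "N \<in> null_sets lebesgue" using N by (simp add: negligible_iff_null_sets)
    then have "AE t in lebesgue. t \<notin> N" by (rule AE_not_in)
    then have "AE t in lebesgue. 0 \<le> t \<and> t \<le> T \<longrightarrow> t \<notin> N" by eventually_elim simp
    then show ?thesis by (simp add: AE_restrict_space_iff)
  qed
  have h_L2: "h n \<in> bochner_L2 T" for n
    using h_cont by (intro continuous_bochner_L2) (rule continuous_on_subset, auto)
  have h_meas: "h n \<in> borel_measurable (I_on T)" for n
    using L2_sm[OF h_L2] by (simp add: strongly_measurable_real_iff)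
  have "(\<lambda>n. LINT t|I_on T. (norm (indicat_real A t *\<^sub>R x - h n t *\<^sub>R x))\<^sup>2) \<longlonglongrightarrow> (LINT t|I_on T. 0)"
  proof (rule integral_dominated_convergence[where w="\<lambda>t. (norm x)\<^sup>2"])
    show "(\<lambda>t. (norm (indicat_real A t *\<^sub>R x - h n t *\<^sub>R x))\<^sup>2) \<in> borel_measurable (I_on T)" for n
      using A h_meas[of n] by (simp add: scaleR_diff_left[symmetric])
    show "AE t in I_on T. (\<lambda>n. (norm (indicat_real A t *\<^sub>R x - h n t *\<^sub>R x))\<^sup>2) \<longlonglongrightarrow> 0"
      using AE_N
    proof eventually_elim
      case (elim t)
      have "(\<lambda>n. (norm (indicat_real A t *\<^sub>R x - h n t *\<^sub>R x))\<^sup>2)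
        \<longlonglongrightarrow> (norm (indicat_real A t *\<^sub>R x - indicat_real A t *\<^sub>R x))\<^sup>2"
        by (intro tendsto_intros h_lim elim)
      then show ?case by simp
    qed
    show "AE t in I_on T. norm ((norm (indicat_real A t *\<^sub>R x - h n t *\<^sub>R x))\<^sup>2) \<le> (norm x)\<^sup>2" for n
    proof (rule AE_I2)
      fix t
      have "\<bar>indicat_real A t - h n t\<bar> \<le> 1" using h_bd[of n t] by (auto simp: indicator_def)
      then have "norm (indicat_real A t *\<^sub>R x - h n t *\<^sub>R x) \<le> norm x"
        by (simp add: scaleR_diff_left[symmetric] mult_left_le_one_le)
      then show "norm ((norm (indicat_real A t *\<^sub>R x - h n t *\<^sub>R x))\<^sup>2) \<le> (norm x)\<^sup>2"
        by (simp add: power_mono)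
    qed
  qed auto
  then have "eventually (\<lambda>n. L2sq T (\<lambda>t. indicator A t *\<^sub>R x - h n t *\<^sub>R x) < e) sequentially"
    unfolding L2sq_def using e by (intro order_tendstoD(2)) auto
  then obtain n where n: "L2sq T (\<lambda>t. indicator A t *\<^sub>R x - h n t *\<^sub>R x) < e"
    by (auto simp: eventually_sequentially)
  have "continuous_on UNIV (\<lambda>t. h n t *\<^sub>R x)" by (intro continuous_intros h_cont)
  moreover then have "(\<lambda>t. h n t *\<^sub>R x) \<in> bochner_L2 T"
    by (intro continuous_bochner_L2) (rule continuous_on_subset, auto)
  ultimately show "\<exists>\<phi>. continuous_on UNIV \<phi> \<and> \<phi> \<in> bochner_L2 T \<and> L2sq T (\<lambda>t. indicator A t *\<^sub>R x - \<phi> t) < e"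
    using n by blast
qed

lemma cont_approximable_cong:
  assumes "cont_approximable T f" "\<And>t. t \<in> {0..T} \<Longrightarrow> f t = g t"
  shows "cont_approximable T g"
proof -
  have "L2sq T (\<lambda>t. g t - \<phi> t) = L2sq T (\<lambda>t. f t - \<phi> t)" for \<phi>
    unfolding L2sq_def by (rule Bochner_Integration.integral_cong) (use assms(2) in auto)
  moreover have "g \<in> bochner_L2 T"
    by (rule L2_cong_AE[of f]) (use assms in \<open>auto simp: cont_approximable_def\<close>)
  ultimately show ?thesis using assms(1) unfolding cont_approximable_def by simp
qed

lemma cont_approximable_simple:
  fixes s :: "real \<Rightarrow> 'b::real_normed_vector"
  assumes "simple_function (I_on T) s"
  shows "cont_approximable T s"
proof -
  have fin: "finite (s ` {0..T})" using simple_functionD(1)[OF assms] by simp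
  have sets: "s -` {x} \<inter> {0..T} \<in> sets (I_on T)" for x
    using simple_functionD(2)[OF assms, of "{x}"] by simp
  have "cont_approximable T (\<lambda>t. \<Sum>x\<in>F. indicator (s -` {x} \<inter> {0..T}) t *\<^sub>R x)" if "finite F" for F
    using that
  proof induction
    case empty
    show ?case using cont_approximable_indicator[of "{}" T 0] by simp
  next
    case (insert x F)
    have "cont_approximable T (\<lambda>t. indicator (s -` {x} \<inter> {0..T}) t *\<^sub>R x
        + (\<Sum>x\<in>F. indicator (s -` {x} \<inter> {0..T}) t *\<^sub>R x))"
      by (rule cont_approximable_add[OF cont_approximable_indicator[OF sets] insert.IH])
    also have "(\<lambda>t. indicator (s -` {x} \<inter> {0..T}) t *\<^sub>R x
        + (\<Sum>x\<in>F. indicator (s -` {x} \<inter> {0..T}) t *\<^sub>R x))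
        = (\<lambda>t. \<Sum>x\<in>insert x F. indicator (s -` {x} \<inter> {0..T}) t *\<^sub>R x)"
      by (rule ext, rule sum.insert[symmetric]) (rule insert.hyps)+
    finally show ?case .
  qed
  from this[OF fin] show ?thesis
  proof (rule cont_approximable_cong)
    fix t assume t: "t \<in> {0..T}"
    have "(\<Sum>x\<in>s ` {0..T}. indicator (s -` {x} \<inter> {0..T}) t *\<^sub>R x) = (\<Sum>x\<in>s ` {0..T}. if x = s t then x else 0)"
      by (rule sum.cong) (use t in \<open>auto simp: indicator_def\<close>)
    then show "(\<Sum>x\<in>s ` {0..T}. indicator (s -` {x} \<inter> {0..T}) t *\<^sub>R x) = s t"
      using fin t by (simp add: sum.delta)
  qed
qed

lemma L2_cont_approximable:
  fixes y :: "real \<Rightarrow> 'b::real_normed_vector"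
  assumes y: "y \<in> bochner_L2 T"
  shows "cont_approximable T y"
proof (rule cont_approximable_limit[OF y])
  fix e :: real assume e: "e > 0"
  obtain s where s: "\<And>i. simple_function (I_on T) (s i)" "AE t in I_on T. (\<lambda>i::nat. s i t) \<longlonglongrightarrow> y t"
    using L2_sm[OF y] unfolding strongly_measurable_def by blast
  \<comment> \<open>The approximating simple functions need not be dominated. Discarding values
    larger than twice the limit yields the majorant 3 |y|, hence the 9 for squares; convergence
    survives, since for y t \<noteq> 0 the discarding eventually stops and for y t = 0 all values
    become 0.\<close>
  define r where "r i t = (if norm (s i t) \<le> 2 * norm (y t) then s i t else 0)" for i t
  have r: "simple_function (I_on T) (r i)" for i
  proof -
    have [measurable]: "(\<lambda>t. norm (y t)) \<in> borel_measurable (I_on T)"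
      by (rule strongly_measurable_norm_borel[OF L2_sm[OF y]])
    have [measurable]: "(\<lambda>t. norm (s i t)) \<in> borel_measurable (I_on T)"
      by (rule borel_measurable_simple_function, rule simple_function_compose1[OF s(1)])
    have "{t \<in> space (I_on T). norm (s i t) \<le> 2 * norm (y t)} \<in> sets (I_on T)" by measurable
    then have "simple_function (I_on T) (\<lambda>t. if t \<in> {t \<in> space (I_on T). norm (s i t) \<le> 2 * norm (y t)} then s i t else 0)"
      by (intro simple_function_If_set s) auto
    then show ?thesis unfolding r_def by (rule simple_function_cong[THEN iffD1, rotated]) auto
  qed
  have sm: "strongly_measurable (I_on T) (\<lambda>t. y t - r i t)" for i
  proof -
    have "strongly_measurable (I_on T) (r i)" unfolding strongly_measurable_def
      by (intro exI[of _ "\<lambda>j. r i"]) (use r in auto)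
    then show ?thesis using L2_sm[OF y] by (intro strongly_measurable_diff)
  qed
  have "(\<lambda>i. LINT t|I_on T. (norm (y t - r i t))\<^sup>2) \<longlonglongrightarrow> (LINT t|I_on T. 0)"
  proof (rule integral_dominated_convergence[where w="\<lambda>t. 9 * (norm (y t))\<^sup>2"])
    show "(\<lambda>t. (norm (y t - r i t))\<^sup>2) \<in> borel_measurable (I_on T)" for i
      using strongly_measurable_norm_borel[OF sm] by measurable
    show "integrable (I_on T) (\<lambda>t. 9 * (norm (y t))\<^sup>2)" using L2_integrable[OF y] by simp
    show "AE t in I_on T. norm ((norm (y t - r i t))\<^sup>2) \<le> 9 * (norm (y t))\<^sup>2" for i
    proof (rule AE_I2)
      fix t
      have "norm (y t - r i t) \<le> norm (y t) + norm (r i t)" by (rule norm_triangle_ineq4)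
      also have "norm (r i t) \<le> 2 * norm (y t)" unfolding r_def by auto
      finally have "norm (y t - r i t) \<le> 3 * norm (y t)" by simp
      from power_mono[OF this, of 2] show "norm ((norm (y t - r i t))\<^sup>2) \<le> 9 * (norm (y t))\<^sup>2"
        by (simp add: power_mult_distrib)
    qed
    show "AE t in I_on T. (\<lambda>i. (norm (y t - r i t))\<^sup>2) \<longlonglongrightarrow> 0" using s(2)
    proof eventually_elim
      case (elim t)
      have "(\<lambda>i. r i t) \<longlonglongrightarrow> y t"
      proof (cases "y t = 0")
        case True
        then have "r i t = 0" for i unfolding r_def by auto
        then show ?thesis using True by simp
      next
        case False
        have "(\<lambda>i. norm (s i t)) \<longlonglongrightarrow> norm (y t)" by (intro tendsto_intros elim)
        then have "eventually (\<lambda>i. norm (s i t) < 2 * norm (y t)) sequentially"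
          by (rule order_tendstoD(2)) (use False in simp)
        then have "eventually (\<lambda>i. r i t = s i t) sequentially"
          by eventually_elim (simp add: r_def)
        then show ?thesis using elim by (simp add: tendsto_cong)
      qed
      then have "(\<lambda>i. (norm (y t - r i t))\<^sup>2) \<longlonglongrightarrow> (norm (y t - y t))\<^sup>2" by (intro tendsto_intros)
      then show ?case by simp
    qed
  qed auto
  then have "eventually (\<lambda>n. L2sq T (\<lambda>t. y t - r n t) < e) sequentially"
    unfolding L2sq_def using e by (intro order_tendstoD(2)) auto
  then obtain n where n: "L2sq T (\<lambda>t. y t - r n t) < e" by (auto simp: eventually_sequentially)
  show "\<exists>f. cont_approximable T f \<and> L2sq T (\<lambda>t. y t - f t) < e"
    by (rule exI[of _ "r n"], rule conjI, rule cont_approximable_simple, rule r, rule n)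
qed

lemma L2_continuous_dense:
  fixes y :: "real \<Rightarrow> 'b::real_normed_vector"
  assumes "y \<in> bochner_L2 T" "e > 0"
  obtains \<phi> where "continuous_on UNIV \<phi>" "\<phi> \<in> bochner_L2 T" "L2sq T (\<lambda>t. y t - \<phi> t) < e"
  using L2_cont_approximable[OF assms(1)] assms(2) unfolding cont_approximable_def by blast

section \<open>Finite-dimensional approximation\<close>

text \<open>\<open>C n\<close> stands for an orthonormal basis of the n-th discrete space, and
  \<open>C_lim\<close> is what \<open>lim_subspaces\<close> means for the orthogonal projections.
  The union of these finite sets also carries the separability on which the measurability results
  rest.\<close>

locale orthonormal_approximation =
  fixes C :: "nat \<Rightarrow> 'u::{real_inner,banach} set"
  assumes C_finite: "\<And>n. finite (C n)" and C_orthogonal: "\<And>n. pairwise orthogonal (C n)"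
    and C_norm: "\<And>n c. c \<in> C n \<Longrightarrow> norm c = 1"
    and C_lim: "\<And>x. (\<lambda>n. \<Sum>c\<in>C n. (x \<bullet> c) *\<^sub>R c) \<longlonglongrightarrow> x"
begin

definition P :: "nat \<Rightarrow> 'u \<Rightarrow> 'u" where
  "P n x = (\<Sum>c\<in>C n. (x \<bullet> c) *\<^sub>R c)"

lemma P_tendsto: "(\<lambda>n. P n x) \<longlonglongrightarrow> x"
  unfolding P_def by (rule C_lim)

lemma C_inner: "c \<in> C n \<Longrightarrow> d \<in> C n \<Longrightarrow> c \<bullet> d = (if c = d then 1 else 0)"
  using C_orthogonal[of n] C_norm[of c n]
  by (auto simp: pairwise_def orthogonal_def norm_eq_1)

lemma P_in_span [simp]: "P n x \<in> span (C n)"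
  unfolding P_def by (intro span_sum span_scale span_base)

lemma P_inner_C: "d \<in> C n \<Longrightarrow> P n x \<bullet> d = x \<bullet> d"
proof -
  assume d: "d \<in> C n"
  have "P n x \<bullet> d = (\<Sum>c\<in>C n. (x \<bullet> c) * (c \<bullet> d))" unfolding P_def by (simp add: inner_sum_left)
  also have "\<dots> = (\<Sum>c\<in>C n. if c = d then x \<bullet> c else 0)"
    by (rule sum.cong) (use d C_inner in auto)
  also have "\<dots> = x \<bullet> d" using d C_finite by (simp add: sum.delta')
  finally show ?thesis .
qed

lemma P_inner: "v \<in> span (C n) \<Longrightarrow> P n x \<bullet> v = x \<bullet> v"
proof (induction v rule: span_induct_alt)
  case (step c d v)
  then show ?case by (simp add: inner_add_right P_inner_C)
qed simp

lemma linear_P: "linear (P n)"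
  unfolding P_def by (rule linearI) (simp_all add: inner_add_left scaleR_add_left sum.distrib scaleR_sum_right)

lemma P_sym: "P n x \<bullet> y = x \<bullet> P n y"
  unfolding P_def by (simp add: inner_sum_left inner_sum_right inner_commute mult.commute)

lemma P_id: "v \<in> span (C n) \<Longrightarrow> P n v = v"
proof -
  assume v: "v \<in> span (C n)"
  have "P n v - v \<in> span (C n)" using v by (intro span_diff P_in_span)
  then have "(P n v - v) \<bullet> (P n v - v) = 0"
    using P_inner[of "P n v - v" n v] by (simp add: inner_diff_left)
  then show ?thesis by simp
qed

lemma norm_P_le: "norm (P n x) \<le> norm x"
proof (cases "P n x = 0")
  case False
  have "norm (P n x) * norm (P n x) \<le> norm x * norm (P n x)"
    using P_inner[of "P n x" n x] norm_cauchy_schwarz[of x "P n x"]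
    by (simp add: power2_norm_eq_inner[symmetric] power2_eq_square)
  then show ?thesis using False by simp
qed simp

lemma bounded_linear_P: "bounded_linear (P n)"
  using linear_P norm_P_le by (intro linear_conv_bounded_linear[THEN iffD1] bounded_linear_intro[where K=1])
    (auto simp: linear_add linear_scale)

lemma P_diff: "P n (x - y) = P n x - P n y" and P_add: "P n (x + y) = P n x + P n y"
  and P_scaleR: "P n (c *\<^sub>R x) = c *\<^sub>R P n x"
  using linear_P by (auto simp: linear_diff linear_add linear_scale)

text \<open>
  A Pettis theorem without separability assumptions on the type: simple functions approximating the
  coordinates of \<open>P n (f t)\<close> converge to \<open>f t\<close>.
\<close>

lemma weakly_measurable_strongly:
  fixes f :: "real \<Rightarrow> 'u"
  assumes S: "S \<in> sets lebesgue" and f: "\<And>v. (\<lambda>t. f t \<bullet> v) \<in> borel_measurable (lebesgue_on S)"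
  shows "strongly_measurable (lebesgue_on S) f"
proof -
  \<comment> \<open>A grid of width 1 / m n is so fine that rounding all \<open>card (C n)\<close>
    coordinates costs at most 1 / (n + 1) in norm.\<close>
  define m where "m n = (real n + 1) * (real (card (C n)) + 1)" for n
  have m: "m n \<ge> real n + 1" "m n > 0" "real (card (C n)) / m n \<le> inverse (real (Suc n))" for n
  proof -
    show "m n \<ge> real n + 1" unfolding m_def by (simp add: mult_le_cancel_left1)
    then show "m n > 0" by linarith
    show "real (card (C n)) / m n \<le> inverse (real (Suc n))"
      unfolding m_def by (simp add: inverse_eq_divide frac_le_eq divide_simps) (simp add: algebra_simps)
  qed
  \<comment> \<open>The cutoff makes the range finite. For fixed t it is inactive as soon as n
    exceeds the norm of f t, because the coordinates refer to unit vectors.\<close>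
  define r where "r n x = (if \<bar>x\<bar> \<le> real n then real_of_int \<lfloor>x * m n\<rfloor> / m n else 0)" for n and x :: real
  define s where "s n t = (\<Sum>c\<in>C n. r n (f t \<bullet> c) *\<^sub>R c)" for n t
  have "simple_function (lebesgue_on S) (\<lambda>t. r n (f t \<bullet> c))" for n c
  proof (rule simple_function_borel_measurable)
    show "(\<lambda>t. r n (f t \<bullet> c)) \<in> borel_measurable (lebesgue_on S)"
      using f[of c] unfolding r_def by measurable
    define B where "B = \<lfloor>- (real n * m n)\<rfloor>"
    define B' where "B' = \<lfloor>real n * m n\<rfloor>"
    have "r n x \<in> insert 0 ((\<lambda>i. real_of_int i / m n) ` {B..B'})" for x
    proof (cases "\<bar>x\<bar> \<le> real n")
      case True
      then have "x \<le> real n" "- real n \<le> x" by auto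
      then have "x * m n \<le> real n * m n" "- real n * m n \<le> x * m n"
        using m(2)[of n] by (intro mult_right_mono; simp)+
      then have "\<lfloor>x * m n\<rfloor> \<in> {B..B'}" unfolding B_def B'_def by (auto intro!: floor_mono)
      then show ?thesis using True unfolding r_def by auto
    qed (simp add: r_def)
    then have "(\<lambda>t. r n (f t \<bullet> c)) ` space (lebesgue_on S) \<subseteq> insert 0 ((\<lambda>i. real_of_int i / m n) ` {B..B'})"
      by blast
    then show "finite ((\<lambda>t. r n (f t \<bullet> c)) ` space (lebesgue_on S))" by (rule finite_subset) simp
  qed
  note r_simple = this
  have simple: "simple_function (lebesgue_on S) (s n)" for n
    unfolding s_def
  proof (rule simple_function_sum)
    fix c
    show "simple_function (lebesgue_on S) (\<lambda>t. r n (f t \<bullet> c) *\<^sub>R c)"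
      by (rule simple_function_compose1[OF r_simple, where g="\<lambda>x. x *\<^sub>R c"])
  qed
  have err: "norm (s n t - P n (f t)) \<le> inverse (real (Suc n))" if "norm (f t) \<le> real n" for n t
  proof -
    have "norm (s n t - P n (f t)) \<le> (\<Sum>c\<in>C n. norm ((r n (f t \<bullet> c) - f t \<bullet> c) *\<^sub>R c))"
      unfolding s_def P_def sum_subtractf[symmetric] scaleR_diff_left[symmetric] by (rule norm_sum)
    also have "\<dots> \<le> (\<Sum>c\<in>C n. 1 / m n)"
    proof (rule sum_mono)
      fix c assume c: "c \<in> C n"
      have "\<bar>f t \<bullet> c\<bar> \<le> norm (f t) * norm c" by (rule Cauchy_Schwarz_ineq2)
      then have "\<bar>f t \<bullet> c\<bar> \<le> real n" using that C_norm[OF c] by simp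
      then have "r n (f t \<bullet> c) = real_of_int \<lfloor>(f t \<bullet> c) * m n\<rfloor> / m n" unfolding r_def by simp
      then have "r n (f t \<bullet> c) - f t \<bullet> c = (real_of_int \<lfloor>(f t \<bullet> c) * m n\<rfloor> - (f t \<bullet> c) * m n) / m n"
        using m(2)[of n] by (simp add: field_simps)
      moreover have "\<bar>real_of_int \<lfloor>(f t \<bullet> c) * m n\<rfloor> - (f t \<bullet> c) * m n\<bar> \<le> 1" by linarith
      ultimately have "\<bar>r n (f t \<bullet> c) - f t \<bullet> c\<bar> \<le> 1 / m n"
        using m(2)[of n] by (simp add: divide_right_mono)
      then show "norm ((r n (f t \<bullet> c) - f t \<bullet> c) *\<^sub>R c) \<le> 1 / m n" using C_norm[OF c] by simp
    qed
    also have "\<dots> \<le> inverse (real (Suc n))" using m(3)[of n] by simp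
    finally show ?thesis .
  qed
  have "(\<lambda>n. s n t) \<longlonglongrightarrow> f t" for t
  proof -
    obtain N where N: "norm (f t) \<le> real N" using real_arch_simple by blast
    have "(\<lambda>n. s n t - P n (f t)) \<longlonglongrightarrow> 0"
    proof (rule Lim_null_comparison[OF _ LIMSEQ_inverse_real_of_nat])
      show "\<forall>\<^sub>F n in sequentially. norm (s n t - P n (f t)) \<le> inverse (real (Suc n))"
        using eventually_ge_at_top[of N] by eventually_elim (use N err in \<open>auto intro: order_trans\<close>)
    qed
    from tendsto_add[OF this P_tendsto[of "f t"]] show ?thesis by simp
  qed
  then show ?thesis unfolding strongly_measurable_def using simple by (intro exI[of _ s]) auto
qed

lemma weakly_measurable_strongly_dual:
  fixes g :: "real \<Rightarrow> 'u \<Rightarrow>\<^sub>L real"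
  assumes S: "S \<in> sets lebesgue" and g: "\<And>v. (\<lambda>t. blinfun_apply (g t) v) \<in> borel_measurable (lebesgue_on S)"
  shows "strongly_measurable (lebesgue_on S) g"
proof -
  have "strongly_measurable (lebesgue_on S) (\<lambda>t. riesz (g t))"
    by (rule weakly_measurable_strongly[OF S]) (use g in simp)
  from strongly_measurable_bounded_linear[OF this bounded_linear_blinfun_inner_right]
  show ?thesis by simp
qed

lemma strongly_measurable_AE_limit:
  fixes f :: "real \<Rightarrow> 'u"
  assumes S: "S \<in> sets lebesgue" and s: "\<And>i::nat. strongly_measurable (lebesgue_on S) (s i)"
    and lim: "AE t in lebesgue_on S. (\<lambda>i. s i t) \<longlonglongrightarrow> f t"
  shows "strongly_measurable (lebesgue_on S) f"
proof (rule weakly_measurable_strongly[OF S])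
  fix v
  show "(\<lambda>t. f t \<bullet> v) \<in> borel_measurable (lebesgue_on S)"
  proof (rule borel_measurable_AE_limit[OF S])
    show "(\<lambda>t. s i t \<bullet> v) \<in> borel_measurable (lebesgue_on S)" for i
      using strongly_measurable_inner[OF s strongly_measurable_const] by (simp add: strongly_measurable_real_iff S)
    show "AE t in lebesgue_on S. (\<lambda>i. s i t \<bullet> v) \<longlonglongrightarrow> f t \<bullet> v"
      using lim by eventually_elim (intro tendsto_intros)
  qed
qed

text \<open>The Riesz-Fischer argument: a subsequence with rapidly decreasing increments converges
  almost everywhere, and Fatou's lemma bounds the distance to its limit. That subsequence is
  returned as well, since pointwise convergence is later needed to match the limit with one found in
  \<open>H\<close>.\<close>

lemma L2_complete:
  fixes y :: "nat \<Rightarrow> real \<Rightarrow> 'u"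
  assumes T: "T \<ge> 0" and y: "\<And>i. y i \<in> bochner_L2 T"
    and Cauchy: "\<And>e. e > 0 \<Longrightarrow> \<exists>n0. \<forall>i\<ge>n0. \<forall>j\<ge>n0. L2sq T (\<lambda>t. y i t - y j t) < e"
  obtains z r where "z \<in> bochner_L2 T" "strict_mono (r::nat\<Rightarrow>nat)"
    "AE t in I_on T. (\<lambda>i. y (r i) t) \<longlonglongrightarrow> z t" "(\<lambda>i. L2sq T (\<lambda>t. y i t - z t)) \<longlonglongrightarrow> 0"
proof -
  have "\<exists>n0. \<forall>i\<ge>n0. \<forall>j\<ge>n0. L2sq T (\<lambda>t. y i t - y j t) < (1/4)^k" for k :: nat
    by (rule Cauchy) simp
  then obtain n0 where n0: "\<And>k i j. i \<ge> n0 k \<Longrightarrow> j \<ge> n0 k \<Longrightarrow> L2sq T (\<lambda>t. y i t - y j t) < (1/4)^k"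
    by metis
  \<comment> \<open>Summing makes \<open>r\<close> strictly increasing and keeps it above
    \<open>n0\<close>, which need not be monotone.\<close>
  define r where "r k = (\<Sum>i\<le>k. n0 i + 1)" for k
  have r_mono: "strict_mono r" unfolding strict_mono_Suc_iff r_def by simp
  have r_ge: "r k \<ge> n0 k" for k unfolding r_def by (induction k) auto
  define d where "d k t = y (r (Suc k)) t - y (r k) t" for k t
  have d_L2: "d k \<in> bochner_L2 T" for k unfolding d_def by (intro L2_diff y)
  have d_le: "L2sq T (d k) \<le> (1/4)^k" for k
    unfolding d_def using n0[of k "r (Suc k)" "r k"] r_ge[of k] strict_monoD[OF r_mono, of k "Suc k"] by simp
  have d_int: "integrable (I_on T) (\<lambda>t. norm (d k t))" for k
    by (rule L2_integrable_norm[OF d_L2])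
  \<comment> \<open>Squared norms of size 4^(-k) give integrals of size 2^(-k) through x \<le> p +
    x^2 / p with p = 2^(-k); these are summable.\<close>
  have d1: "(LINT t|I_on T. norm (d k t)) \<le> (T + 1) * (1/2)^k" for k
  proof -
    have "(LINT t|I_on T. norm (d k t)) \<le> (LINT t|I_on T. (1/2)^k + 2^k * (norm (d k t))\<^sup>2)"
    proof (rule integral_mono)
      fix t
      define p :: real where "p = (1/2)^k"
      have p: "p > 0" "2^k = 1 / p" unfolding p_def by (auto simp: power_divide)
      have "0 \<le> p * (1/2 - norm (d k t) / p)\<^sup>2" using p by simp
      also have "\<dots> = p / 4 + (norm (d k t))\<^sup>2 / p - norm (d k t)"
        using p(1) by (simp add: power2_diff field_simps power2_eq_square)
      finally have "norm (d k t) \<le> p + (norm (d k t))\<^sup>2 / p" using p(1) by simp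
      then show "norm (d k t) \<le> (1/2)^k + 2^k * (norm (d k t))\<^sup>2"
        using p(2) unfolding p_def by simp
    qed (use d_int L2_integrable[OF d_L2] in auto)
    also have "\<dots> = T * (1/2)^k + 2^k * L2sq T (d k)"
      using T L2_integrable[OF d_L2] by (simp add: L2sq_def)
    also have "\<dots> \<le> T * (1/2)^k + 2^k * (1/4)^k" using d_le[of k] by simp
    also have "\<dots> = (T + 1) * (1/2)^k" by (simp add: power_mult_distrib[symmetric] algebra_simps)
    finally show ?thesis .
  qed
  have AE_summable: "AE t in I_on T. summable (\<lambda>k. norm (d k t))"
  proof -
    have "(\<integral>\<^sup>+t. (\<Sum>k. ennreal (norm (d k t))) \<partial>I_on T) = (\<Sum>k. \<integral>\<^sup>+t. ennreal (norm (d k t)) \<partial>I_on T)"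
      by (rule nn_integral_suminf) (use d_int in measurable)
    also have "\<dots> \<le> (\<Sum>k. ennreal ((T + 1) * (1/2)^k))"
    proof (rule suminf_le)
      show "(\<integral>\<^sup>+t. ennreal (norm (d k t)) \<partial>I_on T) \<le> ennreal ((T + 1) * (1/2)^k)" for k
        using nn_integral_eq_integral[OF d_int] d1[of k] by (simp add: ennreal_leI)
    qed auto
    also have "\<dots> < \<infinity>"
    proof -
      have "summable (\<lambda>k. (T + 1) * (1/2::real)^k)" by (intro summable_mult summable_geometric) simp
      then show ?thesis using T by (simp add: suminf_ennreal2)
    qed
    finally have "(\<integral>\<^sup>+t. (\<Sum>k. ennreal (norm (d k t))) \<partial>I_on T) \<noteq> \<infinity>" by simp
    then have "AE t in I_on T. (\<Sum>k. ennreal (norm (d k t))) \<noteq> \<infinity>"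
      by (intro nn_integral_PInf_AE) (use d_int in measurable)
    then show ?thesis by eventually_elim (rule summable_suminf_not_top, auto)
  qed
  define z where "z t = lim (\<lambda>i. y (r i) t)" for t
  have lim: "AE t in I_on T. (\<lambda>i. y (r i) t) \<longlonglongrightarrow> z t"
    using AE_summable
  proof eventually_elim
    case (elim t)
    have "summable (\<lambda>k. d k t)" by (rule summable_norm_cancel[OF elim])
    then have "(\<lambda>n. \<Sum>k<n. d k t) \<longlonglongrightarrow> (\<Sum>k. d k t)" by (rule summable_LIMSEQ)
    moreover have "(\<Sum>k<n. d k t) = y (r n) t - y (r 0) t" for n
      unfolding d_def by (rule sum_lessThan_telescope)
    ultimately have "(\<lambda>n. (y (r n) t - y (r 0) t) + y (r 0) t) \<longlonglongrightarrow> (\<Sum>k. d k t) + y (r 0) t"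
      by (intro tendsto_add tendsto_const) simp
    then have "(\<lambda>n. y (r n) t) \<longlonglongrightarrow> (\<Sum>k. d k t) + y (r 0) t" by simp
    then show ?case unfolding z_def by (simp add: limI)
  qed
  have z_sm: "strongly_measurable (I_on T) z"
    by (rule strongly_measurable_AE_limit[OF _ _ lim]) (use y in \<open>auto intro: L2_sm\<close>)
  have est: "integrable (I_on T) (\<lambda>t. (norm (y i t - z t))\<^sup>2) \<and> L2sq T (\<lambda>t. y i t - z t) \<le> (1/4)^k"
    if i: "i \<ge> n0 k" for i k
  proof -
    define h where "h j t = (norm (y i t - y (r (j + k)) t))\<^sup>2" for j t
    have 1: "integrable (I_on T) (h j)" for j unfolding h_def by (intro L2_integrable L2_diff y)
    have ge: "r (j + k) \<ge> n0 k" for j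
      using r_ge[of k] strict_mono_leD[OF r_mono, of k "j + k"] by simp
    have 2: "(LINT t|I_on T. h j t) \<le> (1/4)^k" for j
      using n0[OF i ge[of j]] unfolding h_def L2sq_def by simp
    have 3: "AE t in I_on T. (\<lambda>j. h j t) \<longlonglongrightarrow> (norm (y i t - z t))\<^sup>2"
      using lim unfolding h_def by eventually_elim (intro tendsto_intros LIMSEQ_ignore_initial_segment)
    have 4: "(\<lambda>t. (norm (y i t - z t))\<^sup>2) \<in> borel_measurable (I_on T)"
      using strongly_measurable_norm_borel[OF strongly_measurable_diff[OF L2_sm[OF y] z_sm]] by measurable
    from Fatou_bound[OF 1 _ 2 3 4] show ?thesis unfolding h_def L2sq_def by simp
  qed
  have z_L2: "z \<in> bochner_L2 T"
  proof -
    have "(\<lambda>t. y (n0 0) t - z t) \<in> bochner_L2 T"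
      using est[of 0 "n0 0"] strongly_measurable_diff[OF L2_sm[OF y] z_sm] unfolding bochner_L2_def by simp
    from L2_diff[OF y[of "n0 0"] this] show ?thesis by simp
  qed
  have "(\<lambda>i. L2sq T (\<lambda>t. y i t - z t)) \<longlonglongrightarrow> 0"
  proof (rule LIMSEQ_I)
    fix e :: real assume "e > 0"
    then obtain k where k: "(1/4::real)^k < e" using real_arch_pow_inv[of e "1/4"] by auto
    have "norm (L2sq T (\<lambda>t. y i t - z t) - 0) < e" if "i \<ge> n0 k" for i using est[OF that] k by simp
    then show "\<exists>no. \<forall>n\<ge>no. norm (L2sq T (\<lambda>t. y n t - z t) - 0) < e" by blast
  qed
  then show ?thesis by (rule that[OF z_L2 r_mono lim])
qed

end

section \<open>Finite-dimensional linear algebra\<close>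

text \<open>A square linear system is solvable once it is injective. \<open>G x\<close> represents
  the functional \<open>b x\<close> on the span up to the scaling of the basis vectors, so
  injectivity of the form becomes injectivity of \<open>G\<close>, and the orthogonal set
  \<open>C\<close> serves for coordinates on both sides.\<close>

lemma finite_dim_solvable:
  fixes b :: "'u::real_inner \<Rightarrow> 'u \<Rightarrow> real"
  assumes C: "finite C" "independent C" "pairwise orthogonal C" and b: "bilinear b" and l: "linear l"
    and inj: "\<And>x. x \<in> span C \<Longrightarrow> (\<And>v. v \<in> span C \<Longrightarrow> b x v = 0) \<Longrightarrow> x = 0"
  shows "\<exists>x\<in>span C. \<forall>v\<in>span C. b x v = l v"
proof -
  have bl: "linear (\<lambda>x. b x v)" and br: "linear (b x)" for x v using b unfolding bilinear_def by auto
  define G where "G x = (\<Sum>c\<in>C. b x c *\<^sub>R c)" for x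
  have lin: "linear G" unfolding G_def
    by (rule linearI) (simp_all add: linear_add[OF bl] linear_scale[OF bl] scaleR_add_left sum.distrib scaleR_sum_right)
  have coeff: "G x \<bullet> d = b x d * (d \<bullet> d)" if "d \<in> C" for x d
  proof -
    have "G x \<bullet> d = (\<Sum>c\<in>C. if c = d then b x c * (c \<bullet> d) else 0)"
      unfolding G_def inner_sum_left
      by (rule sum.cong) (use that C(3) in \<open>auto simp: pairwise_def orthogonal_def\<close>)
    then show ?thesis using that C(1) by (simp add: sum.delta')
  qed
  have C0: "d \<bullet> d \<noteq> 0" if "d \<in> C" for d using that C(2) dependent_zero by auto
  have ext: "b x v = 0" if "\<And>d. d \<in> C \<Longrightarrow> b x d = 0" "v \<in> span C" for x v
    using that(2)
    by (induction v rule: span_induct_alt) (simp_all add: linear_0[OF br] linear_add[OF br] linear_scale[OF br] that(1))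
  have inj_on: "inj_on G (span C)"
  proof (subst linear_injective_on_subspace_0[OF lin subspace_span], intro ballI impI)
    fix x assume x: "x \<in> span C" "G x = 0"
    then have "b x d = 0" if "d \<in> C" for d using coeff[OF that, of x] C0[OF that] by simp
    then show "x = 0" using ext by (intro inj[OF x(1)]) blast
  qed
  have ind: "independent (G ` C)"
    by (rule linear_independent_injective_image[OF lin C(2) inj_on])
  have card: "card (G ` C) = card C" by (rule card_image) (rule inj_on_subset[OF inj_on span_superset])
  have sub: "G ` C \<subseteq> span C" unfolding G_def by (intro image_subsetI span_sum span_scale span_base)
  have full: "c \<in> span (G ` C)" if "c \<in> C" for c
  proof (rule ccontr)
    assume c: "c \<notin> span (G ` C)"
    then have ind': "independent (insert c (G ` C))" using ind by (rule independent_insertI)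
    have sub': "insert c (G ` C) \<subseteq> span C" using sub that span_base by auto
    have "card (insert c (G ` C)) \<le> card C" using independent_span_bound[OF C(1) ind' sub'] by simp
    moreover have "c \<notin> G ` C" using c span_base[of c "G ` C"] by argo
    ultimately show False using C(1) card by simp
  qed
  define y where "y = (\<Sum>c\<in>C. l c *\<^sub>R c)"
  have "y \<in> span (G ` C)" unfolding y_def by (intro span_sum span_scale full)
  then have "y \<in> G ` span C" by (simp add: linear_span_image[OF lin])
  then obtain x where x: "x \<in> span C" "G x = y" by blast
  have "b x d = l d" if "d \<in> C" for d
  proof -
    have "y \<bullet> d = (\<Sum>c\<in>C. if c = d then l c * (c \<bullet> d) else 0)"
      unfolding y_def inner_sum_left
      by (rule sum.cong) (use that C(3) in \<open>auto simp: pairwise_def orthogonal_def\<close>)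
    then have "y \<bullet> d = l d * (d \<bullet> d)" using that C(1) by (simp add: sum.delta')
    then show ?thesis using coeff[OF that, of x] x(2) C0[OF that] by simp
  qed
  note on_C = this
  have "b x v = l v" if "v \<in> span C" for v
    using that
    by (induction v rule: span_induct_alt)
      (simp_all add: linear_0[OF br] linear_add[OF br] linear_scale[OF br] linear_0[OF l] linear_add[OF l] linear_scale[OF l] on_C)
  then show ?thesis using x(1) by blast
qed

text \<open>The ambient type may be infinite dimensional, so compactness of the unit sphere of a
  discrete space has to come from coordinates: boxes of coefficients are compact by induction on the
  basis.\<close>

lemma compact_combinations:
  fixes C :: "'u::real_normed_vector set"
  assumes "finite C"
  shows "compact {\<Sum>c\<in>C. f c *\<^sub>R c | f. \<forall>c\<in>C. \<bar>f c\<bar> \<le> (1::real)}"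
  using assms
proof induction
  case empty
  have "{\<Sum>c\<in>{}. f c *\<^sub>R c | f. \<forall>c\<in>{}. \<bar>f c\<bar> \<le> (1::real)} = {0::'u}" by auto
  then show ?case by simp
next
  case (insert d C)
  let ?K = "{\<Sum>c\<in>C. f c *\<^sub>R c | f. \<forall>c\<in>C. \<bar>f c\<bar> \<le> (1::real)}"
  have "compact ((\<lambda>z. fst z *\<^sub>R d + snd z) ` ({-1..1::real} \<times> ?K))"
    by (intro compact_continuous_image compact_Times insert.IH continuous_intros) auto
  also have "(\<lambda>z. fst z *\<^sub>R d + snd z) ` ({-1..1::real} \<times> ?K)
    = {\<Sum>c\<in>insert d C. f c *\<^sub>R c | f. \<forall>c\<in>insert d C. \<bar>f c\<bar> \<le> (1::real)}" (is "?L = ?R")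
  proof (intro subset_antisym subsetI)
    fix x assume "x \<in> ?L"
    then obtain z where z0: "x = fst z *\<^sub>R d + snd z" "z \<in> {-1..1} \<times> ?K" by (rule imageE)
    then have z: "x = fst z *\<^sub>R d + snd z" "fst z \<in> {-1..1}" "snd z \<in> ?K"
      unfolding mem_Times_iff by blast+
    moreover from z(3) obtain f where "\<forall>c\<in>C. \<bar>f c\<bar> \<le> 1" "snd z = (\<Sum>c\<in>C. f c *\<^sub>R c)" by blast
    moreover define r where "r = fst z"
    ultimately have "\<bar>r\<bar> \<le> 1" "\<forall>c\<in>C. \<bar>f c\<bar> \<le> 1" "x = r *\<^sub>R d + (\<Sum>c\<in>C. f c *\<^sub>R c)" by auto
    moreover have "(\<Sum>c\<in>C. (f(d := r)) c *\<^sub>R c) = (\<Sum>c\<in>C. f c *\<^sub>R c)"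
      by (rule sum.cong) (use insert.hyps in auto)
    ultimately show "x \<in> ?R" using insert.hyps
      by (intro CollectI exI[of _ "f(d := r)"]) auto
  next
    fix x assume "x \<in> ?R"
    then obtain f where f: "\<forall>c\<in>insert d C. \<bar>f c\<bar> \<le> 1" "x = (\<Sum>c\<in>insert d C. f c *\<^sub>R c)" by auto
    then have "x = f d *\<^sub>R d + (\<Sum>c\<in>C. f c *\<^sub>R c)" using insert.hyps by simp
    then show "x \<in> ?L" using f(1)
      by (intro image_eqI[of _ _ "(f d, \<Sum>c\<in>C. f c *\<^sub>R c)"]) auto
  qed
  finally show ?case .
qed

text \<open>The quotient of the two norms is homogeneous of degree 0 and continuous on the compact
  unit sphere, so its maximum is attained; only then does the \<open>GREATEST\<close> in
  \<open>inverse_const\<close> denote this maximum.\<close>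

lemma (in orthonormal_approximation) inverse_const_bound:
  fixes \<iota> :: "'u \<Rightarrow> 'h::real_inner"
  assumes \<iota>: "bounded_linear \<iota>" "inj \<iota>" and nz: "span (C n) \<noteq> {0}"
  shows "\<And>x. x \<in> span (C n) \<Longrightarrow> norm x \<le> inverse_const \<iota> (span (C n)) * norm (\<iota> x)"
    and "inverse_const \<iota> (span (C n)) > 0"
proof -
  interpret bounded_linear \<iota> by (rule \<iota>(1))
  let ?S = "span (C n)"
  have i0: "\<iota> x \<noteq> 0" if "x \<noteq> 0" for x using \<iota>(2) that zero by (metis injD)
  let ?K = "{\<Sum>c\<in>C n. f c *\<^sub>R c | f. \<forall>c\<in>C n. \<bar>f c\<bar> \<le> (1::real)}"
  \<comment> \<open>Unit vectors have coordinates of modulus at most 1, so the coefficient box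
    contains the whole unit sphere of the subspace.\<close>
  have eq: "?S \<inter> sphere 0 1 = ?K \<inter> sphere 0 1"
  proof (intro subset_antisym subsetI)
    fix x assume x: "x \<in> ?S \<inter> sphere 0 1"
    then have "x = (\<Sum>c\<in>C n. (x \<bullet> c) *\<^sub>R c)" using P_id[of x n] by (simp add: P_def)
    moreover have "\<bar>x \<bullet> c\<bar> \<le> 1" if "c \<in> C n" for c
      using Cauchy_Schwarz_ineq2[of x c] x C_norm[OF that] by simp
    ultimately show "x \<in> ?K \<inter> sphere 0 1" using x by blast
  next
    fix x assume x: "x \<in> ?K \<inter> sphere 0 1"
    then obtain f where "x = (\<Sum>c\<in>C n. f c *\<^sub>R c)" by blast
    then have "x \<in> ?S" by (simp add: span_sum span_scale span_base)
    then show "x \<in> ?S \<inter> sphere 0 1" using x by blast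
  qed
  have comp: "compact (?S \<inter> sphere 0 1)" unfolding eq
    by (intro compact_Int_closed compact_combinations C_finite)
      (auto simp: sphere_def intro!: closed_Collect_eq continuous_intros)
  obtain y where y: "y \<in> ?S" "y \<noteq> 0" using nz span_zero by blast
  have ne: "?S \<inter> sphere 0 1 \<noteq> {}"
    using y by (intro ex_in_conv[THEN iffD1] exI[of _ "y /\<^sub>R norm y"]) (auto intro: span_scale)
  have "continuous_on (?S \<inter> sphere 0 1) (\<lambda>x. norm x / norm (\<iota> x))"
  proof (intro continuous_on_divide continuous_on_norm continuous_on_id linear_continuous_on \<iota>(1) ballI)
    fix x assume "x \<in> ?S \<inter> sphere 0 1"
    then have "x \<noteq> 0" by auto
    then show "norm (\<iota> x) \<noteq> 0" using i0 by simp
  qed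
  from continuous_attains_sup[OF comp ne this]
  obtain x where x: "x \<in> ?S" "norm x = 1" and max: "\<And>z. z \<in> ?S \<Longrightarrow> norm z = 1 \<Longrightarrow> norm z / norm (\<iota> z) \<le> norm x / norm (\<iota> x)"
    by auto
  define r where "r = norm x / norm (\<iota> x)"
  have all: "norm z / norm (\<iota> z) \<le> r" if "z \<in> ?S" "z \<noteq> 0" for z
    using max[of "z /\<^sub>R norm z"] that unfolding r_def by (simp add: span_scale scaleR field_simps)
  have "inverse_const \<iota> ?S = r" unfolding inverse_const_def
  proof (rule Greatest_equality)
    show "\<exists>u\<in>?S - {0}. r = norm u / norm (\<iota> u)" using x unfolding r_def by (intro bexI[of _ x]) auto
  qed (use all in auto)
  note r = this
  show "norm z \<le> inverse_const \<iota> ?S * norm (\<iota> z)" if "z \<in> ?S" for z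
  proof (cases "z = 0")
    case False
    then show ?thesis using all[OF that] i0[of z] unfolding r by (simp add: divide_le_eq)
  qed simp
  show "inverse_const \<iota> ?S > 0" unfolding r r_def using x i0[of x] by (cases "x = 0") auto
qed

section \<open>Stability of the scheme\<close>

text \<open>Any two values differ by at most the total variation, whichever index is larger; in
  \<open>energy_core\<close> this spreads the control of one node to all nodes.\<close>

lemma telescope_abs_le:
  fixes h :: "nat \<Rightarrow> real"
  assumes "m \<le> N" "n \<le> N"
  shows "h m \<le> h n + (\<Sum>i<N. \<bar>h (Suc i) - h i\<bar>)"
proof -
  have 1: "\<bar>h j - h i\<bar> \<le> (\<Sum>i<N. \<bar>h (Suc i) - h i\<bar>)" if "i \<le> j" "j \<le> N" for i j
  proof -
    have "h j - h i = (\<Sum>l=i..<j. h (Suc l) - h l)" using sum_Suc_diff'[of i j h] that by simp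
    then have "\<bar>h j - h i\<bar> \<le> (\<Sum>l=i..<j. \<bar>h (Suc l) - h l\<bar>)" by (simp add: sum_abs)
    also have "\<dots> \<le> (\<Sum>i<N. \<bar>h (Suc i) - h i\<bar>)" by (rule sum_mono2) (use that in auto)
    finally show ?thesis .
  qed
  show ?thesis using 1[of m n] 1[of n m] assms by (cases "m \<le> n") auto
qed

lemma young_ineq:
  fixes x y d :: real assumes "d > 0"
  shows "2 * x * y \<le> d * x\<^sup>2 + y\<^sup>2 / d"
proof -
  have "0 \<le> (d * x - y)\<^sup>2 / d" using assms by simp
  also have "\<dots> = d * x\<^sup>2 + y\<^sup>2 / d - 2 * x * y" using assms by (simp add: field_simps power2_eq_square)
  finally show ?thesis by simp
qed

text \<open>
  Here \<open>h\<close> stands for the squared \<open>H\<close>-norms at the nodes, \<open>D\<close> for the dissipation and \<open>f\<close> for the data.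
  If \<open>q = 1\<close> the boundary condition does not damp, and an index at which \<open>h\<close> is controlled by the
  dissipation replaces it.
\<close>

lemma energy_core:
  fixes \<alpha> C1 C2 C3 q :: real
  assumes \<alpha>: "\<alpha> > 0" and C: "C1 \<ge> 0" "C2 \<ge> 0" "C3 \<ge> 0" and q: "0 \<le> q" "q \<le> 1"
  shows "\<exists>G\<ge>0. \<forall>N (h::nat\<Rightarrow>real) D f \<eta>. (\<forall>m\<le>N. 0 \<le> h m) \<longrightarrow> (\<forall>m<N. 0 \<le> D m \<and> 0 \<le> f m) \<longrightarrow> 0 \<le> \<eta> \<longrightarrow>
    (\<forall>m<N. h (Suc m) - h m + \<alpha> * D m \<le> C1 * f m) \<longrightarrow>
    (\<forall>m<N. \<bar>h (Suc m) - h m\<bar> \<le> C2 * (D m + f m)) \<longrightarrow>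
    (q < 1 \<or> (\<exists>m\<le>N. h m \<le> C3 * (sum D {..<N} + sum f {..<N}))) \<longrightarrow>
    sqrt (h 0) \<le> q * sqrt (h N) + \<eta> \<longrightarrow>
    sum D {..<N} \<le> G * (sum f {..<N} + \<eta>\<^sup>2) \<and> (\<forall>m\<le>N. h m \<le> G * (sum f {..<N} + \<eta>\<^sup>2))"
proof -
  define C4 where "C4 = C3 + C2"
  \<comment> \<open>Chosen so that \<delta> times \<open>C4\<close> is at most \<alpha> / 2: the
    boundary term produced by Young's inequality then costs at most half of the dissipation.\<close>
  define \<delta> where "\<delta> = \<alpha> / (2 * (C4 + 1))"
  define G1 where "G1 = (2 / \<alpha>) * (C1 + \<alpha> / 2 + 1 + 1 / \<delta>)"
  define Ga where "Ga = C4 * (G1 + 1) + G1"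
  define c where "c = 1 - q\<^sup>2"
  define B where "B = C1 + 1 + 2 / c"
  define Gb where "Gb = B / \<alpha> + 2 * ((2 / c) * B) + 2 + C1"
  have C4: "C4 \<ge> 0" using C unfolding C4_def by simp
  have \<delta>: "\<delta> > 0" using C4 \<alpha> unfolding \<delta>_def by simp
  have G1: "G1 \<ge> 0" using \<alpha> C \<delta> unfolding G1_def by simp
  have Ga: "Ga \<ge> G1" "Ga \<ge> C4 * (G1 + 1)" "Ga \<ge> 0" using C4 G1 unfolding Ga_def by auto
  have c: "c > 0" if "q < 1" using q that unfolding c_def by (simp add: power_less_one_iff)
  have Gb: "Gb \<ge> 0" "Gb \<ge> B / \<alpha>" "Gb \<ge> 2 * ((2 / c) * B) + 2 + C1" "B \<ge> 0" if "q < 1"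
    using c[OF that] \<alpha> C unfolding Gb_def B_def by auto
  \<comment> \<open>\<open>Gb\<close> contains 2 / c and blows up as q approaches 1, so the undamped
    case has the separate constant \<open>Ga\<close>.\<close>
  define G where "G = (if q < 1 then Gb else 0) + Ga"
  have G0: "G \<ge> 0" using Gb Ga unfolding G_def by auto
  show ?thesis
  proof (intro exI[of _ G] conjI[OF G0] allI impI)
    fix N and h :: "nat \<Rightarrow> real" and D f \<eta>
    assume h: "\<forall>m\<le>N. 0 \<le> h m" and Df: "\<forall>m<N. 0 \<le> D m \<and> 0 \<le> f m" and \<eta>: "0 \<le> \<eta>"
      and a: "\<forall>m<N. h (Suc m) - h m + \<alpha> * D m \<le> C1 * f m"
      and b: "\<forall>m<N. \<bar>h (Suc m) - h m\<bar> \<le> C2 * (D m + f m)"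
      and node: "q < 1 \<or> (\<exists>m\<le>N. h m \<le> C3 * (sum D {..<N} + sum f {..<N}))"
      and bc: "sqrt (h 0) \<le> q * sqrt (h N) + \<eta>"
    define X where "X = sum D {..<N}"
    define F where "F = sum f {..<N}"
    have XF: "X \<ge> 0" "F \<ge> 0" unfolding X_def F_def using Df by (auto intro!: sum_nonneg)
    have fwd: "h m \<le> h 0 + C1 * F" if "m \<le> N" for m
    proof -
      have "h m - h 0 = (\<Sum>i<m. h (Suc i) - h i)" by (simp add: sum_lessThan_telescope)
      also have "\<dots> \<le> (\<Sum>i<m. C1 * f i)"
      proof (rule sum_mono)
        fix i assume "i \<in> {..<m}"
        then have i: "i < N" using that by simp
        have "0 \<le> \<alpha> * D i" using Df i \<alpha> by simp
        then show "h (Suc i) - h i \<le> C1 * f i" using a i by fastforce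
      qed
      also have "\<dots> \<le> (\<Sum>i<N. C1 * f i)" by (rule sum_mono2) (use that Df C in auto)
      finally show ?thesis unfolding F_def by (simp add: sum_distrib_left)
    qed
    have total: "h N - h 0 + \<alpha> * X \<le> C1 * F"
    proof -
      have "h N - h 0 + \<alpha> * X = (\<Sum>i<N. h (Suc i) - h i + \<alpha> * D i)"
        unfolding X_def by (simp add: sum.distrib sum_lessThan_telescope sum_distrib_left)
      also have "\<dots> \<le> (\<Sum>i<N. C1 * f i)" by (rule sum_mono) (use a in auto)
      finally show ?thesis unfolding F_def by (simp add: sum_distrib_left)
    qed
    have h0N: "0 \<le> h 0" "0 \<le> h N" using h by auto
    have "(sqrt (h 0))\<^sup>2 \<le> (q * sqrt (h N) + \<eta>)\<^sup>2" by (rule power_mono[OF bc]) (use h0N in auto)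
    then have h0: "h 0 \<le> q\<^sup>2 * h N + 2 * q * sqrt (h N) * \<eta> + \<eta>\<^sup>2"
      using h0N by (simp add: power2_sum power_mult_distrib)
    have q2: "q\<^sup>2 \<le> 1" using q by (simp add: power_le_one)
    have conc: "X \<le> G * (F + \<eta>\<^sup>2) \<and> (\<forall>m\<le>N. h m \<le> G * (F + \<eta>\<^sup>2))"
    proof (cases "q < 1")
      case True
      note c = c[OF True] and Gb = Gb[OF True]
      \<comment> \<open>With weight c / 2 the total coefficient of \<open>h N\<close> in the bound
        for \<open>h 0\<close> is 1 - c / 2, so the boundary condition keeps half of its
        damping.\<close>
      have "2 * (q * sqrt (h N)) * \<eta> \<le> (c / 2) * (q * sqrt (h N))\<^sup>2 + \<eta>\<^sup>2 / (c / 2)"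
        by (rule young_ineq) (use c in simp)
      also have "\<eta>\<^sup>2 / (c / 2) = (2 / c) * \<eta>\<^sup>2" by simp
      also have "(c / 2) * (q * sqrt (h N))\<^sup>2 + (2 / c) * \<eta>\<^sup>2 \<le> (c / 2) * h N + (2 / c) * \<eta>\<^sup>2"
      proof (intro add_mono mult_left_mono order_refl)
        show "(q * sqrt (h N))\<^sup>2 \<le> h N" using q2 h0N by (simp add: power_mult_distrib mult_left_le_one_le)
      qed (use c in auto)
      finally have "h 0 \<le> q\<^sup>2 * h N + (c / 2) * h N + (1 + 2 / c) * \<eta>\<^sup>2"
        using h0 by (simp add: algebra_simps)
      then have e: "(c / 2) * h N + \<alpha> * X \<le> C1 * F + (1 + 2 / c) * \<eta>\<^sup>2"
      proof -
        have "q\<^sup>2 * h N = h N - c * h N" unfolding c_def by (simp add: algebra_simps)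
        then show ?thesis using total \<open>h 0 \<le> q\<^sup>2 * h N + (c / 2) * h N + (1 + 2 / c) * \<eta>\<^sup>2\<close> by linarith
      qed
      have "C1 * F + (1 + 2 / c) * \<eta>\<^sup>2 \<le> B * F + B * \<eta>\<^sup>2"
        unfolding B_def using XF C c by (intro add_mono mult_right_mono) auto
      then have e': "(c / 2) * h N + \<alpha> * X \<le> B * (F + \<eta>\<^sup>2)" using e by (simp add: algebra_simps)
      have "\<alpha> * X \<le> B * (F + \<eta>\<^sup>2)" using e' c h0N by (smt (verit) mult_nonneg_nonneg divide_nonneg_pos)
      then have X: "X \<le> B / \<alpha> * (F + \<eta>\<^sup>2)" using \<alpha> by (simp add: field_simps)
      have "(c / 2) * h N \<le> B * (F + \<eta>\<^sup>2)" using e' \<alpha> XF by (smt (verit) mult_nonneg_nonneg)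
      then have hN: "h N \<le> (2 / c) * B * (F + \<eta>\<^sup>2)" using c by (simp add: field_simps)
      have "2 * (q * sqrt (h N)) * \<eta> \<le> 1 * (q * sqrt (h N))\<^sup>2 + \<eta>\<^sup>2 / 1" by (rule young_ineq) simp
      moreover have "(q * sqrt (h N))\<^sup>2 \<le> h N" "q\<^sup>2 * h N \<le> h N"
        using q2 h0N by (auto simp: power_mult_distrib mult_left_le_one_le)
      ultimately have "h 0 \<le> 2 * h N + 2 * \<eta>\<^sup>2" using h0 by simp
      have hm: "h m \<le> (2 * ((2 / c) * B) + 2 + C1) * (F + \<eta>\<^sup>2)" if "m \<le> N" for m
      proof -
        have "h m \<le> 2 * ((2 / c) * B * (F + \<eta>\<^sup>2)) + 2 * \<eta>\<^sup>2 + C1 * F"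
          using fwd[OF that] hN \<open>h 0 \<le> 2 * h N + 2 * \<eta>\<^sup>2\<close> by linarith
        also have "\<dots> \<le> 2 * ((2 / c) * B * (F + \<eta>\<^sup>2)) + 2 * (F + \<eta>\<^sup>2) + C1 * (F + \<eta>\<^sup>2)"
          using XF C c Gb(4) by (intro add_mono mult_left_mono) auto
        finally show ?thesis by (simp add: algebra_simps)
      qed
      have GG: "G \<ge> Gb" using True Ga unfolding G_def by simp
      have nn: "F + \<eta>\<^sup>2 \<ge> 0" using XF by simp
      show ?thesis
      proof (intro conjI allI impI)
        show "X \<le> G * (F + \<eta>\<^sup>2)"
          using X mult_right_mono[OF order_trans[OF Gb(2) GG] nn] by linarith
        show "h m \<le> G * (F + \<eta>\<^sup>2)" if "m \<le> N" for m
          using hm[OF that] mult_right_mono[OF order_trans[OF Gb(3) GG] nn] by linarith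
      qed
    next
      case False
      then obtain n where n: "n \<le> N" "h n \<le> C3 * (X + F)" using node unfolding X_def F_def by auto
      \<comment> \<open>One controlled index together with the total variation controls every index;
        this replaces the missing damping.\<close>
      have hm: "h m \<le> C4 * (X + F)" if "m \<le> N" for m
      proof -
        have "(\<Sum>i<N. \<bar>h (Suc i) - h i\<bar>) \<le> (\<Sum>i<N. C2 * (D i + f i))" by (rule sum_mono) (use b in auto)
        also have "\<dots> = C2 * (X + F)" unfolding X_def F_def by (simp add: sum_distrib_left sum.distrib algebra_simps)
        finally show ?thesis using telescope_abs_le[OF that n(1), of h] n(2) unfolding C4_def
          by (simp add: algebra_simps)
      qed
      have "2 * sqrt (h N) * \<eta> \<le> \<delta> * (sqrt (h N))\<^sup>2 + \<eta>\<^sup>2 / \<delta>" by (rule young_ineq[OF \<delta>])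
      then have y: "2 * sqrt (h N) * \<eta> \<le> \<delta> * h N + \<eta>\<^sup>2 / \<delta>" using h0N by simp
      have "2 * q * sqrt (h N) * \<eta> \<le> 2 * sqrt (h N) * \<eta>" "q\<^sup>2 * h N \<le> h N"
        using q q2 h0N \<eta> by (auto simp: mult_left_le_one_le mult.assoc)
      then have "h 0 \<le> h N + \<delta> * h N + \<eta>\<^sup>2 / \<delta> + \<eta>\<^sup>2" using h0 y by linarith
      moreover have "\<delta> * h N \<le> (\<alpha> / 2) * (X + F)"
      proof -
        have "\<delta> * h N \<le> \<delta> * (C4 * (X + F))" using hm[of N] \<delta> by (intro mult_left_mono) auto
        also have "\<dots> = (\<delta> * C4) * (X + F)" by simp
        also have "\<dots> \<le> (\<alpha> / 2) * (X + F)"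
          using XF C4 \<alpha> unfolding \<delta>_def by (intro mult_right_mono) (auto simp: field_simps)
        finally show ?thesis .
      qed
      ultimately have "\<alpha> * X \<le> C1 * F + (\<alpha> / 2) * (X + F) + \<eta>\<^sup>2 / \<delta> + \<eta>\<^sup>2" using total by linarith
      then have "(\<alpha> / 2) * X \<le> (C1 + \<alpha> / 2) * F + (1 + 1 / \<delta>) * \<eta>\<^sup>2"
      proof -
        have "(1 + 1 / \<delta>) * \<eta>\<^sup>2 = \<eta>\<^sup>2 + \<eta>\<^sup>2 / \<delta>" by (simp add: distrib_right)
        moreover have "(C1 + \<alpha> / 2) * F = C1 * F + (\<alpha> / 2) * F" by (simp add: distrib_right)
        moreover have "(\<alpha> / 2) * (X + F) = (\<alpha> / 2) * X + (\<alpha> / 2) * F" by (rule distrib_left)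
        moreover have "\<alpha> * X = (\<alpha> / 2) * X + (\<alpha> / 2) * X" by (simp add: distrib_right[symmetric])
        ultimately show ?thesis
          using \<open>\<alpha> * X \<le> C1 * F + (\<alpha> / 2) * (X + F) + \<eta>\<^sup>2 / \<delta> + \<eta>\<^sup>2\<close> by linarith
      qed
      also have "\<dots> \<le> (C1 + \<alpha> / 2 + 1 + 1 / \<delta>) * F + (C1 + \<alpha> / 2 + 1 + 1 / \<delta>) * \<eta>\<^sup>2"
      proof (rule add_mono; rule mult_right_mono)
        have "0 \<le> 1 / \<delta>" using \<delta> by simp
        then show "C1 + \<alpha> / 2 \<le> C1 + \<alpha> / 2 + 1 + 1 / \<delta>" "1 + 1 / \<delta> \<le> C1 + \<alpha> / 2 + 1 + 1 / \<delta>"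
          using C \<alpha> by linarith+
      qed (use XF in auto)
      also have "\<dots> = (C1 + \<alpha> / 2 + 1 + 1 / \<delta>) * (F + \<eta>\<^sup>2)" by (simp only: distrib_left)
      finally have y: "(\<alpha> / 2) * X \<le> (C1 + \<alpha> / 2 + 1 + 1 / \<delta>) * (F + \<eta>\<^sup>2)" .
      have "X = (2 / \<alpha>) * ((\<alpha> / 2) * X)" using \<alpha> by simp
      also have "\<dots> \<le> (2 / \<alpha>) * ((C1 + \<alpha> / 2 + 1 + 1 / \<delta>) * (F + \<eta>\<^sup>2))"
        using \<alpha> by (intro mult_left_mono[OF y]) simp
      finally have X: "X \<le> G1 * (F + \<eta>\<^sup>2)" unfolding G1_def mult.assoc .
      have nn: "F + \<eta>\<^sup>2 \<ge> 0" using XF by simp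
      have GG: "G = Ga" using False unfolding G_def by simp
      show ?thesis
      proof (intro conjI allI impI)
        show "X \<le> G * (F + \<eta>\<^sup>2)" using X mult_right_mono[OF Ga(1) nn] unfolding GG by linarith
        fix m assume "m \<le> N"
        then have "h m \<le> C4 * (X + F)" by (rule hm)
        also have "\<dots> \<le> C4 * (G1 * (F + \<eta>\<^sup>2) + (F + \<eta>\<^sup>2))" using X C4 by (intro mult_left_mono add_mono) auto
        also have "\<dots> = C4 * (G1 + 1) * (F + \<eta>\<^sup>2)" by (simp add: algebra_simps)
        also have "\<dots> \<le> G * (F + \<eta>\<^sup>2)" unfolding GG by (rule mult_right_mono[OF Ga(2) nn])
        finally show "h m \<le> G * (F + \<eta>\<^sup>2)" .
      qed
    qed
    then show "sum D {..<N} \<le> G * (sum f {..<N} + \<eta>\<^sup>2) \<and> (\<forall>m\<le>N. h m \<le> G * (sum f {..<N} + \<eta>\<^sup>2))"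
      unfolding X_def F_def .
  qed
qed

text \<open>The scalar content of testing the scheme: \<open>h\<close> stands for the squared
  \<open>H\<close>-norms at the nodes, \<open>p\<close> for the \<open>U\<close>-norms of the
  intermediate values, \<open>d\<close> for the squared \<open>H\<close>-norms of the increments,
  \<phi> for the dual norms of the data and \<mu> for the inverse constant. All dependence on
  \<theta> is settled here, with a constant independent of the number of steps and of \<mu>.\<close>

lemma energy_sequences:
  fixes T \<alpha> M \<theta> q K B :: real
  assumes T: "T > 0" and \<alpha>: "\<alpha> > 0" and M: "M \<ge> 1" "\<alpha> \<le> M" and q: "0 \<le> q" "q \<le> 1"
  shows "\<exists>G\<ge>0. \<forall>N k (h::nat\<Rightarrow>real) p d \<phi> \<eta> \<mu>. N > 0 \<longrightarrow> k = T / real N \<longrightarrow> 0 \<le> \<eta> \<longrightarrow> 0 \<le> \<mu> \<longrightarrow>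
    (\<forall>m\<le>N. 0 \<le> h m) \<longrightarrow> (\<forall>m<N. 0 \<le> p m \<and> 0 \<le> d m \<and> 0 \<le> \<phi> m) \<longrightarrow>
    (\<forall>m<N. h (Suc m) - h m + (2 * \<theta> - 1) * d m + 2 * k * \<alpha> * (p m)\<^sup>2 \<le> 2 * k * \<phi> m * p m) \<longrightarrow>
    (\<forall>m<N. \<bar>h (Suc m) - h m + (2 * \<theta> - 1) * d m\<bar> \<le> 2 * k * (M * p m + \<phi> m) * p m) \<longrightarrow>
    (\<forall>m<N. d m \<le> (k * \<mu> * (M * p m + \<phi> m))\<^sup>2) \<longrightarrow>
    (\<forall>m<N. h m \<le> 2 * K\<^sup>2 * (p m)\<^sup>2 + 2 * d m) \<longrightarrow>
    sqrt (h 0) \<le> q * sqrt (h N) + \<eta> \<longrightarrow>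
    (\<theta> < 1/2 \<longrightarrow> k * \<mu>\<^sup>2 * (24 * M^3 * (1/2 - \<theta>)) \<le> \<alpha>\<^sup>2) \<longrightarrow>
    (\<theta> = 1/2 \<and> q = 1 \<longrightarrow> k * \<mu> \<le> B) \<longrightarrow>
    (\<Sum>m<N. k * (p m)\<^sup>2) \<le> G * ((\<Sum>m<N. k * (\<phi> m)\<^sup>2) + \<eta>\<^sup>2) \<and>
    (\<forall>m\<le>N. h m \<le> G * ((\<Sum>m<N. k * (\<phi> m)\<^sup>2) + \<eta>\<^sup>2))"
proof -
  \<comment> \<open>The first summand serves \<theta> \<ge> 1/2; the other two serve \<theta> < 1/2,
    where they come from absorbing the increments and from Young's inequality with half the
    weight.\<close>
  define C1 where "C1 = 1 / \<alpha> + \<alpha> / 6 + 2 / \<alpha>"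
  define C2 where "C2 = \<alpha> + 2 * M + 1"
  \<comment> \<open>An upper bound for 2 M^2 (k \<mu>)^2: for \<theta> < 1/2 one factor k is at most
    T and the step size condition bounds k \<mu>^2; for \<theta> = 1/2 the bound on k \<mu> is used.
    For \<theta> > 1/2 the increments are part of the dissipation and the value is 0.\<close>
  define C7 where "C7 = (if \<theta> < 1/2 then 2 * M\<^sup>2 * (T * (\<alpha>\<^sup>2 / (24 * M^3 * (1/2 - \<theta>))))
    else if \<theta> = 1/2 then 2 * M\<^sup>2 * B\<^sup>2 else 0)"
  define C3 where "C3 = 2 * K\<^sup>2 / T + 2 * (C7 / T) + 2 * (if \<theta> > 1/2 then \<alpha> / (2 * \<theta> - 1) else 0)"
  have C7: "C7 \<ge> 0" unfolding C7_def using M T by auto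
  have C3: "C3 \<ge> 0" unfolding C3_def using C7 T \<alpha> by auto
  have C12: "C1 \<ge> 0" "C2 \<ge> 0" unfolding C1_def C2_def using \<alpha> M by auto
  show ?thesis using energy_core[OF \<alpha> C12 C3 q]
  proof (elim exE conjE, goal_cases)
    case (1 G)
    note core = 1(2)[rule_format (no_asm)]
    show ?thesis
    proof (intro exI[of _ G] conjI[OF 1(1)] allI impI)
      fix N k and h p d \<phi> :: "nat \<Rightarrow> real" and \<eta> \<mu> :: real
      assume N: "N > 0" and k: "k = T / real N" and \<eta>: "0 \<le> \<eta>" and \<mu>: "0 \<le> \<mu>" and h: "\<forall>m\<le>N. 0 \<le> h m"
        and pos: "\<forall>m<N. 0 \<le> p m \<and> 0 \<le> d m \<and> 0 \<le> \<phi> m"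
        and e1: "\<forall>m<N. h (Suc m) - h m + (2 * \<theta> - 1) * d m + 2 * k * \<alpha> * (p m)\<^sup>2 \<le> 2 * k * \<phi> m * p m"
        and e2: "\<forall>m<N. \<bar>h (Suc m) - h m + (2 * \<theta> - 1) * d m\<bar> \<le> 2 * k * (M * p m + \<phi> m) * p m"
        and e3: "\<forall>m<N. d m \<le> (k * \<mu> * (M * p m + \<phi> m))\<^sup>2"
        and e4: "\<forall>m<N. h m \<le> 2 * K\<^sup>2 * (p m)\<^sup>2 + 2 * d m"
        and bc: "sqrt (h 0) \<le> q * sqrt (h N) + \<eta>"
        and c1: "\<theta> < 1/2 \<longrightarrow> k * \<mu>\<^sup>2 * (24 * M^3 * (1/2 - \<theta>)) \<le> \<alpha>\<^sup>2"
        and c2: "\<theta> = 1/2 \<and> q = 1 \<longrightarrow> k * \<mu> \<le> B"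
      have k0: "k > 0" using N T k by simp
      have kT: "k \<le> T" unfolding k using N T by (simp add: divide_le_eq mult_le_cancel_left1 Suc_leI)
      \<comment> \<open>For \<theta> > 1/2 the damping of the increments by the scheme itself is
        counted as dissipation; the division by \<alpha> makes \<alpha> times \<open>D\<close>
        reproduce the term of the energy balance.\<close>
      define D where "D m = k * (p m)\<^sup>2 + (if \<theta> > 1/2 then (2 * \<theta> - 1) / \<alpha> * d m else 0)" for m
      define f where "f m = k * (\<phi> m)\<^sup>2" for m
      have Dp: "k * (p m)\<^sup>2 \<le> D m" if "m < N" for m using pos that \<alpha> unfolding D_def by simp
      have Df: "\<forall>m<N. 0 \<le> D m \<and> 0 \<le> f m" using pos \<alpha> k0 unfolding D_def f_def by simp
      have sq: "(M * x + y)\<^sup>2 \<le> 2 * M\<^sup>2 * (x\<^sup>2 + y\<^sup>2)" for x y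
      proof -
        have "(M * x + y)\<^sup>2 \<le> 2 * (M * x)\<^sup>2 + 2 * y\<^sup>2" by (rule sum_sq_le)
        also have "\<dots> \<le> 2 * M\<^sup>2 * x\<^sup>2 + 2 * M\<^sup>2 * y\<^sup>2"
          using M one_le_power[OF M(1), of 2] mult_right_mono[of 1 "M\<^sup>2" "y\<^sup>2"] by (simp add: power_mult_distrib)
        finally show ?thesis by (simp add: algebra_simps)
      qed
      have d3: "d m \<le> (k * \<mu>)\<^sup>2 * (2 * M\<^sup>2 * ((p m)\<^sup>2 + (\<phi> m)\<^sup>2))" if "m < N" for m
      proof -
        have "d m \<le> (k * \<mu>)\<^sup>2 * (M * p m + \<phi> m)\<^sup>2" using e3 that by (simp add: power_mult_distrib)
        also have "\<dots> \<le> (k * \<mu>)\<^sup>2 * (2 * M\<^sup>2 * ((p m)\<^sup>2 + (\<phi> m)\<^sup>2))" by (intro mult_left_mono sq) simp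
        finally show ?thesis .
      qed
      have cross: "2 * k * (M * p m + \<phi> m) * p m \<le> (2 * M + 1) * (k * (p m)\<^sup>2 + f m)" if "m < N" for m
      proof -
        have "2 * \<phi> m * p m \<le> 1 * (\<phi> m)\<^sup>2 + (p m)\<^sup>2 / 1" by (rule young_ineq) simp
        then have "2 * (M * p m + \<phi> m) * p m \<le> (2 * M + 1) * (p m)\<^sup>2 + 1 * (\<phi> m)\<^sup>2"
          by (simp add: algebra_simps power2_eq_square)
        also have "\<dots> \<le> (2 * M + 1) * (p m)\<^sup>2 + (2 * M + 1) * (\<phi> m)\<^sup>2"
          using M by (intro add_left_mono mult_right_mono) auto
        finally have "k * (2 * (M * p m + \<phi> m) * p m) \<le> k * ((2 * M + 1) * (p m)\<^sup>2 + (2 * M + 1) * (\<phi> m)\<^sup>2)"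
          using k0 by (intro mult_left_mono) auto
        then show ?thesis unfolding f_def by (simp add: algebra_simps)
      qed
      \<comment> \<open>The origin of the constant 24: the left side is at most 4 g M^2 k^2 \<mu>^2
        w, and the step size condition together with \<alpha> \<le> M gives 24 g M^2 k \<mu>^2 \<le>
        \<alpha>. The remaining sixth of the dissipation leaves room for Young's inequality.\<close>
      have gd: "(1 - 2 * \<theta>) * d m \<le> (\<alpha> / 6) * (k * (p m)\<^sup>2 + f m)" if "\<theta> < 1/2" "m < N" for m
      proof -
        define g where "g = 1/2 - \<theta>"
        have g: "g > 0" using that unfolding g_def by simp
        define w where "w = (p m)\<^sup>2 + (\<phi> m)\<^sup>2"
        have w: "w \<ge> 0" unfolding w_def by simp
        have M3: "M^3 = M\<^sup>2 * M" by (simp add: power3_eq_cube power2_eq_square)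
        have M0: "M > 0" "M\<^sup>2 > 0" using M by auto
        have "k * \<mu>\<^sup>2 * (24 * M^3 * g) \<le> \<alpha>\<^sup>2" using c1 that(1) unfolding g_def by simp
        also have "\<alpha>\<^sup>2 \<le> \<alpha> * M" using \<alpha> M by (simp add: power2_eq_square)
        finally have "(k * \<mu>\<^sup>2 * 24 * M\<^sup>2 * g) * M \<le> \<alpha> * M" unfolding M3 by (simp add: mult_ac)
        then have le: "k * \<mu>\<^sup>2 * 24 * M\<^sup>2 * g \<le> \<alpha>" using M0 by simp
        have "(1 - 2 * \<theta>) * d m \<le> (1 - 2 * \<theta>) * ((k * \<mu>)\<^sup>2 * (2 * M\<^sup>2 * w))"
          unfolding w_def using d3[OF that(2)] that(1) by (intro mult_left_mono) auto
        also have "\<dots> = (k * \<mu>\<^sup>2 * 24 * M\<^sup>2 * g) * (k * w / 6)"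
          unfolding g_def by (simp add: power_mult_distrib power2_eq_square field_simps)
        also have "\<dots> \<le> \<alpha> * (k * w / 6)" using le k0 w by (intro mult_right_mono) auto
        finally show ?thesis unfolding w_def f_def by (simp add: algebra_simps)
      qed
      have a: "\<forall>m<N. h (Suc m) - h m + \<alpha> * D m \<le> C1 * f m"
      proof (intro allI impI)
        fix m assume m: "m < N"
        note e1' = e1[rule_format, OF m]
        have f0: "f m \<ge> 0" using Df m by simp
        show "h (Suc m) - h m + \<alpha> * D m \<le> C1 * f m"
        proof (cases "\<theta> < 1/2")
          case False
          have aD: "\<alpha> * D m = k * \<alpha> * (p m)\<^sup>2 + (2 * \<theta> - 1) * d m"
            unfolding D_def using False \<alpha> by (simp add: field_simps)
          have "2 * p m * \<phi> m \<le> \<alpha> * (p m)\<^sup>2 + (\<phi> m)\<^sup>2 / \<alpha>" by (rule young_ineq[OF \<alpha>])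
          then have "k * (2 * p m * \<phi> m) \<le> k * (\<alpha> * (p m)\<^sup>2 + (\<phi> m)\<^sup>2 / \<alpha>)" using k0 by simp
          then have "2 * k * \<phi> m * p m \<le> k * \<alpha> * (p m)\<^sup>2 + (1 / \<alpha>) * f m"
            unfolding f_def by (simp add: algebra_simps)
          then have "h (Suc m) - h m + \<alpha> * D m \<le> (1 / \<alpha>) * f m" using e1' aD by linarith
          also have "\<dots> \<le> C1 * f m" unfolding C1_def add.assoc using f0 \<alpha>
            by (intro mult_right_mono) (simp_all only: le_add_same_cancel1, auto)
          finally show ?thesis .
        next
          case True
          have aD: "\<alpha> * D m = k * \<alpha> * (p m)\<^sup>2" unfolding D_def using True by simp
          have "\<alpha> / 2 > 0" using \<alpha> by simp
          from young_ineq[OF this, of "p m" "\<phi> m"]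
          have "k * (2 * p m * \<phi> m) \<le> k * (\<alpha> / 2 * (p m)\<^sup>2 + (\<phi> m)\<^sup>2 / (\<alpha> / 2))" using k0 by simp
          then have y: "2 * k * \<phi> m * p m \<le> (1/2) * (k * \<alpha> * (p m)\<^sup>2) + (2 / \<alpha>) * f m"
            unfolding f_def by (simp add: algebra_simps)
          have g: "(1 - 2 * \<theta>) * d m \<le> (1/6) * (k * \<alpha> * (p m)\<^sup>2) + (\<alpha> / 6) * f m"
            using gd[OF True m] by (simp add: algebra_simps)
          have "0 \<le> k * \<alpha> * (p m)\<^sup>2" using k0 \<alpha> by simp
          then have "h (Suc m) - h m + \<alpha> * D m \<le> (\<alpha> / 6) * f m + (2 / \<alpha>) * f m"
            using e1' y g unfolding aD by (simp add: left_diff_distrib)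
          also have "\<dots> \<le> C1 * f m"
          proof -
            have "0 \<le> (1 / \<alpha>) * f m" using f0 \<alpha> by simp
            then show ?thesis unfolding C1_def by (simp only: distrib_right)
          qed
          finally show ?thesis .
        qed
      qed
      have b: "\<forall>m<N. \<bar>h (Suc m) - h m\<bar> \<le> C2 * (D m + f m)"
      proof (intro allI impI)
        fix m assume m: "m < N"
        define Z where "Z = k * (p m)\<^sup>2 + f m"
        have Z0: "0 \<le> Z" "Z \<le> D m + f m" using Dp[OF m] Df m k0 unfolding Z_def f_def by auto
        have bd: "\<bar>h (Suc m) - h m + (2 * \<theta> - 1) * d m\<bar> \<le> (2 * M + 1) * Z"
          using e2 cross[OF m] m unfolding Z_def by fastforce
        have d0: "0 \<le> d m" using pos m by simp
        have "\<bar>(2 * \<theta> - 1) * d m\<bar> \<le> \<alpha> * (D m + f m)"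
        proof (cases "\<theta> < 1/2")
          case True
          have "\<bar>(2 * \<theta> - 1) * d m\<bar> = (1 - 2 * \<theta>) * d m" using True d0 by (simp add: abs_mult)
          also have "\<dots> \<le> (\<alpha> / 6) * Z" using gd[OF True m] unfolding Z_def .
          also have "\<dots> \<le> \<alpha> * (D m + f m)" using Z0 \<alpha> by (intro mult_mono) auto
          finally show ?thesis .
        next
          case False
          have "\<bar>(2 * \<theta> - 1) * d m\<bar> = (2 * \<theta> - 1) * d m" using False d0 by (simp add: abs_mult)
          also have "\<dots> \<le> \<alpha> * D m"
          proof (cases "\<theta> > 1/2")
            case True
            then show ?thesis unfolding D_def using \<alpha> k0 by (simp add: distrib_left)
          next
            case False
            then have "2 * \<theta> - 1 = 0" using \<open>\<not> \<theta> < 1/2\<close> by simp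
            then show ?thesis unfolding D_def using \<alpha> k0 by simp
          qed
          also have "\<dots> \<le> \<alpha> * (D m + f m)" using Df m \<alpha> by (intro mult_left_mono) auto
          finally show ?thesis .
        qed
        moreover have "(2 * M + 1) * Z \<le> (2 * M + 1) * (D m + f m)" using Z0 M by (intro mult_left_mono) auto
        ultimately have "\<bar>h (Suc m) - h m\<bar> \<le> \<alpha> * (D m + f m) + (2 * M + 1) * (D m + f m)" using bd by linarith
        then show "\<bar>h (Suc m) - h m\<bar> \<le> C2 * (D m + f m)" unfolding C2_def by (simp add: algebra_simps)
      qed
      have node: "q < 1 \<or> (\<exists>m\<le>N. h m \<le> C3 * (sum D {..<N} + sum f {..<N}))"
      proof (cases "q < 1")
        case False
        then have q1: "q = 1" using q by simp
        define Z where "Z = sum D {..<N} + sum f {..<N}"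
        \<comment> \<open>Pigeonhole: some cell carries at most the average of dissipation plus
          data. Since N k = T, this bounds the intermediate value on that cell independently of the
          step size.\<close>
        have "\<exists>m<N. real N * (D m + f m) \<le> Z"
        proof (rule ccontr)
          assume "\<not> ?thesis"
          then have "(\<Sum>m<N. Z) < (\<Sum>m<N. real N * (D m + f m))"
            using N by (intro sum_strict_mono) (auto simp: not_le lessThan_empty_iff)
          also have "\<dots> = real N * Z" unfolding Z_def sum.distrib[symmetric] by (rule sum_distrib_left[symmetric])
          finally show False by simp
        qed
        then obtain m where m: "m < N" and mZ: "real N * (D m + f m) \<le> Z" by blast
        have DfN: "D m + f m \<le> Z"
          using mZ mult_right_mono[of 1 "real N" "D m + f m"] Df m N by (simp add: Suc_leI)
        define w where "w = (p m)\<^sup>2 + (\<phi> m)\<^sup>2"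
        have "T * w = real N * (k * w)" using N unfolding k by simp
        also have "k * w \<le> D m + f m" using Dp[OF m] unfolding w_def f_def by (simp add: algebra_simps)
        finally have "T * w \<le> Z" using mZ N by (smt (verit) mult_left_mono of_nat_0_le_iff)
        then have w: "w \<le> Z / T" using T by (simp add: field_simps)
        have w0: "w \<ge> 0" unfolding w_def by simp
        have Z0: "Z \<ge> 0" using DfN Df m by (smt (verit))
        \<comment> \<open>To pass from the intermediate value to the node, the increment on the
          chosen cell must be bounded too. This is the place where the case of norm 1 at \<theta> =
          1/2 needs a bound on k \<mu>.\<close>
        have "d m \<le> (C7 / T) * Z + (if \<theta> > 1/2 then \<alpha> / (2 * \<theta> - 1) else 0) * Z"
        proof (cases "\<theta> > 1/2")
          case True
          have "(2 * \<theta> - 1) / \<alpha> * d m \<le> Z"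
            using DfN Df m True k0 unfolding D_def by (smt (verit) mult_nonneg_nonneg zero_le_power2)
          then have "d m \<le> \<alpha> / (2 * \<theta> - 1) * Z" using True \<alpha> by (simp add: field_simps)
          then show ?thesis using True C7 T Z0 by (simp add: add_increasing)
        next
          case False
          have "(k * \<mu>)\<^sup>2 * (2 * M\<^sup>2) \<le> C7"
          proof (cases "\<theta> < 1/2")
            case True
            define g where "g = 24 * M^3 * (1/2 - \<theta>)"
            have g: "g > 0" using True M unfolding g_def by simp
            have "k * \<mu>\<^sup>2 * g \<le> \<alpha>\<^sup>2" using c1 True unfolding g_def by simp
            then have "k * \<mu>\<^sup>2 \<le> \<alpha>\<^sup>2 / g" using g by (simp add: field_simps)
            then have "k * (k * \<mu>\<^sup>2) \<le> T * (\<alpha>\<^sup>2 / g)" using kT k0 T by (intro mult_mono) auto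
            then have "2 * M\<^sup>2 * (k * (k * \<mu>\<^sup>2)) \<le> 2 * M\<^sup>2 * (T * (\<alpha>\<^sup>2 / g))" by (intro mult_left_mono) auto
            then show ?thesis using True unfolding C7_def g_def[symmetric]
              by (simp add: power_mult_distrib power2_eq_square mult_ac)
          next
            case False
            then have t: "\<theta> = 1/2" using \<open>\<not> 1/2 < \<theta>\<close> by simp
            then have "(k * \<mu>)\<^sup>2 \<le> B\<^sup>2" using c2 q1 k0 \<mu> by (intro power_mono) auto
            then have "(k * \<mu>)\<^sup>2 * (2 * M\<^sup>2) \<le> B\<^sup>2 * (2 * M\<^sup>2)" by (rule mult_right_mono) simp
            then show ?thesis using t unfolding C7_def by (simp add: mult_ac)
          qed
          then have "(k * \<mu>)\<^sup>2 * (2 * M\<^sup>2) * w \<le> C7 * (Z / T)" using w w0 C7 by (intro mult_mono) auto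
          then have "d m \<le> C7 * (Z / T)" using d3[OF m] unfolding w_def by (simp add: mult.assoc)
          then show ?thesis using False by simp
        qed
        moreover have "2 * K\<^sup>2 * (p m)\<^sup>2 \<le> 2 * K\<^sup>2 * (Z / T)"
          using w unfolding w_def by (intro mult_left_mono) (auto intro: order_trans[rotated])
        moreover have "2 * K\<^sup>2 * (Z / T) = 2 * K\<^sup>2 / T * Z" by simp
        moreover have "C3 * Z = 2 * K\<^sup>2 / T * Z + 2 * ((C7 / T) * Z) + 2 * ((if \<theta> > 1/2 then \<alpha> / (2 * \<theta> - 1) else 0) * Z)"
          unfolding C3_def by (simp only: distrib_right mult.assoc)
        ultimately have "h m \<le> C3 * Z" using e4[rule_format, OF m] by linarith
        then show ?thesis using m unfolding Z_def by (intro disjI2 exI[of _ m]) auto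
      qed simp
      note concl = core[OF h Df \<eta> a b node bc]
      have "(\<Sum>m<N. k * (p m)\<^sup>2) \<le> sum D {..<N}" by (rule sum_mono) (use Dp in auto)
      then show "(\<Sum>m<N. k * (p m)\<^sup>2) \<le> G * ((\<Sum>m<N. k * (\<phi> m)\<^sup>2) + \<eta>\<^sup>2) \<and>
        (\<forall>m\<le>N. h m \<le> G * ((\<Sum>m<N. k * (\<phi> m)\<^sup>2) + \<eta>\<^sup>2))"
        using concl unfolding f_def by (meson order_trans)
    qed
  qed
qed

text \<open>Two tests enter: the intermediate value \<open>x m\<close> yields the energy balance,
  and the increment \<open>z m\<close> with the inverse inequality bounds the increment itself.
  \<open>A\<close> and \<open>F\<close> are left abstract so that the residual of a comparison
  function can serve as data.\<close>

lemma scheme_stability: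
  fixes T \<alpha> M \<theta> q B :: real and \<iota> :: "'u::real_inner \<Rightarrow> 'h::real_inner"
  assumes T: "T > 0" and \<alpha>: "\<alpha> > 0" and M: "M \<ge> 1" "\<alpha> \<le> M" and q: "0 \<le> q" "q \<le> 1"
    and \<theta>: "0 \<le> \<theta>" "\<theta> \<le> 1" and \<iota>: "bounded_linear \<iota>"
  obtains G where "G \<ge> 0" and "\<And>N k S (e::nat\<Rightarrow>'u) A F \<phi> \<eta> \<mu>.
     \<lbrakk>N > 0; k = T / real N; subspace S; \<forall>m\<le>N. e m \<in> S; 0 \<le> \<eta>; 0 \<le> \<mu>; \<forall>m<N. 0 \<le> \<phi> m;
      \<forall>m<N. \<forall>x\<in>S. \<forall>v\<in>S. \<bar>A m x v\<bar> \<le> M * norm x * norm v; \<forall>m<N. \<forall>x\<in>S. \<alpha> * (norm x)\<^sup>2 \<le> A m x x;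
      \<forall>m<N. \<forall>v\<in>S. \<bar>F m v\<bar> \<le> \<phi> m * norm v;
      \<forall>m<N. \<forall>v\<in>S. \<iota> ((e (Suc m) - e m) /\<^sub>R k) \<bullet> \<iota> v + A m (\<theta> *\<^sub>R e (Suc m) + (1 - \<theta>) *\<^sub>R e m) v = F m v;
      norm (\<iota> (e 0)) \<le> q * norm (\<iota> (e N)) + \<eta>; \<forall>x\<in>S. norm x \<le> \<mu> * norm (\<iota> x);
      \<theta> < 1/2 \<Longrightarrow> k * \<mu>\<^sup>2 * (24 * M^3 * (1/2 - \<theta>)) \<le> \<alpha>\<^sup>2; \<theta> = 1/2 \<Longrightarrow> q = 1 \<Longrightarrow> k * \<mu> \<le> B\<rbrakk> \<Longrightarrow>
     (\<Sum>m<N. k * (norm (\<theta> *\<^sub>R e (Suc m) + (1 - \<theta>) *\<^sub>R e m))\<^sup>2) \<le> G * ((\<Sum>m<N. k * (\<phi> m)\<^sup>2) + \<eta>\<^sup>2) \<and>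
     (\<forall>m\<le>N. (norm (\<iota> (e m)))\<^sup>2 \<le> G * ((\<Sum>m<N. k * (\<phi> m)\<^sup>2) + \<eta>\<^sup>2))"
proof -
  interpret bounded_linear \<iota> by (rule \<iota>)
  obtain K where K: "\<And>x. norm (\<iota> x) \<le> norm x * K" using bounded by blast
  show ?thesis using energy_sequences[OF T \<alpha> M q, of \<theta> K B]
  proof (elim exE conjE, goal_cases)
    case (1 G)
    note seq = 1(2)[rule_format (no_asm)]
    show ?thesis
    proof (rule that[OF 1(1)])
      fix N k S \<phi> \<eta> \<mu> and e :: "nat \<Rightarrow> 'u" and A :: "nat \<Rightarrow> 'u \<Rightarrow> 'u \<Rightarrow> real" and F :: "nat \<Rightarrow> 'u \<Rightarrow> real"
      assume N: "N > 0" and k: "k = T / real N" and S: "subspace S" and e: "\<forall>m\<le>N. e m \<in> S"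
        and \<eta>: "0 \<le> \<eta>" and \<mu>0: "0 \<le> \<mu>" and \<phi>: "\<forall>m<N. 0 \<le> \<phi> m"
        and A: "\<forall>m<N. \<forall>x\<in>S. \<forall>v\<in>S. \<bar>A m x v\<bar> \<le> M * norm x * norm v"
        and coer: "\<forall>m<N. \<forall>x\<in>S. \<alpha> * (norm x)\<^sup>2 \<le> A m x x"
        and F: "\<forall>m<N. \<forall>v\<in>S. \<bar>F m v\<bar> \<le> \<phi> m * norm v"
        and eq: "\<forall>m<N. \<forall>v\<in>S. \<iota> ((e (Suc m) - e m) /\<^sub>R k) \<bullet> \<iota> v + A m (\<theta> *\<^sub>R e (Suc m) + (1 - \<theta>) *\<^sub>R e m) v = F m v"
        and bc: "norm (\<iota> (e 0)) \<le> q * norm (\<iota> (e N)) + \<eta>" and \<mu>: "\<forall>x\<in>S. norm x \<le> \<mu> * norm (\<iota> x)"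
        and c1: "\<theta> < 1/2 \<Longrightarrow> k * \<mu>\<^sup>2 * (24 * M^3 * (1/2 - \<theta>)) \<le> \<alpha>\<^sup>2" and c2: "\<theta> = 1/2 \<Longrightarrow> q = 1 \<Longrightarrow> k * \<mu> \<le> B"
      have k0: "k > 0" using N T k by simp
      define x where "x m = \<theta> *\<^sub>R e (Suc m) + (1 - \<theta>) *\<^sub>R e m" for m
      define z where "z m = e (Suc m) - e m" for m
      have xS: "x m \<in> S" and zS: "z m \<in> S" if "m < N" for m
        unfolding x_def z_def using e that S by (auto intro!: subspace_add subspace_scale subspace_diff)
      have eq': "\<iota> (z m) \<bullet> \<iota> v = k * (F m v - A m (x m) v)" if "m < N" "v \<in> S" for m v
      proof -
        have "\<iota> (z m) \<bullet> \<iota> v / k + A m (x m) v = F m v"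
          using eq that unfolding x_def z_def by (simp add: scaleR divide_inverse mult.commute)
        then show ?thesis using k0 by (simp add: field_simps)
      qed
      \<comment> \<open>The identity |a|^2 - |b|^2 + (2 \<theta> - 1) |a - b|^2 = 2 (a - b) .
        (\<theta> a + (1 - \<theta>) b), from which the case distinction at \<theta> = 1/2
        stems.\<close>
      have id: "(norm (\<iota> (e (Suc m))))\<^sup>2 - (norm (\<iota> (e m)))\<^sup>2 + (2 * \<theta> - 1) * (norm (\<iota> (z m)))\<^sup>2
        = 2 * (\<iota> (z m) \<bullet> \<iota> (x m))" for m
        unfolding z_def x_def power2_norm_eq_inner
        by (simp add: diff add scaleR inner_diff_left inner_diff_right inner_add_left inner_add_right
            inner_commute algebra_simps)
      show "(\<Sum>m<N. k * (norm (\<theta> *\<^sub>R e (Suc m) + (1 - \<theta>) *\<^sub>R e m))\<^sup>2) \<le> G * ((\<Sum>m<N. k * (\<phi> m)\<^sup>2) + \<eta>\<^sup>2) \<and>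
       (\<forall>m\<le>N. (norm (\<iota> (e m)))\<^sup>2 \<le> G * ((\<Sum>m<N. k * (\<phi> m)\<^sup>2) + \<eta>\<^sup>2))"
        unfolding x_def[symmetric]
      proof (rule seq[OF N k \<eta> \<mu>0, where d="\<lambda>m. (norm (\<iota> (z m)))\<^sup>2"])
        show "\<forall>m<N. 0 \<le> norm (x m) \<and> 0 \<le> (norm (\<iota> (z m)))\<^sup>2 \<and> 0 \<le> \<phi> m" using \<phi> by simp
        show "\<forall>m<N. (norm (\<iota> (e (Suc m))))\<^sup>2 - (norm (\<iota> (e m)))\<^sup>2 + (2 * \<theta> - 1) * (norm (\<iota> (z m)))\<^sup>2
            + 2 * k * \<alpha> * (norm (x m))\<^sup>2 \<le> 2 * k * \<phi> m * norm (x m)"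
        proof (intro allI impI)
          fix m assume m: "m < N"
          have "F m (x m) - A m (x m) (x m) \<le> \<phi> m * norm (x m) - \<alpha> * (norm (x m))\<^sup>2"
            using F coer m xS[OF m] by (smt (verit))
          then have "2 * (k * (F m (x m) - A m (x m) (x m))) \<le> 2 * (k * (\<phi> m * norm (x m) - \<alpha> * (norm (x m))\<^sup>2))"
            using k0 by simp
          then show "(norm (\<iota> (e (Suc m))))\<^sup>2 - (norm (\<iota> (e m)))\<^sup>2 + (2 * \<theta> - 1) * (norm (\<iota> (z m)))\<^sup>2
            + 2 * k * \<alpha> * (norm (x m))\<^sup>2 \<le> 2 * k * \<phi> m * norm (x m)"
            unfolding id eq'[OF m xS[OF m]] by (simp add: algebra_simps)
        qed
        have FA: "\<bar>F m v - A m (x m) v\<bar> \<le> (M * norm (x m) + \<phi> m) * norm v" if "m < N" "v \<in> S" for m v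
        proof -
          have "\<bar>F m v\<bar> \<le> \<phi> m * norm v" "\<bar>A m (x m) v\<bar> \<le> M * norm (x m) * norm v"
            using F A that xS by auto
          then show ?thesis by (simp add: algebra_simps)
        qed
        show "\<forall>m<N. \<bar>(norm (\<iota> (e (Suc m))))\<^sup>2 - (norm (\<iota> (e m)))\<^sup>2 + (2 * \<theta> - 1) * (norm (\<iota> (z m)))\<^sup>2\<bar>
          \<le> 2 * k * (M * norm (x m) + \<phi> m) * norm (x m)"
        proof (intro allI impI)
          fix m assume m: "m < N"
          have "k * \<bar>F m (x m) - A m (x m) (x m)\<bar> \<le> k * ((M * norm (x m) + \<phi> m) * norm (x m))"
            using FA[OF m xS[OF m]] k0 by (intro mult_left_mono) auto
          then show "\<bar>(norm (\<iota> (e (Suc m))))\<^sup>2 - (norm (\<iota> (e m)))\<^sup>2 + (2 * \<theta> - 1) * (norm (\<iota> (z m)))\<^sup>2\<bar>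
            \<le> 2 * k * (M * norm (x m) + \<phi> m) * norm (x m)"
            unfolding id eq'[OF m xS[OF m]] using k0 by (simp add: abs_mult mult.assoc)
        qed
        \<comment> \<open>Testing with the increment produces its \<open>U\<close>-norm on the
          right; the inverse inequality turns this into \<mu> times its \<open>H\<close>-norm, one
          factor of which cancels.\<close>
        show "\<forall>m<N. (norm (\<iota> (z m)))\<^sup>2 \<le> (k * \<mu> * (M * norm (x m) + \<phi> m))\<^sup>2"
        proof (intro allI impI power_mono norm_ge_zero)
          fix m assume m: "m < N"
          define w where "w = M * norm (x m) + \<phi> m"
          have w: "w \<ge> 0" unfolding w_def using \<phi> m M by simp
          have "(norm (\<iota> (z m)))\<^sup>2 = k * (F m (z m) - A m (x m) (z m))"
            using eq'[OF m zS[OF m]] by (simp add: power2_norm_eq_inner)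
          also have "\<dots> \<le> k * (w * norm (z m))"
            using FA[OF m zS[OF m]] k0 unfolding w_def by (intro mult_left_mono) auto
          also have "\<dots> \<le> k * (w * (\<mu> * norm (\<iota> (z m))))"
            using \<mu> zS[OF m] w k0 by (intro mult_left_mono) auto
          finally have "norm (\<iota> (z m)) * norm (\<iota> (z m)) \<le> (k * \<mu> * w) * norm (\<iota> (z m))"
            by (simp add: power2_eq_square mult_ac)
          then show "norm (\<iota> (z m)) \<le> k * \<mu> * (M * norm (x m) + \<phi> m)"
            using w k0 \<mu>0 unfolding w_def[symmetric] by (cases "norm (\<iota> (z m)) = 0") auto
        qed
        show "\<forall>m<N. (norm (\<iota> (e m)))\<^sup>2 \<le> 2 * K\<^sup>2 * (norm (x m))\<^sup>2 + 2 * (norm (\<iota> (z m)))\<^sup>2"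
        proof (intro allI impI)
          fix m assume "m < N"
          have "e m = x m - \<theta> *\<^sub>R z m" unfolding x_def z_def by (simp add: algebra_simps)
          then have "\<iota> (e m) = \<iota> (x m) - \<theta> *\<^sub>R \<iota> (z m)" by (simp add: diff scaleR)
          then have "(norm (\<iota> (e m)))\<^sup>2 \<le> 2 * (norm (\<iota> (x m)))\<^sup>2 + 2 * (norm (\<theta> *\<^sub>R \<iota> (z m)))\<^sup>2"
            using norm_diff_sq_le[of "\<iota> (x m)" "\<theta> *\<^sub>R \<iota> (z m)"] by simp
          also have "(norm (\<iota> (x m)))\<^sup>2 \<le> (norm (x m) * K)\<^sup>2" by (rule power_mono[OF K]) simp
          also have "(norm (\<theta> *\<^sub>R \<iota> (z m)))\<^sup>2 \<le> (norm (\<iota> (z m)))\<^sup>2"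
            using \<theta> by (intro power_mono) (auto simp: mult_left_le_one_le)
          finally show "(norm (\<iota> (e m)))\<^sup>2 \<le> 2 * K\<^sup>2 * (norm (x m))\<^sup>2 + 2 * (norm (\<iota> (z m)))\<^sup>2"
            by (simp add: power_mult_distrib mult_ac)
        qed
      qed (use bc c1 c2 in auto)
    qed
  qed
qed

section \<open>Integrals over subintervals\<close>

lemma AE_lebesgue_on_interior: "AE t in lebesgue_on {a..b::real}. a < t \<and> t < b"
proof -
  have "AE t in lborel. t \<noteq> a" "AE t in lborel. t \<noteq> b" by (rule AE_lborel_singleton)+
  then have "AE t in lebesgue. t \<noteq> a" "AE t in lebesgue. t \<noteq> b" by (auto intro: AE_completion)
  then have ae: "AE t in lebesgue. t \<in> {a..b} \<longrightarrow> a < t \<and> t < b" by eventually_elim auto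
  show ?thesis by (subst AE_restrict_space_iff) (use ae in \<open>simp, blast\<close>)
qed

lemma AE_lebesgue_on_subset:
  assumes "AE t in lebesgue_on B. P t" "A \<subseteq> B" "A \<in> sets lebesgue" "B \<in> sets lebesgue"
  shows "AE t in lebesgue_on A. P t"
proof -
  have "AE t in lebesgue. t \<in> B \<longrightarrow> P t" using assms(1,4) by (simp add: AE_restrict_space_iff)
  then have "AE t in lebesgue. t \<in> A \<longrightarrow> P t" by eventually_elim (use assms(2) in auto)
  then show ?thesis using assms(3) by (simp add: AE_restrict_space_iff)
qed

lemma integrable_lebesgue_on_subset:
  fixes h :: "real \<Rightarrow> real"
  assumes "integrable (lebesgue_on B) h" "A \<subseteq> B" "A \<in> sets lebesgue" "B \<in> sets lebesgue"
  shows "integrable (lebesgue_on A) h"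
proof -
  have "set_integrable lebesgue B h" using assms(1,4)
    by (simp add: set_integrable_def integrable_restrict_space)
  then have "set_integrable lebesgue A h" by (rule set_integrable_subset) (use assms in auto)
  then show ?thesis using assms(3) by (simp add: set_integrable_def integrable_restrict_space)
qed

lemma integral_lebesgue_on_split:
  fixes h :: "real \<Rightarrow> real"
  assumes h: "integrable (lebesgue_on {a..c}) h" and "a \<le> b" "b \<le> c"
  shows "(LINT t|lebesgue_on {a..c}. h t) = (LINT t|lebesgue_on {a..b}. h t) + (LINT t|lebesgue_on {b..c}. h t)"
proof -
  have i: "integrable lebesgue (\<lambda>t. indicator {x..y} t *\<^sub>R h t)" if "a \<le> x" "y \<le> c" for x y
    using integrable_lebesgue_on_subset[OF h, of "{x..y}"] that by (simp add: integrable_restrict_space)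
  have "AE t in lborel. t \<noteq> b" by (rule AE_lborel_singleton)
  then have "AE t in lebesgue. t \<noteq> b" by (rule AE_completion)
  then have ae: "AE t in lebesgue. indicator {a..c} t *\<^sub>R h t = indicator {a..b} t *\<^sub>R h t + indicator {b..c} t *\<^sub>R h t"
    by eventually_elim (use assms(2,3) in \<open>auto simp: indicator_def\<close>)
  have "(LINT t|lebesgue. indicator {a..c} t *\<^sub>R h t) = (LINT t|lebesgue. indicator {a..b} t *\<^sub>R h t + indicator {b..c} t *\<^sub>R h t)"
    by (rule integral_cong_AE) (use ae i[of a c] i[of a b] i[of b c] assms(2,3) in auto)
  also have "\<dots> = (LINT t|lebesgue. indicator {a..b} t *\<^sub>R h t) + (LINT t|lebesgue. indicator {b..c} t *\<^sub>R h t)"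
    by (rule Bochner_Integration.integral_add) (use i assms(2,3) in auto)
  finally show ?thesis by (simp add: integral_restrict_space)
qed

lemma integral_lebesgue_on_const:
  fixes h :: "real \<Rightarrow> real"
  assumes "a \<le> b" "\<And>t. a < t \<Longrightarrow> t < b \<Longrightarrow> h t = c"
  shows "(LINT t|lebesgue_on {a..b}. h t) = (b - a) * c" "integrable (lebesgue_on {a..b}) h"
proof -
  have ae: "AE t in lebesgue_on {a..b}. h t = c"
    using AE_lebesgue_on_interior by eventually_elim (use assms(2) in auto)
  have fin: "finite_measure (lebesgue_on {a..b})" by (rule finite_measure_lebesgue_on) simp
  have int: "integrable (lebesgue_on {a..b}) (\<lambda>t. c)" by (rule finite_measure.integrable_const[OF fin])
  have ae': "AE t in lebesgue_on {a..b}. c = h t" using ae by eventually_elim simp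
  have meas: "h \<in> borel_measurable (lebesgue_on {a..b})"
    by (rule measurable_cong_AE_lebesgue_on[OF _ _ ae']) auto
  show "integrable (lebesgue_on {a..b}) h"
    using integrable_cong_AE[OF meas _ ae] int by simp
  have "(LINT t|lebesgue_on {a..b}. h t) = (LINT t|lebesgue_on {a..b}. c)"
    by (rule integral_cong_AE) (use ae meas in auto)
  then show "(LINT t|lebesgue_on {a..b}. h t) = (b - a) * c" using assms(1) by (simp add: measure_restrict_space)
qed

lemma integral_lebesgue_on_FTC:
  fixes F f :: "real \<Rightarrow> real"
  assumes "a \<le> b" "\<And>x. (F has_real_derivative f x) (at x)" "continuous_on {a..b} f"
  shows "(LINT x|lebesgue_on {a..b}. f x) = F b - F a"
proof -
  have "(f has_integral (F b - F a)) {a..b}"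
    by (rule fundamental_theorem_of_calculus[OF assms(1)])
      (use assms(2) in \<open>auto simp: has_real_derivative_iff_has_vector_derivative[symmetric] intro: has_field_derivative_at_within\<close>)
  then show ?thesis
    using lebesgue_integral_eq_integral[OF continuous_imp_integrable_real[OF assms(3)]] by (simp add: integral_unique)
qed

lemma integral_lebesgue_on_partition:
  fixes h :: "real \<Rightarrow> real" and \<sigma> :: "nat \<Rightarrow> real"
  assumes "integrable (lebesgue_on {\<sigma> 0..\<sigma> n}) h" "\<And>j. j < n \<Longrightarrow> \<sigma> j \<le> \<sigma> (Suc j)"
  shows "(LINT t|lebesgue_on {\<sigma> 0..\<sigma> n}. h t) = (\<Sum>j<n. LINT t|lebesgue_on {\<sigma> j..\<sigma> (Suc j)}. h t)"
  using assms
proof (induction n)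
  case 0
  then show ?case using integral_lebesgue_on_const(1)[of "\<sigma> 0" "\<sigma> 0" h 0] by simp
next
  case (Suc n)
  have mono: "\<sigma> 0 \<le> \<sigma> j" if "j \<le> Suc n" for j using that
    by (induction j) (use Suc.prems(2) in \<open>auto intro: order_trans\<close>)
  have "(LINT t|lebesgue_on {\<sigma> 0..\<sigma> (Suc n)}. h t)
    = (LINT t|lebesgue_on {\<sigma> 0..\<sigma> n}. h t) + (LINT t|lebesgue_on {\<sigma> n..\<sigma> (Suc n)}. h t)"
    by (rule integral_lebesgue_on_split[OF Suc.prems(1)]) (use mono Suc.prems(2) in auto)
  also have "(LINT t|lebesgue_on {\<sigma> 0..\<sigma> n}. h t) = (\<Sum>j<n. LINT t|lebesgue_on {\<sigma> j..\<sigma> (Suc j)}. h t)"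
  proof (rule Suc.IH)
    show "integrable (lebesgue_on {\<sigma> 0..\<sigma> n}) h"
      by (rule integrable_lebesgue_on_subset[OF Suc.prems(1)]) (use Suc.prems(2) in auto)
  qed (use Suc.prems(2) in auto)
  finally show ?case by simp
qed

text \<open>Otherwise the integrand would exceed its mean almost everywhere, which is impossible on
  an interval of positive length. This selects nodes from a set of full measure without losing
  control of the integrand there.\<close>

lemma mean_value_good_point:
  fixes h :: "real \<Rightarrow> real"
  assumes h: "integrable (lebesgue_on {a..b}) h" and ab: "a < b" and P: "AE t in lebesgue_on {a..b}. P t"
  obtains \<tau> where "a < \<tau>" "\<tau> < b" "P \<tau>" "(b - a) * h \<tau> \<le> (LINT t|lebesgue_on {a..b}. h t)"
proof (rule ccontr)
  assume "\<not> thesis"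
  then have neg: "\<And>t. a < t \<Longrightarrow> t < b \<Longrightarrow> P t \<Longrightarrow> (LINT t|lebesgue_on {a..b}. h t) < (b - a) * h t"
    using that by force
  define c where "c = (LINT t|lebesgue_on {a..b}. h t) / (b - a)"
  have gt: "AE t in lebesgue_on {a..b}. c < h t" using P AE_lebesgue_on_interior
  proof eventually_elim
    case (elim t)
    then show ?case using neg[of t] ab unfolding c_def by (simp add: divide_less_eq mult.commute)
  qed
  have int0: "(LINT t|lebesgue_on {a..b}. h t - c) = 0"
    using h ab unfolding c_def by simp
  have nn: "AE t in lebesgue_on {a..b}. 0 \<le> h t - c" using gt by eventually_elim simp
  have "integrable (lebesgue_on {a..b}) (\<lambda>t. h t - c)" using h by simp
  from integral_nonneg_eq_0_iff_AE[OF this nn] int0 have "AE t in lebesgue_on {a..b}. h t - c = 0" by simp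
  with gt have "AE t in lebesgue_on {a..b}. False" by eventually_elim simp
  then have "emeasure (lebesgue_on {a..b}) {a..b} = 0"
  proof -
    have *: "{t \<in> space (lebesgue_on {a..b}). True} = {a..b}" by auto
    have "AE t in lebesgue_on {a..b}. \<not> True" using \<open>AE t in lebesgue_on {a..b}. False\<close> by simp
    from emeasure_eq_0_AE[OF this] show ?thesis unfolding * .
  qed
  then show False using ab by (simp add: emeasure_restrict_space)
qed

text \<open>The variance about the mean is nonnegative.\<close>

lemma square_integral_mean_le:
  fixes h :: "real \<Rightarrow> real"
  assumes h2: "integrable (lebesgue_on {a..b}) (\<lambda>t. (h t)\<^sup>2)" and h: "integrable (lebesgue_on {a..b}) h" and ab: "a < b"
  shows "(LINT t|lebesgue_on {a..b}. h t)\<^sup>2 \<le> (b - a) * (LINT t|lebesgue_on {a..b}. (h t)\<^sup>2)"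
proof -
  define c where "c = (LINT t|lebesgue_on {a..b}. h t)"
  have "0 \<le> (LINT t|lebesgue_on {a..b}. (h t - c / (b - a))\<^sup>2)" by (rule integral_nonneg_AE) auto
  also have "\<dots> = (LINT t|lebesgue_on {a..b}. (h t)\<^sup>2 - 2 * (c / (b - a)) * h t + (c / (b - a))\<^sup>2)"
    by (simp add: power2_diff algebra_simps)
  also have "\<dots> = (LINT t|lebesgue_on {a..b}. (h t)\<^sup>2) - 2 * (c / (b - a)) * c + (b - a) * (c / (b - a))\<^sup>2"
    unfolding c_def using h2 h ab by simp
  also have "\<dots> = (LINT t|lebesgue_on {a..b}. (h t)\<^sup>2) - c\<^sup>2 / (b - a)"
  proof -
    define w where "w = b - a"
    have "w \<noteq> 0" using ab unfolding w_def by simp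
    then show ?thesis unfolding w_def[symmetric] by (simp add: power2_eq_square)
  qed
  finally show ?thesis using ab unfolding c_def[symmetric] by (simp add: field_simps)
qed

lemma strongly_measurable_subset:
  assumes "strongly_measurable (lebesgue_on B) f" "A \<subseteq> B" "A \<in> sets lebesgue" "B \<in> sets lebesgue"
  shows "strongly_measurable (lebesgue_on A) f"
proof -
  obtain s where s: "\<And>i. simple_function (lebesgue_on B) (s i)" "AE t in lebesgue_on B. (\<lambda>i::nat. s i t) \<longlonglongrightarrow> f t"
    using assms(1) unfolding strongly_measurable_def by blast
  have "simple_function (lebesgue_on A) (s i)" for i
    unfolding simple_function_def
  proof (intro conjI ballI)
    have "s i ` A \<subseteq> s i ` B" using assms(2) by blast
    moreover have "finite (s i ` B)" using simple_functionD(1)[OF s(1), of i] by simp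
    ultimately show "finite (s i ` space (lebesgue_on A))" by (simp add: finite_subset)
    fix x
    have "s i -` {x} \<inter> B \<in> sets (lebesgue_on B)" using simple_functionD(2)[OF s(1), of i "{x}"] by simp
    then obtain D where D: "D \<in> sets lebesgue" "s i -` {x} \<inter> B = B \<inter> D"
      unfolding sets_restrict_space by blast
    have "s i -` {x} \<inter> A = A \<inter> D" using D(2) assms(2) by blast
    then show "s i -` {x} \<inter> space (lebesgue_on A) \<in> sets (lebesgue_on A)"
      unfolding sets_restrict_space using D(1) by auto
  qed
  moreover have "AE t in lebesgue_on A. (\<lambda>i. s i t) \<longlonglongrightarrow> f t"
    by (rule AE_lebesgue_on_subset[OF s(2) assms(2-4)])
  ultimately show ?thesis unfolding strongly_measurable_def by blast
qed

lemma L2_subinterval: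
  assumes "f \<in> bochner_L2 T" "t \<le> T"
  shows "f \<in> bochner_L2 t"
  using assms unfolding bochner_L2_def
  by (auto intro: strongly_measurable_subset integrable_lebesgue_on_subset)

section \<open>Partitions and piecewise linear functions\<close>

locale partition =
  fixes T :: real and n :: nat and \<sigma> :: "nat \<Rightarrow> real"
  assumes \<sigma>_0: "\<sigma> 0 = 0" and \<sigma>_n: "\<sigma> n = T" and \<sigma>_less: "\<And>j. j < n \<Longrightarrow> \<sigma> j < \<sigma> (Suc j)"
begin

abbreviation cell :: "nat \<Rightarrow> real measure" where
  "cell j \<equiv> lebesgue_on {\<sigma> j..\<sigma> (Suc j)}"

lemma \<sigma>_mono: "i \<le> j \<Longrightarrow> j \<le> n \<Longrightarrow> \<sigma> i \<le> \<sigma> j"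
proof (induction j)
  case (Suc j)
  then show ?case using \<sigma>_less[of j] by (cases "i = Suc j") auto
qed simp

lemma \<sigma>_bounds: "j \<le> n \<Longrightarrow> 0 \<le> \<sigma> j" "j \<le> n \<Longrightarrow> \<sigma> j \<le> T"
  using \<sigma>_mono[of 0 j] \<sigma>_mono[of j n] \<sigma>_0 \<sigma>_n by auto

lemma cell_ex_le: "t \<in> {0..T} \<Longrightarrow> n > 0 \<Longrightarrow> \<exists>j<n. \<sigma> j \<le> t \<and> t \<le> \<sigma> (Suc j)"
proof -
  assume t: "t \<in> {0..T}" and n: "n > 0"
  define j where "j = (LEAST j. t \<le> \<sigma> (Suc j))"
  have ex: "t \<le> \<sigma> (Suc (n - 1))" using t n \<sigma>_n by simp
  have j: "t \<le> \<sigma> (Suc j)" unfolding j_def by (rule LeastI[of _ "n - 1"]) (rule ex)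
  have jn: "j \<le> n - 1" unfolding j_def by (rule Least_le) (rule ex)
  have "\<sigma> j \<le> t"
  proof (cases j)
    case 0 then show ?thesis using t \<sigma>_0 by simp
  next
    case (Suc i)
    then have "\<not> t \<le> \<sigma> (Suc i)" unfolding j_def by (intro not_less_Least) simp
    then show ?thesis using Suc by simp
  qed
  then show ?thesis using j jn n by (intro exI[of _ j]) auto
qed

lemma integral_cells:
  fixes h :: "real \<Rightarrow> real"
  assumes "integrable (I_on T) h"
  shows "(LINT t|I_on T. h t) = (\<Sum>j<n. LINT t|cell j. h t)"
  using integral_lebesgue_on_partition[of \<sigma> n h] assms \<sigma>_less unfolding \<sigma>_0 \<sigma>_n by (auto intro: less_imp_le)

lemma integrable_cell:
  fixes h :: "real \<Rightarrow> real"
  assumes "integrable (I_on T) h" "j < n"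
  shows "integrable (cell j) h"
  by (rule integrable_lebesgue_on_subset[OF assms(1)]) (use \<sigma>_bounds[of j] \<sigma>_bounds[of "Suc j"] assms(2) in auto)

lemma AE_cell:
  assumes "AE t in I_on T. P t" "j < n"
  shows "AE t in cell j. P t"
  by (rule AE_lebesgue_on_subset[OF assms(1)]) (use \<sigma>_bounds[of j] \<sigma>_bounds[of "Suc j"] assms(2) in auto)

lemma AE_in_cell: "AE t in I_on T. \<exists>j<n. \<sigma> j < t \<and> t < \<sigma> (Suc j)"
proof -
  have "AE t in lebesgue. \<forall>j\<in>{..n}. t \<noteq> \<sigma> j"
    by (intro AE_finite_allI finite_atMost AE_completion AE_lborel_singleton)
  then have "AE t in I_on T. \<forall>j\<in>{..n}. t \<noteq> \<sigma> j"
    by (simp add: AE_restrict_space_iff) (erule eventually_mono, simp)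
  moreover have "AE t in I_on T. t \<in> {0..T}" by (rule AE_I2) simp
  moreover have "AE t in I_on T. 0 < t \<and> t < T" by (rule AE_lebesgue_on_interior)
  ultimately show ?thesis
  proof eventually_elim
    case (elim t)
    have "n > 0" using elim \<sigma>_0 \<sigma>_n by (cases n) auto
    from cell_ex_le[OF elim(2) this] obtain j where j: "j < n" "\<sigma> j \<le> t" "t \<le> \<sigma> (Suc j)" by blast
    then have "t \<noteq> \<sigma> j" "t \<noteq> \<sigma> (Suc j)" using elim(1) by auto
    then show ?case using j by (intro exI[of _ j]) auto
  qed
qed

lemma integrable_cellwise_const:
  fixes h :: "real \<Rightarrow> real"
  assumes "\<And>j t. j < n \<Longrightarrow> \<sigma> j < t \<Longrightarrow> t < \<sigma> (Suc j) \<Longrightarrow> h t = c j"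
  shows "integrable (I_on T) h" "(LINT t|I_on T. h t) = (\<Sum>j<n. (\<sigma> (Suc j) - \<sigma> j) * c j)"
proof -
  define g where "g t = (\<Sum>j<n. indicator {\<sigma> j<..<\<sigma> (Suc j)} t * c j)" for t
  have g: "g t = c i" if "i < n" "\<sigma> i < t" "t < \<sigma> (Suc i)" for i t
  proof -
    have "indicator {\<sigma> j<..<\<sigma> (Suc j)} t * c j = (if j = i then c i else 0)" if "j < n" for j
    proof (cases "j = i")
      case False
      then have "Suc j \<le> i \<or> Suc i \<le> j" by auto
      then have "\<sigma> (Suc j) \<le> \<sigma> i \<or> \<sigma> (Suc i) \<le> \<sigma> j" using \<sigma>_mono \<open>i < n\<close> \<open>j < n\<close> by auto
      then show ?thesis using \<open>\<sigma> i < t\<close> \<open>t < \<sigma> (Suc i)\<close> False by (auto simp: indicator_def)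
    qed (use \<open>\<sigma> i < t\<close> \<open>t < \<sigma> (Suc i)\<close> in auto)
    then have "g t = (\<Sum>j<n. if j = i then c i else 0)" unfolding g_def by (intro sum.cong) auto
    then show ?thesis using \<open>i < n\<close> by simp
  qed
  have ae: "AE t in I_on T. g t = h t" using AE_in_cell
    by eventually_elim (use g assms in auto)
  have gm: "g \<in> borel_measurable (I_on T)"
  proof -
    have "g \<in> borel_measurable lebesgue" unfolding g_def
      by (intro borel_measurable_sum borel_measurable_times borel_measurable_indicator borel_measurable_const) simp
    then show ?thesis by (rule measurable_restrict_space1)
  qed
  have meas: "h \<in> borel_measurable (I_on T)"
    by (rule measurable_cong_AE_lebesgue_on[OF _ gm ae]) auto
  show int: "integrable (I_on T) h"
  proof (rule Bochner_Integration.integrable_bound[of _ "\<lambda>t. \<Sum>j<n. \<bar>c j\<bar>"])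
    show "AE t in I_on T. norm (h t) \<le> norm (\<Sum>j<n. \<bar>c j\<bar>)" using AE_in_cell
    proof eventually_elim
      case (elim t)
      then obtain j where j: "j < n" "h t = c j" using assms by blast
      have "\<bar>c j\<bar> \<le> (\<Sum>j<n. \<bar>c j\<bar>)" by (rule member_le_sum) (use j in auto)
      then show ?case using j by simp
    qed
  qed (use meas in auto)
  have "(LINT t|I_on T. h t) = (\<Sum>j<n. LINT t|cell j. h t)"
    by (rule integral_cells[OF int])
  also have "\<dots> = (\<Sum>j<n. (\<sigma> (Suc j) - \<sigma> j) * c j)"
  proof (rule sum.cong)
    fix j assume "j \<in> {..<n}"
    then show "(LINT t|cell j. h t) = (\<sigma> (Suc j) - \<sigma> j) * c j"
      using \<sigma>_less[of j] assms[of j] by (intro integral_lebesgue_on_const) auto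
  qed simp
  finally show "(LINT t|I_on T. h t) = (\<Sum>j<n. (\<sigma> (Suc j) - \<sigma> j) * c j)" .
qed

text \<open>The j-th coefficient rises from 0 to 1 across cell j and is constant elsewhere. One
  global formula thus makes the interpolant Lipschitz on the whole line, including times beyond
  \<open>T\<close> at which sampled nodal values may lie, and displays it as a combination of
  finitely many vectors.\<close>

definition pl :: "(nat \<Rightarrow> 'b::real_normed_vector) \<Rightarrow> real \<Rightarrow> 'b" where
  "pl x t = x 0 + (\<Sum>j<n. max 0 (min 1 ((t - \<sigma> j) / (\<sigma> (Suc j) - \<sigma> j))) *\<^sub>R (x (Suc j) - x j))"

definition slope :: "(nat \<Rightarrow> 'b::real_normed_vector) \<Rightarrow> nat \<Rightarrow> 'b" where
  "slope x j = (x (Suc j) - x j) /\<^sub>R (\<sigma> (Suc j) - \<sigma> j)"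

definition pd :: "(nat \<Rightarrow> 'b::real_normed_vector) \<Rightarrow> real \<Rightarrow> 'b" where
  "pd x t = (\<Sum>j<n. indicator {\<sigma> j<..<\<sigma> (Suc j)} t *\<^sub>R slope x j)"

lemma pl_cell:
  assumes i: "i < n" and t: "\<sigma> i \<le> t" "t \<le> \<sigma> (Suc i)"
  shows "pl x t = x i + (t - \<sigma> i) *\<^sub>R slope x i"
proof -
  let ?c = "\<lambda>j. max 0 (min 1 ((t - \<sigma> j) / (\<sigma> (Suc j) - \<sigma> j)))"
  have c: "?c j = (if j < i then 1 else if j = i then (t - \<sigma> i) / (\<sigma> (Suc i) - \<sigma> i) else 0)" if "j < n" for j
  proof -
    have pos: "\<sigma> (Suc j) - \<sigma> j > 0" using \<sigma>_less[OF that] by simp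
    consider "j < i" | "j = i" | "i < j" by linarith
    then show ?thesis
    proof cases
      case 1
      then have "\<sigma> (Suc j) \<le> \<sigma> i" using i by (intro \<sigma>_mono) auto
      then have "1 \<le> (t - \<sigma> j) / (\<sigma> (Suc j) - \<sigma> j)" using t pos by (simp add: le_divide_eq)
      then show ?thesis using 1 by simp
    next
      case 2
      then show ?thesis using t pos by (simp add: divide_le_eq)
    next
      case 3
      then have "\<sigma> (Suc i) \<le> \<sigma> j" using that by (intro \<sigma>_mono) auto
      then have "(t - \<sigma> j) / (\<sigma> (Suc j) - \<sigma> j) \<le> 0" using t pos by (simp add: divide_le_0_iff)
      then show ?thesis using 3 by simp
    qed
  qed
  have "(\<Sum>j<n. ?c j *\<^sub>R (x (Suc j) - x j)) = (\<Sum>j\<in>{..<i} \<union> {i}. ?c j *\<^sub>R (x (Suc j) - x j))"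
    by (rule sum.mono_neutral_right) (use i c in auto)
  also have "\<dots> = (\<Sum>j<i. ?c j *\<^sub>R (x (Suc j) - x j)) + ?c i *\<^sub>R (x (Suc i) - x i)"
    by (subst sum.union_disjoint) auto
  also have "(\<Sum>j<i. ?c j *\<^sub>R (x (Suc j) - x j)) = (\<Sum>j<i. x (Suc j) - x j)"
    by (rule sum.cong) (use i c in auto)
  also have "\<dots> = x i - x 0" by (rule sum_lessThan_telescope)
  finally show ?thesis unfolding pl_def slope_def using c[OF i] by (simp add: divide_inverse)
qed

lemma pd_cell:
  assumes i: "i < n" and t: "\<sigma> i < t" "t < \<sigma> (Suc i)"
  shows "pd x t = slope x i"
proof -
  have "indicator {\<sigma> j<..<\<sigma> (Suc j)} t *\<^sub>R slope x j = (if j = i then slope x i else 0)" if "j < n" for j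
  proof (cases "j = i")
    case False
    then have "Suc j \<le> i \<or> Suc i \<le> j" by auto
    then have "\<sigma> (Suc j) \<le> \<sigma> i \<or> \<sigma> (Suc i) \<le> \<sigma> j" using \<sigma>_mono \<open>i < n\<close> \<open>j < n\<close> by auto
    then show ?thesis using t False by (auto simp: indicator_def)
  qed (use t in auto)
  then have "pd x t = (\<Sum>j<n. if j = i then slope x i else 0)" unfolding pd_def by (intro sum.cong) auto
  then show ?thesis using i by simp
qed

lemma pl_node: "j \<le> n \<Longrightarrow> n > 0 \<Longrightarrow> pl x (\<sigma> j) = x j"
proof (cases "j < n")
  case True
  then show ?thesis using pl_cell[of j "\<sigma> j" x] \<sigma>_less[of j] by simp
next
  case False
  assume "j \<le> n" "n > 0"
  then obtain i where i: "n = Suc i" "j = Suc i" using False by (cases n) auto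
  then show ?thesis using pl_cell[of i "\<sigma> j" x] \<sigma>_less[of i] by (simp add: slope_def)
qed

lemma pl_lipschitz:
  fixes x :: "nat \<Rightarrow> 'b::real_normed_vector"
  obtains L where "L \<ge> 0" "\<And>s t. norm (pl x t - pl x s) \<le> L * \<bar>t - s\<bar>"
proof
  let ?L = "\<Sum>j<n. norm (slope x j)"
  show "?L \<ge> 0" by (simp add: sum_nonneg)
  fix s t
  have "pl x t - pl x s = (\<Sum>j<n. (max 0 (min 1 ((t - \<sigma> j) / (\<sigma> (Suc j) - \<sigma> j)))
      - max 0 (min 1 ((s - \<sigma> j) / (\<sigma> (Suc j) - \<sigma> j)))) *\<^sub>R (x (Suc j) - x j))"
    unfolding pl_def by (simp add: sum_subtractf scaleR_diff_left)
  also have "norm \<dots> \<le> (\<Sum>j<n. \<bar>t - s\<bar> * norm (slope x j))"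
  proof (rule sum_norm_le)
    fix j assume "j \<in> {..<n}"
    then have pos: "\<sigma> (Suc j) - \<sigma> j > 0" using \<sigma>_less[of j] by simp
    define p q where "p = (t - \<sigma> j) / (\<sigma> (Suc j) - \<sigma> j)" and "q = (s - \<sigma> j) / (\<sigma> (Suc j) - \<sigma> j)"
    have "\<bar>max 0 (min 1 p) - max 0 (min 1 q)\<bar> \<le> \<bar>p - q\<bar>" by linarith
    also have "p - q = (t - s) / (\<sigma> (Suc j) - \<sigma> j)" unfolding p_def q_def by (simp add: diff_divide_distrib)
    also have "\<bar>\<dots>\<bar> = \<bar>t - s\<bar> / (\<sigma> (Suc j) - \<sigma> j)" using pos by simp
    finally have "\<bar>max 0 (min 1 p) - max 0 (min 1 q)\<bar> * norm (x (Suc j) - x j)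
        \<le> \<bar>t - s\<bar> / (\<sigma> (Suc j) - \<sigma> j) * norm (x (Suc j) - x j)" by (rule mult_right_mono) simp
    also have "\<bar>t - s\<bar> / (\<sigma> (Suc j) - \<sigma> j) * norm (x (Suc j) - x j) = \<bar>t - s\<bar> * norm (slope x j)"
    proof -
      define w where "w = \<sigma> (Suc j) - \<sigma> j"
      have "w > 0" unfolding w_def by (rule pos)
      then show ?thesis unfolding slope_def w_def[symmetric] by (simp add: divide_inverse)
    qed
    finally show "norm ((max 0 (min 1 ((t - \<sigma> j) / (\<sigma> (Suc j) - \<sigma> j)))
      - max 0 (min 1 ((s - \<sigma> j) / (\<sigma> (Suc j) - \<sigma> j)))) *\<^sub>R (x (Suc j) - x j)) \<le> \<bar>t - s\<bar> * norm (slope x j)"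
      unfolding p_def q_def norm_scaleR .
  qed
  also have "\<dots> = ?L * \<bar>t - s\<bar>" by (simp add: sum_distrib_left[symmetric] mult.commute)
  finally show "norm (pl x t - pl x s) \<le> ?L * \<bar>t - s\<bar>" .
qed

lemma continuous_pl: "continuous_on A (pl (x :: nat \<Rightarrow> 'b::real_normed_vector))"
proof -
  obtain L where "L \<ge> 0" "\<And>s t. norm (pl x t - pl x s) \<le> L * \<bar>t - s\<bar>" using pl_lipschitz[of x] by blast
  then have "L-lipschitz_on A (pl x)" by (intro lipschitz_onI) (auto simp: dist_norm)
  then show ?thesis by (rule lipschitz_on_continuous_on)
qed

lemma pd_bochner_L2: "pd (x :: nat \<Rightarrow> 'b::real_normed_vector) \<in> bochner_L2 T"
proof -
  have "simple_function (I_on T) (\<lambda>t. indicator {\<sigma> j<..<\<sigma> (Suc j)} t *\<^sub>R slope x j)" for j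
  proof (rule simple_function_compose1[where g="\<lambda>i. i *\<^sub>R slope x j" and f="indicat_real {\<sigma> j<..<\<sigma> (Suc j)}"])
    have "indicat_real {\<sigma> j<..<\<sigma> (Suc j)} \<in> borel_measurable lebesgue" by (rule borel_measurable_indicator) simp
    then have "indicat_real {\<sigma> j<..<\<sigma> (Suc j)} \<in> borel_measurable (I_on T)" by (rule measurable_restrict_space1)
    then show "simple_function (I_on T) (indicat_real {\<sigma> j<..<\<sigma> (Suc j)})"
    proof (rule simple_function_borel_measurable)
      show "finite (indicat_real {\<sigma> j<..<\<sigma> (Suc j)} ` space (I_on T))"
        by (rule finite_subset[of _ "{0, 1}"]) (auto simp: indicator_def)
    qed
  qed
  then have "simple_function (I_on T) (pd x)" unfolding pd_def by (rule simple_function_sum)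
  then have "strongly_measurable (I_on T) (pd x)"
    unfolding strongly_measurable_def by (intro exI[of _ "\<lambda>i. pd x"]) auto
  then show ?thesis
  proof (rule L2_bounded[of _ _ "\<Sum>j<n. norm (slope x j)"])
    show "AE t in I_on T. norm (pd x t) \<le> (\<Sum>j<n. norm (slope x j))"
      unfolding pd_def by (rule AE_I2, rule sum_norm_le) (auto simp: indicator_def)
  qed
qed

lemma bounded_linear_pl:
  assumes "bounded_linear h"
  shows "h (pl x t) = pl (\<lambda>j. h (x j)) t" "h (pd x t) = pd (\<lambda>j. h (x j)) t" "h (slope x j) = slope (\<lambda>j. h (x j)) j"
proof -
  interpret bounded_linear h by (rule assms)
  show s: "h (slope x j) = slope (\<lambda>j. h (x j)) j" for j unfolding slope_def by (simp add: scaleR diff)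
  show "h (pl x t) = pl (\<lambda>j. h (x j)) t" unfolding pl_def by (simp add: add sum scaleR diff)
  show "h (pd x t) = pd (\<lambda>j. h (x j)) t" unfolding pd_def by (simp add: sum scaleR s)
qed

lemma pl_real_integral:
  fixes x :: "nat \<Rightarrow> real"
  assumes t: "t \<in> {0..T}" and n: "n > 0"
  shows "(LINT s|I_on t. pd x s) = pl x t - pl x 0"
proof -
  obtain i where i: "i < n" "\<sigma> i \<le> t" "t \<le> \<sigma> (Suc i)" using cell_ex_le[OF t n] by blast
  \<comment> \<open>The given partition cut off at t, so that the last cell may be
    incomplete.\<close>
  define \<rho> where "\<rho> j = (if j \<le> i then \<sigma> j else t)" for j
  have int: "integrable (I_on T) (pd x)" using integrable_cellwise_const(1)[of "pd x" "slope x"] pd_cell by blast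
  have "integrable (lebesgue_on {\<rho> 0..\<rho> (Suc i)}) (pd x)"
    by (rule integrable_lebesgue_on_subset[OF int]) (use t \<sigma>_0 in \<open>auto simp: \<rho>_def\<close>)
  then have "(LINT s|lebesgue_on {\<rho> 0..\<rho> (Suc i)}. pd x s) = (\<Sum>j<Suc i. LINT s|lebesgue_on {\<rho> j..\<rho> (Suc j)}. pd x s)"
  proof (rule integral_lebesgue_on_partition)
    fix j assume "j < Suc i"
    then show "\<rho> j \<le> \<rho> (Suc j)" using \<sigma>_less[of j] i unfolding \<rho>_def by (cases "j = i") auto
  qed
  also have "\<dots> = (\<Sum>j<Suc i. (\<rho> (Suc j) - \<rho> j) * slope x j)"
  proof (rule sum.cong)
    fix j assume j: "j \<in> {..<Suc i}"
    show "(LINT s|lebesgue_on {\<rho> j..\<rho> (Suc j)}. pd x s) = (\<rho> (Suc j) - \<rho> j) * slope x j"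
    proof (rule integral_lebesgue_on_const(1))
      have "\<rho> (Suc j) \<le> \<sigma> (Suc j)" "\<rho> j = \<sigma> j" "\<rho> j \<le> \<rho> (Suc j)"
        using j i \<sigma>_less[of j] unfolding \<rho>_def by (auto simp: less_Suc_eq)
      then show "\<rho> j \<le> \<rho> (Suc j)" "\<And>s. \<rho> j < s \<Longrightarrow> s < \<rho> (Suc j) \<Longrightarrow> pd x s = slope x j"
        using j i pd_cell[of j _ x] by auto
    qed
  qed simp
  also have "\<dots> = (\<Sum>j<i. x (Suc j) - x j) + (t - \<sigma> i) * slope x i"
  proof -
    have "(\<rho> (Suc j) - \<rho> j) * slope x j = x (Suc j) - x j" if "j < i" for j
      using that i \<sigma>_less[of j] unfolding \<rho>_def slope_def by simp
    then show ?thesis unfolding sum.lessThan_Suc by (simp add: \<rho>_def)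
  qed
  also have "\<dots> = pl x t - pl x 0"
    using pl_cell[OF i, of x] pl_node[of 0 x] n \<sigma>_0 by (simp add: sum_lessThan_telescope)
  finally show ?thesis using \<sigma>_0 by (simp add: \<rho>_def)
qed

end

lemma norm_sum3_sq_le: "(norm (a + b + c))\<^sup>2 \<le> 3 * (norm a)\<^sup>2 + 3 * (norm b)\<^sup>2 + 3 * (norm c)\<^sup>2"
proof -
  have "norm (a + b + c) \<le> norm a + norm b + norm c"
    by (meson norm_triangle_ineq norm_triangle_le add_mono order_refl order_trans)
  then have "(norm (a + b + c))\<^sup>2 \<le> (norm a + norm b + norm c)\<^sup>2" by (rule power_mono) simp
  also have "\<dots> \<le> 3 * (norm a)\<^sup>2 + 3 * (norm b)\<^sup>2 + 3 * (norm c)\<^sup>2"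
    using zero_le_power2[of "norm a - norm b"] zero_le_power2[of "norm b - norm c"] zero_le_power2[of "norm a - norm c"]
    unfolding power2_diff power2_sum by (simp add: algebra_simps)
  finally show ?thesis .
qed

text \<open>
  The nodes are points where \<open>y\<close> behaves well. The end points \<open>0\<close> and \<open>T\<close> need not be such points, so
  \<open>\<rho>\<close> repeats the neighbouring node there and interpolants are constant on the first and last cell.
\<close>

lemma good_nodes:
  fixes y :: "real \<Rightarrow> 'b::real_normed_vector"
  assumes T: "T > 0" and y: "y \<in> bochner_L2 T" and P: "AE t in I_on T. P t" and \<epsilon>: "\<epsilon> > 0" and \<delta>: "\<delta> > 0"
  obtains n \<sigma> \<rho> where "partition T n \<sigma>" "n \<ge> 2" "\<forall>j<n. \<sigma> (Suc j) - \<sigma> j \<le> \<delta>"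
    "\<forall>j\<le>n. P (\<rho> j)" "\<forall>j. 0 < j \<and> j < n \<longrightarrow> \<rho> j = \<sigma> j" "\<rho> 0 = \<sigma> 1" "\<rho> n = \<sigma> (n - 1)"
    "(\<Sum>j<n. LINT t|lebesgue_on {\<sigma> j..\<sigma> (Suc j)}. (norm (y t - y (\<rho> j)))\<^sup>2 + (norm (y t - y (\<rho> (Suc j))))\<^sup>2) \<le> \<epsilon>"
proof -
  \<comment> \<open>The defect of the continuous approximation enters the final sum with weight 30,
    namely 6 from the integrals and 24 from the nodal values; 60 leaves half of the tolerance for
    the oscillation of \<phi>, which gets \<epsilon> / 2 through \<open>w\<close>.\<close>
  obtain \<phi> where \<phi>: "continuous_on UNIV \<phi>" "\<phi> \<in> bochner_L2 T" "L2sq T (\<lambda>t. y t - \<phi> t) < \<epsilon> / 60"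
    using L2_continuous_dense[OF y, of "\<epsilon> / 60"] \<epsilon> by auto
  define h where "h t = (norm (y t - \<phi> t))\<^sup>2" for t
  have h_int: "integrable (I_on T) h" unfolding h_def by (rule L2_integrable[OF L2_diff[OF y \<phi>(2)]])
  have h_nn: "0 \<le> h t" for t unfolding h_def by simp
  define H where "H = (LINT t|I_on T. h t)"
  have H: "H < \<epsilon> / 60" using \<phi>(3) unfolding H_def h_def L2sq_def .
  define w where "w = \<epsilon> / (12 * T)"
  have w: "w > 0" using \<epsilon> T unfolding w_def by simp
  have "uniformly_continuous_on {0..T} \<phi>"
    by (rule compact_uniformly_continuous) (use \<phi>(1) continuous_on_subset in blast, simp)
  then obtain \<delta>1 where \<delta>1: "\<delta>1 > 0" "\<And>t s. t \<in> {0..T} \<Longrightarrow> s \<in> {0..T} \<Longrightarrow> dist s t < \<delta>1 \<Longrightarrow> dist (\<phi> s) (\<phi> t) < sqrt w"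
    unfolding uniformly_continuous_on_def using w by (metis real_sqrt_gt_0_iff)
  define d where "d = min \<delta> (\<delta>1 / 2)"
  have d: "d > 0" "d \<le> \<delta>" "d < \<delta>1" using \<delta> \<delta>1(1) unfolding d_def by auto
  obtain K :: nat where K: "2 * T / d < real (Suc K)"
    using reals_Archimedean2[of "2 * T / d"] by (metis less_Suc_eq of_nat_less_iff order_less_trans)
  define \<kappa> where "\<kappa> = T / real (Suc K)"
  have \<kappa>: "\<kappa> > 0" "2 * \<kappa> \<le> d" using T K d unfolding \<kappa>_def by (auto simp: field_simps)
  have \<kappa>T: "real (Suc K) * \<kappa> = T" unfolding \<kappa>_def by simp
  interpret cells: partition T "Suc K" "\<lambda>i. real i * \<kappa>"
    by unfold_locales (use \<kappa>T \<kappa> in auto)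
  \<comment> \<open>Smallness of the defect \<open>h\<close> in the mean says nothing about
    arbitrary nodes. In each cell of a uniform grid a time is picked where \<open>h\<close> is at
    most its mean, so that the nodal sum is bounded by the integral.\<close>
  have "\<exists>\<tau>. real i * \<kappa> < \<tau> \<and> \<tau> < real (Suc i) * \<kappa> \<and> P \<tau> \<and> \<kappa> * h \<tau> \<le> (LINT t|lebesgue_on {real i * \<kappa>..real (Suc i) * \<kappa>}. h t)"
    if i: "i < Suc K" for i
    using mean_value_good_point[OF cells.integrable_cell[OF h_int i] cells.\<sigma>_less[OF i] cells.AE_cell[OF P i]]
    by (auto simp: algebra_simps)
  then obtain \<tau> where \<tau>: "\<And>i. i < Suc K \<Longrightarrow> real i * \<kappa> < \<tau> i" "\<And>i. i < Suc K \<Longrightarrow> \<tau> i < real (Suc i) * \<kappa>"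
    "\<And>i. i < Suc K \<Longrightarrow> P (\<tau> i)"
    "\<And>i. i < Suc K \<Longrightarrow> \<kappa> * h (\<tau> i) \<le> (LINT t|lebesgue_on {real i * \<kappa>..real (Suc i) * \<kappa>}. h t)"
    by metis
  have sum_h: "\<kappa> * (\<Sum>i<Suc K. h (\<tau> i)) \<le> H"
  proof -
    have "\<kappa> * (\<Sum>i<Suc K. h (\<tau> i)) = (\<Sum>i<Suc K. \<kappa> * h (\<tau> i))" by (rule sum_distrib_left)
    also have "\<dots> \<le> (\<Sum>i<Suc K. LINT t|lebesgue_on {real i * \<kappa>..real (Suc i) * \<kappa>}. h t)"
      by (rule sum_mono) (use \<tau>(4) in auto)
    also have "\<dots> = H" unfolding H_def by (rule cells.integral_cells[OF h_int, symmetric])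
    finally show ?thesis .
  qed
  define n where "n = Suc (Suc K)"
  \<comment> \<open>One chosen time per uniform cell keeps neighbouring nodes within two cell
    lengths of each other; 0 and T are added as end points.\<close>
  define \<sigma> where "\<sigma> j = (if j = 0 then 0 else if j \<le> Suc K then \<tau> (j - 1) else T)" for j
  define \<rho> where "\<rho> j = \<tau> (min (j - 1) K)" for j
  have gap: "\<sigma> j < \<sigma> (Suc j) \<and> \<sigma> (Suc j) - \<sigma> j \<le> 2 * \<kappa>" if "j < n" for j
  proof -
    have "j = 0 \<or> 0 < j \<and> j \<le> K \<or> j = Suc K" using that unfolding n_def by linarith
    then consider "j = 0" | "0 < j" "j \<le> K" | "j = Suc K" by blast
    then show ?thesis
    proof cases
      case 1 then show ?thesis using \<tau>(1,2)[of 0] \<kappa>(1) unfolding \<sigma>_def by simp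
    next
      case 2
      then obtain i where i: "j = Suc i" "Suc i < Suc K" by (cases j) auto
      have e: "real (Suc (Suc i)) * \<kappa> = real i * \<kappa> + 2 * \<kappa>" by (simp add: algebra_simps)
      show ?thesis using \<tau>(1,2)[of i] \<tau>(1,2)[of "Suc i"] i unfolding \<sigma>_def e by auto
    next
      case 3
      have "real K * \<kappa> < \<tau> K" "\<tau> K < real (Suc K) * \<kappa>" using \<tau>(1,2)[of K] by auto
      moreover have "real (Suc K) * \<kappa> = real K * \<kappa> + \<kappa>" by (simp add: algebra_simps)
      moreover have "\<sigma> j = \<tau> K" "\<sigma> (Suc j) = T" using 3 unfolding \<sigma>_def by auto
      ultimately show ?thesis using \<kappa>T \<kappa>(1) by linarith
    qed
  qed
  interpret S: partition T n \<sigma>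
    by unfold_locales (use gap in \<open>auto simp: n_def \<sigma>_def\<close>)
  have \<rho>_cell: "\<rho> j \<in> {\<sigma> j..\<sigma> (Suc j)}" "\<rho> (Suc j) \<in> {\<sigma> j..\<sigma> (Suc j)}" if "j < n" for j
  proof -
    have g: "\<sigma> j \<le> \<sigma> (Suc j)" using gap[OF that] by simp
    have "\<rho> j = \<sigma> j \<or> \<rho> j = \<sigma> (Suc j)" "\<rho> (Suc j) = \<sigma> j \<or> \<rho> (Suc j) = \<sigma> (Suc j)"
    proof -
      show "\<rho> j = \<sigma> j \<or> \<rho> j = \<sigma> (Suc j)"
        using that unfolding n_def \<rho>_def \<sigma>_def by (cases j) (auto simp: min_def)
      show "\<rho> (Suc j) = \<sigma> j \<or> \<rho> (Suc j) = \<sigma> (Suc j)"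
      proof (cases "j \<le> K")
        case True
        then show ?thesis unfolding \<rho>_def \<sigma>_def by (auto simp: min_def)
      next
        case False
        then have "j = Suc K" using that unfolding n_def by simp
        then show ?thesis unfolding \<rho>_def \<sigma>_def by simp
      qed
    qed
    then show "\<rho> j \<in> {\<sigma> j..\<sigma> (Suc j)}" "\<rho> (Suc j) \<in> {\<sigma> j..\<sigma> (Suc j)}" using g by auto
  qed
  have pt: "(norm (y t - y p))\<^sup>2 \<le> 3 * h t + 3 * w + 3 * h p"
    if j: "j < n" and t: "t \<in> {\<sigma> j..\<sigma> (Suc j)}" and p: "p \<in> {\<sigma> j..\<sigma> (Suc j)}" for j t p
  proof -
    have "\<bar>t - p\<bar> < \<delta>1" using t p gap[OF j] \<kappa>(2) d by auto
    moreover have "t \<in> {0..T}" "p \<in> {0..T}" using t p S.\<sigma>_bounds[of j] S.\<sigma>_bounds[of "Suc j"] j by auto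
    ultimately have "norm (\<phi> t - \<phi> p) < sqrt w" using \<delta>1(2)[of p t] by (simp add: dist_norm)
    then have "(norm (\<phi> t - \<phi> p))\<^sup>2 \<le> (sqrt w)\<^sup>2" by (intro power_mono) auto
    then have "(norm (\<phi> t - \<phi> p))\<^sup>2 \<le> w" using w by simp
    moreover have "y t - y p = (y t - \<phi> t) + (\<phi> t - \<phi> p) + (\<phi> p - y p)" by simp
    moreover have "norm (\<phi> p - y p) = norm (y p - \<phi> p)" by (rule norm_minus_commute)
    ultimately show ?thesis using norm_sum3_sq_le[of "y t - \<phi> t" "\<phi> t - \<phi> p" "\<phi> p - y p"] unfolding h_def by simp
  qed
  have "(\<Sum>j<n. LINT t|lebesgue_on {\<sigma> j..\<sigma> (Suc j)}. (norm (y t - y (\<rho> j)))\<^sup>2 + (norm (y t - y (\<rho> (Suc j))))\<^sup>2)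
    \<le> (\<Sum>j<n. 6 * (LINT t|lebesgue_on {\<sigma> j..\<sigma> (Suc j)}. h t) + 6 * w * (\<sigma> (Suc j) - \<sigma> j) + 6 * \<kappa> * (h (\<rho> j) + h (\<rho> (Suc j))))"
  proof (rule sum_mono)
    fix j assume "j \<in> {..<n}"
    then have j: "j < n" by simp
    have hi: "integrable (lebesgue_on {\<sigma> j..\<sigma> (Suc j)}) h" by (rule S.integrable_cell[OF h_int j])
    have "(LINT t|lebesgue_on {\<sigma> j..\<sigma> (Suc j)}. (norm (y t - y (\<rho> j)))\<^sup>2 + (norm (y t - y (\<rho> (Suc j))))\<^sup>2)
      \<le> (LINT t|lebesgue_on {\<sigma> j..\<sigma> (Suc j)}. 6 * h t + (6 * w + 3 * (h (\<rho> j) + h (\<rho> (Suc j)))))"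
    proof (rule integral_mono')
      show "integrable (lebesgue_on {\<sigma> j..\<sigma> (Suc j)}) (\<lambda>t. 6 * h t + (6 * w + 3 * (h (\<rho> j) + h (\<rho> (Suc j)))))"
        using hi by simp
      fix t assume "t \<in> space (lebesgue_on {\<sigma> j..\<sigma> (Suc j)})"
      then have t: "t \<in> {\<sigma> j..\<sigma> (Suc j)}" by simp
      show "(norm (y t - y (\<rho> j)))\<^sup>2 + (norm (y t - y (\<rho> (Suc j))))\<^sup>2 \<le> 6 * h t + (6 * w + 3 * (h (\<rho> j) + h (\<rho> (Suc j))))"
        using pt[OF j t \<rho>_cell(1)[OF j]] pt[OF j t \<rho>_cell(2)[OF j]] by simp
      show "0 \<le> 6 * h t + (6 * w + 3 * (h (\<rho> j) + h (\<rho> (Suc j))))"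
        by (intro add_nonneg_nonneg mult_nonneg_nonneg h_nn) (use w in auto)
    qed
    also have "\<dots> = 6 * (LINT t|lebesgue_on {\<sigma> j..\<sigma> (Suc j)}. h t)
        + (\<sigma> (Suc j) - \<sigma> j) * (6 * w + 3 * (h (\<rho> j) + h (\<rho> (Suc j))))"
      using hi gap[OF j] by simp
    also have "\<dots> = 6 * (LINT t|lebesgue_on {\<sigma> j..\<sigma> (Suc j)}. h t) + 6 * w * (\<sigma> (Suc j) - \<sigma> j)
        + (\<sigma> (Suc j) - \<sigma> j) * (3 * (h (\<rho> j) + h (\<rho> (Suc j))))" by (simp add: algebra_simps)
    also have "(\<sigma> (Suc j) - \<sigma> j) * (3 * (h (\<rho> j) + h (\<rho> (Suc j)))) \<le> (2 * \<kappa>) * (3 * (h (\<rho> j) + h (\<rho> (Suc j))))"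
      using gap[OF j] h_nn by (intro mult_right_mono) auto
    also have "(2 * \<kappa>) * (3 * (h (\<rho> j) + h (\<rho> (Suc j)))) = 6 * \<kappa> * (h (\<rho> j) + h (\<rho> (Suc j)))"
      by (simp add: distrib_left mult_ac)
    finally show "(LINT t|lebesgue_on {\<sigma> j..\<sigma> (Suc j)}. (norm (y t - y (\<rho> j)))\<^sup>2 + (norm (y t - y (\<rho> (Suc j))))\<^sup>2)
      \<le> 6 * (LINT t|lebesgue_on {\<sigma> j..\<sigma> (Suc j)}. h t) + 6 * w * (\<sigma> (Suc j) - \<sigma> j) + 6 * \<kappa> * (h (\<rho> j) + h (\<rho> (Suc j)))"
      by simp
  qed
  also have "\<dots> = 6 * (\<Sum>j<n. LINT t|lebesgue_on {\<sigma> j..\<sigma> (Suc j)}. h t) + 6 * w * (\<Sum>j<n. \<sigma> (Suc j) - \<sigma> j)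
     + 6 * \<kappa> * ((\<Sum>j<n. h (\<rho> j)) + (\<Sum>j<n. h (\<rho> (Suc j))))"
    by (simp only: sum.distrib sum_distrib_left[symmetric])
  also have "(\<Sum>j<n. LINT t|lebesgue_on {\<sigma> j..\<sigma> (Suc j)}. h t) = H" unfolding H_def by (rule S.integral_cells[OF h_int, symmetric])
  also have "(\<Sum>j<n. \<sigma> (Suc j) - \<sigma> j) = T" using S.\<sigma>_0 S.\<sigma>_n by (simp add: sum_lessThan_telescope)
  also have "6 * H + 6 * w * T + 6 * \<kappa> * ((\<Sum>j<n. h (\<rho> j)) + (\<Sum>j<n. h (\<rho> (Suc j)))) \<le> \<epsilon>"
  proof -
    define Z where "Z = (\<Sum>i<Suc K. h (\<tau> i))"
    have "(\<Sum>j<n. h (\<rho> j)) = h (\<tau> 0) + (\<Sum>i<Suc K. h (\<tau> (min i K)))"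
      unfolding n_def \<rho>_def by (subst sum.lessThan_Suc_shift) simp
    moreover have "(\<Sum>i<Suc K. h (\<tau> (min i K))) = Z" unfolding Z_def by (rule sum.cong) auto
    moreover have "(\<Sum>j<n. h (\<rho> (Suc j))) = (\<Sum>i<Suc K. h (\<tau> (min i K))) + h (\<tau> K)"
      unfolding n_def \<rho>_def by simp
    moreover have "h (\<tau> 0) \<le> Z" "h (\<tau> K) \<le> Z" unfolding Z_def by (rule member_le_sum; simp add: h_nn)+
    ultimately have "(\<Sum>j<n. h (\<rho> j)) + (\<Sum>j<n. h (\<rho> (Suc j))) \<le> 4 * Z" by linarith
    then have "\<kappa> * ((\<Sum>j<n. h (\<rho> j)) + (\<Sum>j<n. h (\<rho> (Suc j)))) \<le> \<kappa> * (4 * Z)" using \<kappa>(1) by simp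
    then have "\<kappa> * ((\<Sum>j<n. h (\<rho> j)) + (\<Sum>j<n. h (\<rho> (Suc j)))) \<le> 4 * H" using sum_h unfolding Z_def by linarith
    moreover have "6 * w * T = \<epsilon> / 2" using T unfolding w_def by simp
    ultimately show ?thesis using H by linarith
  qed
  finally have final: "(\<Sum>j<n. LINT t|lebesgue_on {\<sigma> j..\<sigma> (Suc j)}. (norm (y t - y (\<rho> j)))\<^sup>2 + (norm (y t - y (\<rho> (Suc j))))\<^sup>2) \<le> \<epsilon>" .
  show ?thesis
  proof (rule that[OF S.partition_axioms _ _ _ _ _ _ final])
    show "n \<ge> 2" unfolding n_def by simp
    show "\<forall>j<n. \<sigma> (Suc j) - \<sigma> j \<le> \<delta>" using gap \<kappa>(2) d by force
    show "\<forall>j\<le>n. P (\<rho> j)" unfolding \<rho>_def using \<tau>(3) by simp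
    show "\<forall>j. 0 < j \<and> j < n \<longrightarrow> \<rho> j = \<sigma> j" unfolding \<rho>_def \<sigma>_def n_def by (auto simp: min_def)
    show "\<rho> 0 = \<sigma> 1" unfolding \<rho>_def \<sigma>_def by simp
    show "\<rho> n = \<sigma> (n - 1)" unfolding \<rho>_def \<sigma>_def n_def by simp
  qed
qed

section \<open>The evolution triple\<close>

locale gelfand_triple = orthonormal_approximation C
  for C :: "nat \<Rightarrow> 'u::{real_inner,banach} set" +
  fixes \<iota> :: "'u \<Rightarrow> 'h::{real_inner,banach}"
  assumes \<iota>: "bounded_linear \<iota>"
begin

sublocale \<iota>: bounded_linear \<iota> by (rule \<iota>)

text \<open>The composite embedding of \<open>U\<close> into \<open>H\<close> and of
  \<open>H\<close> into the dual of \<open>U\<close>.\<close>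

definition emb :: "'u \<Rightarrow> 'u \<Rightarrow>\<^sub>L real" where
  "emb x = blinfun_inner_right (\<iota> x) o\<^sub>L Blinfun \<iota>"

lemma emb_apply [simp]: "blinfun_apply (emb x) v = \<iota> x \<bullet> \<iota> v"
  unfolding emb_def by (simp add: bounded_linear_Blinfun_apply[OF \<iota>])

lemma bounded_linear_emb: "bounded_linear emb"
proof -
  obtain K where K: "\<And>x. norm (\<iota> x) \<le> norm x * K" "K \<ge> 0" using \<iota>.nonneg_bounded by blast
  show ?thesis
  proof (rule bounded_linear_intro[where K="K * K"])
    show "emb (x + y) = emb x + emb y" for x y by (rule blinfun_eqI) (simp add: \<iota>.add inner_add_left blinfun.add_left)
    show "emb (r *\<^sub>R x) = r *\<^sub>R emb x" for r x by (rule blinfun_eqI) (simp add: \<iota>.scaleR blinfun.scaleR_left)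
    show "norm (emb x) \<le> norm x * (K * K)" for x
    proof (rule norm_blinfun_bound)
      show "0 \<le> norm x * (K * K)" using K by simp
      fix v
      have "\<bar>\<iota> x \<bullet> \<iota> v\<bar> \<le> norm (\<iota> x) * norm (\<iota> v)" by (rule Cauchy_Schwarz_ineq2)
      also have "\<dots> \<le> (norm x * K) * (norm v * K)" using K by (intro mult_mono) auto
      finally show "norm ((emb x) v) \<le> norm x * (K * K) * norm v" by (simp add: mult_ac)
    qed
  qed
qed

text \<open>
  An element of \<open>W\<close> given by its continuous representative \<open>u\<close> in \<open>H\<close>, the corresponding \<open>y\<close> in
  \<open>L\<^sup>2(0,T;U)\<close>, and its derivative \<open>g\<close>, in integrated form.
\<close>

definition wtriple :: "real \<Rightarrow> (real \<Rightarrow> 'h) \<Rightarrow> (real \<Rightarrow> 'u) \<Rightarrow> (real \<Rightarrow> 'u \<Rightarrow>\<^sub>L real) \<Rightarrow> bool" where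
  "wtriple T u y g \<longleftrightarrow> continuous_on {0..T} u \<and> y \<in> bochner_L2 T \<and> g \<in> bochner_L2 T \<and>
     (AE t in I_on T. \<iota> (y t) = u t) \<and>
     (\<forall>t\<in>{0..T}. \<forall>v. (u t - u 0) \<bullet> \<iota> v = (LINT s|I_on t. blinfun_apply (g s) v))"

lemma wtriple_restrict:
  assumes "wtriple T u y g" "0 \<le> t" "t \<le> T"
  shows "wtriple t u y g"
  using assms unfolding wtriple_def
  by (auto intro: L2_subinterval AE_lebesgue_on_subset[where B="{0..T}"] elim: continuous_on_subset)

lemma integrable_dual_apply:
  assumes "g \<in> bochner_L2 T" "0 \<le> a" "b \<le> T"
  shows "integrable (lebesgue_on {a..b}) (\<lambda>t. blinfun_apply (g t :: 'u \<Rightarrow>\<^sub>L real) v)"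
  by (rule integrable_lebesgue_on_subset[OF L2_integrable_pairing[OF assms(1) L2_const[of v]]])
    (use assms in auto)

lemma wtriple_increment:
  assumes w: "wtriple T u y g" and "0 \<le> s" "s \<le> t" "t \<le> T"
  shows "(u t - u s) \<bullet> \<iota> v = (LINT r|lebesgue_on {s..t}. blinfun_apply (g r) v)"
proof -
  have g: "g \<in> bochner_L2 T" using w unfolding wtriple_def by simp
  have "(u t - u 0) \<bullet> \<iota> v = (LINT r|I_on t. (g r) v)"
    "(u s - u 0) \<bullet> \<iota> v = (LINT r|I_on s. (g r) v)"
    using w assms unfolding wtriple_def by auto
  moreover have "(LINT r|I_on t. (g r) v)
    = (LINT r|I_on s. (g r) v) + (LINT r|lebesgue_on {s..t}. (g r) v)"
    by (rule integral_lebesgue_on_split[OF integrable_dual_apply[OF g]]) (use assms in auto)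
  ultimately show ?thesis by (simp add: inner_diff_left)
qed

lemma wtriple_diff:
  assumes 1: "wtriple T u1 y1 g1" and 2: "wtriple T u2 y2 g2"
  shows "wtriple T (\<lambda>t. u1 t - u2 t) (\<lambda>t. y1 t - y2 t) (\<lambda>t. g1 t - g2 t)"
  unfolding wtriple_def
proof (intro conjI ballI allI)
  show "AE t in I_on T. \<iota> (y1 t - y2 t) = u1 t - u2 t"
  proof -
    have "AE t in I_on T. \<iota> (y1 t) = u1 t" "AE t in I_on T. \<iota> (y2 t) = u2 t"
      using 1 2 unfolding wtriple_def by auto
    then show ?thesis by eventually_elim (simp add: \<iota>.diff)
  qed
  fix t v assume t: "t \<in> {0..T}"
  have "(LINT s|I_on t. (g1 s - g2 s) v)
    = (LINT s|I_on t. (g1 s) v) - (LINT s|I_on t. (g2 s) v)"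
    unfolding blinfun.diff_left
    by (rule Bochner_Integration.integral_diff; rule integrable_dual_apply[of _ T])
      (use 1 2 t in \<open>auto simp: wtriple_def\<close>)
  moreover have "(u1 t - u1 0) \<bullet> \<iota> v = (LINT s|I_on t. (g1 s) v)"
    "(u2 t - u2 0) \<bullet> \<iota> v = (LINT s|I_on t. (g2 s) v)"
    using 1 2 t unfolding wtriple_def by auto
  moreover have "u1 t - u2 t - (u1 0 - u2 0) = (u1 t - u1 0) - (u2 t - u2 0)" by simp
  ultimately show "(u1 t - u2 t - (u1 0 - u2 0)) \<bullet> \<iota> v = (LINT s|I_on t. (g1 s - g2 s) v)"
    by (simp only: inner_diff_left)
qed (use 1 2 in \<open>auto simp: wtriple_def intro: continuous_on_diff L2_diff\<close>)

end

text \<open>\<open>D\<close> is the average of \<open>g\<close> in the sense of pairings with fixed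
  vectors, so the norm is estimated vector by vector. Inserting \<gamma> at t and at r leaves three
  contributions: the defect at t, the oscillation of \<gamma>, and the mean defect.\<close>

lemma blinfun_average_diff_bound:
  fixes g \<gamma> :: "real \<Rightarrow> 'u::real_normed_vector \<Rightarrow>\<^sub>L real" and D :: "'u \<Rightarrow>\<^sub>L real"
  assumes ab: "a < b" and D: "\<And>v. (b - a) * blinfun_apply D v = (LINT r|lebesgue_on {a..b}. blinfun_apply (g r) v)"
    and gi: "\<And>v. integrable (lebesgue_on {a..b}) (\<lambda>r. blinfun_apply (g r) v)"
    and ni: "integrable (lebesgue_on {a..b}) (\<lambda>r. norm (g r - \<gamma> r))"
    and n2: "integrable (lebesgue_on {a..b}) (\<lambda>r. (norm (g r - \<gamma> r))\<^sup>2)"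
    and w: "w \<ge> 0" "\<And>r. r \<in> {a..b} \<Longrightarrow> norm (\<gamma> t - \<gamma> r) \<le> sqrt w"
  shows "(norm (g t - D))\<^sup>2 \<le> 3 * (norm (g t - \<gamma> t))\<^sup>2 + 3 * w
      + 3 * ((LINT r|lebesgue_on {a..b}. (norm (g r - \<gamma> r))\<^sup>2) / (b - a))"
proof -
  define J where "J = (LINT r|lebesgue_on {a..b}. norm (g r - \<gamma> r))"
  define A where "A = (LINT r|lebesgue_on {a..b}. (norm (g r - \<gamma> r))\<^sup>2)"
  have J0: "J \<ge> 0" unfolding J_def by (rule integral_nonneg_AE) auto
  define R where "R = norm (g t - \<gamma> t) + sqrt w + J / (b - a)"
  have R0: "R \<ge> 0" unfolding R_def using J0 ab w by simp
  have "norm (g t - D) \<le> R"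
  proof (rule norm_blinfun_bound[OF R0])
    fix v
    have "(b - a) * (g t - D) v = (LINT r|lebesgue_on {a..b}. (g t) v - (g r) v)"
      using ab gi by (simp add: blinfun.diff_left right_diff_distrib D)
    also have "\<bar>\<dots>\<bar> \<le> (LINT r|lebesgue_on {a..b}. (norm (g t - \<gamma> t) + sqrt w) * norm v + norm (g r - \<gamma> r) * norm v)"
    proof (rule integral_abs_bound_integral)
      show "integrable (lebesgue_on {a..b}) (\<lambda>r. (g t) v - (g r) v)" using gi by simp
      show "integrable (lebesgue_on {a..b}) (\<lambda>r. (norm (g t - \<gamma> t) + sqrt w) * norm v + norm (g r - \<gamma> r) * norm v)"
        using ni by simp
      fix r assume "r \<in> space (lebesgue_on {a..b})"
      then have r: "r \<in> {a..b}" by simp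
      have "(g t) v - (g r) v = (g t - g r) v" by (simp add: blinfun.diff_left)
      also have "\<bar>\<dots>\<bar> \<le> norm (g t - g r) * norm v" using norm_blinfun[of "g t - g r" v] by simp
      also have "norm (g t - g r) \<le> norm (g t - \<gamma> t) + sqrt w + norm (g r - \<gamma> r)"
      proof -
        have "g t - g r = (g t - \<gamma> t) + (\<gamma> t - \<gamma> r) - (g r - \<gamma> r)" by simp
        then show ?thesis
          using norm_triangle_ineq4[of "(g t - \<gamma> t) + (\<gamma> t - \<gamma> r)" "g r - \<gamma> r"]
            norm_triangle_ineq[of "g t - \<gamma> t" "\<gamma> t - \<gamma> r"] w(2)[OF r] by simp
      qed
      finally show "\<bar>(g t) v - (g r) v\<bar> \<le> (norm (g t - \<gamma> t) + sqrt w) * norm v + norm (g r - \<gamma> r) * norm v"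
        by (simp add: mult_right_mono distrib_right)
    qed
    also have "\<dots> = (b - a) * ((norm (g t - \<gamma> t) + sqrt w) * norm v) + J * norm v"
      unfolding J_def using ni ab by simp
    also have "\<dots> = (b - a) * (R * norm v)" unfolding R_def using ab by (simp add: field_simps)
    finally have "(b - a) * \<bar>(g t - D) v\<bar> \<le> (b - a) * (R * norm v)" using ab by (simp add: abs_mult)
    then show "norm ((g t - D) v) \<le> R * norm v" using ab by simp
  qed
  then have "(norm (g t - D))\<^sup>2 \<le> R\<^sup>2" by (rule power_mono) simp
  also have "\<dots> \<le> 3 * (norm (g t - \<gamma> t))\<^sup>2 + 3 * (sqrt w)\<^sup>2 + 3 * (J / (b - a))\<^sup>2"
    using norm_sum3_sq_le[of "norm (g t - \<gamma> t)" "sqrt w" "J / (b - a)"] J0 ab unfolding R_def by simp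
  also have "(J / (b - a))\<^sup>2 \<le> A / (b - a)"
  proof -
    have "J\<^sup>2 \<le> (b - a) * A" unfolding J_def A_def by (rule square_integral_mean_le[OF n2 ni ab])
    then have "J\<^sup>2 / (b - a)\<^sup>2 \<le> (b - a) * A / (b - a)\<^sup>2" by (rule divide_right_mono) simp
    also have "\<dots> = A / (b - a)" using ab by (simp add: power2_eq_square)
    finally show ?thesis by (simp add: power_divide)
  qed
  finally show ?thesis using w unfolding A_def by simp
qed

section \<open>Piecewise linear approximation in \<open>W\<close> and the energy identity\<close>

lemma (in partition) pl_convex:
  fixes x :: "nat \<Rightarrow> 'b::real_normed_vector"
  assumes j: "j < n" and t: "\<sigma> j \<le> t" "t \<le> \<sigma> (Suc j)" and a: "norm (z - x j) \<le> a" "norm (z - x (Suc j)) \<le> a"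
  shows "norm (z - pl x t) \<le> a"
proof -
  define r where "r = (t - \<sigma> j) / (\<sigma> (Suc j) - \<sigma> j)"
  have pos: "\<sigma> (Suc j) - \<sigma> j > 0" using \<sigma>_less[OF j] by simp
  have r: "0 \<le> r" "r \<le> 1" using t pos unfolding r_def by (auto simp: divide_le_eq)
  have "pl x t = x j + r *\<^sub>R (x (Suc j) - x j)"
    unfolding pl_cell[OF j t] slope_def r_def by (simp add: divide_inverse)
  then have "z - pl x t = (1 - r) *\<^sub>R (z - x j) + r *\<^sub>R (z - x (Suc j))" by (simp add: algebra_simps)
  then have "norm (z - pl x t) \<le> (1 - r) * norm (z - x j) + r * norm (z - x (Suc j))"
    using r norm_triangle_ineq[of "(1 - r) *\<^sub>R (z - x j)" "r *\<^sub>R (z - x (Suc j))"] by simp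
  also have "\<dots> \<le> (1 - r) * a + r * a" using a r by (intro add_mono mult_left_mono) auto
  finally show ?thesis by (simp add: algebra_simps)
qed

lemma (in partition) pl_L2:
  fixes x :: "nat \<Rightarrow> 'b::real_normed_vector"
  assumes y: "y \<in> bochner_L2 T"
    and err: "(\<Sum>j<n. LINT t|cell j. (norm (y t - x j))\<^sup>2 + (norm (y t - x (Suc j)))\<^sup>2) \<le> e"
  shows "L2sq T (\<lambda>t. y t - pl x t) \<le> e"
proof -
  have L2: "(\<lambda>t. y t - pl x t) \<in> bochner_L2 T"
    by (intro L2_diff y continuous_bochner_L2 continuous_pl)
  have "L2sq T (\<lambda>t. y t - pl x t) = (\<Sum>j<n. LINT t|cell j. (norm (y t - pl x t))\<^sup>2)"
    unfolding L2sq_def by (rule integral_cells[OF L2_integrable[OF L2]])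
  also have "\<dots> \<le> (\<Sum>j<n. LINT t|cell j. (norm (y t - x j))\<^sup>2 + (norm (y t - x (Suc j)))\<^sup>2)"
  proof (rule sum_mono, rule integral_mono')
    fix j assume "j \<in> {..<n}"
    then have j: "j < n" by simp
    have "integrable (cell j) (\<lambda>t. (norm (y t - z))\<^sup>2)" for z
      by (rule integrable_cell[OF L2_integrable[OF L2_diff[OF y L2_const]] j])
    then show "integrable (cell j) (\<lambda>t. (norm (y t - x j))\<^sup>2 + (norm (y t - x (Suc j)))\<^sup>2)" by simp
    fix t assume "t \<in> space (cell j)"
    then have t: "\<sigma> j \<le> t" "t \<le> \<sigma> (Suc j)" by auto
    let ?a = "max (norm (y t - x j)) (norm (y t - x (Suc j)))"
    have "norm (y t - pl x t) \<le> ?a" by (rule pl_convex[OF j t]) auto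
    then have "(norm (y t - pl x t))\<^sup>2 \<le> ?a\<^sup>2" by (rule power_mono) simp
    also have "\<dots> \<le> (norm (y t - x j))\<^sup>2 + (norm (y t - x (Suc j)))\<^sup>2" by (simp add: max_def)
    finally show "(norm (y t - pl x t))\<^sup>2 \<le> (norm (y t - x j))\<^sup>2 + (norm (y t - x (Suc j)))\<^sup>2" .
  qed simp
  finally show ?thesis using err by simp
qed

lemma L2_pl_dense:
  fixes y :: "real \<Rightarrow> 'b::real_normed_vector"
  assumes T: "T > 0" and y: "y \<in> bochner_L2 T" and e: "e > 0"
  obtains n \<sigma> and x :: "nat \<Rightarrow> 'b" where "partition T n \<sigma>" "n > 0" "L2sq T (\<lambda>t. y t - partition.pl n \<sigma> x t) \<le> e"
proof -
  have P: "AE t in I_on T. True" and one: "(1::real) > 0" by auto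
  obtain n \<sigma> \<rho> where part: "partition T n \<sigma>" and n2: "n \<ge> 2" and gap: "\<forall>j<n. \<sigma> (Suc j) - \<sigma> j \<le> 1"
      and "\<forall>j\<le>n. True" and \<rho>: "\<forall>j. 0 < j \<and> j < n \<longrightarrow> \<rho> j = \<sigma> j" "\<rho> 0 = \<sigma> 1" "\<rho> n = \<sigma> (n - 1)"
      and err: "(\<Sum>j<n. LINT t|lebesgue_on {\<sigma> j..\<sigma> (Suc j)}. (norm (y t - y (\<rho> j)))\<^sup>2 + (norm (y t - y (\<rho> (Suc j))))\<^sup>2) \<le> e"
    by (rule good_nodes[OF T y P e one])
  show ?thesis
    by (rule that[OF part _ partition.pl_L2[OF part y err]]) (use n2 in simp)
qed

context gelfand_triple
begin

lemma emb_0: "emb 0 = 0"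
  by (rule linear_0[OF bounded_linear.linear[OF bounded_linear_emb]])

lemma pl_wtriple:
  assumes part: "partition T n \<sigma>" and n: "n > 0"
  shows "wtriple T (\<lambda>t. \<iota> (partition.pl n \<sigma> x t)) (partition.pl n \<sigma> x) (\<lambda>t. emb (partition.pd n \<sigma> x t))"
proof -
  interpret partition T n \<sigma> by (rule part)
  show ?thesis unfolding wtriple_def
  proof (intro conjI ballI allI)
    show "continuous_on {0..T} (\<lambda>t. \<iota> (pl x t))" by (intro \<iota>.continuous_on continuous_pl)
    show "pl x \<in> bochner_L2 T" by (intro continuous_bochner_L2 continuous_pl)
    show "(\<lambda>t. emb (pd x t)) \<in> bochner_L2 T" by (rule L2_bounded_linear[OF pd_bochner_L2 bounded_linear_emb])
    fix t v assume t: "t \<in> {0..T}"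
    have bl: "bounded_linear (\<lambda>z. \<iota> z \<bullet> \<iota> v)"
      by (rule bounded_linear_compose[OF bounded_linear_inner_left \<iota>])
    have "(LINT s|I_on t. pd (\<lambda>j. \<iota> (x j) \<bullet> \<iota> v) s) = pl (\<lambda>j. \<iota> (x j) \<bullet> \<iota> v) t - pl (\<lambda>j. \<iota> (x j) \<bullet> \<iota> v) 0"
      by (rule pl_real_integral[OF t n])
    then show "(\<iota> (pl x t) - \<iota> (pl x 0)) \<bullet> \<iota> v = (LINT s|I_on t. (emb (pd x s)) v)"
      using bounded_linear_pl(1,2)[OF bl, of x] by (simp add: inner_diff_left)
  qed auto
qed

text \<open>A single interpolant approximates in all three norms at once. Its nodal values agree
  with \<open>u\<close> in \<open>H\<close> at the interior nodes, so on interior cells its slope,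
  viewed as a functional, is exactly the average of \<open>g\<close>; averages of \<open>g\<close>
  over short cells are close to \<open>g\<close> in the L2 sense.\<close>

lemma W_approx:
  assumes w: "wtriple T u y g" and T: "T > 0" and e: "e > 0"
  obtains n \<sigma> x where "partition T n \<sigma>" "n > 0" "L2sq T (\<lambda>t. y t - partition.pl n \<sigma> x t) \<le> e"
    "L2sq T (\<lambda>t. g t - emb (partition.pd n \<sigma> x t)) \<le> e"
    "\<forall>t\<in>{0..T}. norm (u t - \<iota> (partition.pl n \<sigma> x t)) \<le> e"
proof -
  have u: "continuous_on {0..T} u" and y: "y \<in> bochner_L2 T" and g: "g \<in> bochner_L2 T"
    and yu: "AE t in I_on T. \<iota> (y t) = u t" using w unfolding wtriple_def by auto
  have e24: "e / 24 > 0" using e by simp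
  obtain \<gamma> where \<gamma>: "continuous_on UNIV \<gamma>" "\<gamma> \<in> bochner_L2 T" "L2sq T (\<lambda>t. g t - \<gamma> t) < e / 24"
    by (rule L2_continuous_dense[OF g e24])
  have \<gamma>T: "continuous_on {0..T} \<gamma>" using \<gamma>(1) continuous_on_subset by blast
  define w where "w = e / (12 * T)"
  have w0: "w > 0" using e T unfolding w_def by simp
  have "uniformly_continuous_on {0..T} \<gamma>" by (rule compact_uniformly_continuous[OF \<gamma>T]) simp
  then obtain d1 where d1: "d1 > 0" "\<And>t s. t \<in> {0..T} \<Longrightarrow> s \<in> {0..T} \<Longrightarrow> dist s t < d1 \<Longrightarrow> dist (\<gamma> s) (\<gamma> t) < sqrt w"
    unfolding uniformly_continuous_on_def using w0 by (metis real_sqrt_gt_0_iff)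
  have "uniformly_continuous_on {0..T} u" by (rule compact_uniformly_continuous[OF u]) simp
  then obtain d2 where d2: "d2 > 0" "\<And>t s. t \<in> {0..T} \<Longrightarrow> s \<in> {0..T} \<Longrightarrow> dist s t < d2 \<Longrightarrow> dist (u s) (u t) < e"
    unfolding uniformly_continuous_on_def using e by metis
  have "bounded (\<gamma> ` {0..T})" by (intro compact_imp_bounded compact_continuous_image \<gamma>T) simp
  then obtain B0 where B0: "\<And>t. t \<in> {0..T} \<Longrightarrow> norm (\<gamma> t) \<le> B0" unfolding bounded_iff by blast
  define B where "B = B0\<^sup>2"
  have B: "(norm (\<gamma> t))\<^sup>2 \<le> B" if "t \<in> {0..T}" for t unfolding B_def by (rule power_mono[OF B0[OF that]]) simp
  have Bn: "B \<ge> 0" unfolding B_def by simp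
  \<comment> \<open>The first two terms exploit uniform continuity of \<gamma> and \<open>u\<close>;
    the third makes the two end cells, each costing at most 2 B d, contribute no more than e /
    2.\<close>
  define d where "d = min (min (d1 / 2) (d2 / 2)) (e / (8 * (B + 1)))"
  have d: "d > 0" "d < d1" "d < d2" "d \<le> e / (8 * (B + 1))" using d1(1) d2(1) e Bn unfolding d_def by auto
  obtain n \<sigma> \<rho> where part: "partition T n \<sigma>" and n2: "n \<ge> 2" and gap: "\<forall>j<n. \<sigma> (Suc j) - \<sigma> j \<le> d"
      and good: "\<forall>j\<le>n. \<iota> (y (\<rho> j)) = u (\<rho> j)" and \<rho>: "\<forall>j. 0 < j \<and> j < n \<longrightarrow> \<rho> j = \<sigma> j" "\<rho> 0 = \<sigma> 1" "\<rho> n = \<sigma> (n - 1)"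
      and err: "(\<Sum>j<n. LINT t|lebesgue_on {\<sigma> j..\<sigma> (Suc j)}. (norm (y t - y (\<rho> j)))\<^sup>2 + (norm (y t - y (\<rho> (Suc j))))\<^sup>2) \<le> e"
    by (rule good_nodes[OF T y yu e d(1)])
  interpret partition T n \<sigma> by (rule part)
  define x where "x j = y (\<rho> j)" for j
  have \<rho>_cell: "\<rho> j \<in> {\<sigma> j..\<sigma> (Suc j)}" "\<rho> (Suc j) \<in> {\<sigma> j..\<sigma> (Suc j)}" if j: "j < n" for j
  proof -
    have "\<rho> j = \<sigma> j \<or> \<rho> j = \<sigma> (Suc j)" using \<rho>(1)[rule_format, of j] \<rho>(2) j by (cases "j = 0") auto
    moreover have "\<rho> (Suc j) = \<sigma> j \<or> \<rho> (Suc j) = \<sigma> (Suc j)"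
      using \<rho>(1)[rule_format, of "Suc j"] \<rho>(3) j by (cases "Suc j = n") auto
    ultimately show "\<rho> j \<in> {\<sigma> j..\<sigma> (Suc j)}" "\<rho> (Suc j) \<in> {\<sigma> j..\<sigma> (Suc j)}" using \<sigma>_less[OF j] by auto
  qed
  have cell_T: "t \<in> {0..T}" if "j < n" "t \<in> {\<sigma> j..\<sigma> (Suc j)}" for j t
    using \<sigma>_bounds[of j] \<sigma>_bounds[of "Suc j"] that by auto
  have V: "L2sq T (\<lambda>t. y t - pl x t) \<le> e" by (rule pl_L2[OF y]) (use err in \<open>simp add: x_def\<close>)
  have H: "\<forall>t\<in>{0..T}. norm (u t - \<iota> (pl x t)) \<le> e"
  proof
    fix t assume "t \<in> {0..T}"
    then obtain j where j: "j < n" "\<sigma> j \<le> t" "t \<le> \<sigma> (Suc j)" using cell_ex_le[of t] n2 by auto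
    have near: "norm (u t - u p) \<le> e" if "p \<in> {\<sigma> j..\<sigma> (Suc j)}" for p
    proof -
      have "\<bar>t - p\<bar> < d2" using j that gap[rule_format, OF j(1)] d(3) by auto
      then show ?thesis using d2(2)[of p t] cell_T[OF j(1) that] cell_T[OF j(1), of t] j by (simp add: dist_norm)
    qed
    have "norm (u t - pl (\<lambda>j. \<iota> (x j)) t) \<le> e"
      by (rule pl_convex[OF j]) (use near \<rho>_cell[OF j(1)] good j(1) in \<open>auto simp: x_def\<close>)
    then show "norm (u t - \<iota> (pl x t)) \<le> e" unfolding bounded_linear_pl(1)[OF \<iota>] .
  qed
  have diff_L2: "(\<lambda>t. g t - emb (pd x t)) \<in> bochner_L2 T"
    by (intro L2_diff g L2_bounded_linear[OF pd_bochner_L2 bounded_linear_emb])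
  have g\<gamma>: "(\<lambda>t. g t - \<gamma> t) \<in> bochner_L2 T" by (rule L2_diff[OF g \<gamma>(2)])
  define A where "A j = (LINT t|cell j. (norm (g t - \<gamma> t))\<^sup>2)" for j
  have A0: "A j \<ge> 0" for j unfolding A_def by (rule integral_nonneg_AE) auto
  have cell: "(LINT t|cell j. (norm (g t - emb (pd x t)))\<^sup>2)
      \<le> 6 * A j + 3 * w * (\<sigma> (Suc j) - \<sigma> j) + (if j = 0 \<or> j = n - 1 then 2 * B * d else 0)" if j: "j < n" for j
  proof -
    let ?L = "cell j"
    have i2: "integrable ?L (\<lambda>t. (norm (g t - \<gamma> t))\<^sup>2)" by (rule integrable_cell[OF L2_integrable[OF g\<gamma>] j])
    have i1: "integrable ?L (\<lambda>t. norm (g t - \<gamma> t))" by (rule integrable_cell[OF L2_integrable_norm[OF g\<gamma>] j])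
    have pos: "\<sigma> j < \<sigma> (Suc j)" by (rule \<sigma>_less[OF j])
    have wg: "0 \<le> w * (\<sigma> (Suc j) - \<sigma> j)" using w0 pos by simp
    show ?thesis
    proof (cases "j = 0 \<or> j = n - 1")
      case True
      \<comment> \<open>On an end cell the repeated node makes the interpolant constant, so its
        slope does not follow \<open>g\<close>; the shortness of the cell and the bound
        \<open>B\<close> on \<gamma> limit the loss.\<close>
      have "x j = x (Suc j)"
      proof (cases "j = 0")
        case True then show ?thesis using \<rho>(1)[rule_format, of 1] \<rho>(2) n2 unfolding x_def by simp
      next
        case False
        then have "j = n - 1" "Suc j = n" using True j by auto
        then show ?thesis using \<rho>(1)[rule_format, of j] \<rho>(3) False j unfolding x_def by simp
      qed
      then have s0: "slope x j = 0" unfolding slope_def by simp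
      have "(LINT t|?L. (norm (g t - emb (pd x t)))\<^sup>2) \<le> (LINT t|?L. 2 * (norm (g t - \<gamma> t))\<^sup>2 + 2 * B)"
      proof (rule integral_mono_AE')
        show "integrable ?L (\<lambda>t. 2 * (norm (g t - \<gamma> t))\<^sup>2 + 2 * B)" using i2 by simp
        show "AE t in ?L. (norm (g t - emb (pd x t)))\<^sup>2 \<le> 2 * (norm (g t - \<gamma> t))\<^sup>2 + 2 * B"
          using AE_lebesgue_on_interior
        proof eventually_elim
          case (elim t)
          have "pd x t = 0" using pd_cell[OF j, of t x] elim s0 by simp
          then have "(norm (g t - emb (pd x t)))\<^sup>2 = (norm ((g t - \<gamma> t) + \<gamma> t))\<^sup>2"
            by (simp add: emb_0)
          also have "\<dots> \<le> 2 * (norm (g t - \<gamma> t))\<^sup>2 + 2 * (norm (\<gamma> t))\<^sup>2" by (rule norm_add_sq_le)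
          finally show ?case using B[of t] cell_T[OF j, of t] elim by simp
        qed
        show "AE t in ?L. 0 \<le> 2 * (norm (g t - \<gamma> t))\<^sup>2 + 2 * B" using Bn by simp
      qed
      also have "\<dots> = 2 * A j + (\<sigma> (Suc j) - \<sigma> j) * (2 * B)" unfolding A_def using i2 pos by simp
      also have "(\<sigma> (Suc j) - \<sigma> j) * (2 * B) \<le> d * (2 * B)" using gap j Bn by (intro mult_right_mono) auto
      finally have "(LINT t|?L. (norm (g t - emb (pd x t)))\<^sup>2) \<le> 2 * A j + 2 * B * d" by (simp add: mult_ac)
      then show ?thesis using True A0[of j] wg by simp
    next
      case False
      then have x_node: "\<iota> (x j) = u (\<sigma> j)" "\<iota> (x (Suc j)) = u (\<sigma> (Suc j))"
        using good[rule_format, of j] good[rule_format, of "Suc j"] \<rho>(1)[rule_format, of j] \<rho>(1)[rule_format, of "Suc j"] j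
        unfolding x_def by auto
      have "(LINT t|?L. (norm (g t - emb (pd x t)))\<^sup>2)
        \<le> (LINT t|?L. 3 * (norm (g t - \<gamma> t))\<^sup>2 + (3 * w + 3 * (A j / (\<sigma> (Suc j) - \<sigma> j))))"
      proof (rule integral_mono_AE')
        show "integrable ?L (\<lambda>t. 3 * (norm (g t - \<gamma> t))\<^sup>2 + (3 * w + 3 * (A j / (\<sigma> (Suc j) - \<sigma> j))))" using i2 by simp
        show "AE t in ?L. (norm (g t - emb (pd x t)))\<^sup>2 \<le> 3 * (norm (g t - \<gamma> t))\<^sup>2 + (3 * w + 3 * (A j / (\<sigma> (Suc j) - \<sigma> j)))"
          using AE_lebesgue_on_interior
        proof eventually_elim
          case (elim t)
          have pdt: "pd x t = slope x j" using pd_cell[OF j, of t x] elim by simp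
          have "(norm (g t - emb (slope x j)))\<^sup>2 \<le> 3 * (norm (g t - \<gamma> t))\<^sup>2 + 3 * w + 3 * (A j / (\<sigma> (Suc j) - \<sigma> j))"
            unfolding A_def
          proof (rule blinfun_average_diff_bound[OF pos _ _ i1 i2])
            fix v
            show "integrable ?L (\<lambda>r. (g r) v)"
              by (rule integrable_dual_apply[OF g]) (use \<sigma>_bounds[of j] \<sigma>_bounds[of "Suc j"] j in auto)
            have "(LINT r|?L. (g r) v) = (u (\<sigma> (Suc j)) - u (\<sigma> j)) \<bullet> \<iota> v"
              by (rule wtriple_increment[OF w, symmetric]) (use \<sigma>_bounds[of j] \<sigma>_bounds[of "Suc j"] j pos in auto)
            also have "\<dots> = (\<sigma> (Suc j) - \<sigma> j) * (emb (slope x j)) v"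
              using pos unfolding slope_def by (simp add: \<iota>.scaleR \<iota>.diff x_node)
            finally show "(\<sigma> (Suc j) - \<sigma> j) * (emb (slope x j)) v = (LINT r|?L. (g r) v)" by simp
          next
            fix r assume r: "r \<in> {\<sigma> j..\<sigma> (Suc j)}"
            have "\<bar>t - r\<bar> < d1" using elim r gap[rule_format, OF j] d(2) by auto
            then show "norm (\<gamma> t - \<gamma> r) \<le> sqrt w"
              using d1(2)[of r t] cell_T[OF j r] cell_T[OF j, of t] elim by (simp add: dist_norm)
          qed (use w0 in simp)
          then show ?case unfolding pdt by simp
        qed
        show "AE t in ?L. 0 \<le> 3 * (norm (g t - \<gamma> t))\<^sup>2 + (3 * w + 3 * (A j / (\<sigma> (Suc j) - \<sigma> j)))"
          using w0 A0 pos by simp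
      qed
      also have "\<dots> = 3 * A j + (\<sigma> (Suc j) - \<sigma> j) * (3 * w + 3 * (A j / (\<sigma> (Suc j) - \<sigma> j)))"
        unfolding A_def using i2 pos by simp
      also have "\<dots> = 6 * A j + 3 * w * (\<sigma> (Suc j) - \<sigma> j)" using pos by (simp add: distrib_left)
      finally show ?thesis using False by simp
    qed
  qed
  have D: "L2sq T (\<lambda>t. g t - emb (pd x t)) \<le> e"
  proof -
    have "L2sq T (\<lambda>t. g t - emb (pd x t)) = (\<Sum>j<n. LINT t|cell j. (norm (g t - emb (pd x t)))\<^sup>2)"
      unfolding L2sq_def by (rule integral_cells[OF L2_integrable[OF diff_L2]])
    also have "\<dots> \<le> (\<Sum>j<n. 6 * A j + 3 * w * (\<sigma> (Suc j) - \<sigma> j) + (if j = 0 \<or> j = n - 1 then 2 * B * d else 0))"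
      by (rule sum_mono) (use cell in auto)
    also have "\<dots> = 6 * (\<Sum>j<n. A j) + 3 * w * (\<Sum>j<n. \<sigma> (Suc j) - \<sigma> j) + (\<Sum>j<n. if j = 0 \<or> j = n - 1 then 2 * B * d else 0)"
      by (simp only: sum.distrib sum_distrib_left[symmetric])
    also have "(\<Sum>j<n. A j) = L2sq T (\<lambda>t. g t - \<gamma> t)"
      unfolding A_def L2sq_def by (rule integral_cells[OF L2_integrable[OF g\<gamma>], symmetric])
    also have "(\<Sum>j<n. \<sigma> (Suc j) - \<sigma> j) = T" using \<sigma>_0 \<sigma>_n by (simp add: sum_lessThan_telescope)
    also have "(\<Sum>j<n. if j = 0 \<or> j = n - 1 then 2 * B * d else 0) = (\<Sum>j\<in>{0, n - 1}. 2 * B * d)"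
      by (rule sum.mono_neutral_cong_right) (use n2 in auto)
    also have "\<dots> = 4 * B * d" using n2 by simp
    also have "6 * L2sq T (\<lambda>t. g t - \<gamma> t) + 3 * w * T + 4 * B * d \<le> e"
    proof -
      have "3 * w * T = e / 4" using T unfolding w_def by simp
      moreover have "4 * B * d \<le> e / 2"
      proof -
        have "4 * B * d \<le> 4 * (B + 1) * (e / (8 * (B + 1)))" using d Bn by (intro mult_mono) auto
        also have "\<dots> = e / 2" using Bn by (simp add: field_simps)
        finally show ?thesis .
      qed
      ultimately show ?thesis using \<gamma>(3) by linarith
    qed
    finally show ?thesis .
  qed
  show ?thesis by (rule that[OF part _ V D H]) (use n2 in simp)
qed

lemma pl_energy:
  assumes part: "partition T n \<sigma>" and n: "n > 0"
  shows "(norm (\<iota> (partition.pl n \<sigma> x T)))\<^sup>2 - (norm (\<iota> (partition.pl n \<sigma> x 0)))\<^sup>2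
    = 2 * (LINT t|I_on T. blinfun_apply (emb (partition.pd n \<sigma> x t)) (partition.pl n \<sigma> x t))"
proof -
  interpret partition T n \<sigma> by (rule part)
  have int: "integrable (I_on T) (\<lambda>t. (emb (pd x t)) (pl x t))"
    using pl_wtriple[OF part n, of x] unfolding wtriple_def by (intro L2_integrable_pairing) auto
  have "2 * (LINT t|cell j. (emb (pd x t)) (pl x t))
      = (norm (\<iota> (x (Suc j))))\<^sup>2 - (norm (\<iota> (x j)))\<^sup>2" if j: "j < n" for j
  proof -
    define a where "a = \<iota> (x j)"
    define b where "b = \<iota> (slope x j)"
    \<comment> \<open>On a cell the slope is constant and the interpolant affine, so the pairing is
      affine in t and has an explicit antiderivative.\<close>
    have "(LINT t|cell j. (emb (pd x t)) (pl x t))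
        = (LINT t|cell j. a \<bullet> b + (t - \<sigma> j) * (b \<bullet> b))"
    proof (rule integral_cong_AE_lebesgue_on[OF _ borel_measurable_integrable[OF integrable_cell[OF int j]]])
      show "AE t in cell j. (emb (pd x t)) (pl x t) = a \<bullet> b + (t - \<sigma> j) * (b \<bullet> b)"
        using AE_lebesgue_on_interior
      proof eventually_elim
        case (elim t)
        then show ?case
          using pl_cell[OF j, of t x] pd_cell[OF j, of t x] unfolding a_def b_def
          by (simp add: \<iota>.add \<iota>.scaleR inner_add_right inner_commute)
      qed
    qed simp
    also have "\<dots> = ((\<sigma> (Suc j) - \<sigma> j) * (a \<bullet> b) + (\<sigma> (Suc j) - \<sigma> j)\<^sup>2 / 2 * (b \<bullet> b))
        - ((\<sigma> j - \<sigma> j) * (a \<bullet> b) + (\<sigma> j - \<sigma> j)\<^sup>2 / 2 * (b \<bullet> b))"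
      using \<sigma>_less[OF j]
      by (intro integral_lebesgue_on_FTC[where F="\<lambda>t. (t - \<sigma> j) * (a \<bullet> b) + (t - \<sigma> j)\<^sup>2 / 2 * (b \<bullet> b)"])
        (auto intro!: derivative_eq_intros continuous_intros)
    finally have "2 * (LINT t|cell j. (emb (pd x t)) (pl x t))
        = 2 * (\<sigma> (Suc j) - \<sigma> j) * (a \<bullet> b) + (\<sigma> (Suc j) - \<sigma> j)\<^sup>2 * (b \<bullet> b)" by simp
    moreover have "x (Suc j) = x j + (\<sigma> (Suc j) - \<sigma> j) *\<^sub>R slope x j" unfolding slope_def using \<sigma>_less[OF j] by simp
    then have "\<iota> (x (Suc j)) = a + (\<sigma> (Suc j) - \<sigma> j) *\<^sub>R b" unfolding a_def b_def by (simp only: \<iota>.add \<iota>.scaleR)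
    ultimately show ?thesis
      unfolding a_def[symmetric] power2_norm_eq_inner by (simp add: inner_add_left inner_add_right inner_commute power2_eq_square)
  qed
  then have "2 * (LINT t|I_on T. (emb (pd x t)) (pl x t)) = (\<Sum>j<n. (norm (\<iota> (x (Suc j))))\<^sup>2 - (norm (\<iota> (x j)))\<^sup>2)"
    unfolding integral_cells[OF int] sum_distrib_left by (intro sum.cong) auto
  also have "\<dots> = (norm (\<iota> (x n)))\<^sup>2 - (norm (\<iota> (x 0)))\<^sup>2" by (rule sum_lessThan_telescope)
  finally show ?thesis using pl_node[of n x] pl_node[of 0 x] n unfolding \<sigma>_0 \<sigma>_n by simp
qed

text \<open>The identity is exact for piecewise linear functions, and both of its sides are
  continuous under the three kinds of convergence delivered by \<open>W_approx\<close>.\<close>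

lemma wtriple_energy:
  assumes w: "wtriple T u y g" and T: "T \<ge> 0"
  shows "(norm (u T))\<^sup>2 - (norm (u 0))\<^sup>2 = 2 * (LINT t|I_on T. blinfun_apply (g t) (y t))"
proof (cases "T = 0")
  case True
  have "(LINT t|lebesgue_on {0..0}. (g t) (y t)) = (0 - 0) * 0"
    by (rule integral_lebesgue_on_const) auto
  then show ?thesis using True by simp
next
  case False
  then have T0: "T > 0" using T by simp
  have y: "y \<in> bochner_L2 T" and g: "g \<in> bochner_L2 T" using w unfolding wtriple_def by auto
  define \<epsilon> where "\<epsilon> i = inverse (real (Suc i))" for i
  have \<epsilon>: "\<epsilon> \<longlonglongrightarrow> 0" "\<And>i. \<epsilon> i > 0" unfolding \<epsilon>_def using LIMSEQ_inverse_real_of_nat by auto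
  have "\<forall>i. \<exists>z \<gamma>. z \<in> bochner_L2 T \<and> \<gamma> \<in> bochner_L2 T \<and> L2sq T (\<lambda>t. z t - y t) \<le> \<epsilon> i \<and> L2sq T (\<lambda>t. \<gamma> t - g t) \<le> \<epsilon> i
      \<and> norm (\<iota> (z 0) - u 0) \<le> \<epsilon> i \<and> norm (\<iota> (z T) - u T) \<le> \<epsilon> i
      \<and> (norm (\<iota> (z T)))\<^sup>2 - (norm (\<iota> (z 0)))\<^sup>2 = 2 * (LINT t|I_on T. (\<gamma> t) (z t))"
  proof
    fix i
    obtain n \<sigma> x where p: "partition T n \<sigma>" "n > 0" and a: "L2sq T (\<lambda>t. y t - partition.pl n \<sigma> x t) \<le> \<epsilon> i"
      "L2sq T (\<lambda>t. g t - emb (partition.pd n \<sigma> x t)) \<le> \<epsilon> i" "\<forall>t\<in>{0..T}. norm (u t - \<iota> (partition.pl n \<sigma> x t)) \<le> \<epsilon> i"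
      by (rule W_approx[OF w T0 \<epsilon>(2)])
    have "wtriple T (\<lambda>t. \<iota> (partition.pl n \<sigma> x t)) (partition.pl n \<sigma> x) (\<lambda>t. emb (partition.pd n \<sigma> x t))" by (rule pl_wtriple[OF p])
    then show "\<exists>z \<gamma>. z \<in> bochner_L2 T \<and> \<gamma> \<in> bochner_L2 T \<and> L2sq T (\<lambda>t. z t - y t) \<le> \<epsilon> i \<and> L2sq T (\<lambda>t. \<gamma> t - g t) \<le> \<epsilon> i
      \<and> norm (\<iota> (z 0) - u 0) \<le> \<epsilon> i \<and> norm (\<iota> (z T) - u T) \<le> \<epsilon> i
      \<and> (norm (\<iota> (z T)))\<^sup>2 - (norm (\<iota> (z 0)))\<^sup>2 = 2 * (LINT t|I_on T. (\<gamma> t) (z t))"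
      using a pl_energy[OF p, of x] T unfolding wtriple_def L2sq_def
      by (intro exI[of _ "partition.pl n \<sigma> x"] exI[of _ "\<lambda>t. emb (partition.pd n \<sigma> x t)"]) (simp add: norm_minus_commute)
  qed
  then obtain z \<gamma> where "\<forall>i. z i \<in> bochner_L2 T \<and> \<gamma> i \<in> bochner_L2 T \<and> L2sq T (\<lambda>t. z i t - y t) \<le> \<epsilon> i \<and> L2sq T (\<lambda>t. \<gamma> i t - g t) \<le> \<epsilon> i
      \<and> norm (\<iota> (z i 0) - u 0) \<le> \<epsilon> i \<and> norm (\<iota> (z i T) - u T) \<le> \<epsilon> i
      \<and> (norm (\<iota> (z i T)))\<^sup>2 - (norm (\<iota> (z i 0)))\<^sup>2 = 2 * (LINT t|I_on T. (\<gamma> i t) (z i t))"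
    unfolding choice_iff by (elim exE)
  then have L: "z i \<in> bochner_L2 T" "\<gamma> i \<in> bochner_L2 T" and le: "L2sq T (\<lambda>t. z i t - y t) \<le> \<epsilon> i" "L2sq T (\<lambda>t. \<gamma> i t - g t) \<le> \<epsilon> i"
      "norm (\<iota> (z i 0) - u 0) \<le> \<epsilon> i" "norm (\<iota> (z i T) - u T) \<le> \<epsilon> i"
      and eq: "(norm (\<iota> (z i T)))\<^sup>2 - (norm (\<iota> (z i 0)))\<^sup>2 = 2 * (LINT t|I_on T. (\<gamma> i t) (z i t))" for i by blast+
  have small: "f \<longlonglongrightarrow> 0" if "\<And>i. 0 \<le> f i" "\<And>i. f i \<le> \<epsilon> i" for f :: "nat \<Rightarrow> real"
    by (rule tendsto_sandwich[OF always_eventually always_eventually tendsto_const \<epsilon>(1)]) (use that in auto)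
  have pair: "(\<lambda>i. LINT t|I_on T. (\<gamma> i t) (z i t)) \<longlonglongrightarrow> (LINT t|I_on T. (g t) (y t))"
    by (rule L2_pairing_tendsto[OF L(2) L(1) g y]) (intro small L2sq_nonneg le)+
  have lim: "(\<lambda>i. \<iota> (z i s)) \<longlonglongrightarrow> u s" if "\<And>i. norm (\<iota> (z i s) - u s) \<le> \<epsilon> i" for s
    by (rule LIM_zero_cancel, rule tendsto_norm_zero_cancel, rule small[OF norm_ge_zero that])
  have "(\<lambda>i. (norm (\<iota> (z i T)))\<^sup>2 - (norm (\<iota> (z i 0)))\<^sup>2) \<longlonglongrightarrow> (norm (u T))\<^sup>2 - (norm (u 0))\<^sup>2"
    by (intro tendsto_intros lim le)
  then show ?thesis unfolding eq using LIMSEQ_unique[OF _ tendsto_mult_left[OF pair]] by blast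
qed

end

section \<open>Step functions\<close>

lemma uniform_partition: "T > 0 \<Longrightarrow> N > 0 \<Longrightarrow> partition T N (\<lambda>m. real m * (T / real N))"
  by unfold_locales (auto simp: field_simps)

lemma floor_simple_function:
  assumes k: "k > 0"
  shows "simple_function (I_on T) (\<lambda>t. F (nat \<lfloor>t / k\<rfloor>))"
proof -
  have "simple_function (I_on T) (\<lambda>t. \<lfloor>t / k\<rfloor>)"
  proof (rule simple_function_eq_measurable[THEN iffD2], intro conjI)
    have "(\<lambda>t. \<lfloor>t / k\<rfloor>) ` space (I_on T) \<subseteq> {0..\<lfloor>T / k\<rfloor>}"
    proof (rule image_subsetI)
      fix t assume "t \<in> space (I_on T)"
      then have t: "0 \<le> t" "t \<le> T" by auto
      then have "0 \<le> t / k" "t / k \<le> T / k" using k by (auto intro: divide_right_mono)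
      then show "\<lfloor>t / k\<rfloor> \<in> {0..\<lfloor>T / k\<rfloor>}" using floor_mono by auto
    qed
    then show "finite ((\<lambda>t. \<lfloor>t / k\<rfloor>) ` space (I_on T))" by (rule finite_subset) simp
    have "(\<lambda>t::real. t / k) \<in> borel_measurable lborel" by simp
    from measurable_compose[OF this measurable_real_floor]
    have "(\<lambda>t. \<lfloor>t / k\<rfloor>) \<in> measurable lebesgue (count_space UNIV)" by (rule measurable_completion)
    then show "(\<lambda>t. \<lfloor>t / k\<rfloor>) \<in> measurable (I_on T) (count_space UNIV)" by (rule measurable_restrict_space1)
  qed
  then show ?thesis by (rule simple_function_compose1[where g="\<lambda>i. F (nat i)"])
qed

lemma floor_bochner_L2:
  fixes F :: "nat \<Rightarrow> 'b::real_normed_vector"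
  assumes k: "k > 0"
  shows "(\<lambda>t. F (nat \<lfloor>t / k\<rfloor>)) \<in> bochner_L2 T"
proof -
  have s: "simple_function (I_on T) (\<lambda>t. F (nat \<lfloor>t / k\<rfloor>))" by (rule floor_simple_function[OF k])
  have fin: "finite ((\<lambda>t. F (nat \<lfloor>t / k\<rfloor>)) ` {0..T})" using simple_functionD(1)[OF s] by simp
  have "strongly_measurable (I_on T) (\<lambda>t. F (nat \<lfloor>t / k\<rfloor>))" unfolding strongly_measurable_def
    by (intro exI[of _ "\<lambda>i t. F (nat \<lfloor>t / k\<rfloor>)"]) (use s in auto)
  then show ?thesis
  proof (rule L2_bounded[of _ _ "Max (norm ` (\<lambda>t. F (nat \<lfloor>t / k\<rfloor>)) ` {0..T})"])
    show "AE t in I_on T. norm (F (nat \<lfloor>t / k\<rfloor>)) \<le> Max (norm ` (\<lambda>t. F (nat \<lfloor>t / k\<rfloor>)) ` {0..T})"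
    proof (rule AE_I2)
      fix t assume "t \<in> space (I_on T)"
      then have "norm (F (nat \<lfloor>t / k\<rfloor>)) \<in> norm ` (\<lambda>t. F (nat \<lfloor>t / k\<rfloor>)) ` {0..T}" by simp
      then show "norm (F (nat \<lfloor>t / k\<rfloor>)) \<le> Max (norm ` (\<lambda>t. F (nat \<lfloor>t / k\<rfloor>)) ` {0..T})"
        by (rule Max_ge[OF finite_imageI[OF fin]])
    qed
  qed
qed

lemma floor_bounds:
  assumes k: "k > 0" and t: "0 \<le> t"
  shows "real (nat \<lfloor>t / k\<rfloor>) * k \<le> t" "t < real (Suc (nat \<lfloor>t / k\<rfloor>)) * k"
proof -
  have "0 \<le> t / k" using assms by simp
  then have r: "real (nat \<lfloor>t / k\<rfloor>) = real_of_int \<lfloor>t / k\<rfloor>" by simp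
  have "real_of_int \<lfloor>t / k\<rfloor> \<le> t / k" by (rule of_int_floor_le)
  then show "real (nat \<lfloor>t / k\<rfloor>) * k \<le> t" unfolding r using k by (simp add: le_divide_eq)
  have "t / k < real_of_int \<lfloor>t / k\<rfloor> + 1" by linarith
  then show "t < real (Suc (nat \<lfloor>t / k\<rfloor>)) * k" unfolding of_nat_Suc r using k by (simp add: divide_less_eq add.commute)
qed

lemma step_fun_AE:
  assumes T: "T > 0" and N: "N > 0"
  shows "AE t in I_on T. step_fun \<theta> (T / real N) w t
    = \<theta> *\<^sub>R w (Suc (nat \<lfloor>t / (T / real N)\<rfloor>)) + (1 - \<theta>) *\<^sub>R w (nat \<lfloor>t / (T / real N)\<rfloor>)"
  using partition.AE_in_cell[OF uniform_partition[OF T N]]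
proof eventually_elim
  case (elim t)
  then obtain m where m: "real m * (T / real N) < t" "t < real (Suc m) * (T / real N)" by blast
  have "T / real N > 0" using T N by simp
  then show ?case using step_fun_interval[OF _ m] nat_floor_in_cell[OF _ m] by simp
qed

lemma step_fun_bochner_L2:
  fixes w :: "nat \<Rightarrow> 'b::real_normed_vector"
  assumes T: "T > 0" and N: "N > 0"
  shows "step_fun \<theta> (T / real N) w \<in> bochner_L2 T"
proof (rule L2_cong_AE)
  have "T / real N > 0" using T N by simp
  then show "(\<lambda>t. \<theta> *\<^sub>R w (Suc (nat \<lfloor>t / (T / real N)\<rfloor>)) + (1 - \<theta>) *\<^sub>R w (nat \<lfloor>t / (T / real N)\<rfloor>)) \<in> bochner_L2 T"
    by (rule floor_bochner_L2)
  show "AE t in I_on T. \<theta> *\<^sub>R w (Suc (nat \<lfloor>t / (T / real N)\<rfloor>)) + (1 - \<theta>) *\<^sub>R w (nat \<lfloor>t / (T / real N)\<rfloor>) = step_fun \<theta> (T / real N) w t"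
    using step_fun_AE[OF T N, of \<theta> w] by eventually_elim (rule sym)
qed

section \<open>Consistency\<close>

context gelfand_triple
begin

text \<open>The discrete derivative in \<open>V'\<close>; projecting pointwise makes \<open>V_proj\<close> superfluous.\<close>

definition dd :: "nat \<Rightarrow> real \<Rightarrow> (nat \<Rightarrow> 'u) \<Rightarrow> real \<Rightarrow> 'u \<Rightarrow>\<^sub>L real" where
  "dd i k w t = emb (disc_deriv k w t) o\<^sub>L Blinfun (P i)"

lemma Blinfun_P_apply [simp]: "blinfun_apply (Blinfun (P i)) v = P i v"
  by (simp add: bounded_linear_Blinfun_apply[OF bounded_linear_P])

lemma dd_apply [simp]: "blinfun_apply (dd i k w t) v = \<iota> (disc_deriv k w t) \<bullet> \<iota> (P i v)"
  unfolding dd_def by simp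

lemma dd_bochner_L2: "k > 0 \<Longrightarrow> dd i k w \<in> bochner_L2 T"
  unfolding dd_def disc_deriv_def Let_def
  by (rule floor_bochner_L2[where F="\<lambda>m. emb ((w (Suc m) - w m) /\<^sub>R k) o\<^sub>L Blinfun (P i)"])

lemma norm_Blinfun_P_le: "norm (Blinfun (P i)) \<le> 1"
  by (rule norm_blinfun_bound) (auto simp: norm_P_le)

text \<open>Since \<open>P i\<close> is symmetric, composing a functional with it amounts to
  projecting its Riesz representative, for which strong convergence is known.\<close>

lemma functional_P_tendsto:
  fixes f :: "'u \<Rightarrow>\<^sub>L real"
  shows "(\<lambda>i. norm (f - (f o\<^sub>L Blinfun (P i)))) \<longlonglongrightarrow> 0"
proof -
  have "f - (f o\<^sub>L Blinfun (P i)) = blinfun_inner_right (riesz f - P i (riesz f))" for i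
  proof (rule blinfun_eqI)
    fix v
    have "(f - (f o\<^sub>L Blinfun (P i))) v = riesz f \<bullet> v - riesz f \<bullet> P i v"
      by (simp add: blinfun.diff_left)
    also have "\<dots> = (riesz f - P i (riesz f)) \<bullet> v" unfolding inner_diff_left P_sym ..
    finally show "(f - (f o\<^sub>L Blinfun (P i))) v = (blinfun_inner_right (riesz f - P i (riesz f))) v"
      by simp
  qed
  then have eq: "norm (f - (f o\<^sub>L Blinfun (P i))) = norm (riesz f - P i (riesz f))" for i by simp
  have "(\<lambda>i. norm (riesz f - P i (riesz f))) \<longlonglongrightarrow> norm (riesz f - riesz f)"
    by (intro tendsto_intros P_tendsto)
  then show ?thesis unfolding eq by simp
qed

text \<open>Two projections occur: the inner one because nodal values are projected, the outer one
  from the definition of \<open>dd\<close>.\<close>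

lemma emb_P_tendsto: "(\<lambda>i. norm (emb s - (emb (P i s) o\<^sub>L Blinfun (P i)))) \<longlonglongrightarrow> 0"
proof -
  obtain E where E: "E \<ge> 0" "\<And>x. norm (emb x) \<le> norm x * E" using bounded_linear.nonneg_bounded[OF bounded_linear_emb] by blast
  show ?thesis
  proof (rule Lim_null_comparison)
  show "\<forall>\<^sub>F i in sequentially. norm (norm (emb s - (emb (P i s) o\<^sub>L Blinfun (P i))))
    \<le> norm (emb s - (emb s o\<^sub>L Blinfun (P i))) + norm (s - P i s) * E"
  proof (rule always_eventually, rule allI)
    fix i
    have split: "emb s - (emb (P i s) o\<^sub>L Blinfun (P i)) = (emb s - (emb s o\<^sub>L Blinfun (P i))) + (emb (s - P i s) o\<^sub>L Blinfun (P i))"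
      by (rule blinfun_eqI) (simp add: blinfun.diff_left blinfun.add_left \<iota>.diff inner_diff_left)
    have "norm (emb s - (emb (P i s) o\<^sub>L Blinfun (P i)))
      \<le> norm (emb s - (emb s o\<^sub>L Blinfun (P i))) + norm (emb (s - P i s) o\<^sub>L Blinfun (P i))"
      unfolding split by (rule norm_triangle_ineq)
    also have "norm (emb (s - P i s) o\<^sub>L Blinfun (P i)) \<le> norm (emb (s - P i s)) * norm (Blinfun (P i))"
      by (rule norm_blinfun_compose)
    also have "\<dots> \<le> norm (emb (s - P i s)) * 1" by (intro mult_left_mono norm_Blinfun_P_le) simp
    also have "\<dots> \<le> norm (s - P i s) * E" using E(2) by simp
    finally show "norm (norm (emb s - (emb (P i s) o\<^sub>L Blinfun (P i))))
      \<le> norm (emb s - (emb s o\<^sub>L Blinfun (P i))) + norm (s - P i s) * E" by simp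
  qed
  have "(\<lambda>i. norm (emb s - (emb s o\<^sub>L Blinfun (P i))) + norm (s - P i s) * E) \<longlonglongrightarrow> 0 + norm (s - s) * E"
    by (intro tendsto_intros functional_P_tendsto P_tendsto)
  then show "(\<lambda>i. norm (emb s - (emb s o\<^sub>L Blinfun (P i))) + norm (s - P i s) * E) \<longlonglongrightarrow> 0" by simp
  qed
qed

lemma pl_step_fun_uniform:
  fixes k :: "nat \<Rightarrow> real"
  assumes part: "partition T n \<sigma>" and \<theta>: "0 \<le> \<theta>" "\<theta> \<le> 1" and k: "\<And>i. k i > 0" "k \<longlonglongrightarrow> 0" and e: "e > 0"
  shows "\<forall>\<^sub>F i in sequentially. \<forall>t\<ge>0. norm (partition.pl n \<sigma> x t
     - step_fun \<theta> (k i) (\<lambda>m. P i (partition.pl n \<sigma> x (real m * k i))) t) \<le> e"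
proof -
  interpret partition T n \<sigma> by (rule part)
  obtain L where L: "L \<ge> 0" "\<And>s t. norm (pl x t - pl x s) \<le> L * \<bar>t - s\<bar>" using pl_lipschitz[of x] by blast
  \<comment> \<open>All values of the interpolant are combinations of finitely many fixed vectors
    with coefficients in the unit interval, so their projection error is bounded uniformly in
    time.\<close>
  define \<beta> where "\<beta> i = norm (x 0 - P i (x 0)) + (\<Sum>j<n. norm ((x (Suc j) - x j) - P i (x (Suc j) - x j)))" for i
  have \<beta>: "norm (pl x s - P i (pl x s)) \<le> \<beta> i" for s i
  proof -
    let ?c = "\<lambda>j. max 0 (min 1 ((s - \<sigma> j) / (\<sigma> (Suc j) - \<sigma> j)))"
    have "pl x s - P i (pl x s) = (x 0 - P i (x 0)) + (\<Sum>j<n. ?c j *\<^sub>R ((x (Suc j) - x j) - P i (x (Suc j) - x j)))"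
      unfolding bounded_linear_pl(1)[OF bounded_linear_P] unfolding pl_def P_diff[symmetric]
      by (simp only: scaleR_diff_right sum_subtractf add_diff_add)
    also have "norm \<dots> \<le> \<beta> i" unfolding \<beta>_def
    proof (rule norm_triangle_mono[OF order_refl sum_norm_le])
      fix j
      have "norm (?c j *\<^sub>R ((x (Suc j) - x j) - P i (x (Suc j) - x j))) = ?c j * norm ((x (Suc j) - x j) - P i (x (Suc j) - x j))"
        by simp
      also have "\<dots> \<le> 1 * norm ((x (Suc j) - x j) - P i (x (Suc j) - x j))" by (rule mult_right_mono) auto
      finally show "norm (?c j *\<^sub>R ((x (Suc j) - x j) - P i (x (Suc j) - x j))) \<le> norm ((x (Suc j) - x j) - P i (x (Suc j) - x j))" by simp
    qed
    finally show ?thesis .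
  qed
  have bound: "norm (pl x t - step_fun \<theta> (k i) (\<lambda>m. P i (pl x (real m * k i))) t) \<le> \<beta> i + L * k i" if t: "t \<ge> 0" for t i
  proof -
    define m where "m = nat \<lfloor>t / k i\<rfloor>"
    have m: "real m * k i \<le> t" "t < real (Suc m) * k i" using floor_bounds[OF k(1) t] unfolding m_def by auto
    have Lk: "0 \<le> L * k i" using L(1) k(1)[of i] by simp
    show ?thesis
    proof (cases "t = real m * k i")
      case True
      then show ?thesis using step_fun_node[OF k(1), of \<theta> i "\<lambda>m. P i (pl x (real m * k i))" m] \<beta>[of t i] Lk by simp
    next
      case False
      define a b where "a = pl x (real m * k i)" and "b = pl x (real (Suc m) * k i)"
      have sf: "step_fun \<theta> (k i) (\<lambda>m. P i (pl x (real m * k i))) t = \<theta> *\<^sub>R P i b + (1 - \<theta>) *\<^sub>R P i a"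
        using step_fun_interval[OF k(1), of m i t \<theta> "\<lambda>m. P i (pl x (real m * k i))"] m False
        unfolding a_def b_def by (simp del: of_nat_Suc)
      have "norm (pl x t - b) \<le> L * k i"
      proof -
        have "\<bar>t - real (Suc m) * k i\<bar> \<le> k i" using m by (simp add: algebra_simps)
        then show ?thesis using L(2)[of t "real (Suc m) * k i"] mult_left_mono[OF _ L(1)] unfolding b_def by (meson order_trans)
      qed
      moreover have "norm (pl x t - a) \<le> L * k i"
      proof -
        have "\<bar>t - real m * k i\<bar> \<le> k i" using m by (simp add: algebra_simps)
        then show ?thesis using L(2)[of t "real m * k i"] mult_left_mono[OF _ L(1)] unfolding a_def by (meson order_trans)
      qed
      ultimately have b1: "norm (pl x t - P i b) \<le> \<beta> i + L * k i" and a1: "norm (pl x t - P i a) \<le> \<beta> i + L * k i"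
        using \<beta>[of "real m * k i" i] \<beta>[of "real (Suc m) * k i" i]
          norm_triangle_ineq[of "pl x t - b" "b - P i b"] norm_triangle_ineq[of "pl x t - a" "a - P i a"]
        unfolding a_def[symmetric] b_def[symmetric] by auto
      have "pl x t - (\<theta> *\<^sub>R P i b + (1 - \<theta>) *\<^sub>R P i a) = \<theta> *\<^sub>R (pl x t - P i b) + (1 - \<theta>) *\<^sub>R (pl x t - P i a)"
        by (simp add: algebra_simps)
      then have "norm (pl x t - (\<theta> *\<^sub>R P i b + (1 - \<theta>) *\<^sub>R P i a)) \<le> \<theta> * norm (pl x t - P i b) + (1 - \<theta>) * norm (pl x t - P i a)"
        using \<theta> norm_triangle_ineq[of "\<theta> *\<^sub>R (pl x t - P i b)" "(1 - \<theta>) *\<^sub>R (pl x t - P i a)"] by simp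
      also have "\<dots> \<le> \<theta> * (\<beta> i + L * k i) + (1 - \<theta>) * (\<beta> i + L * k i)"
        using \<theta> a1 b1 by (intro add_mono mult_left_mono) auto
      also have "\<dots> = \<beta> i + L * k i" by (simp add: algebra_simps)
      finally show ?thesis unfolding sf .
    qed
  qed
  have "(\<lambda>i. \<beta> i + L * k i) \<longlonglongrightarrow> (norm (x 0 - x 0) + (\<Sum>j<n. norm ((x (Suc j) - x j) - (x (Suc j) - x j)))) + L * 0"
    unfolding \<beta>_def by (intro tendsto_intros P_tendsto k(2))
  then have "\<forall>\<^sub>F i in sequentially. \<beta> i + L * k i < e" by (rule order_tendstoD(2)) (use e in simp)
  then show ?thesis
  proof eventually_elim
    case (elim i)
    show ?case
    proof (intro allI impI)
      fix t :: real assume "0 \<le> t"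
      from bound[OF this, of i] elim
      show "norm (pl x t - step_fun \<theta> (k i) (\<lambda>m. P i (pl x (real m * k i))) t) \<le> e" by linarith
    qed
  qed
qed

text \<open>Away from the coarse nodes, a small enough time step places both ends of the surrounding
  fine cell in one coarse cell, where the difference quotient is exactly the projected slope. The
  Lipschitz bound supplies the majorant for dominated convergence.\<close>

lemma pd_dd_L2:
  fixes k :: "nat \<Rightarrow> real"
  assumes part: "partition T n \<sigma>" and k: "\<And>i. k i > 0" "k \<longlonglongrightarrow> 0"
  shows "(\<lambda>i. L2sq T (\<lambda>t. emb (partition.pd n \<sigma> x t)
     - dd i (k i) (\<lambda>m. P i (partition.pl n \<sigma> x (real m * k i))) t)) \<longlonglongrightarrow> 0"
proof -
  interpret partition T n \<sigma> by (rule part)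
  obtain L where L: "L \<ge> 0" "\<And>s t. norm (pl x t - pl x s) \<le> L * \<bar>t - s\<bar>" using pl_lipschitz[of x] by blast
  obtain E where E: "E \<ge> 0" "\<And>x. norm (emb x) \<le> norm x * E" using bounded_linear.nonneg_bounded[OF bounded_linear_emb] by blast
  define S where "S = (\<Sum>j<n. norm (slope x j))"
  define z where "z i = (\<lambda>m. P i (pl x (real m * k i)))" for i
  define G where "G i t = emb (pd x t) - dd i (k i) (z i) t" for i t
  have z_eq: "disc_deriv (k i) (z i) t = P i ((pl x (real (Suc m) * k i) - pl x (real m * k i)) /\<^sub>R k i)"
    if "m = nat \<lfloor>t / k i\<rfloor>" for i t m
    unfolding disc_deriv_def z_def Let_def that by (simp add: P_scaleR P_diff)
  have dz: "norm (disc_deriv (k i) (z i) t) \<le> L" for i t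
  proof -
    define m where "m = nat \<lfloor>t / k i\<rfloor>"
    have "norm (disc_deriv (k i) (z i) t) \<le> norm (pl x (real (Suc m) * k i) - pl x (real m * k i)) / k i"
      unfolding z_eq[OF m_def] using norm_P_le[of i "(pl x (real (Suc m) * k i) - pl x (real m * k i)) /\<^sub>R k i"] k(1)[of i]
      by (simp add: divide_inverse mult.commute)
    also have "\<dots> \<le> L * \<bar>real (Suc m) * k i - real m * k i\<bar> / k i"
      by (rule divide_right_mono[OF L(2)]) (use k(1)[of i] in simp)
    also have "\<dots> = L" using k(1)[of i] by (simp add: algebra_simps)
    finally show ?thesis .
  qed
  have G_bd: "norm (G i t) \<le> S * E + L * E" for i t
  proof -
    have "norm (pd x t) \<le> S" unfolding pd_def S_def by (rule sum_norm_le) (auto simp: indicator_def)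
    then have 1: "norm (emb (pd x t)) \<le> S * E" using E by (meson mult_right_mono order_trans)
    have "norm (dd i (k i) (z i) t) \<le> norm (emb (disc_deriv (k i) (z i) t)) * norm (Blinfun (P i))"
      unfolding dd_def by (rule norm_blinfun_compose)
    also have "\<dots> \<le> norm (emb (disc_deriv (k i) (z i) t)) * 1" by (intro mult_left_mono norm_Blinfun_P_le) simp
    also have "\<dots> \<le> L * E" using E dz[of i t] by (simp add: mult_right_mono order_trans[OF E(2)])
    finally show ?thesis unfolding G_def using 1 norm_triangle_ineq4[of "emb (pd x t)" "dd i (k i) (z i) t"] by linarith
  qed
  have G_sm: "strongly_measurable (I_on T) (G i)" for i
    unfolding G_def
    by (intro strongly_measurable_diff L2_sm dd_bochner_L2 k(1) L2_bounded_linear[OF pd_bochner_L2 bounded_linear_emb])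
  have lim: "AE t in I_on T. (\<lambda>i. norm (G i t)) \<longlonglongrightarrow> 0"
    using AE_in_cell
  proof eventually_elim
    case (elim t)
    then obtain j where j: "j < n" "\<sigma> j < t" "t < \<sigma> (Suc j)" by blast
    have t0: "0 \<le> t" using j \<sigma>_bounds[of j] by simp
    have "\<forall>\<^sub>F i in sequentially. k i < min (t - \<sigma> j) (\<sigma> (Suc j) - t)"
      by (rule order_tendstoD(2)[OF k(2)]) (use j in simp)
    then have ev: "\<forall>\<^sub>F i in sequentially. norm (G i t) = norm (emb (slope x j) - (emb (P i (slope x j)) o\<^sub>L Blinfun (P i)))"
    proof eventually_elim
      case (elim i)
      define m where "m = nat \<lfloor>t / k i\<rfloor>"
      have m: "real m * k i \<le> t" "t < real (Suc m) * k i" using floor_bounds[OF k(1) t0] unfolding m_def by auto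
      have e: "real (Suc m) * k i = real m * k i + k i" by (simp add: algebra_simps)
      have 1: "pl x (real m * k i) = x j + (real m * k i - \<sigma> j) *\<^sub>R slope x j"
        by (rule pl_cell[OF j(1)]) (use m e elim j in auto)
      have 2: "pl x (real (Suc m) * k i) = x j + (real (Suc m) * k i - \<sigma> j) *\<^sub>R slope x j"
        by (rule pl_cell[OF j(1)]) (use m e elim j in auto)
      have "pl x (real (Suc m) * k i) - pl x (real m * k i) = k i *\<^sub>R slope x j"
        unfolding 1 2 unfolding e by (simp add: algebra_simps)
      then have "disc_deriv (k i) (z i) t = P i (slope x j)" unfolding z_eq[OF m_def] using k(1)[of i] by simp
      then show ?case unfolding G_def dd_def using pd_cell[OF j, of x] by simp
    qed
    show ?case by (rule tendsto_cong[THEN iffD2, OF ev emb_P_tendsto])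
  qed
  have "(\<lambda>i. LINT t|I_on T. (norm (G i t))\<^sup>2) \<longlonglongrightarrow> (LINT t|I_on T. 0)"
  proof (rule integral_dominated_convergence[where w="\<lambda>t. (S * E + L * E)\<^sup>2"])
    show "(\<lambda>t. (norm (G i t))\<^sup>2) \<in> borel_measurable (I_on T)" for i
      using strongly_measurable_norm_borel[OF G_sm] by simp
    show "AE t in I_on T. (\<lambda>i. (norm (G i t))\<^sup>2) \<longlonglongrightarrow> 0"
      using lim
    proof eventually_elim
      case (elim t)
      from tendsto_power[OF elim, of 2] show ?case by simp
    qed
    show "AE t in I_on T. norm ((norm (G i t))\<^sup>2) \<le> (S * E + L * E)\<^sup>2" for i
      using power_mono[OF G_bd norm_ge_zero, of i _ 2] by simp
  qed auto
  then show ?thesis unfolding L2sq_def G_def z_def by simp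
qed

text \<open>The order of the limits matters: a piecewise linear approximation with error e / 4 is
  fixed first, and then the step size and the discrete spaces are refined for this fixed
  function.\<close>

lemma consistency:
  fixes N :: "nat \<Rightarrow> nat"
  assumes T: "T > 0" and w: "wtriple T u y g" and N: "\<And>i. N i > 0" "filterlim N at_top sequentially"
    and \<theta>: "0 \<le> \<theta>" "\<theta> \<le> 1" and e: "e > 0"
  obtains z :: "nat \<Rightarrow> nat \<Rightarrow> 'u" where "\<forall>i m. z i m \<in> span (C i)"
    "\<forall>\<^sub>F i in sequentially. L2sq T (\<lambda>t. y t - step_fun \<theta> (T / real (N i)) (z i) t) \<le> e
       \<and> L2sq T (\<lambda>t. g t - dd i (T / real (N i)) (z i) t) \<le> e
       \<and> (\<forall>t\<in>{0..T}. norm (u t - \<iota> (step_fun \<theta> (T / real (N i)) (z i) t)) \<le> e)"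
proof -
  define k where "k i = T / real (N i)" for i
  have k0: "k i > 0" for i using T N(1) unfolding k_def by simp
  have "filterlim (\<lambda>i. real (N i)) at_top sequentially"
    by (rule filterlim_compose[OF filterlim_real_sequentially N(2)])
  then have klim: "k \<longlonglongrightarrow> 0" unfolding k_def by (intro tendsto_divide_0[OF tendsto_const] filterlim_at_top_imp_at_infinity)
  have y: "y \<in> bochner_L2 T" and g: "g \<in> bochner_L2 T" using w unfolding wtriple_def by auto
  obtain K where K: "K \<ge> 0" "\<And>x. norm (\<iota> x) \<le> norm x * K" using \<iota>.nonneg_bounded by blast
  have e4: "e / 4 > 0" using e by simp
  obtain n \<sigma> x where part: "partition T n \<sigma>" and n: "n > 0" and V: "L2sq T (\<lambda>t. y t - partition.pl n \<sigma> x t) \<le> e / 4"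
    and D: "L2sq T (\<lambda>t. g t - emb (partition.pd n \<sigma> x t)) \<le> e / 4"
    and H: "\<forall>t\<in>{0..T}. norm (u t - \<iota> (partition.pl n \<sigma> x t)) \<le> e / 4"
    by (rule W_approx[OF w T e4])
  interpret partition T n \<sigma> by (rule part)
  define z where "z i m = P i (pl x (real m * k i))" for i m
  \<comment> \<open>A uniform error d in \<open>U\<close> costs T d^2 in the squared norm of
    \<open>V\<close> and d K in the norm of \<open>H\<close>; both are kept below e / 4.\<close>
  define d where "d = min (sqrt (e / (4 * T))) (e / (4 * (K + 1)))"
  have d: "d > 0" "d\<^sup>2 \<le> e / (4 * T)" "d * K \<le> e / 4"
  proof -
    have a: "sqrt (e / (4 * T)) > 0" "e / (4 * (K + 1)) > 0" using e T K by auto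
    then show d0: "d > 0" unfolding d_def by simp
    have "d\<^sup>2 \<le> (sqrt (e / (4 * T)))\<^sup>2" by (rule power_mono) (use d0 in \<open>auto simp: d_def\<close>)
    then show "d\<^sup>2 \<le> e / (4 * T)" using e T by simp
    have "d * K \<le> (e / (4 * (K + 1))) * (K + 1)" using K d0 a by (intro mult_mono) (auto simp: d_def)
    also have "\<dots> = e / 4" using K by (simp add: field_simps)
    finally show "d * K \<le> e / 4" .
  qed
  have L2s: "step_fun \<theta> (k i) (z i) \<in> bochner_L2 T" for i unfolding k_def by (rule step_fun_bochner_L2[OF T N(1)])
  have pl_L2: "pl x \<in> bochner_L2 T" by (intro continuous_bochner_L2 continuous_pl)
  have pd_L2: "(\<lambda>t. emb (pd x t)) \<in> bochner_L2 T" by (rule L2_bounded_linear[OF pd_bochner_L2 bounded_linear_emb])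
  have 1: "\<forall>\<^sub>F i in sequentially. \<forall>t\<ge>0. norm (pl x t - step_fun \<theta> (k i) (z i) t) \<le> d"
    using pl_step_fun_uniform[OF part \<theta> k0 klim d(1), of x] unfolding z_def .
  have 2: "\<forall>\<^sub>F i in sequentially. L2sq T (\<lambda>t. emb (pd x t) - dd i (k i) (z i) t) < e / 4"
    using order_tendstoD(2)[OF pd_dd_L2[OF part k0 klim, of x] e4] unfolding z_def .
  show ?thesis
  proof (rule that)
    show "\<forall>i m. z i m \<in> span (C i)" unfolding z_def by simp
    show "\<forall>\<^sub>F i in sequentially. L2sq T (\<lambda>t. y t - step_fun \<theta> (T / real (N i)) (z i) t) \<le> e
       \<and> L2sq T (\<lambda>t. g t - dd i (T / real (N i)) (z i) t) \<le> e
       \<and> (\<forall>t\<in>{0..T}. norm (u t - \<iota> (step_fun \<theta> (T / real (N i)) (z i) t)) \<le> e)"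
      using 1 2 unfolding k_def[symmetric]
    proof eventually_elim
      case (elim i)
      have "L2sq T (\<lambda>t. pl x t - step_fun \<theta> (k i) (z i) t) \<le> (LINT t|I_on T. d\<^sup>2)"
        unfolding L2sq_def by (rule integral_mono') (use elim(1) in \<open>auto intro!: power_mono\<close>)
      also have "\<dots> = T * d\<^sup>2" using T by simp
      also have "\<dots> \<le> e / 4" using d(2) T by (simp add: field_simps)
      finally have "L2sq T (\<lambda>t. y t - step_fun \<theta> (k i) (z i) t) \<le> e"
        using L2sq_triangle[OF y pl_L2 L2s[of i]] V by linarith
      moreover have "L2sq T (\<lambda>t. g t - dd i (k i) (z i) t) \<le> e"
        using L2sq_triangle[OF g pd_L2 dd_bochner_L2[OF k0, of i i "z i" T]] D elim(2) by linarith
      moreover have "norm (u t - \<iota> (step_fun \<theta> (k i) (z i) t)) \<le> e" if t: "t \<in> {0..T}" for t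
      proof -
        have "norm (\<iota> (pl x t - step_fun \<theta> (k i) (z i) t)) \<le> norm (pl x t - step_fun \<theta> (k i) (z i) t) * K" by (rule K(2))
        also have "\<dots> \<le> d * K" using elim(1) t K(1) by (intro mult_right_mono) auto
        finally have "norm (\<iota> (pl x t) - \<iota> (step_fun \<theta> (k i) (z i) t)) \<le> e / 4" using d(3) by (simp add: \<iota>.diff)
        moreover have "norm (u t - \<iota> (pl x t)) \<le> e / 4" using H t by blast
        ultimately show ?thesis using e
          norm_triangle_ineq[of "u t - \<iota> (pl x t)" "\<iota> (pl x t) - \<iota> (step_fun \<theta> (k i) (z i) t)"] by simp
      qed
      ultimately show ?case by blast
    qed
  qed
qed

end

section \<open>The time-dependent form\<close>

locale evolution_form = gelfand_triple C \<iota>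
  for C :: "nat \<Rightarrow> 'u::{real_inner,banach} set" and \<iota> :: "'u \<Rightarrow> 'h::{real_inner,banach}" +
  fixes T M \<alpha> :: real and a :: "real \<Rightarrow> 'u \<Rightarrow> 'u \<Rightarrow> real"
  assumes T: "T > 0" and \<iota>_inj: "inj \<iota>"
    and a_bilinear: "\<And>t. t \<in> {0..T} \<Longrightarrow> bilinear (a t)"
    and a_measurable: "\<And>v w. (\<lambda>t. a t v w) \<in> borel_measurable (I_on T)"
    and M: "M \<ge> 1"
    and a_bounded: "AE t in I_on T. \<forall>v w. \<bar>a t v w\<bar> \<le> M * norm v * norm w"
    and \<alpha>: "\<alpha> > 0"
    and a_coercive: "\<And>t v. t \<in> {0..T} \<Longrightarrow> a t v v \<ge> \<alpha> * (norm v)\<^sup>2"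
begin

definition regular_time :: "real \<Rightarrow> bool" where
  "regular_time t \<longleftrightarrow> t \<in> {0..T} \<and> (\<forall>v w. \<bar>a t v w\<bar> \<le> M * norm v * norm w)"

lemma AE_regular: "AE t in I_on T. regular_time t"
proof -
  have "AE t in I_on T. t \<in> {0..T}" by (rule AE_I2) simp
  with a_bounded show ?thesis by eventually_elim (auto simp: regular_time_def)
qed

lemma regular_bounded_bilinear: "regular_time t \<Longrightarrow> bounded_bilinear (a t)"
proof -
  assume t: "regular_time t"
  then have b: "bilinear (a t)" using a_bilinear unfolding regular_time_def by simp
  show ?thesis
  proof
    show "\<exists>K. \<forall>x y. norm (a t x y) \<le> norm x * norm y * K"
      using t unfolding regular_time_def by (intro exI[of _ M]) (simp add: mult_ac)
  qed (use b in \<open>simp_all add: bilinear_ladd bilinear_radd bilinear_lmul bilinear_rmul\<close>)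
qed

text \<open>Setting the operator to zero off the regular times makes the bounds below hold at all times.\<close>

definition AA :: "real \<Rightarrow> 'u \<Rightarrow> 'u \<Rightarrow>\<^sub>L real" where
  "AA t x = (if regular_time t then Blinfun (a t x) else 0)"

lemma AA_apply: "regular_time t \<Longrightarrow> blinfun_apply (AA t x) v = a t x v"
  unfolding AA_def
  by (simp add: bounded_linear_Blinfun_apply bounded_bilinear.bounded_linear_right[OF regular_bounded_bilinear])

lemma norm_AA_le: "norm (AA t x) \<le> M * norm x"
proof (cases "regular_time t")
  case True
  show ?thesis
  proof (rule norm_blinfun_bound)
    show "0 \<le> M * norm x" using M by simp
    show "norm ((AA t x) v) \<le> M * norm x * norm v" for v
      using True unfolding AA_apply[OF True] regular_time_def by simp
  qed
next
  case False
  then show ?thesis using M unfolding AA_def by simp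
qed

lemma linear_AA: "linear (AA t)"
proof (cases "regular_time t")
  case True
  interpret bounded_bilinear "a t" by (rule regular_bounded_bilinear[OF True])
  show ?thesis
    by (rule linearI; rule blinfun_eqI)
      (simp_all add: AA_apply[OF True] blinfun.add_left blinfun.scaleR_left add_left scaleR_left)
next
  case False
  then show ?thesis unfolding AA_def by (auto intro!: linearI)
qed

lemma AA_diff: "AA t (x - y) = AA t x - AA t y"
  using linear_AA by (simp add: linear_diff)

lemma AA_coercive: "regular_time t \<Longrightarrow> \<alpha> * (norm v)\<^sup>2 \<le> blinfun_apply (AA t v) v"
  unfolding AA_apply using a_coercive[of t v] by (simp add: regular_time_def AA_apply)

lemma AA_const_measurable: "(\<lambda>t. blinfun_apply (AA t x) v) \<in> borel_measurable (I_on T)"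
proof (rule measurable_cong_AE_lebesgue_on[OF _ a_measurable[of x v]])
  show "AE t in I_on T. a t x v = (AA t x) v"
    using AE_regular by eventually_elim (simp add: AA_apply)
qed auto

text \<open>Measurability in t is assumed for fixed arguments of the form only. Simple functions in
  place of \<open>y\<close> reduce to this case, continuity of the form at regular times gives the
  limit, and weak measurability is lifted to strong measurability in the dual.\<close>

lemma AA_bochner_L2:
  assumes y: "y \<in> bochner_L2 T"
  shows "(\<lambda>t. AA t (y t)) \<in> bochner_L2 T"
proof (rule L2_dominated[where h="\<lambda>t. M\<^sup>2 * (norm (y t))\<^sup>2"])
  show "integrable (I_on T) (\<lambda>t. M\<^sup>2 * (norm (y t))\<^sup>2)" using L2_integrable[OF y] by simp
  show "AE t in I_on T. (norm (AA t (y t)))\<^sup>2 \<le> M\<^sup>2 * (norm (y t))\<^sup>2"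
    using power_mono[OF norm_AA_le norm_ge_zero, of _ _ 2] by (simp add: power_mult_distrib)
  show "strongly_measurable (I_on T) (\<lambda>t. AA t (y t))"
  proof (rule weakly_measurable_strongly_dual)
    fix v
    obtain s where s: "\<And>i. simple_function (I_on T) (s i)" "AE t in I_on T. (\<lambda>i::nat. s i t) \<longlonglongrightarrow> y t"
      using L2_sm[OF y] unfolding strongly_measurable_def by blast
    show "(\<lambda>t. (AA t (y t)) v) \<in> borel_measurable (I_on T)"
    proof (rule borel_measurable_AE_limit)
      fix i
      have fin: "finite (s i ` {0..T})" using simple_functionD(1)[OF s(1), of i] by simp
      have sets: "s i -` {x} \<inter> {0..T} \<in> sets (I_on T)" for x
        using simple_functionD(2)[OF s(1), of i "{x}"] by simp
      have "(\<lambda>t. \<Sum>x\<in>s i ` {0..T}. indicator (s i -` {x} \<inter> {0..T}) t * (AA t x) v) \<in> borel_measurable (I_on T)"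
        by (intro borel_measurable_sum borel_measurable_times borel_measurable_indicator sets AA_const_measurable)
      moreover have "(\<Sum>x\<in>s i ` {0..T}. indicator (s i -` {x} \<inter> {0..T}) t * (AA t x) v) = (AA t (s i t)) v"
        if t: "t \<in> {0..T}" for t
      proof -
        have "(\<Sum>x\<in>s i ` {0..T}. indicator (s i -` {x} \<inter> {0..T}) t * (AA t x) v)
          = (\<Sum>x\<in>s i ` {0..T}. if x = s i t then (AA t (s i t)) v else 0)"
          by (rule sum.cong) (use t in \<open>auto simp: indicator_def\<close>)
        then show ?thesis using fin t by (simp add: sum.delta)
      qed
      ultimately show "(\<lambda>t. (AA t (s i t)) v) \<in> borel_measurable (I_on T)"
        by (subst measurable_cong[where g="\<lambda>t. \<Sum>x\<in>s i ` {0..T}. indicator (s i -` {x} \<inter> {0..T}) t * (AA t x) v"]) auto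
    next
      show "AE t in I_on T. (\<lambda>i. (AA t (s i t)) v) \<longlonglongrightarrow> (AA t (y t)) v"
        using s(2) AE_regular
      proof eventually_elim
        case (elim t)
        show ?case unfolding AA_apply[OF elim(2)]
          by (intro bounded_bilinear.tendsto[OF regular_bounded_bilinear[OF elim(2)]] elim(1) tendsto_const)
      qed
    qed simp
  qed simp
qed

lemma integrable_AA:
  assumes "0 \<le> b" "c \<le> T"
  shows "integrable (lebesgue_on {b..c}) (\<lambda>t. blinfun_apply (AA t x) v)"
  by (rule integrable_dual_apply[OF AA_bochner_L2[OF L2_const] assms])

lemma AE_regular_sub:
  assumes "0 \<le> b" "c \<le> T"
  shows "AE t in lebesgue_on {b..c}. regular_time t"
  by (rule AE_lebesgue_on_subset[OF AE_regular]) (use assms in auto)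

lemma integral_a_eq_AA:
  assumes "0 \<le> b" "c \<le> T"
  shows "(LINT t|lebesgue_on {b..c}. a t x v) = (LINT t|lebesgue_on {b..c}. blinfun_apply (AA t x) v)"
proof (rule integral_cong_AE)
  have ae: "AE t in lebesgue_on {b..c}. (AA t x) v = a t x v"
    using AE_regular_sub[OF assms] by eventually_elim (simp add: AA_apply)
  show "(\<lambda>t. (AA t x) v) \<in> borel_measurable (lebesgue_on {b..c})"
    using integrable_AA[OF assms] by blast
  then show "(\<lambda>t. a t x v) \<in> borel_measurable (lebesgue_on {b..c})"
    by (rule measurable_cong_AE_lebesgue_on[OF _ _ ae, rotated]) auto
  show "AE t in lebesgue_on {b..c}. a t x v = (AA t x) v"
    using ae by eventually_elim simp
qed

end

section \<open>The discrete problem\<close>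

locale discrete_evolution = evolution_form C \<iota> T M \<alpha> a
  for C :: "nat \<Rightarrow> 'u::{real_inner,banach} set" and \<iota> :: "'u \<Rightarrow> 'h::{real_inner,banach}"
    and T M \<alpha> :: real and a :: "real \<Rightarrow> 'u \<Rightarrow> 'u \<Rightarrow> real" +
  fixes N :: nat and \<theta> :: real
  assumes N: "N > 0" and \<theta>: "0 \<le> \<theta>" "\<theta> \<le> 1"
begin

definition k :: real where "k = T / real N"

lemma k_pos: "k > 0" and Nk: "real N * k = T"
  using T N unfolding k_def by auto

lemma cell_bounds: "m < N \<Longrightarrow> 0 \<le> real m * k" "m < N \<Longrightarrow> real (Suc m) * k \<le> T"
  "real m * k < real (Suc m) * k" "real (Suc m) * k - real m * k = k"
proof -
  show "m < N \<Longrightarrow> 0 \<le> real m * k" using k_pos by simp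
  show "real (Suc m) * k \<le> T" if "m < N"
  proof -
    have "real (Suc m) * k \<le> real N * k" using that k_pos by (intro mult_right_mono) auto
    then show ?thesis using Nk by simp
  qed
  show "real m * k < real (Suc m) * k" "real (Suc m) * k - real m * k = k" using k_pos by (auto simp: algebra_simps)
qed

definition Am :: "nat \<Rightarrow> 'u \<Rightarrow> 'u \<Rightarrow> real" where
  "Am m x v = 1 / k * (LINT t|lebesgue_on {real m * k..real (Suc m) * k}. a t x v)"

lemma Am_eq: "m < N \<Longrightarrow> Am m x v = 1 / k * (LINT t|lebesgue_on {real m * k..real (Suc m) * k}. blinfun_apply (AA t x) v)"
  unfolding Am_def by (subst integral_a_eq_AA) (use cell_bounds in auto)

lemma Am_bilinear: "m < N \<Longrightarrow> bilinear (Am m)"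
proof -
  assume m: "m < N"
  note i = integrable_AA[OF cell_bounds(1,2)[OF m]]
  show ?thesis unfolding bilinear_def
  proof (intro conjI allI; rule linearI)
    show "Am m (x + y) v = Am m x v + Am m y v" "Am m v (x + y) = Am m v x + Am m v y"
      "Am m (r *\<^sub>R x) v = r *\<^sub>R Am m x v" "Am m v (r *\<^sub>R x) = r *\<^sub>R Am m v x" for x y v r
      unfolding Am_eq[OF m] using i
      by (simp_all add: linear_add[OF linear_AA] linear_scale[OF linear_AA] blinfun.add_left blinfun.add_right
          blinfun.scaleR_left blinfun.scaleR_right distrib_left)
  qed
qed

lemma Am_bound: "m < N \<Longrightarrow> \<bar>Am m x v\<bar> \<le> M * norm x * norm v"
proof -
  assume m: "m < N"
  note i = integrable_AA[OF cell_bounds(1,2)[OF m]]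
  have "\<bar>LINT t|lebesgue_on {real m * k..real (Suc m) * k}. (AA t x) v\<bar>
    \<le> (LINT t|lebesgue_on {real m * k..real (Suc m) * k}. M * norm x * norm v)"
  proof (rule integral_abs_bound_integral[OF i])
    show "\<bar>(AA t x) v\<bar> \<le> M * norm x * norm v" for t
      using norm_blinfun[of "AA t x" v] norm_AA_le[of t x] mult_right_mono[OF norm_AA_le norm_ge_zero, of t x v] by simp
  qed simp
  also have "\<dots> = k * (M * norm x * norm v)" using cell_bounds(3,4)[of m] by (simp add: less_imp_le del: of_nat_Suc)
  finally show ?thesis unfolding Am_eq[OF m] using k_pos by (simp add: abs_mult field_simps)
qed

lemma Am_coercive: "m < N \<Longrightarrow> \<alpha> * (norm x)\<^sup>2 \<le> Am m x x"
proof -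
  assume m: "m < N"
  note i = integrable_AA[OF cell_bounds(1,2)[OF m]]
  have "(LINT t|lebesgue_on {real m * k..real (Suc m) * k}. \<alpha> * (norm x)\<^sup>2)
    \<le> (LINT t|lebesgue_on {real m * k..real (Suc m) * k}. (AA t x) x)"
  proof (rule integral_mono_AE[OF _ i])
    show "AE t in lebesgue_on {real m * k..real (Suc m) * k}. \<alpha> * (norm x)\<^sup>2 \<le> (AA t x) x"
      using AE_regular_sub[OF cell_bounds(1,2)[OF m]] by eventually_elim (rule AA_coercive)
  qed simp
  moreover have "(LINT t|lebesgue_on {real m * k..real (Suc m) * k}. \<alpha> * (norm x)\<^sup>2) = k * (\<alpha> * (norm x)\<^sup>2)"
    using cell_bounds(3,4)[of m] by (simp add: less_imp_le del: of_nat_Suc)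
  ultimately show ?thesis unfolding Am_eq[OF m] using k_pos by (simp add: field_simps)
qed

definition step :: "nat \<Rightarrow> ('u \<Rightarrow> real) \<Rightarrow> 'u set \<Rightarrow> 'u \<Rightarrow> 'u \<Rightarrow> bool" where
  "step m l S x x' \<longleftrightarrow> (\<forall>v\<in>S. \<iota> ((x' - x) /\<^sub>R k) \<bullet> \<iota> v + Am m (\<theta> *\<^sub>R x' + (1 - \<theta>) *\<^sub>R x) v = l v)"

lemma independent_C: "independent (C n)"
  by (rule pairwise_orthogonal_independent[OF C_orthogonal]) (use C_norm in force)

lemma \<iota>_eq_0: "\<iota> x = 0 \<Longrightarrow> x = 0"
  using \<iota>_inj \<iota>.zero by (metis injD)

text \<open>Collecting the unknown on the left shows which form has to be inverted: the inner
  product of \<open>H\<close> plus a nonnegative multiple of the cell average of the form, definite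
  on every discrete space.\<close>

lemma step_iff:
  assumes m: "m < N"
  shows "step m l S x x' \<longleftrightarrow> (\<forall>v\<in>S. \<iota> x' \<bullet> \<iota> v + k * \<theta> * Am m x' v = k * l v + \<iota> x \<bullet> \<iota> v - k * (1 - \<theta>) * Am m x v)"
proof -
  have "\<iota> ((x' - x) /\<^sub>R k) \<bullet> \<iota> v + Am m (\<theta> *\<^sub>R x' + (1 - \<theta>) *\<^sub>R x) v = l v
    \<longleftrightarrow> \<iota> x' \<bullet> \<iota> v + k * \<theta> * Am m x' v = k * l v + \<iota> x \<bullet> \<iota> v - k * (1 - \<theta>) * Am m x v" for v
  proof -
    have "\<iota> ((x' - x) /\<^sub>R k) \<bullet> \<iota> v + Am m (\<theta> *\<^sub>R x' + (1 - \<theta>) *\<^sub>R x) v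
      = (\<iota> x' \<bullet> \<iota> v - \<iota> x \<bullet> \<iota> v) / k + \<theta> * Am m x' v + (1 - \<theta>) * Am m x v"
      using bilinear_ladd[OF Am_bilinear[OF m]] bilinear_lmul[OF Am_bilinear[OF m]]
      by (simp add: \<iota>.scaleR \<iota>.diff inner_diff_left divide_inverse mult.commute)
    then have 1: "k * (\<iota> ((x' - x) /\<^sub>R k) \<bullet> \<iota> v + Am m (\<theta> *\<^sub>R x' + (1 - \<theta>) *\<^sub>R x) v)
      = \<iota> x' \<bullet> \<iota> v - \<iota> x \<bullet> \<iota> v + k * \<theta> * Am m x' v + k * (1 - \<theta>) * Am m x v" (is "k * ?p = _")
      using k_pos by (simp add: distrib_left mult.assoc)
    have 2: "?p = l v \<longleftrightarrow> k * ?p = k * l v" using k_pos by simp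
    show ?thesis unfolding 2 1 by (rule iffI) linarith+
  qed
  then show ?thesis unfolding step_def by simp
qed

lemma step_exists:
  assumes m: "m < N" and l: "linear l"
  shows "\<exists>x'\<in>span (C n). step m l (span (C n)) x x'"
proof -
  define b where "b x v = \<iota> x \<bullet> \<iota> v + k * \<theta> * Am m x v" for x v
  note la = bilinear_ladd[OF Am_bilinear[OF m]] and ra = bilinear_radd[OF Am_bilinear[OF m]]
    and ls = bilinear_lmul[OF Am_bilinear[OF m]] and rs = bilinear_rmul[OF Am_bilinear[OF m]]
  have "bilinear b" unfolding bilinear_def b_def
    by (intro conjI allI; rule linearI)
      (simp_all add: la ra ls rs \<iota>.add \<iota>.scaleR inner_add_left inner_add_right algebra_simps)
  moreover have "linear (\<lambda>v. k * l v + \<iota> x \<bullet> \<iota> v - k * (1 - \<theta>) * Am m x v)"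
    by (rule linearI) (simp_all add: linear_add[OF l] linear_scale[OF l] ra rs \<iota>.add \<iota>.scaleR inner_add_right algebra_simps)
  moreover have "z = 0" if "z \<in> span (C n)" "\<And>v. v \<in> span (C n) \<Longrightarrow> b z v = 0" for z
  proof -
    have "b z z = 0" using that by blast
    moreover have "0 \<le> k * \<theta> * Am m z z"
      using k_pos \<theta> Am_coercive[OF m, of z] \<alpha> by (smt (verit) mult_nonneg_nonneg zero_le_power2)
    ultimately have "\<iota> z \<bullet> \<iota> z \<le> 0" unfolding b_def by linarith
    then have "\<iota> z = 0" using inner_ge_zero[of "\<iota> z"] by simp
    then show ?thesis by (rule \<iota>_eq_0)
  qed
  ultimately have "\<exists>x'\<in>span (C n). \<forall>v\<in>span (C n). b x' v = k * l v + \<iota> x \<bullet> \<iota> v - k * (1 - \<theta>) * Am m x v"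
    by (rule finite_dim_solvable[OF C_finite independent_C C_orthogonal])
  then show ?thesis unfolding step_iff[OF m] b_def .
qed

lemma step_unique:
  assumes m: "m < N" and S: "subspace S" and "x' \<in> S" "x'' \<in> S" "step m l S x x'" "step m l S x x''"
  shows "x' = x''"
proof -
  define z where "z = x' - x''"
  have z: "z \<in> S" using assms unfolding z_def by (simp add: subspace_diff)
  have "\<iota> x' \<bullet> \<iota> z + k * \<theta> * Am m x' z = \<iota> x'' \<bullet> \<iota> z + k * \<theta> * Am m x'' z"
    using assms(5,6) z unfolding step_iff[OF m] by simp
  then have "\<iota> z \<bullet> \<iota> z + k * \<theta> * Am m z z = 0"
    unfolding z_def bilinear_lsub[OF Am_bilinear[OF m]] by (simp add: \<iota>.diff inner_diff_left algebra_simps)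
  moreover have "0 \<le> k * \<theta> * Am m z z"
    using k_pos \<theta> Am_coercive[OF m, of z] \<alpha> by (smt (verit) mult_nonneg_nonneg zero_le_power2)
  ultimately have "\<iota> z \<bullet> \<iota> z \<le> 0" by linarith
  then have "\<iota> z = 0" using inner_ge_zero[of "\<iota> z"] by simp
  then show ?thesis using \<iota>_eq_0[of z] unfolding z_def by simp
qed

text \<open>The value 0 beyond \<open>N\<close> makes a trajectory unique as a function, so that
  linear dependence on the initial value becomes an equation between functions.\<close>

definition trajectory :: "(nat \<Rightarrow> 'u \<Rightarrow> real) \<Rightarrow> 'u set \<Rightarrow> 'u \<Rightarrow> (nat \<Rightarrow> 'u) \<Rightarrow> bool" where
  "trajectory l S x w \<longleftrightarrow> w 0 = x \<and> (\<forall>m\<le>N. w m \<in> S) \<and> (\<forall>m<N. step m (l m) S (w m) (w (Suc m))) \<and> (\<forall>m>N. w m = 0)"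

lemma trajectory_exists:
  assumes x: "x \<in> span (C n)" and l: "\<And>m. linear (l m)"
  shows "\<exists>w. trajectory l (span (C n)) x w"
proof -
  define nxt where "nxt m x = (SOME x'. x' \<in> span (C n) \<and> step m (l m) (span (C n)) x x')" for m x
  define w where "w m = (if m \<le> N then rec_nat x nxt m else 0)" for m
  have nxt: "nxt m x \<in> span (C n) \<and> step m (l m) (span (C n)) x (nxt m x)" if "m < N" for m x
    unfolding nxt_def by (rule someI_ex) (use step_exists[OF that l[of m], where n=n and x=x] in blast)
  have "w m \<in> span (C n)" if "m \<le> N" for m
    using that by (induction m) (use x nxt in \<open>auto simp: w_def\<close>)
  then show ?thesis unfolding trajectory_def
    by (intro exI[of _ w]) (use nxt in \<open>auto simp: w_def\<close>)
qed

lemma trajectory_unique: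
  assumes S: "subspace S" and w: "trajectory l S x w" and w': "trajectory l S x w'"
  shows "w = w'"
proof
  fix m
  show "w m = w' m"
  proof (cases "m \<le> N")
    case True
    then show ?thesis
    proof (induction m)
      case 0 then show ?case using w w' unfolding trajectory_def by simp
    next
      case (Suc m)
      then have m: "m < N" "w m = w' m" by auto
      show ?case
      proof (rule step_unique[OF m(1) S])
        show "w (Suc m) \<in> S" "w' (Suc m) \<in> S" "step m (l m) S (w m) (w (Suc m))"
          using w w' m(1) unfolding trajectory_def by auto
        show "step m (l m) S (w m) (w' (Suc m))" unfolding m(2) using w' m(1) unfolding trajectory_def by auto
      qed
    qed
  next
    case False then show ?thesis using w w' unfolding trajectory_def by simp
  qed
qed

lemma trajectory_add:
  assumes S: "subspace S" and "trajectory l S x w" "trajectory l' S x' w'"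
  shows "trajectory (\<lambda>m v. l m v + l' m v) S (x + x') (\<lambda>m. w m + w' m)"
  unfolding trajectory_def
proof (intro conjI allI impI)
  fix m assume m: "m < N"
  show "step m (\<lambda>v. l m v + l' m v) S (w m + w' m) (w (Suc m) + w' (Suc m))"
    unfolding step_iff[OF m]
  proof
    fix v assume v: "v \<in> S"
    have "\<iota> (w (Suc m)) \<bullet> \<iota> v + k * \<theta> * Am m (w (Suc m)) v = k * l m v + \<iota> (w m) \<bullet> \<iota> v - k * (1 - \<theta>) * Am m (w m) v"
      "\<iota> (w' (Suc m)) \<bullet> \<iota> v + k * \<theta> * Am m (w' (Suc m)) v = k * l' m v + \<iota> (w' m) \<bullet> \<iota> v - k * (1 - \<theta>) * Am m (w' m) v"
      using assms m v unfolding trajectory_def step_iff[OF m] by (auto simp: step_iff)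
    then show "\<iota> (w (Suc m) + w' (Suc m)) \<bullet> \<iota> v + k * \<theta> * Am m (w (Suc m) + w' (Suc m)) v
      = k * (l m v + l' m v) + \<iota> (w m + w' m) \<bullet> \<iota> v - k * (1 - \<theta>) * Am m (w m + w' m) v"
      unfolding bilinear_ladd[OF Am_bilinear[OF m]] \<iota>.add inner_add_left distrib_left by linarith
  qed
qed (use assms in \<open>auto simp: trajectory_def subspace_add\<close>)

lemma trajectory_scaleR:
  assumes S: "subspace S" and "trajectory l S x w"
  shows "trajectory (\<lambda>m v. c * l m v) S (c *\<^sub>R x) (\<lambda>m. c *\<^sub>R w m)"
  unfolding trajectory_def
proof (intro conjI allI impI)
  fix m assume m: "m < N"
  show "step m (\<lambda>v. c * l m v) S (c *\<^sub>R w m) (c *\<^sub>R w (Suc m))"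
    unfolding step_iff[OF m]
  proof
    fix v assume v: "v \<in> S"
    have "\<iota> (w (Suc m)) \<bullet> \<iota> v + k * \<theta> * Am m (w (Suc m)) v = k * l m v + \<iota> (w m) \<bullet> \<iota> v - k * (1 - \<theta>) * Am m (w m) v"
      using assms m v unfolding trajectory_def by (auto simp: step_iff)
    then have "c * (\<iota> (w (Suc m)) \<bullet> \<iota> v + k * \<theta> * Am m (w (Suc m)) v) = c * (k * l m v + \<iota> (w m) \<bullet> \<iota> v - k * (1 - \<theta>) * Am m (w m) v)"
      by simp
    then show "\<iota> (c *\<^sub>R w (Suc m)) \<bullet> \<iota> v + k * \<theta> * Am m (c *\<^sub>R w (Suc m)) v
      = k * (c * l m v) + \<iota> (c *\<^sub>R w m) \<bullet> \<iota> v - k * (1 - \<theta>) * Am m (c *\<^sub>R w m) v"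
      unfolding bilinear_lmul[OF Am_bilinear[OF m]] \<iota>.scaleR inner_scaleR_left by (simp add: algebra_simps)
  qed
qed (use assms in \<open>auto simp: trajectory_def subspace_scale\<close>)

text \<open>A shooting argument: the trajectory is the sum of a homogeneous one started at the
  unknown x and an inhomogeneous one started at 0. The boundary condition becomes a square linear
  problem for x in the discrete space, so uniqueness yields existence.\<close>

lemma boundary_problem_solvable:
  fixes \<Phi> :: "'h \<Rightarrow>\<^sub>L 'h"
  assumes l: "\<And>m. linear (l m)"
    and uniq: "\<And>w. trajectory (\<lambda>m v. 0) (span (C n)) (w 0) w \<Longrightarrow>
       (\<And>v. v \<in> span (C n) \<Longrightarrow> (\<iota> (w 0) - blinfun_apply \<Phi> (\<iota> (w N))) \<bullet> \<iota> v = 0) \<Longrightarrow> w 0 = 0"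
  shows "\<exists>w. trajectory l (span (C n)) (w 0) w \<and>
    (\<forall>v\<in>span (C n). (\<iota> (w 0) - blinfun_apply \<Phi> (\<iota> (w N))) \<bullet> \<iota> v = \<xi> \<bullet> \<iota> v)"
proof -
  let ?S = "span (C n)"
  \<comment> \<open>Projecting the initial value first makes the solution operator linear on the
    whole type, as bilinearity of \<open>b\<close> demands.\<close>
  define tr where "tr x = (THE w. trajectory (\<lambda>m v. 0) ?S (P n x) w)" for x
  have tr: "trajectory (\<lambda>m v. 0) ?S (P n x) (tr x)" for x
  proof -
    have "linear (\<lambda>v::'u. 0::real)" by (auto intro: linearI)
    then obtain w where w: "trajectory (\<lambda>m v. 0) ?S (P n x) w" using trajectory_exists[of "P n x" n "\<lambda>m v. 0"] by auto
    show ?thesis unfolding tr_def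
      by (rule theI[where P="trajectory (\<lambda>m v. 0) ?S (P n x)" and a=w, OF w]) (rule trajectory_unique[OF subspace_span _ w])
  qed
  have tr_add: "tr (x + y) m = tr x m + tr y m" for x y m
  proof -
    have "trajectory (\<lambda>m v. 0) ?S (P n (x + y)) (\<lambda>m. tr x m + tr y m)"
      using trajectory_add[OF subspace_span tr[of x] tr[of y]] by (simp add: P_add)
    from trajectory_unique[OF subspace_span tr[of "x + y"] this] show ?thesis by simp
  qed
  have tr_scale: "tr (c *\<^sub>R x) m = c *\<^sub>R tr x m" for c x m
  proof -
    have "trajectory (\<lambda>m v. 0) ?S (P n (c *\<^sub>R x)) (\<lambda>m. c *\<^sub>R tr x m)"
      using trajectory_scaleR[OF subspace_span tr[of x], of c] by (simp add: P_scaleR)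
    from trajectory_unique[OF subspace_span tr[of "c *\<^sub>R x"] this] show ?thesis by simp
  qed
  define b where "b x v = (\<iota> (P n x) - \<Phi> (\<iota> (tr x N))) \<bullet> \<iota> v" for x v
  have "bilinear b" unfolding bilinear_def b_def
    by (intro conjI allI; rule linearI)
      (simp_all add: P_add P_scaleR tr_add tr_scale \<iota>.add \<iota>.scaleR blinfun.add_right blinfun.scaleR_right
        inner_add_left inner_add_right inner_diff_left inner_diff_right algebra_simps)
  moreover obtain w0 where w0: "trajectory l ?S 0 w0" using trajectory_exists[OF span_zero, of l n] l by blast
  moreover have "linear (\<lambda>v. (\<xi> + \<Phi> (\<iota> (w0 N))) \<bullet> \<iota> v)"
    by (rule linearI) (simp_all add: \<iota>.add \<iota>.scaleR inner_add_right)
  moreover have "x = 0" if x: "x \<in> ?S" "\<And>v. v \<in> ?S \<Longrightarrow> b x v = 0" for x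
  proof -
    have x0: "tr x 0 = x" using tr[of x] P_id[OF x(1)] unfolding trajectory_def by simp
    have "tr x 0 = 0"
    proof (rule uniq)
      show "trajectory (\<lambda>m v. 0) ?S (tr x 0) (tr x)" using tr[of x] P_id[OF x(1)] x0 by simp
      show "(\<iota> (tr x 0) - \<Phi> (\<iota> (tr x N))) \<bullet> \<iota> v = 0" if "v \<in> ?S" for v
        using x(2)[OF that] P_id[OF x(1)] unfolding b_def x0 by simp
    qed
    then show ?thesis using x0 by simp
  qed
  ultimately obtain x where x: "x \<in> ?S" "\<forall>v\<in>?S. b x v = (\<xi> + \<Phi> (\<iota> (w0 N))) \<bullet> \<iota> v"
    using finite_dim_solvable[OF C_finite independent_C C_orthogonal, of b "\<lambda>v. (\<xi> + \<Phi> (\<iota> (w0 N))) \<bullet> \<iota> v" n]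
    by blast
  define w where "w m = tr x m + w0 m" for m
  have tx: "trajectory (\<lambda>m v. 0) ?S x (tr x)" using tr[of x] P_id[OF x(1)] by simp
  have tw: "trajectory l ?S x w" using trajectory_add[OF subspace_span tx w0] unfolding w_def by simp
  have w0x: "w 0 = x" using tw unfolding trajectory_def by simp
  have "(\<iota> (w 0) - \<Phi> (\<iota> (w N))) \<bullet> \<iota> v = \<xi> \<bullet> \<iota> v" if v: "v \<in> ?S" for v
  proof -
    have "w N = tr x N + w0 N" unfolding w_def ..
    then show ?thesis using x(2)[rule_format, OF v] unfolding w0x b_def P_id[OF x(1)]
      by (simp add: \<iota>.add blinfun.add_right inner_diff_left inner_add_left algebra_simps)
  qed
  then show ?thesis using tw w0x by (intro exI[of _ w]) auto
qed

definition load :: "(real \<Rightarrow> 'u \<Rightarrow>\<^sub>L real) \<Rightarrow> nat \<Rightarrow> 'u \<Rightarrow> real" where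
  "load f m v = 1 / k * (LINT t|lebesgue_on {real m * k..real (Suc m) * k}. blinfun_apply (f t) v)"

lemma linear_load:
  assumes f: "f \<in> bochner_L2 T" and m: "m < N"
  shows "linear (load f m)"
  unfolding load_def
  by (rule linearI) (simp_all add: blinfun.add_right blinfun.scaleR_right distrib_left
      integrable_dual_apply[OF f cell_bounds(1,2)[OF m]] del: of_nat_Suc)

lemma theta_scheme_iff:
  "theta_scheme T \<iota> a \<Phi> f \<xi> \<theta> N S w \<longleftrightarrow> w \<in> {..N} \<rightarrow>\<^sub>E S \<and>
     (\<forall>v\<in>S. (\<iota> (w 0) - blinfun_apply \<Phi> (\<iota> (w N))) \<bullet> \<iota> v = \<xi> \<bullet> \<iota> v) \<and>
     (\<forall>m<N. step m (load f m) S (w m) (w (Suc m)))"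
  unfolding theta_scheme_def Let_def step_def Am_def load_def k_def ..

text \<open>This is all that the remaining argument needs from the step size conditions: both unique
  solvability and the error estimate refer to this predicate, and the constant is an argument so
  that it can be chosen uniformly.\<close>

definition stable :: "real \<Rightarrow> real \<Rightarrow> 'u set \<Rightarrow> bool" where
  "stable q G S \<longleftrightarrow> (\<forall>e F \<phi> \<eta>. (\<forall>m\<le>N. e m \<in> S) \<longrightarrow> 0 \<le> \<eta> \<longrightarrow> (\<forall>m<N. 0 \<le> \<phi> m) \<longrightarrow>
     (\<forall>m<N. \<forall>v\<in>S. \<bar>F m v\<bar> \<le> \<phi> m * norm v) \<longrightarrow> (\<forall>m<N. step m (F m) S (e m) (e (Suc m))) \<longrightarrow>
     norm (\<iota> (e 0)) \<le> q * norm (\<iota> (e N)) + \<eta> \<longrightarrow>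
     (\<Sum>m<N. k * (norm (\<theta> *\<^sub>R e (Suc m) + (1 - \<theta>) *\<^sub>R e m))\<^sup>2) \<le> G * ((\<Sum>m<N. k * (\<phi> m)\<^sup>2) + \<eta>\<^sup>2) \<and>
     (\<forall>m\<le>N. (norm (\<iota> (e m)))\<^sup>2 \<le> G * ((\<Sum>m<N. k * (\<phi> m)\<^sup>2) + \<eta>\<^sup>2)))"

text \<open>The equation holds only against the discrete space, but testing it with x itself
  recovers the full \<open>H\<close>-norm of x.\<close>

lemma boundary_bound:
  fixes \<Phi> :: "'h \<Rightarrow>\<^sub>L 'h"
  assumes x: "x \<in> S" and eq: "\<And>v. v \<in> S \<Longrightarrow> (\<iota> x - blinfun_apply \<Phi> z) \<bullet> \<iota> v = r \<bullet> \<iota> v"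
  shows "norm (\<iota> x) \<le> norm \<Phi> * norm z + norm r"
proof (cases "\<iota> x = 0")
  case False
  have "norm (\<iota> x) * norm (\<iota> x) = (\<Phi> z + r) \<bullet> \<iota> x"
    using eq[OF x] by (simp add: power2_norm_eq_inner[symmetric] power2_eq_square inner_diff_left inner_add_left)
  also have "\<dots> \<le> norm (\<Phi> z + r) * norm (\<iota> x)" by (rule norm_cauchy_schwarz)
  finally have "norm (\<iota> x) \<le> norm (\<Phi> z + r)" using False by simp
  also have "\<dots> \<le> norm (\<Phi> z) + norm r" by (rule norm_triangle_ineq)
  also have "norm (\<Phi> z) \<le> norm \<Phi> * norm z" by (rule norm_blinfun)
  finally show ?thesis by simp
qed simp

text \<open>Stability with zero data forces a homogeneous solution to vanish. Applied to differences
  this is uniqueness, and it is also the injectivity behind existence.\<close>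

lemma theta_scheme_ex1:
  assumes stab: "stable (norm \<Phi>) G (span (C n))" and f: "f \<in> bochner_L2 T"
  shows "\<exists>!w. theta_scheme T \<iota> a \<Phi> f \<xi> \<theta> N (span (C n)) w"
proof -
  let ?S = "span (C n)"
  have zero: "e m = 0" if e: "\<forall>m\<le>N. e m \<in> ?S" and st: "\<forall>m<N. step m (\<lambda>v. 0) ?S (e m) (e (Suc m))"
    and bc: "\<And>v. v \<in> ?S \<Longrightarrow> (\<iota> (e 0) - \<Phi> (\<iota> (e N))) \<bullet> \<iota> v = 0" and m: "m \<le> N" for e m
  proof -
    have "norm (\<iota> (e 0)) \<le> norm \<Phi> * norm (\<iota> (e N)) + norm (0::'h)"
      by (rule boundary_bound[of _ ?S]) (use e bc in auto)
    then have "(norm (\<iota> (e m)))\<^sup>2 \<le> G * ((\<Sum>m<N. k * 0\<^sup>2) + 0\<^sup>2)"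
      using stab[unfolded stable_def, THEN spec[of _ e], THEN spec[of _ "\<lambda>m v. 0"], THEN spec[of _ "\<lambda>m. 0"],
          THEN spec[of _ 0]] e st m by simp
    then have "\<iota> (e m) = 0" by simp
    then show ?thesis by (rule \<iota>_eq_0)
  qed
  \<comment> \<open>The solvability lemma asks for linear functionals at every index, whereas
    linearity of the load is available for m < N.\<close>
  define l where "l m = (if m < N then load f m else (\<lambda>v. 0))" for m
  have lin: "linear (l m)" for m unfolding l_def using linear_load[OF f] by (auto intro: linearI)
  have "\<exists>w. trajectory l ?S (w 0) w \<and> (\<forall>v\<in>?S. (\<iota> (w 0) - \<Phi> (\<iota> (w N))) \<bullet> \<iota> v = \<xi> \<bullet> \<iota> v)"
  proof (rule boundary_problem_solvable[OF lin])
    fix w assume "trajectory (\<lambda>m v. 0) ?S (w 0) w" and "\<And>v. v \<in> ?S \<Longrightarrow> (\<iota> (w 0) - \<Phi> (\<iota> (w N))) \<bullet> \<iota> v = 0"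
    then show "w 0 = 0" using zero[of w 0] unfolding trajectory_def by simp
  qed
  then obtain w where w: "trajectory l ?S (w 0) w" "\<forall>v\<in>?S. (\<iota> (w 0) - \<Phi> (\<iota> (w N))) \<bullet> \<iota> v = \<xi> \<bullet> \<iota> v" by blast
  define w' where "w' = restrict w {..N}"
  have ex: "theta_scheme T \<iota> a \<Phi> f \<xi> \<theta> N ?S w'"
    unfolding theta_scheme_iff w'_def using w unfolding trajectory_def l_def by auto
  show ?thesis
  proof (intro ex1I[of _ w'])
    show "theta_scheme T \<iota> a \<Phi> f \<xi> \<theta> N ?S w'" by (rule ex)
    fix v assume v: "theta_scheme T \<iota> a \<Phi> f \<xi> \<theta> N ?S v"
    note v' = v[unfolded theta_scheme_iff] and w'' = ex[unfolded theta_scheme_iff]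
    have vS: "\<forall>m\<le>N. v m \<in> ?S" "\<forall>m\<le>N. w' m \<in> ?S" using v' w'' by auto
    have "v m - w' m = 0" if m: "m \<le> N" for m
    proof (rule zero[of "\<lambda>m. v m - w' m"])
      show "\<forall>m\<le>N. v m - w' m \<in> ?S" using vS by (simp add: span_diff)
      show "(\<iota> (v 0 - w' 0) - \<Phi> (\<iota> (v N - w' N))) \<bullet> \<iota> x = 0" if "x \<in> ?S" for x
      proof -
        have "(\<iota> (v 0) - \<Phi> (\<iota> (v N))) \<bullet> \<iota> x = \<xi> \<bullet> \<iota> x" "(\<iota> (w' 0) - \<Phi> (\<iota> (w' N))) \<bullet> \<iota> x = \<xi> \<bullet> \<iota> x"
          using v' w'' that by blast+
        then show ?thesis by (simp add: \<iota>.diff blinfun.diff_right inner_diff_left)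
      qed
      show "\<forall>m<N. step m (\<lambda>v. 0) ?S (v m - w' m) (v (Suc m) - w' (Suc m))"
      proof (intro allI impI)
        fix m assume m: "m < N"
        have "step m (load f m) ?S (v m) (v (Suc m))" "step m (load f m) ?S (w' m) (w' (Suc m))" using v' w'' m by auto
        then show "step m (\<lambda>v. 0) ?S (v m - w' m) (v (Suc m) - w' (Suc m))"
          unfolding step_iff[OF m] bilinear_lsub[OF Am_bilinear[OF m]] \<iota>.diff inner_diff_left right_diff_distrib by fastforce
      qed
    qed (rule m)
    then have "v m = w' m" if "m \<in> {..N}" for m using that by simp
    then show "v = w'" using v' w'' by (intro PiE_ext) auto
  qed
qed

lemma k_partition: "partition T N (\<lambda>m. real m * k)"
  unfolding k_def by (rule uniform_partition[OF T N])

lemma disc_deriv_cell: "real m * k < t \<Longrightarrow> t < real (Suc m) * k \<Longrightarrow> disc_deriv k w t = (w (Suc m) - w m) /\<^sub>R k"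
  by (rule disc_deriv_interval[OF k_pos])

lemma step_fun_cell: "real m * k < t \<Longrightarrow> t < real (Suc m) * k \<Longrightarrow> step_fun \<theta> k w t = \<theta> *\<^sub>R w (Suc m) + (1 - \<theta>) *\<^sub>R w m"
  by (rule step_fun_interval[OF k_pos])

lemma step_fun_L2: "step_fun \<theta> k w \<in> bochner_L2 T"
  unfolding k_def by (rule step_fun_bochner_L2[OF T N])

lemma L2sq_cellwise:
  fixes h :: "real \<Rightarrow> 'b::real_normed_vector"
  assumes "\<And>m t. m < N \<Longrightarrow> real m * k < t \<Longrightarrow> t < real (Suc m) * k \<Longrightarrow> norm (h t) \<le> c m"
    and "\<And>m. m < N \<Longrightarrow> 0 \<le> c m"
  shows "L2sq T h \<le> (\<Sum>m<N. k * (c m)\<^sup>2)"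
proof -
  interpret partition T N "\<lambda>m. real m * k" by (rule k_partition)
  define H where "H t = (c (nat \<lfloor>t / k\<rfloor>))\<^sup>2" for t
  have Hc: "H t = (c m)\<^sup>2" if "m < N" "real m * k < t" "t < real (Suc m) * k" for m t
    unfolding H_def using nat_floor_in_cell[OF k_pos that(2,3)] by simp
  note int = integrable_cellwise_const[of H "\<lambda>m. (c m)\<^sup>2", OF Hc]
  have "L2sq T h \<le> (LINT t|I_on T. H t)" unfolding L2sq_def
  proof (rule integral_mono_AE'[OF int(1)])
    show "AE t in I_on T. (norm (h t))\<^sup>2 \<le> H t" using AE_in_cell
    proof eventually_elim
      case (elim t)
      then obtain m where "m < N" "real m * k < t" "t < real (Suc m) * k" by blast
      then show ?case using Hc[of m t] power_mono[OF assms(1)[of m t] norm_ge_zero, of 2] by simp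
    qed
  qed (simp_all add: H_def)
  also have "\<dots> = (\<Sum>m<N. k * (c m)\<^sup>2)" using int(2) by (simp only: cell_bounds(4))
  finally show ?thesis .
qed

text \<open>The difference of the discrete solution and the comparison function solves the scheme
  with the consistency residual as data. Stability bounds it at the nodes and in \<open>V\<close>;
  its discrete derivative is read off from the scheme.\<close>

lemma error_bounds:
  fixes \<Phi> :: "'h \<Rightarrow>\<^sub>L 'h"
  assumes stab: "stable (norm \<Phi>) G (span (C n))" and \<Phi>: "norm \<Phi> \<le> 1"
    and f: "f \<in> bochner_L2 T" and y: "y \<in> bochner_L2 T" and g: "g \<in> bochner_L2 T"
    and eq: "AE t in I_on T. g t + AA t (y t) = f t" and ic: "u 0 - blinfun_apply \<Phi> (u T) = \<xi>"
    and W: "theta_scheme T \<iota> a \<Phi> f \<xi> \<theta> N (span (C n)) w" and z: "\<And>m. z m \<in> span (C n)"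
    and V: "L2sq T (\<lambda>t. y t - step_fun \<theta> k z t) \<le> e" and D: "L2sq T (\<lambda>t. g t - dd n k z t) \<le> e"
    and H: "\<forall>t\<in>{0..T}. norm (u t - \<iota> (step_fun \<theta> k z t)) \<le> e"
    and G: "G \<ge> 0" and R: "R = G * ((2 + 2 * M\<^sup>2) * e + 4 * e\<^sup>2)"
  shows "L2sq T (\<lambda>t. g t - dd n k w t) \<le> 2 * e + 2 * (2 * M\<^sup>2 * R + 2 * ((2 + 2 * M\<^sup>2) * e))"
    "L2sq T (\<lambda>t. y t - step_fun \<theta> k w t) \<le> 2 * e + 2 * R"
    "\<forall>t\<in>{0..T}. norm (u t - \<iota> (step_fun \<theta> k w t)) \<le> e + sqrt R"
proof -
  let ?S = "span (C n)"
  interpret partition T N "\<lambda>m. real m * k" by (rule k_partition)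
  note W' = W[unfolded theta_scheme_iff]
  have wS: "w m \<in> ?S" if "m \<le> N" for m using W' that by auto
  define E where "E m = w m - z m" for m
  define x where "x m = \<theta> *\<^sub>R E (Suc m) + (1 - \<theta>) *\<^sub>R E m" for m
  have ES: "E m \<in> ?S" if "m \<le> N" for m unfolding E_def using wS[OF that] z by (simp add: span_diff)
  define F where "F m v = load f m v - \<iota> ((z (Suc m) - z m) /\<^sub>R k) \<bullet> \<iota> v - Am m (\<theta> *\<^sub>R z (Suc m) + (1 - \<theta>) *\<^sub>R z m) v" for m v
  define \<psi> where "\<psi> t = norm (g t - dd n k z t) + M * norm (y t - step_fun \<theta> k z t)" for t
  have L1: "(\<lambda>t. g t - dd n k z t) \<in> bochner_L2 T" by (intro L2_diff g dd_bochner_L2 k_pos)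
  have L2: "(\<lambda>t. y t - step_fun \<theta> k z t) \<in> bochner_L2 T" by (intro L2_diff y step_fun_L2)
  have \<psi>_int: "integrable (I_on T) \<psi>" unfolding \<psi>_def using L2_integrable_norm[OF L1] L2_integrable_norm[OF L2] by simp
  have \<psi>_nn: "0 \<le> \<psi> t" for t unfolding \<psi>_def using M by simp
  have \<psi>_sq: "(\<psi> t)\<^sup>2 \<le> 2 * (norm (g t - dd n k z t))\<^sup>2 + 2 * M\<^sup>2 * (norm (y t - step_fun \<theta> k z t))\<^sup>2" for t
    using sum_sq_le[of "norm (g t - dd n k z t)" "M * norm (y t - step_fun \<theta> k z t)"] unfolding \<psi>_def by (simp add: power_mult_distrib)
  have bd_int: "integrable (I_on T) (\<lambda>t. 2 * (norm (g t - dd n k z t))\<^sup>2 + 2 * M\<^sup>2 * (norm (y t - step_fun \<theta> k z t))\<^sup>2)"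
    using L2_integrable[OF L1] L2_integrable[OF L2] by simp
  have \<psi>2_int: "integrable (I_on T) (\<lambda>t. (\<psi> t)\<^sup>2)"
  proof (rule Bochner_Integration.integrable_bound[OF bd_int])
    show "(\<lambda>t. (\<psi> t)\<^sup>2) \<in> borel_measurable (I_on T)" using borel_measurable_integrable[OF \<psi>_int] by simp
    show "AE t in I_on T. norm ((\<psi> t)\<^sup>2) \<le> norm (2 * (norm (g t - dd n k z t))\<^sup>2 + 2 * M\<^sup>2 * (norm (y t - step_fun \<theta> k z t))\<^sup>2)"
      using \<psi>_sq by simp
  qed
  have \<psi>2_le: "(LINT t|I_on T. (\<psi> t)\<^sup>2) \<le> (2 + 2 * M\<^sup>2) * e"
  proof -
    have "(LINT t|I_on T. (\<psi> t)\<^sup>2) \<le> (LINT t|I_on T. 2 * (norm (g t - dd n k z t))\<^sup>2 + 2 * M\<^sup>2 * (norm (y t - step_fun \<theta> k z t))\<^sup>2)"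
      by (rule integral_mono[OF \<psi>2_int bd_int \<psi>_sq])
    also have "\<dots> = 2 * L2sq T (\<lambda>t. g t - dd n k z t) + 2 * M\<^sup>2 * L2sq T (\<lambda>t. y t - step_fun \<theta> k z t)"
      unfolding L2sq_def using L2_integrable[OF L1] L2_integrable[OF L2] by simp
    also have "\<dots> \<le> 2 * e + 2 * M\<^sup>2 * e" using V D by (intro add_mono mult_left_mono) auto
    finally show ?thesis by (simp add: algebra_simps)
  qed
  \<comment> \<open>The scheme averages over cells, so the dual norm of the residual is bounded by
    the cell average of \<psi>; by convexity of the square, the weighted sum of the squares does not
    exceed the integral of the square of \<psi>.\<close>
  define \<phi> where "\<phi> m = (LINT t|lebesgue_on {real m * k..real (Suc m) * k}. \<psi> t) / k" for m
  have \<phi>_nn: "0 \<le> \<phi> m" for m unfolding \<phi>_def using k_pos \<psi>_nn by (simp add: integral_nonneg_AE)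
  have \<phi>_sum: "(\<Sum>m<N. k * (\<phi> m)\<^sup>2) \<le> (2 + 2 * M\<^sup>2) * e"
  proof -
    have "k * (\<phi> m)\<^sup>2 \<le> (LINT t|lebesgue_on {real m * k..real (Suc m) * k}. (\<psi> t)\<^sup>2)" if m: "m < N" for m
    proof -
      have "(LINT t|lebesgue_on {real m * k..real (Suc m) * k}. \<psi> t)\<^sup>2
        \<le> k * (LINT t|lebesgue_on {real m * k..real (Suc m) * k}. (\<psi> t)\<^sup>2)"
        using square_integral_mean_le[OF integrable_cell[OF \<psi>2_int m] integrable_cell[OF \<psi>_int m] cell_bounds(3)]
        unfolding cell_bounds(4) .
      then show ?thesis unfolding \<phi>_def using k_pos by (simp add: power_divide power2_eq_square field_simps)
    qed
    then have "(\<Sum>m<N. k * (\<phi> m)\<^sup>2) \<le> (\<Sum>m<N. LINT t|lebesgue_on {real m * k..real (Suc m) * k}. (\<psi> t)\<^sup>2)"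
      by (intro sum_mono) auto
    also have "\<dots> = (LINT t|I_on T. (\<psi> t)\<^sup>2)" by (rule integral_cells[OF \<psi>2_int, symmetric])
    finally show ?thesis using \<psi>2_le by simp
  qed
  have F_bd: "\<bar>F m v\<bar> \<le> \<phi> m * norm v" if m: "m < N" and v: "v \<in> ?S" for m v
  proof -
    let ?L = "lebesgue_on {real m * k..real (Suc m) * k}"
    define zx where "zx = \<theta> *\<^sub>R z (Suc m) + (1 - \<theta>) *\<^sub>R z m"
    define zd where "zd = (z (Suc m) - z m) /\<^sub>R k"
    note b = cell_bounds(1,2)[OF m]
    have i1: "integrable ?L (\<lambda>t. (f t) v)" by (rule integrable_dual_apply[OF f b])
    have i2: "integrable ?L (\<lambda>t. (AA t zx) v)" by (rule integrable_AA[OF b])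
    have "k * F m v = (LINT t|?L. (f t) v) - k * (\<iota> zd \<bullet> \<iota> v) - (LINT t|?L. (AA t zx) v)"
      unfolding F_def load_def Am_eq[OF m] zd_def[symmetric] zx_def[symmetric] using k_pos by (simp add: right_diff_distrib)
    also have "\<dots> = (LINT t|?L. (f t) v - \<iota> zd \<bullet> \<iota> v - (AA t zx) v)"
    proof -
      have "(LINT t|?L. \<iota> zd \<bullet> \<iota> v) = k * (\<iota> zd \<bullet> \<iota> v)"
        using integral_lebesgue_on_const(1)[OF less_imp_le[OF cell_bounds(3)], of m "\<lambda>t. \<iota> zd \<bullet> \<iota> v"] unfolding cell_bounds(4) by simp
      moreover have "integrable ?L (\<lambda>t. \<iota> zd \<bullet> \<iota> v)" by simp
      ultimately show ?thesis using i1 i2 by (simp del: lebesgue_integral_const)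
    qed
    also have "\<bar>\<dots>\<bar> \<le> (LINT t|?L. \<psi> t * norm v)"
    proof (rule order_trans[OF integral_abs_bound])
      show "(LINT t|?L. \<bar>(f t) v - \<iota> zd \<bullet> \<iota> v - (AA t zx) v\<bar>) \<le> (LINT t|?L. \<psi> t * norm v)"
      proof (rule integral_mono_AE')
        show "integrable ?L (\<lambda>t. \<psi> t * norm v)" using integrable_cell[OF \<psi>_int m] by simp
        show "AE t in ?L. \<bar>(f t) v - \<iota> zd \<bullet> \<iota> v - (AA t zx) v\<bar> \<le> \<psi> t * norm v"
          using AE_cell[OF eq m] AE_lebesgue_on_interior
        proof eventually_elim
          case (elim t)
          have t: "real m * k < t" "t < real (Suc m) * k" using elim(2) by auto
          have zt: "step_fun \<theta> k z t = zx" unfolding zx_def by (rule step_fun_cell[OF t])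
          have dt: "(dd n k z t) v = \<iota> zd \<bullet> \<iota> v"
            unfolding dd_apply disc_deriv_cell[OF t] zd_def[symmetric] P_id[OF v] ..
          \<comment> \<open>Substituting the equation for \<open>f\<close> leaves the error of the
            derivative plus the operator applied to the error of the function. On discrete test
            vectors the projection inside \<open>dd\<close> acts as the identity.\<close>
          have "(f t) v - \<iota> zd \<bullet> \<iota> v - (AA t zx) v
            = (g t - dd n k z t) v + (AA t (y t - zx)) v"
            unfolding elim(1)[symmetric] dt[symmetric] AA_diff by (simp add: blinfun.add_left blinfun.diff_left)
          also have "\<bar>\<dots>\<bar> \<le> norm (g t - dd n k z t) * norm v + norm (AA t (y t - zx)) * norm v"
            using norm_blinfun[of "g t - dd n k z t" v] norm_blinfun[of "AA t (y t - zx)" v] by simp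
          also have "\<dots> \<le> norm (g t - dd n k z t) * norm v + (M * norm (y t - zx)) * norm v"
            by (intro add_left_mono mult_right_mono norm_AA_le) simp
          also have "\<dots> = \<psi> t * norm v" unfolding \<psi>_def zt by (simp add: distrib_right)
          finally show ?case .
        qed
        show "AE t in ?L. 0 \<le> \<psi> t * norm v" using \<psi>_nn by simp
      qed
    qed
    also have "\<dots> = k * (\<phi> m * norm v)" unfolding \<phi>_def using k_pos by simp
    finally have "k * \<bar>F m v\<bar> \<le> k * (\<phi> m * norm v)" using k_pos by (simp add: abs_mult)
    then show ?thesis using k_pos by simp
  qed
  have F_step: "step m (F m) ?S (E m) (E (Suc m))" if m: "m < N" for m
    unfolding step_def
  proof
    fix v assume v: "v \<in> ?S"
    have "\<iota> ((w (Suc m) - w m) /\<^sub>R k) \<bullet> \<iota> v + Am m (\<theta> *\<^sub>R w (Suc m) + (1 - \<theta>) *\<^sub>R w m) v = load f m v"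
      using W' m v unfolding step_def by simp
    moreover have "(E (Suc m) - E m) /\<^sub>R k = (w (Suc m) - w m) /\<^sub>R k - (z (Suc m) - z m) /\<^sub>R k"
      unfolding E_def by (simp add: algebra_simps)
    moreover have "\<theta> *\<^sub>R E (Suc m) + (1 - \<theta>) *\<^sub>R E m = (\<theta> *\<^sub>R w (Suc m) + (1 - \<theta>) *\<^sub>R w m) - (\<theta> *\<^sub>R z (Suc m) + (1 - \<theta>) *\<^sub>R z m)"
      unfolding E_def by (simp add: algebra_simps)
    ultimately show "\<iota> ((E (Suc m) - E m) /\<^sub>R k) \<bullet> \<iota> v + Am m (\<theta> *\<^sub>R E (Suc m) + (1 - \<theta>) *\<^sub>R E m) v = F m v"
      unfolding F_def by (simp only: \<iota>.diff inner_diff_left bilinear_lsub[OF Am_bilinear[OF m]])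
  qed
  have e0: "0 \<le> e" using V L2sq_nonneg order_trans by blast
  have node: "step_fun \<theta> k z (real m * k) = z m" "step_fun \<theta> k w (real m * k) = w m" for m
    by (rule step_fun_node[OF k_pos])+
  have H0: "norm (u 0 - \<iota> (z 0)) \<le> e" using H[rule_format, of 0] T node(1)[of 0] by simp
  have HT: "norm (u T - \<iota> (z N)) \<le> e" using H[rule_format, of T] T node(1)[of N] unfolding Nk by auto
  \<comment> \<open>The defect of the comparison function in the boundary condition; it consists of
    two nodal errors, hence the bound 2 e.\<close>
  define r where "r = (u 0 - \<iota> (z 0)) - \<Phi> (u T - \<iota> (z N))"
  have "norm (\<Phi> (u T - \<iota> (z N))) \<le> norm \<Phi> * norm (u T - \<iota> (z N))" by (rule norm_blinfun)
  also have "\<dots> \<le> 1 * e" using \<Phi> HT by (intro mult_mono) auto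
  finally have r_le: "norm r \<le> 2 * e" unfolding r_def using H0 norm_triangle_ineq4[of "u 0 - \<iota> (z 0)" "\<Phi> (u T - \<iota> (z N))"] by linarith
  have "norm (\<iota> (E 0)) \<le> norm \<Phi> * norm (\<iota> (E N)) + norm r"
  proof (rule boundary_bound[of _ ?S])
    show "E 0 \<in> ?S" by (rule ES) simp
    fix v assume "v \<in> ?S"
    then have "(\<iota> (w 0) - \<Phi> (\<iota> (w N))) \<bullet> \<iota> v = \<xi> \<bullet> \<iota> v" using W' by blast
    then show "(\<iota> (E 0) - \<Phi> (\<iota> (E N))) \<bullet> \<iota> v = r \<bullet> \<iota> v"
      unfolding E_def r_def ic[symmetric] by (simp add: \<iota>.diff blinfun.diff_right inner_diff_left algebra_simps)
  qed
  then have bc: "norm (\<iota> (E 0)) \<le> norm \<Phi> * norm (\<iota> (E N)) + 2 * e" using r_le by linarith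
  have GR: "G * ((\<Sum>m<N. k * (\<phi> m)\<^sup>2) + (2 * e)\<^sup>2) \<le> R"
    unfolding R using \<phi>_sum G by (intro mult_left_mono) (auto simp: power_mult_distrib)
  have st: "(\<Sum>m<N. k * (norm (x m))\<^sup>2) \<le> R" "\<And>m. m \<le> N \<Longrightarrow> (norm (\<iota> (E m)))\<^sup>2 \<le> R"
  proof -
    have "(\<Sum>m<N. k * (norm (x m))\<^sup>2) \<le> G * ((\<Sum>m<N. k * (\<phi> m)\<^sup>2) + (2 * e)\<^sup>2) \<and>
       (\<forall>m\<le>N. (norm (\<iota> (E m)))\<^sup>2 \<le> G * ((\<Sum>m<N. k * (\<phi> m)\<^sup>2) + (2 * e)\<^sup>2))"
      unfolding x_def
      using stab[unfolded stable_def, THEN spec[of _ E], THEN spec[of _ F], THEN spec[of _ \<phi>], THEN spec[of _ "2 * e"]]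
        ES e0 \<phi>_nn F_bd F_step bc by simp
    then show "(\<Sum>m<N. k * (norm (x m))\<^sup>2) \<le> R" "\<And>m. m \<le> N \<Longrightarrow> (norm (\<iota> (E m)))\<^sup>2 \<le> R"
      using GR by (auto intro: order_trans)
  qed
  have sE: "step_fun \<theta> k w t - step_fun \<theta> k z t = x m" if "real m * k < t" "t < real (Suc m) * k" for m t
    unfolding step_fun_cell[OF that] x_def E_def by (simp add: algebra_simps)
  have s_err: "L2sq T (\<lambda>t. step_fun \<theta> k z t - step_fun \<theta> k w t) \<le> R"
  proof -
    have "L2sq T (\<lambda>t. step_fun \<theta> k z t - step_fun \<theta> k w t) \<le> (\<Sum>m<N. k * (norm (x m))\<^sup>2)"
    proof (rule L2sq_cellwise)
      show "norm (step_fun \<theta> k z t - step_fun \<theta> k w t) \<le> norm (x m)" if "real m * k < t" "t < real (Suc m) * k" for m t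
        using sE[OF that] by (metis norm_minus_commute order_refl)
    qed simp
    then show ?thesis using st(1) by simp
  qed
  show "L2sq T (\<lambda>t. y t - step_fun \<theta> k w t) \<le> 2 * e + 2 * R"
    using L2sq_triangle[OF y step_fun_L2[where w=z] step_fun_L2[where w=w]] V s_err by linarith
  \<comment> \<open>No bound on the increments in \<open>H\<close> is used here. \<open>dd\<close>
    sees a test vector v only through \<open>P n v\<close>, an admissible test vector of the scheme,
    so the difference quotient can be expressed by the residual and the form.\<close>
  have d_err: "L2sq T (\<lambda>t. dd n k z t - dd n k w t) \<le> 2 * M\<^sup>2 * R + 2 * ((2 + 2 * M\<^sup>2) * e)"
  proof -
    have "L2sq T (\<lambda>t. dd n k z t - dd n k w t) \<le> (\<Sum>m<N. k * (M * norm (x m) + \<phi> m)\<^sup>2)"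
    proof (rule L2sq_cellwise)
      fix m t assume m: "m < N" and t: "real m * k < t" "t < real (Suc m) * k"
      have c0: "0 \<le> M * norm (x m) + \<phi> m" using M \<phi>_nn by simp
      show "norm (dd n k z t - dd n k w t) \<le> M * norm (x m) + \<phi> m"
      proof (rule norm_blinfun_bound[OF c0])
        fix v
        have "(dd n k z t - dd n k w t) v = - (\<iota> ((E (Suc m) - E m) /\<^sub>R k) \<bullet> \<iota> (P n v))"
          unfolding blinfun.diff_left dd_apply disc_deriv_cell[OF t] E_def
          by (simp only: \<iota>.diff \<iota>.scaleR inner_diff_left inner_scaleR_left) (simp add: algebra_simps)
        also have "\<iota> ((E (Suc m) - E m) /\<^sub>R k) \<bullet> \<iota> (P n v) = F m (P n v) - Am m (x m) (P n v)"
          using F_step[OF m] P_in_span[of n v] unfolding step_def x_def[symmetric] by (simp add: eq_diff_eq)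
        also have "\<bar>- (F m (P n v) - Am m (x m) (P n v))\<bar> \<le> \<phi> m * norm (P n v) + M * norm (x m) * norm (P n v)"
          using F_bd[OF m P_in_span, of v] Am_bound[OF m, of "x m" "P n v"] by linarith
        also have "\<dots> = (M * norm (x m) + \<phi> m) * norm (P n v)" by (simp add: algebra_simps)
        also have "\<dots> \<le> (M * norm (x m) + \<phi> m) * norm v" by (intro mult_left_mono norm_P_le c0)
        finally show "norm ((dd n k z t - dd n k w t) v) \<le> (M * norm (x m) + \<phi> m) * norm v" by simp
      qed
    qed (use M \<phi>_nn in simp)
    also have "\<dots> \<le> (\<Sum>m<N. 2 * M\<^sup>2 * (k * (norm (x m))\<^sup>2) + 2 * (k * (\<phi> m)\<^sup>2))"
    proof (rule sum_mono)
      fix m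
      have "k * (M * norm (x m) + \<phi> m)\<^sup>2 \<le> k * (2 * (M * norm (x m))\<^sup>2 + 2 * (\<phi> m)\<^sup>2)"
        using k_pos by (intro mult_left_mono sum_sq_le) simp
      then show "k * (M * norm (x m) + \<phi> m)\<^sup>2 \<le> 2 * M\<^sup>2 * (k * (norm (x m))\<^sup>2) + 2 * (k * (\<phi> m)\<^sup>2)"
        by (simp add: power_mult_distrib algebra_simps)
    qed
    also have "\<dots> = 2 * M\<^sup>2 * (\<Sum>m<N. k * (norm (x m))\<^sup>2) + 2 * (\<Sum>m<N. k * (\<phi> m)\<^sup>2)"
      by (simp only: sum.distrib sum_distrib_left)
    also have "\<dots> \<le> 2 * M\<^sup>2 * R + 2 * ((2 + 2 * M\<^sup>2) * e)"
      using st(1) \<phi>_sum by (intro add_mono mult_left_mono) auto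
    finally show ?thesis .
  qed
  show "L2sq T (\<lambda>t. g t - dd n k w t) \<le> 2 * e + 2 * (2 * M\<^sup>2 * R + 2 * ((2 + 2 * M\<^sup>2) * e))"
    by (rule order_trans[OF L2sq_triangle[OF g dd_bochner_L2[OF k_pos, where i=n and w=z] dd_bochner_L2[OF k_pos, where i=n and w=w]]])
      (intro add_mono mult_left_mono D d_err; simp)
  have \<iota>E: "norm (\<iota> (E m)) \<le> sqrt R" if "m \<le> N" for m using st(2)[OF that] by (rule real_le_rsqrt)
  show "\<forall>t\<in>{0..T}. norm (u t - \<iota> (step_fun \<theta> k w t)) \<le> e + sqrt R"
  proof
    fix t assume t: "t \<in> {0..T}"
    have "norm (\<iota> (step_fun \<theta> k z t) - \<iota> (step_fun \<theta> k w t)) \<le> sqrt R"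
    proof -
      obtain m where m: "m < N" "real m * k \<le> t" "t \<le> real (Suc m) * k" using cell_ex_le[OF t N] by blast
      consider "t = real m * k" | "t = real (Suc m) * k" | "real m * k < t" "t < real (Suc m) * k" using m by linarith
      then show ?thesis
      proof cases
        case 1
        then show ?thesis using node[of m] \<iota>E[of m] m(1) unfolding E_def by (simp add: \<iota>.diff norm_minus_commute)
      next
        case 2
        then show ?thesis using node[of "Suc m"] \<iota>E[of "Suc m"] m(1) unfolding E_def
          by (simp add: \<iota>.diff norm_minus_commute del: of_nat_Suc)
      next
        case 3
        have "\<iota> (step_fun \<theta> k w t) - \<iota> (step_fun \<theta> k z t) = \<theta> *\<^sub>R \<iota> (E (Suc m)) + (1 - \<theta>) *\<^sub>R \<iota> (E m)"
          using sE[OF 3] unfolding x_def \<iota>.diff[symmetric] by (simp add: \<iota>.add \<iota>.scaleR)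
        then have "norm (\<iota> (step_fun \<theta> k z t) - \<iota> (step_fun \<theta> k w t)) \<le> \<theta> * norm (\<iota> (E (Suc m))) + (1 - \<theta>) * norm (\<iota> (E m))"
          using norm_triangle_ineq[of "\<theta> *\<^sub>R \<iota> (E (Suc m))" "(1 - \<theta>) *\<^sub>R \<iota> (E m)"] \<theta> by (simp add: norm_minus_commute)
        also have "\<dots> \<le> \<theta> * sqrt R + (1 - \<theta>) * sqrt R" using \<theta> \<iota>E m(1) by (intro add_mono mult_left_mono) auto
        finally show ?thesis by (simp add: algebra_simps)
      qed
    qed
    then show "norm (u t - \<iota> (step_fun \<theta> k w t)) \<le> e + sqrt R"
      using H[rule_format, OF t] norm_triangle_ineq[of "u t - \<iota> (step_fun \<theta> k z t)" "\<iota> (step_fun \<theta> k z t) - \<iota> (step_fun \<theta> k w t)"] by simp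
  qed
qed

end

section \<open>Convergence\<close>

context evolution_form
begin

text \<open>The step size hypotheses multiplied out; for \<theta> = 1/2 the product of step size and
  inverse constant is \<open>T\<close> times the quotient bounded in the theorem.\<close>

definition cfl :: "real \<Rightarrow> real \<Rightarrow> real \<Rightarrow> real \<Rightarrow> real \<Rightarrow> bool" where
  "cfl \<theta> q k \<mu> B \<longleftrightarrow> (\<theta> < 1/2 \<longrightarrow> k * \<mu>\<^sup>2 * (24 * M^3 * (1/2 - \<theta>)) \<le> \<alpha>\<^sup>2) \<and> (\<theta> = 1/2 \<and> q = 1 \<longrightarrow> k * \<mu> \<le> B)"

lemma alpha_le_M:
  assumes "(x::'u) \<noteq> 0"
  shows "\<alpha> \<le> M"
proof -
  obtain t where t: "regular_time t"
    using mean_value_good_point[of 0 T "\<lambda>t. 0", OF _ T AE_regular] by auto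
  have "\<alpha> * (norm x)\<^sup>2 \<le> (AA t x) x" by (rule AA_coercive[OF t])
  also have "\<dots> \<le> norm (AA t x) * norm x" using norm_blinfun[of "AA t x" x] by simp
  also have "\<dots> \<le> (M * norm x) * norm x" by (intro mult_right_mono norm_AA_le) simp
  finally show ?thesis using assms by (simp add: power2_eq_square)
qed

lemma uniform_stability:
  assumes q: "0 \<le> q" "q \<le> 1" and \<theta>: "0 \<le> \<theta>" "\<theta> \<le> 1"
  obtains G where "G \<ge> 0" "\<And>N n. N > 0 \<Longrightarrow> span (C n) \<noteq> {0} \<Longrightarrow>
     cfl \<theta> q (T / real N) (inverse_const \<iota> (span (C n))) B \<Longrightarrow> discrete_evolution.stable \<iota> T a N \<theta> q G (span (C n))"
proof (cases "\<alpha> \<le> M")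
  case False
  \<comment> \<open>A coercivity constant above the bound \<open>M\<close> is possible only if
    \<open>U\<close> is trivial, and then the claim about nonzero discrete spaces is
    vacuous.\<close>
  then have "span (C n) = {0}" for n using alpha_le_M span_zero[of "C n"] by blast
  then show ?thesis using that[of 0] by simp
next
  case True
  show ?thesis
  proof (rule scheme_stability[OF T \<alpha> M True q \<theta> \<iota>, of B], goal_cases)
    case (1 G)
    note stab = 1(2)
    show ?thesis
    proof (rule that[OF 1(1)])
      fix N n assume N: "N > 0" and nz: "span (C n) \<noteq> {0}" and cfl: "cfl \<theta> q (T / real N) (inverse_const \<iota> (span (C n))) B"
      interpret D: discrete_evolution C \<iota> T M \<alpha> a N \<theta>
        by unfold_locales (use N \<theta> in auto)
      note \<mu> = inverse_const_bound[OF \<iota> \<iota>_inj nz]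
      show "D.stable q G (span (C n))"
        unfolding D.stable_def
      proof (intro allI impI)
        fix e F \<phi> and \<eta> :: real
        assume e: "\<forall>m\<le>N. e m \<in> span (C n)" and \<eta>: "0 \<le> \<eta>" and \<phi>: "\<forall>m<N. 0 \<le> \<phi> m"
          and F: "\<forall>m<N. \<forall>v\<in>span (C n). \<bar>F m v\<bar> \<le> \<phi> m * norm v"
          and st: "\<forall>m<N. D.step m (F m) (span (C n)) (e m) (e (Suc m))"
          and bc: "norm (\<iota> (e 0)) \<le> q * norm (\<iota> (e N)) + \<eta>"
        show "(\<Sum>m<N. D.k * (norm (\<theta> *\<^sub>R e (Suc m) + (1 - \<theta>) *\<^sub>R e m))\<^sup>2) \<le> G * ((\<Sum>m<N. D.k * (\<phi> m)\<^sup>2) + \<eta>\<^sup>2) \<and>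
          (\<forall>m\<le>N. (norm (\<iota> (e m)))\<^sup>2 \<le> G * ((\<Sum>m<N. D.k * (\<phi> m)\<^sup>2) + \<eta>\<^sup>2))"
        proof (rule stab[OF N D.k_def subspace_span e \<eta> less_imp_le[OF \<mu>(2)] \<phi> _ _ F _ bc])
          show "\<forall>m<N. \<forall>x\<in>span (C n). \<forall>v\<in>span (C n). \<bar>D.Am m x v\<bar> \<le> M * norm x * norm v" using D.Am_bound by blast
          show "\<forall>m<N. \<forall>x\<in>span (C n). \<alpha> * (norm x)\<^sup>2 \<le> D.Am m x x" using D.Am_coercive by blast
          show "\<forall>m<N. \<forall>v\<in>span (C n). \<iota> ((e (Suc m) - e m) /\<^sub>R D.k) \<bullet> \<iota> v + D.Am m (\<theta> *\<^sub>R e (Suc m) + (1 - \<theta>) *\<^sub>R e m) v = F m v"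
            using st unfolding D.step_def .
          show "\<forall>x\<in>span (C n). norm x \<le> inverse_const \<iota> (span (C n)) * norm (\<iota> x)" using \<mu>(1) by blast
        qed (use cfl in \<open>auto simp: cfl_def D.k_def\<close>)
      qed
    qed
  qed
qed

lemma convergence:
  fixes \<Phi> :: "'h \<Rightarrow>\<^sub>L 'h" and N :: "nat \<Rightarrow> nat"
  assumes \<Phi>: "norm \<Phi> \<le> 1" and f: "f \<in> bochner_L2 T" and w: "wtriple T u y g"
    and eq: "AE t in I_on T. g t + AA t (y t) = f t" and ic: "u 0 - blinfun_apply \<Phi> (u T) = \<xi>"
    and N: "\<And>i. N i > 0" "filterlim N at_top sequentially" and \<theta>: "0 \<le> \<theta>" "\<theta> \<le> 1"
    and nz: "\<And>n. span (C n) \<noteq> {0}"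
    and cfl: "\<And>i. cfl \<theta> (norm \<Phi>) (T / real (N i)) (inverse_const \<iota> (span (C i))) B"
    and W: "\<And>i. theta_scheme T \<iota> a \<Phi> f \<xi> \<theta> (N i) (span (C i)) (W i)"
    and e: "e > 0"
  shows "\<forall>\<^sub>F i in sequentially. L2sq T (\<lambda>t. g t - dd i (T / real (N i)) (W i) t) < e
     \<and> L2sq T (\<lambda>t. y t - step_fun \<theta> (T / real (N i)) (W i) t) < e
     \<and> (\<forall>t\<in>{0..T}. norm (u t - \<iota> (step_fun \<theta> (T / real (N i)) (W i) t)) < e)"
proof -
  obtain G where G: "G \<ge> 0" and stab: "\<And>N n. N > 0 \<Longrightarrow> span (C n) \<noteq> {0} \<Longrightarrow>
     cfl \<theta> (norm \<Phi>) (T / real N) (inverse_const \<iota> (span (C n))) B \<Longrightarrow> discrete_evolution.stable \<iota> T a N \<theta> (norm \<Phi>) G (span (C n))"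
    using uniform_stability[OF norm_ge_zero \<Phi> \<theta>] by metis
  \<comment> \<open>\<open>G\<close> does not depend on the discretization, so all three error
    bounds tend to 0 with the consistency tolerance d alone; a suitable d can be fixed before the
    index is taken large.\<close>
  define R where "R d = G * ((2 + 2 * M\<^sup>2) * d + 4 * d\<^sup>2)" for d
  have R: "((\<lambda>d. R d) \<longlongrightarrow> G * ((2 + 2 * M\<^sup>2) * 0 + 4 * 0\<^sup>2)) (at_right 0)"
    unfolding R_def by (intro tendsto_intros)
  have "((\<lambda>d. 2 * d + 2 * (2 * M\<^sup>2 * R d + 2 * ((2 + 2 * M\<^sup>2) * d))) \<longlongrightarrow>
      2 * 0 + 2 * (2 * M\<^sup>2 * (G * ((2 + 2 * M\<^sup>2) * 0 + 4 * 0\<^sup>2)) + 2 * ((2 + 2 * M\<^sup>2) * 0))) (at_right 0)"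
    by (intro tendsto_intros R)
  then have 1: "\<forall>\<^sub>F d in at_right 0. 2 * d + 2 * (2 * M\<^sup>2 * R d + 2 * ((2 + 2 * M\<^sup>2) * d)) < e"
    by (rule order_tendstoD(2)) (use e in simp)
  have "((\<lambda>d. 2 * d + 2 * R d) \<longlongrightarrow> 2 * 0 + 2 * (G * ((2 + 2 * M\<^sup>2) * 0 + 4 * 0\<^sup>2))) (at_right 0)"
    by (intro tendsto_intros R)
  then have 2: "\<forall>\<^sub>F d in at_right 0. 2 * d + 2 * R d < e" by (rule order_tendstoD(2)) (use e in simp)
  have "((\<lambda>d. d + sqrt (R d)) \<longlongrightarrow> 0 + sqrt (G * ((2 + 2 * M\<^sup>2) * 0 + 4 * 0\<^sup>2))) (at_right 0)"
    by (intro tendsto_intros R)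
  then have 3: "\<forall>\<^sub>F d in at_right 0. d + sqrt (R d) < e" by (rule order_tendstoD(2)) (use e in simp)
  have 4: "\<forall>\<^sub>F d in at_right (0::real). d > 0" by (rule eventually_at_right_less)
  have ev: "\<forall>\<^sub>F d in at_right 0. 2 * d + 2 * (2 * M\<^sup>2 * R d + 2 * ((2 + 2 * M\<^sup>2) * d)) < e \<and> 2 * d + 2 * R d < e
      \<and> d + sqrt (R d) < e \<and> d > 0"
    using 1 2 3 4 by eventually_elim blast
  then obtain d where d: "2 * d + 2 * (2 * M\<^sup>2 * R d + 2 * ((2 + 2 * M\<^sup>2) * d)) < e" "2 * d + 2 * R d < e"
      "d + sqrt (R d) < e" "d > 0"
    using eventually_happens'[OF trivial_limit_at_right_real ev] by blast
  obtain z where z: "\<forall>i m. z i m \<in> span (C i)" and cons: "\<forall>\<^sub>F i in sequentially.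
       L2sq T (\<lambda>t. y t - step_fun \<theta> (T / real (N i)) (z i) t) \<le> d
       \<and> L2sq T (\<lambda>t. g t - dd i (T / real (N i)) (z i) t) \<le> d
       \<and> (\<forall>t\<in>{0..T}. norm (u t - \<iota> (step_fun \<theta> (T / real (N i)) (z i) t)) \<le> d)"
    by (rule consistency[OF T w N \<theta> d(4)])
  have y: "y \<in> bochner_L2 T" and g: "g \<in> bochner_L2 T" using w unfolding wtriple_def by auto
  show ?thesis using cons
  proof eventually_elim
    case (elim i)
    interpret D: discrete_evolution C \<iota> T M \<alpha> a "N i" \<theta>
      by unfold_locales (use N(1) \<theta> in auto)
    have k: "D.k = T / real (N i)" by (rule D.k_def)
    note eb = D.error_bounds[OF stab[OF N(1) nz cfl] \<Phi> f y g eq ic W[of i], of "z i" d "R d", unfolded k]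
    note bounds = eb[OF z[rule_format] elim[THEN conjunct1] elim[THEN conjunct2, THEN conjunct1]
        elim[THEN conjunct2, THEN conjunct2] G R_def]
    show ?case using bounds d by (auto intro: le_less_trans)
  qed
qed

end

section \<open>Existence for the initial value problem\<close>

lemma integral_time_mono:
  fixes h :: "real \<Rightarrow> real"
  assumes h: "integrable (I_on T) h" "AE s in I_on T. 0 \<le> h s" and t: "0 \<le> t" "t \<le> T"
  shows "(LINT s|I_on t. h s) \<le> (LINT s|I_on T. h s)"
proof -
  have "0 \<le> (LINT s|lebesgue_on {t..T}. h s)"
    by (intro integral_nonneg_AE AE_lebesgue_on_subset[where B="{0..T}", OF h(2)]) (use t in auto)
  then show ?thesis using integral_lebesgue_on_split[OF h(1) t] by simp
qed

lemma L2sq_time_mono: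
  assumes "f \<in> bochner_L2 T" "0 \<le> t" "t \<le> T"
  shows "L2sq t f \<le> L2sq T f"
  unfolding L2sq_def by (rule integral_time_mono[OF L2_integrable[OF assms(1)] _ assms(2,3)]) simp

lemma L2sq_mono_AE:
  fixes f :: "real \<Rightarrow> 'b::real_normed_vector" and g :: "real \<Rightarrow> 'c::real_normed_vector"
  assumes "f \<in> bochner_L2 T" "g \<in> bochner_L2 T" "AE t in I_on T. (norm (f t))\<^sup>2 \<le> c * (norm (g t))\<^sup>2"
  shows "L2sq T f \<le> c * L2sq T g"
proof -
  have "L2sq T f \<le> (LINT t|I_on T. c * (norm (g t))\<^sup>2)"
    unfolding L2sq_def using assms(3) L2_integrable[OF assms(1)] L2_integrable[OF assms(2)]
    by (intro integral_mono_AE) auto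
  then show ?thesis unfolding L2sq_def by simp
qed

lemma linear_riesz: "linear (riesz :: ('a::{real_inner,banach} \<Rightarrow>\<^sub>L real) \<Rightarrow> 'a)"
proof (rule linearI)
  fix g h :: "'a \<Rightarrow>\<^sub>L real" and c :: real
  show "riesz (g + h) = riesz g + riesz h"
    by (rule iffD1[OF vector_eq_rdot]) (simp add: inner_add_left blinfun.add_left)
  show "riesz (c *\<^sub>R g) = c *\<^sub>R riesz g"
    by (rule iffD1[OF vector_eq_rdot]) (simp add: blinfun.scaleR_left)
qed

lemma bounded_linear_riesz: "bounded_linear (riesz :: ('a::{real_inner,banach} \<Rightarrow>\<^sub>L real) \<Rightarrow> 'a)"
  by (intro bounded_linear_intro[of _ 1]) (simp_all add: linear_add[OF linear_riesz] linear_cmul[OF linear_riesz])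

lemma blinfun_inner_right_linear:
  "blinfun_inner_right (x - y) = blinfun_inner_right x - blinfun_inner_right (y :: 'a::real_inner)"
  "blinfun_inner_right (c *\<^sub>R x) = c *\<^sub>R blinfun_inner_right x"
  by (auto intro!: blinfun_eqI simp: inner_diff_left blinfun.diff_left blinfun.scaleR_left)

section \<open>Energy estimate and limits of solutions\<close>

context evolution_form
begin

definition evolves :: "(real \<Rightarrow> 'u \<Rightarrow>\<^sub>L real) \<Rightarrow> (real \<Rightarrow> 'h) \<Rightarrow> (real \<Rightarrow> 'u) \<Rightarrow> (real \<Rightarrow> 'u \<Rightarrow>\<^sub>L real) \<Rightarrow> bool" where
  "evolves f u y g \<longleftrightarrow> wtriple T u y g \<and> (AE t in I_on T. g t + AA t (y t) = f t)"

lemma evolvesD: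
  assumes "evolves f u y g"
  shows "wtriple T u y g" "AE t in I_on T. g t + AA t (y t) = f t" "y \<in> bochner_L2 T" "g \<in> bochner_L2 T" "f \<in> bochner_L2 T"
    "continuous_on {0..T} u"
  using assms L2_cong_AE[OF L2_add[OF _ AA_bochner_L2], of g y f] unfolding evolves_def wtriple_def by auto

lemma evolves_diff:
  assumes "evolves f1 u1 y1 g1" "evolves f2 u2 y2 g2"
  shows "evolves (\<lambda>t. f1 t - f2 t) (\<lambda>t. u1 t - u2 t) (\<lambda>t. y1 t - y2 t) (\<lambda>t. g1 t - g2 t)"
  unfolding evolves_def
proof
  show "AE t in I_on T. g1 t - g2 t + AA t (y1 t - y2 t) = f1 t - f2 t"
    using evolvesD(2)[OF assms(1)] evolvesD(2)[OF assms(2)] by eventually_elim (simp add: AA_diff algebra_simps)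
qed (rule wtriple_diff[OF evolvesD(1)[OF assms(1)] evolvesD(1)[OF assms(2)]])

text \<open>Young's inequality spends one of the two \<alpha> given by coercivity on the data. The
  identity is applied on \<open>{0..t}\<close> for every t, which later turns L2 convergence of data
  into uniform convergence in \<open>H\<close>.\<close>

lemma energy_estimate:
  assumes ev: "evolves f u y g" and t: "t \<in> {0..T}"
  shows "(norm (u t))\<^sup>2 + \<alpha> * L2sq t y \<le> (norm (u 0))\<^sup>2 + L2sq t f / \<alpha>"
proof -
  note y = evolvesD(3)[OF ev] and g = evolvesD(4)[OF ev] and f = evolvesD(5)[OF ev]
  have t0: "0 \<le> t" "t \<le> T" using t by auto
  have y': "y \<in> bochner_L2 t" "g \<in> bochner_L2 t" "f \<in> bochner_L2 t" by (auto intro: L2_subinterval[OF _ t0(2)] y g f)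
  note E = wtriple_energy[OF wtriple_restrict[OF evolvesD(1)[OF ev] t0] t0(1)]
  have "AE s in I_on t. regular_time s" by (rule AE_lebesgue_on_subset[where B="{0..T}", OF AE_regular]) (use t0 in auto)
  moreover have "AE s in I_on t. g s + AA s (y s) = f s"
    by (rule AE_lebesgue_on_subset[where B="{0..T}", OF evolvesD(2)[OF ev]]) (use t0 in auto)
  ultimately have "AE s in I_on t. 2 * (g s) (y s) \<le> (norm (f s))\<^sup>2 / \<alpha> - \<alpha> * (norm (y s))\<^sup>2"
  proof eventually_elim
    case (elim s)
    have "2 * (g s) (y s) = 2 * (f s) (y s) - 2 * (AA s (y s)) (y s)"
      unfolding elim(2)[symmetric] by (simp add: blinfun.add_left)
    also have "\<dots> \<le> 2 * (norm (f s) * norm (y s)) - 2 * (\<alpha> * (norm (y s))\<^sup>2)"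
      using AA_coercive[OF elim(1), of "y s"] norm_blinfun[of "f s" "y s"] by simp
    also have "2 * (norm (f s) * norm (y s)) \<le> (norm (f s))\<^sup>2 / \<alpha> + \<alpha> * (norm (y s))\<^sup>2"
    proof -
      have "0 \<le> (norm (f s) - \<alpha> * norm (y s))\<^sup>2 / \<alpha>" using \<alpha> by simp
      also have "\<dots> = (norm (f s))\<^sup>2 / \<alpha> + \<alpha> * (norm (y s))\<^sup>2 - 2 * (norm (f s) * norm (y s))"
        using \<alpha> by (simp add: power2_eq_square field_simps)
      finally show ?thesis by simp
    qed
    finally show ?case by simp
  qed
  then have "(LINT s|I_on t. 2 * (g s) (y s)) \<le> (LINT s|I_on t. (norm (f s))\<^sup>2 / \<alpha> - \<alpha> * (norm (y s))\<^sup>2)"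
    using L2_integrable[OF y'(1)] L2_integrable[OF y'(3)] L2_integrable_pairing[OF y'(2,1)]
    by (intro integral_mono_AE) auto
  also have "\<dots> = L2sq t f / \<alpha> - \<alpha> * L2sq t y"
    using L2_integrable[OF y'(1)] L2_integrable[OF y'(3)] unfolding L2sq_def by simp
  finally show ?thesis using E by simp
qed

lemma AA_L2sq_le:
  assumes "y \<in> bochner_L2 T"
  shows "L2sq T (\<lambda>t. AA t (y t)) \<le> M\<^sup>2 * L2sq T y"
  using power_mono[OF norm_AA_le norm_ge_zero, of _ _ 2]
  by (intro L2sq_mono_AE AA_bochner_L2 assms) (simp add: power_mult_distrib)

text \<open>Differences of solutions are solutions, so the energy estimate makes the solutions
  Cauchy uniformly in \<open>H\<close> and in \<open>V\<close>. The operator is bounded on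
  \<open>V\<close>, hence the derivatives converge as well, and the integrated form of the
  derivative passes to the limit.\<close>

lemma evolves_limit:
  assumes ev: "\<And>i. evolves (f i) (u i) (y i) (g i)" and F: "F \<in> bochner_L2 T"
    and lim: "(\<lambda>i. L2sq T (\<lambda>t. f i t - F t)) \<longlonglongrightarrow> 0" "(\<lambda>i. u i 0) \<longlonglongrightarrow> \<xi>"
  shows "\<exists>U Y G. evolves F U Y G \<and> U 0 = \<xi>"
proof -
  note y = evolvesD(3)[OF ev] and f = evolvesD(5)[OF ev] and gi = evolvesD(4)[OF ev]
  define D where "D i j = (norm (u i 0 - u j 0))\<^sup>2 + L2sq T (\<lambda>t. f i t - f j t) / \<alpha>" for i j
  have D_bound: "(norm (u i t - u j t))\<^sup>2 \<le> D i j" "\<alpha> * L2sq T (\<lambda>t. y i t - y j t) \<le> D i j" if t: "t \<in> {0..T}" for i j t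
  proof -
    note dd = evolves_diff[OF ev[of i] ev[of j]]
    have "L2sq t (\<lambda>t. f i t - f j t) \<le> L2sq T (\<lambda>t. f i t - f j t)"
      using t by (intro L2sq_time_mono evolvesD(5)[OF dd]) auto
    then have "L2sq t (\<lambda>t. f i t - f j t) / \<alpha> \<le> L2sq T (\<lambda>t. f i t - f j t) / \<alpha>" using \<alpha> by (simp add: divide_right_mono)
    moreover have "0 \<le> \<alpha> * L2sq t (\<lambda>t. y i t - y j t)" using \<alpha> by simp
    ultimately show "(norm (u i t - u j t))\<^sup>2 \<le> D i j" using energy_estimate[OF dd t] unfolding D_def by linarith
    have TT: "T \<in> {0..T}" and nn: "0 \<le> (norm (u i T - u j T))\<^sup>2" using T by auto
    show "\<alpha> * L2sq T (\<lambda>t. y i t - y j t) \<le> D i j"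
      using energy_estimate[OF dd TT] nn unfolding D_def by linarith
  qed
  have D_small: "\<exists>n0. \<forall>i\<ge>n0. \<forall>j\<ge>n0. D i j < e" if e: "e > 0" for e
  proof -
    have e1: "e * \<alpha> / 8 > 0" and e2: "sqrt (e / 8) > 0" using e \<alpha> by auto
    obtain n1 where n1: "\<And>i. i \<ge> n1 \<Longrightarrow> L2sq T (\<lambda>t. f i t - F t) < e * \<alpha> / 8"
      using order_tendstoD(2)[OF lim(1) e1] unfolding eventually_sequentially by blast
    obtain n2 where n2: "\<And>i j. i \<ge> n2 \<Longrightarrow> j \<ge> n2 \<Longrightarrow> norm (u i 0 - u j 0) < sqrt (e / 8)"
      using LIMSEQ_imp_Cauchy[OF lim(2)] e2 unfolding Cauchy_iff by metis
    have "D i j < e" if ij: "i \<ge> max n1 n2" "j \<ge> max n1 n2" for i j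
    proof -
      have "(norm (u i 0 - u j 0))\<^sup>2 < (sqrt (e / 8))\<^sup>2"
        by (rule power_strict_mono[OF n2 norm_ge_zero]) (use ij in auto)
      then have 1: "(norm (u i 0 - u j 0))\<^sup>2 < e / 8" using e by simp
      have "L2sq T (\<lambda>t. f i t - f j t) \<le> 2 * L2sq T (\<lambda>t. f i t - F t) + 2 * L2sq T (\<lambda>t. F t - f j t)"
        by (rule L2sq_triangle[OF f F f])
      also have "L2sq T (\<lambda>t. F t - f j t) = L2sq T (\<lambda>t. f j t - F t)" unfolding L2sq_def by (simp add: norm_minus_commute)
      finally have "L2sq T (\<lambda>t. f i t - f j t) < e * \<alpha> / 2" using n1[of i] n1[of j] ij by simp
      then have "L2sq T (\<lambda>t. f i t - f j t) / \<alpha> < e / 2" using \<alpha> by (simp add: field_simps)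
      then show ?thesis using 1 e unfolding D_def by linarith
    qed
    then show ?thesis by blast
  qed
  obtain z r where z: "z \<in> bochner_L2 T" "strict_mono (r::nat\<Rightarrow>nat)" "AE t in I_on T. (\<lambda>i. y (r i) t) \<longlonglongrightarrow> z t"
      "(\<lambda>i. L2sq T (\<lambda>t. y i t - z t)) \<longlonglongrightarrow> 0"
  proof (rule L2_complete[OF _ y])
    fix e :: real assume e: "e > 0"
    then obtain n0 where n0: "\<forall>i\<ge>n0. \<forall>j\<ge>n0. D i j < \<alpha> * e" using D_small[of "\<alpha> * e"] \<alpha> by auto
    have "L2sq T (\<lambda>t. y i t - y j t) < e" if "i \<ge> n0" "j \<ge> n0" for i j
    proof -
      have "\<alpha> * L2sq T (\<lambda>t. y i t - y j t) < \<alpha> * e" using D_bound(2)[of T i j] n0 that T by force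
      then show ?thesis using \<alpha> by simp
    qed
    then show "\<exists>n0. \<forall>i\<ge>n0. \<forall>j\<ge>n0. L2sq T (\<lambda>t. y i t - y j t) < e" by blast
  qed (use T in auto)
  have "uniformly_Cauchy_on {0..T} u"
    unfolding uniformly_Cauchy_on_def
  proof (intro allI impI)
    fix e :: real assume e: "e > 0"
    then obtain n0 where n0: "\<forall>i\<ge>n0. \<forall>j\<ge>n0. D i j < e\<^sup>2" using D_small[of "e\<^sup>2"] by auto
    have "dist (u i t) (u j t) < e" if "t \<in> {0..T}" "i \<ge> n0" "j \<ge> n0" for i j t
    proof -
      have "(norm (u i t - u j t))\<^sup>2 < e\<^sup>2" using D_bound(1)[OF that(1), of i j] n0 that by force
      then show ?thesis using e by (simp add: dist_norm power2_less_imp_less)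
    qed
    then show "\<exists>M. \<forall>x\<in>{0..T}. \<forall>m\<ge>M. \<forall>n\<ge>M. dist (u m x) (u n x) < e" by blast
  qed
  then obtain U where U: "uniform_limit {0..T} u U sequentially"
    using Cauchy_uniformly_convergent unfolding uniformly_convergent_on_def by blast
  have U_pt: "(\<lambda>i. u i t) \<longlonglongrightarrow> U t" if "t \<in> {0..T}" for t using tendsto_uniform_limitI[OF U that] .
  \<comment> \<open>The limit of the derivatives is prescribed by the limit equation, so their
    convergence need only be checked rather than derived from completeness of the dual
    space.\<close>
  define G where "G t = F t - AA t (z t)" for t
  have G: "G \<in> bochner_L2 T" unfolding G_def by (rule L2_diff[OF F AA_bochner_L2[OF z(1)]])
  have g_lim: "(\<lambda>i. L2sq T (\<lambda>t. g i t - G t)) \<longlonglongrightarrow> 0"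
  proof (rule tendsto_sandwich[of "\<lambda>_. 0"])
    show "\<forall>\<^sub>F i in sequentially. L2sq T (\<lambda>t. g i t - G t) \<le> 2 * L2sq T (\<lambda>t. f i t - F t) + 2 * (M\<^sup>2 * L2sq T (\<lambda>t. y i t - z t))"
    proof (intro always_eventually allI)
      fix i
      have yz: "(\<lambda>t. y i t - z t) \<in> bochner_L2 T" by (rule L2_diff[OF y z(1)])
      have "L2sq T (\<lambda>t. g i t - G t) = L2sq T (\<lambda>t. (f i t - F t) - AA t (y i t - z t))"
      proof (rule L2sq_cong_AE)
        show "AE t in I_on T. norm (g i t - G t) = norm ((f i t - F t) - AA t (y i t - z t))"
          using evolvesD(2)[OF ev[of i]]
        proof eventually_elim
          case (elim t)
          show ?case unfolding G_def AA_diff elim[symmetric] by (simp add: algebra_simps)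
        qed
      qed (intro L2_sm L2_diff gi G f F AA_bochner_L2[OF yz])+
      also have "\<dots> \<le> 2 * L2sq T (\<lambda>t. f i t - F t) + 2 * L2sq T (\<lambda>t. AA t (y i t - z t))"
        by (intro L2sq_diff_le L2_diff f F AA_bochner_L2[OF yz])
      also have "L2sq T (\<lambda>t. AA t (y i t - z t)) \<le> M\<^sup>2 * L2sq T (\<lambda>t. y i t - z t)" by (rule AA_L2sq_le[OF yz])
      finally show "L2sq T (\<lambda>t. g i t - G t) \<le> 2 * L2sq T (\<lambda>t. f i t - F t) + 2 * (M\<^sup>2 * L2sq T (\<lambda>t. y i t - z t))" by simp
    qed
    show "(\<lambda>i. 2 * L2sq T (\<lambda>t. f i t - F t) + 2 * (M\<^sup>2 * L2sq T (\<lambda>t. y i t - z t))) \<longlonglongrightarrow> 0"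
      using tendsto_add[OF tendsto_mult_left[OF lim(1), of 2] tendsto_mult_left[OF tendsto_mult_left[OF z(4), of "M\<^sup>2"], of 2]] by simp
  qed auto
  have "evolves F U z G"
    unfolding evolves_def wtriple_def
  proof (intro conjI ballI allI)
    show "continuous_on {0..T} U"
      by (rule uniform_limit_theorem[OF _ U]) (use evolvesD(6)[OF ev] in auto)
    show "AE t in I_on T. G t + AA t (z t) = F t" by (simp add: G_def)
    have "AE t in I_on T. \<forall>i. \<iota> (y i t) = u i t"
      unfolding AE_all_countable using evolvesD(1)[OF ev] unfolding wtriple_def by blast
    moreover have "AE t in I_on T. t \<in> {0..T}" by (rule AE_I2) simp
    ultimately show "AE t in I_on T. \<iota> (z t) = U t"
      using z(3)
    proof eventually_elim
      case (elim t)
      \<comment> \<open>The uniform limit in \<open>H\<close> and the limit in \<open>V\<close> are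
        matched pointwise along the almost everywhere convergent subsequence.\<close>
      have "(\<lambda>i. u (r i) t) \<longlonglongrightarrow> U t" using LIMSEQ_subseq_LIMSEQ[OF U_pt[OF elim(2)] z(2)] by (simp add: o_def)
      moreover have "(\<lambda>i. \<iota> (y (r i) t)) \<longlonglongrightarrow> \<iota> (z t)" by (rule \<iota>.tendsto[OF elim(3)])
      ultimately show ?case using elim(1) LIMSEQ_unique by auto
    qed
    fix t v assume t: "t \<in> {0..T}"
    have "(\<lambda>i. (u i t - u i 0) \<bullet> \<iota> v) \<longlonglongrightarrow> (U t - U 0) \<bullet> \<iota> v"
      using T by (intro tendsto_intros U_pt t) auto
    moreover have "(\<lambda>i. (u i t - u i 0) \<bullet> \<iota> v) \<longlonglongrightarrow> (LINT s|I_on t. (G s) v)"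
    proof -
      have tT: "t \<le> T" "0 \<le> t" using t by auto
      have "(\<lambda>i. LINT s|I_on t. (g i s) v) \<longlonglongrightarrow> (LINT s|I_on t. (G s) v)"
      proof (rule L2_pairing_tendsto)
        show "(\<lambda>i. L2sq t (\<lambda>s. g i s - G s)) \<longlonglongrightarrow> 0"
          by (rule tendsto_sandwich[OF always_eventually always_eventually tendsto_const g_lim])
            (use L2sq_time_mono[OF L2_diff[OF gi G] tT(2,1)] in auto)
      qed (use L2_subinterval[OF _ tT(1)] gi G in \<open>auto simp: L2sq_def\<close>)
      then show ?thesis using evolvesD(1)[OF ev] t unfolding wtriple_def by simp
    qed
    ultimately show "(U t - U 0) \<bullet> \<iota> v = (LINT s|I_on t. (G s) v)" by (rule LIMSEQ_unique)
  qed (use z(1) G in auto)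
  moreover have "U 0 = \<xi>" using LIMSEQ_unique[OF U_pt lim(2)] T by simp
  ultimately show ?thesis by blast
qed

end

section \<open>The model equation whose operator is a multiple of the Riesz map\<close>

locale heat_form = gelfand_triple C \<iota>
  for C :: "nat \<Rightarrow> 'u::{real_inner,banach} set" and \<iota> :: "'u \<Rightarrow> 'h::{real_inner,banach}" +
  fixes T c :: real
  assumes T: "T > 0" and \<iota>_inj: "inj \<iota>" and c: "c > 0"
begin

lemma form_bound: "\<bar>c * (v \<bullet> w)\<bar> \<le> max 1 c * norm v * norm (w::'u)"
proof -
  have "\<bar>c * (v \<bullet> w)\<bar> \<le> c * (norm v * norm w)" using c Cauchy_Schwarz_ineq2[of v w] by (simp add: abs_mult)
  also have "\<dots> \<le> max 1 c * (norm v * norm w)" by (intro mult_right_mono) auto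
  finally show ?thesis by (simp add: mult.assoc)
qed

end

text \<open>The maximum with 1 reflects the convention that the bound of a form is at least
  1.\<close>

sublocale heat_form \<subseteq> heat: evolution_form C \<iota> T "max 1 c" c "\<lambda>t x v. c * (x \<bullet> v)"
proof
  fix t assume "t \<in> {0..T}"
  show "bilinear (\<lambda>x v. c * (x \<bullet> v))"
    by (auto simp: bilinear_def inner_add_left inner_add_right algebra_simps intro!: linearI)
qed (use form_bound T \<iota>_inj c in \<open>auto simp: power2_norm_eq_inner\<close>)

context heat_form
begin

lemma regular_time_iff: "heat.regular_time t \<longleftrightarrow> t \<in> {0..T}"
  unfolding heat.regular_time_def using form_bound by blast

lemma heat_AA: "t \<in> {0..T} \<Longrightarrow> heat.AA t x = c *\<^sub>R blinfun_inner_right x"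
  by (rule blinfun_eqI) (simp add: heat.AA_apply regular_time_iff blinfun.scaleR_left)

text \<open>One implicit Euler step in the full space \<open>U\<close>; the form to be inverted is
  symmetric, so minimisation provides the solution.\<close>

lemma resolvent:
  assumes k: "k > 0"
  shows "\<exists>z. \<forall>v. \<iota> (z - x) \<bullet> \<iota> v + k * c * ((z - b) \<bullet> v) = 0"
proof -
  obtain K where K: "\<And>x. norm (\<iota> x) \<le> norm x * K" "K > 0" using \<iota>.pos_bounded by blast
  have kc: "k * c > 0" using k c by simp
  have "bounded_bilinear (\<lambda>x v. \<iota> x \<bullet> \<iota> v + k * c * (x \<bullet> v))"
  proof
    show "\<exists>B. \<forall>x v. norm (\<iota> x \<bullet> \<iota> v + k * c * (x \<bullet> v)) \<le> norm x * norm v * B"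
    proof (intro exI allI)
      fix x v
      have "\<bar>\<iota> x \<bullet> \<iota> v\<bar> \<le> (norm x * K) * (norm v * K)"
        by (rule order_trans[OF Cauchy_Schwarz_ineq2]) (intro mult_mono K(1); use K(2) in simp)
      moreover have "\<bar>k * c * (x \<bullet> v)\<bar> \<le> k * c * (norm x * norm v)"
        unfolding abs_mult[of "k * c"] using kc Cauchy_Schwarz_ineq2[of x v] by (intro mult_mono) auto
      ultimately show "norm (\<iota> x \<bullet> \<iota> v + k * c * (x \<bullet> v)) \<le> norm x * norm v * (K * K + k * c)"
        by (simp add: algebra_simps)
    qed
  qed (simp_all add: \<iota>.add \<iota>.scaleR inner_add_left inner_add_right algebra_simps)
  moreover have "bounded_linear (\<lambda>v. \<iota> x \<bullet> \<iota> v + k * c * (b \<bullet> v))"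
    by (intro bounded_linear_add bounded_linear_compose[OF bounded_linear_inner_right \<iota>]
        bounded_linear_const_mult bounded_linear_inner_right)
  ultimately have "\<exists>z. \<forall>v. \<iota> z \<bullet> \<iota> v + k * c * (z \<bullet> v) = \<iota> x \<bullet> \<iota> v + k * c * (b \<bullet> v)"
    by (intro symmetric_Lax_Milgram[OF _ _ kc]) (auto simp: inner_commute power2_norm_eq_inner)
  then show ?thesis by (simp add: \<iota>.diff inner_diff_left algebra_simps)
qed

text \<open>Testing a step with its own increment makes the \<open>H\<close>-term nonnegative, so
  the deviation \<open>e\<close> from the data grows by at most L k per step and stays below T L.
  Telescoping its squared norms then bounds the sum of squared increments in \<open>U\<close>
  independently of the step size; the start \<open>Y 0 = F 0\<close> makes the initial deviation
  vanish.\<close>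

lemma rothe_increments:
  fixes F Y :: "nat \<Rightarrow> 'u"
  assumes k: "k > 0" "real N * k = T" and L: "L \<ge> 0" "\<And>m. norm (F (Suc m) - F m) \<le> L * k" and Y0: "Y 0 = F 0"
    and step: "\<And>m v. \<iota> (Y (Suc m) - Y m) \<bullet> \<iota> v + k * c * ((Y (Suc m) - F (Suc m)) \<bullet> v) = 0"
  shows "(\<Sum>m<N. (norm (Y (Suc m) - Y m))\<^sup>2) \<le> 4 * T\<^sup>2 * L\<^sup>2 + 2 * T * L\<^sup>2 * k"
proof -
  define e where "e m = Y m - F m" for m
  have kc: "k * c > 0" using k c by simp
  have bound: "(norm (e (Suc m)))\<^sup>2 - e (Suc m) \<bullet> e m \<le> norm (e (Suc m)) * (L * k)" for m
  proof -
    have "k * c * (e (Suc m) \<bullet> (Y (Suc m) - Y m)) \<le> 0"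
      using step[of m "Y (Suc m) - Y m"] inner_ge_zero[of "\<iota> (Y (Suc m) - Y m)"] unfolding e_def by linarith
    then have "e (Suc m) \<bullet> (Y (Suc m) - Y m) \<le> 0" using kc by (meson mult_pos_pos not_le)
    moreover have "Y (Suc m) - Y m = (e (Suc m) - e m) + (F (Suc m) - F m)" unfolding e_def by simp
    ultimately have "(norm (e (Suc m)))\<^sup>2 - e (Suc m) \<bullet> e m \<le> - (e (Suc m) \<bullet> (F (Suc m) - F m))"
      by (simp add: inner_add_right inner_diff_right power2_norm_eq_inner)
    also have "\<dots> \<le> norm (e (Suc m)) * norm (F (Suc m) - F m)"
      using Cauchy_Schwarz_ineq2[of "e (Suc m)" "F (Suc m) - F m"] by linarith
    also have "\<dots> \<le> norm (e (Suc m)) * (L * k)" by (intro mult_left_mono L(2)) simp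
    finally show ?thesis .
  qed
  have e_step: "norm (e (Suc m)) \<le> norm (e m) + L * k" for m
  proof (cases "e (Suc m) = 0")
    case False
    have "norm (e (Suc m)) * norm (e (Suc m)) \<le> norm (e (Suc m)) * (norm (e m) + L * k)"
      using bound[of m] norm_cauchy_schwarz[of "e (Suc m)" "e m"] by (simp add: power2_eq_square algebra_simps)
    then show ?thesis using False by simp
  qed (use L(1) k(1) in simp)
  have e_le: "norm (e m) \<le> real m * (L * k)" for m
  proof (induction m)
    case (Suc m)
    then show ?case using e_step[of m] by (simp add: algebra_simps)
  qed (simp add: e_def Y0)
  have "(norm (e (Suc m) - e m))\<^sup>2 \<le> 2 * (T * L) * (L * k) + ((norm (e m))\<^sup>2 - (norm (e (Suc m)))\<^sup>2)" if m: "m < N" for m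
  proof -
    have "real (Suc m) * (L * k) \<le> real N * (L * k)" using m L(1) k(1) by (intro mult_right_mono) auto
    also have "real N * (L * k) = T * L" using k(2) by (simp add: mult_ac)
    finally have "norm (e (Suc m)) \<le> T * L" using e_le[of "Suc m"] by linarith
    then have "norm (e (Suc m)) * (L * k) \<le> (T * L) * (L * k)" using L(1) k(1) by (intro mult_right_mono) auto
    then have b: "2 * ((norm (e (Suc m)))\<^sup>2 - e (Suc m) \<bullet> e m) \<le> 2 * ((T * L) * (L * k))"
      using order_trans[OF bound[of m]] by (intro mult_left_mono) auto
    \<comment> \<open>The last bracket telescopes, and the first is controlled by
      \<open>bound\<close>.\<close>
    have "(norm (e (Suc m) - e m))\<^sup>2 = 2 * ((norm (e (Suc m)))\<^sup>2 - e (Suc m) \<bullet> e m) + ((norm (e m))\<^sup>2 - (norm (e (Suc m)))\<^sup>2)"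
      by (simp add: power2_norm_eq_inner inner_diff_left inner_diff_right inner_commute)
    then show ?thesis using b by (simp only: mult.assoc add_right_mono)
  qed
  then have "(\<Sum>m<N. (norm (e (Suc m) - e m))\<^sup>2) \<le> (\<Sum>m<N. 2 * (T * L) * (L * k) + ((norm (e m))\<^sup>2 - (norm (e (Suc m)))\<^sup>2))"
    by (intro sum_mono) simp
  also have "\<dots> = real N * (2 * (T * L) * (L * k)) + ((norm (e 0))\<^sup>2 - (norm (e N))\<^sup>2)"
    by (simp add: sum.distrib sum_lessThan_telescope'[of "\<lambda>m. (norm (e m))\<^sup>2"])
  also have "real N * (2 * (T * L) * (L * k)) = 2 * T\<^sup>2 * L\<^sup>2"
    using k(2) by (simp add: power2_eq_square mult_ac flip: k(2))
  also have "(norm (e 0))\<^sup>2 = 0" by (simp add: e_def Y0)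
  finally have sum_e: "(\<Sum>m<N. (norm (e (Suc m) - e m))\<^sup>2) \<le> 2 * T\<^sup>2 * L\<^sup>2" by (smt (verit) zero_le_power2)
  have "(norm (Y (Suc m) - Y m))\<^sup>2 \<le> 2 * (norm (e (Suc m) - e m))\<^sup>2 + 2 * (L * k)\<^sup>2" for m
  proof -
    have "Y (Suc m) - Y m = (e (Suc m) - e m) + (F (Suc m) - F m)" unfolding e_def by simp
    moreover have "(norm (F (Suc m) - F m))\<^sup>2 \<le> (L * k)\<^sup>2" by (intro power_mono L(2)) simp
    ultimately show ?thesis using norm_add_sq_le[of "e (Suc m) - e m" "F (Suc m) - F m"] by simp
  qed
  then have "(\<Sum>m<N. (norm (Y (Suc m) - Y m))\<^sup>2) \<le> (\<Sum>m<N. 2 * (norm (e (Suc m) - e m))\<^sup>2 + 2 * (L * k)\<^sup>2)"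
    by (rule sum_mono)
  also have "\<dots> = 2 * (\<Sum>m<N. (norm (e (Suc m) - e m))\<^sup>2) + 2 * (real N * k) * L\<^sup>2 * k"
    by (simp add: sum.distrib sum_distrib_left[symmetric] power2_eq_square)
  also have "\<dots> \<le> 4 * T\<^sup>2 * L\<^sup>2 + 2 * T * L\<^sup>2 * k" using sum_e unfolding k(2) by (simp add: mult.commute mult.left_commute)
  finally show ?thesis .
qed

text \<open>The interpolant of the Euler values solves the equation exactly for the right-hand side
  \<open>f\<close> that it generates. On a cell, \<open>f\<close> misses the intended data only by
  the distance of the interpolant and of the data to their values at the right end; the bounded sum
  of squared increments makes this of order k in the squared norm.\<close>

lemma rothe_approximation:
  assumes L: "L \<ge> 0" "\<And>s t. norm (F t - F s) \<le> L * \<bar>t - s\<bar>" and N: "N > 0"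
  shows "\<exists>f u y g. heat.evolves f u y g \<and> u 0 = \<iota> (F 0) \<and>
    L2sq T (\<lambda>t. f t - c *\<^sub>R blinfun_inner_right (F t))
      \<le> (T / real N) * (2 * c\<^sup>2 * (4 * T\<^sup>2 * L\<^sup>2 + 2 * T * L\<^sup>2 * (T / real N) + T * L\<^sup>2 * (T / real N)))"
proof -
  interpret D: discrete_evolution C \<iota> T "max 1 c" c "\<lambda>t x v. c * (x \<bullet> v)" N 1
    by unfold_locales (use N in auto)
  define k where "k = D.k"
  have kT: "k = T / real N" unfolding k_def by (rule D.k_def)
  have k: "k > 0" "real N * k = T" unfolding kT using T N by auto
  interpret partition T N "\<lambda>m. real m * k" unfolding k_def by (rule D.k_partition)
  obtain R where R: "\<And>x b v. \<iota> (R x b - x) \<bullet> \<iota> v + k * c * ((R x b - b) \<bullet> v) = 0"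
    using resolvent[OF k(1)] by metis
  define Fk where "Fk m = F (real m * k)" for m
  define Y where "Y = rec_nat (F 0) (\<lambda>m x. R x (Fk (Suc m)))"
  have Y0: "Y 0 = Fk 0" unfolding Y_def Fk_def by simp
  have step: "\<iota> (Y (Suc m) - Y m) \<bullet> \<iota> v + k * c * ((Y (Suc m) - Fk (Suc m)) \<bullet> v) = 0" for m v
    using R[of "Y m" "Fk (Suc m)" v] unfolding Y_def by simp
  have FL: "norm (Fk (Suc m) - Fk m) \<le> L * k" for m
    using L(2)[of "real (Suc m) * k" "real m * k"] k(1) unfolding Fk_def by (simp add: algebra_simps)
  define f where "f t = emb (pd Y t) + heat.AA t (pl Y t)" for t
  have w: "wtriple T (\<lambda>t. \<iota> (pl Y t)) (pl Y) (\<lambda>t. emb (pd Y t))" by (rule pl_wtriple[OF partition_axioms N])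
  have ev: "heat.evolves f (\<lambda>t. \<iota> (pl Y t)) (pl Y) (\<lambda>t. emb (pd Y t))"
    unfolding heat.evolves_def f_def using w by simp
  have "L2sq T (\<lambda>t. f t - c *\<^sub>R blinfun_inner_right (F t)) \<le> (\<Sum>m<N. k * (c * (norm (Y (Suc m) - Y m) + L * k))\<^sup>2)"
    unfolding k_def
  proof (rule D.L2sq_cellwise, unfold k_def[symmetric])
    fix m t assume m: "m < N" and t: "real m * k < t" "t < real (Suc m) * k"
    have tT: "t \<in> {0..T}" using t \<sigma>_bounds[of m] \<sigma>_bounds[of "Suc m"] m by auto
    have d: "slope Y m = (Y (Suc m) - Y m) /\<^sub>R k" unfolding slope_def by (simp add: algebra_simps)
    have e1: "emb (slope Y m) = - (c *\<^sub>R blinfun_inner_right (Y (Suc m) - Fk (Suc m)))"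
    proof (rule blinfun_eqI)
      fix v
      have "k * (\<iota> (slope Y m) \<bullet> \<iota> v) = \<iota> (Y (Suc m) - Y m) \<bullet> \<iota> v" unfolding d using k(1) by (simp add: \<iota>.scaleR)
      also have "\<dots> = k * - (c * ((Y (Suc m) - Fk (Suc m)) \<bullet> v))" using step[of m v] by simp
      finally have "\<iota> (slope Y m) \<bullet> \<iota> v = - (c * ((Y (Suc m) - Fk (Suc m)) \<bullet> v))" using k(1) by (simp only: mult_cancel_left) simp
      then show "(emb (slope Y m)) v = (- (c *\<^sub>R blinfun_inner_right (Y (Suc m) - Fk (Suc m)))) v"
        by (simp add: blinfun.minus_left blinfun.scaleR_left)
    qed
    have "f t - c *\<^sub>R blinfun_inner_right (F t) = c *\<^sub>R blinfun_inner_right ((pl Y t - Y (Suc m)) + (Fk (Suc m) - F t))"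
      unfolding f_def pd_cell[OF m t] e1 heat_AA[OF tT]
      by (rule blinfun_eqI) (simp add: blinfun.bilinear_simps inner_diff_left inner_add_left algebra_simps)
    then have "norm (f t - c *\<^sub>R blinfun_inner_right (F t)) = c * norm ((pl Y t - Y (Suc m)) + (Fk (Suc m) - F t))"
      using c by simp
    also have "\<dots> \<le> c * (norm (Y (Suc m) - Y m) + L * k)"
    proof (intro mult_left_mono norm_triangle_le add_mono)
      show "norm (pl Y t - Y (Suc m)) \<le> norm (Y (Suc m) - Y m)"
        using pl_convex[OF m, of t "Y (Suc m)" Y "norm (Y (Suc m) - Y m)"] t by (simp add: norm_minus_commute)
      have "norm (Fk (Suc m) - F t) \<le> L * \<bar>real (Suc m) * k - t\<bar>" unfolding Fk_def by (rule L(2))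
      also have "\<dots> \<le> L * k" using t L(1) by (intro mult_left_mono) (auto simp: algebra_simps)
      finally show "norm (Fk (Suc m) - F t) \<le> L * k" .
    qed (use c in simp)
    finally show "norm (f t - c *\<^sub>R blinfun_inner_right (F t)) \<le> c * (norm (Y (Suc m) - Y m) + L * k)" .
  qed (use c L(1) k(1) in simp)
  also have "\<dots> \<le> (\<Sum>m<N. k * (c\<^sup>2 * (2 * (norm (Y (Suc m) - Y m))\<^sup>2 + 2 * (L * k)\<^sup>2)))"
    unfolding power_mult_distrib[of c] by (intro sum_mono mult_left_mono sum_sq_le) (use k(1) in auto)
  also have "\<dots> = k * (2 * c\<^sup>2 * ((\<Sum>m<N. (norm (Y (Suc m) - Y m))\<^sup>2) + (real N * k) * L\<^sup>2 * k))"
    by (simp add: sum_distrib_left[symmetric] sum.distrib power2_eq_square algebra_simps)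
  also have "\<dots> \<le> k * (2 * c\<^sup>2 * (4 * T\<^sup>2 * L\<^sup>2 + 2 * T * L\<^sup>2 * k + T * L\<^sup>2 * k))"
    unfolding k(2) using rothe_increments[OF k L(1) FL Y0 step] k(1) T by (intro mult_left_mono add_mono) auto
  finally show ?thesis using ev pl_node[of 0 Y] N unfolding kT[symmetric] Y0 Fk_def
    by (intro exI[of _ f] exI[of _ "\<lambda>t. \<iota> (pl Y t)"] exI conjI) auto
qed

end

context heat_form
begin

lemma heat_Lipschitz_data:
  assumes L: "L \<ge> 0" "\<And>s t. norm (F t - F s) \<le> L * \<bar>t - s\<bar>"
  shows "\<exists>u y g. heat.evolves (\<lambda>t. c *\<^sub>R blinfun_inner_right (F t)) u y g \<and> u 0 = \<iota> (F 0)"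
proof -
  define R where "R k = k * (2 * c\<^sup>2 * (4 * T\<^sup>2 * L\<^sup>2 + 2 * T * L\<^sup>2 * k + T * L\<^sup>2 * k))" for k
  have "\<exists>f u y g. heat.evolves f u y g \<and> u 0 = \<iota> (F 0)
      \<and> L2sq T (\<lambda>t. f t - c *\<^sub>R blinfun_inner_right (F t)) \<le> R (T / real (Suc i))" for i
    unfolding R_def by (rule rothe_approximation[OF L]) simp
  then have "\<forall>i. \<exists>f u y g. heat.evolves f u y g \<and> u 0 = \<iota> (F 0)
      \<and> L2sq T (\<lambda>t. f t - c *\<^sub>R blinfun_inner_right (F t)) \<le> R (T / real (Suc i))" by (rule allI)
  then obtain f u y g where "\<forall>i. heat.evolves (f i) (u i) (y i) (g i) \<and> u i 0 = \<iota> (F 0)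
      \<and> L2sq T (\<lambda>t. f i t - c *\<^sub>R blinfun_inner_right (F t)) \<le> R (T / real (Suc i))"
    unfolding choice_iff by (elim exE)
  then have ev: "heat.evolves (f i) (u i) (y i) (g i)" and u0: "u i 0 = \<iota> (F 0)"
      and fR: "L2sq T (\<lambda>t. f i t - c *\<^sub>R blinfun_inner_right (F t)) \<le> R (T / real (Suc i))" for i by blast+
  have Fc: "continuous_on {0..T} F"
    unfolding continuous_on_iff
  proof (intro ballI allI impI)
    fix t e :: real assume e: "e > 0"
    have "dist (F s) (F t) < e" if "dist s t < e / (L + 1)" for s
    proof -
      have "dist (F s) (F t) \<le> L * dist s t" using L(2)[of s t] by (simp add: dist_norm)
      also have "\<dots> \<le> (L + 1) * dist s t" by (intro mult_right_mono) auto
      also have "\<dots> < e" using that L(1) by (simp add: field_simps)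
      finally show ?thesis .
    qed
    then show "\<exists>d>0. \<forall>s\<in>{0..T}. dist s t < d \<longrightarrow> dist (F s) (F t) < e"
      using e L(1) by (intro exI[of _ "e / (L + 1)"]) auto
  qed
  have F2: "(\<lambda>t. c *\<^sub>R blinfun_inner_right (F t)) \<in> bochner_L2 T"
    by (intro L2_scaleR L2_bounded_linear[OF continuous_bochner_L2[OF Fc]] bounded_linear_blinfun_inner_right)
  have k0: "(\<lambda>i. T / real (Suc i)) \<longlonglongrightarrow> 0" using tendsto_mult_right_zero[OF LIMSEQ_inverse_real_of_nat, of T]
    by (simp add: divide_inverse)
  have "(\<lambda>i. R (T / real (Suc i))) \<longlonglongrightarrow> 0 * (2 * c\<^sup>2 * (4 * T\<^sup>2 * L\<^sup>2 + 2 * T * L\<^sup>2 * 0 + T * L\<^sup>2 * 0))"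
    unfolding R_def by (intro tendsto_intros k0)
  then have "(\<lambda>i. R (T / real (Suc i))) \<longlonglongrightarrow> 0" by simp
  then have "(\<lambda>i. L2sq T (\<lambda>t. f i t - c *\<^sub>R blinfun_inner_right (F t))) \<longlonglongrightarrow> 0"
    by (rule tendsto_sandwich[of "\<lambda>_. 0", rotated 3]) (use fR in auto)
  then show ?thesis by (rule heat.evolves_limit[OF ev F2]) (simp add: u0)
qed

text \<open>A ramp of width \<delta> at time 0 shifts the value there by \<open>d\<close> at an L2
  cost that vanishes with \<delta>; this makes Lipschitz data compatible with a prescribed initial
  value.\<close>

lemma cutoff_L2sq:
  fixes d :: "'b::real_normed_vector"
  assumes \<delta>: "0 < \<delta>"
  shows "L2sq T (\<lambda>t. max 0 (1 - t / \<delta>) *\<^sub>R d) \<le> \<delta> * (norm d)\<^sup>2"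
proof -
  have A: "{0..min \<delta> T} \<in> sets (I_on T)" by (simp add: sets_restrict_space_iff)
  have "L2sq T (\<lambda>t. max 0 (1 - t / \<delta>) *\<^sub>R d) \<le> (LINT t|I_on T. (norm d)\<^sup>2 * indicator {0..min \<delta> T} t)"
    unfolding L2sq_def
  proof (rule integral_mono')
    have "integrable (I_on T) (\<lambda>t. indicator {0..min \<delta> T} t *\<^sub>R (norm d)\<^sup>2)"
      by (intro integrable_mult_indicator A) simp
    then show "integrable (I_on T) (\<lambda>t. (norm d)\<^sup>2 * indicator {0..min \<delta> T} t)" by (simp add: mult.commute)
    fix t assume "t \<in> space (I_on T)"
    then have t: "0 \<le> t" "t \<le> T" by auto
    show "(norm (max 0 (1 - t / \<delta>) *\<^sub>R d))\<^sup>2 \<le> (norm d)\<^sup>2 * indicator {0..min \<delta> T} t"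
    proof (cases "t \<le> \<delta>")
      case True
      then have "norm (max 0 (1 - t / \<delta>) *\<^sub>R d) \<le> 1 * norm d"
        unfolding norm_scaleR using t \<delta> by (intro mult_right_mono) auto
      then show ?thesis using True t by (simp add: power_mono)
    next
      case False
      then have "1 - t / \<delta> \<le> 0" using \<delta> by simp
      then show ?thesis using False by (simp add: max_def)
    qed
  qed simp
  also have "\<dots> = (norm d)\<^sup>2 * measure (I_on T) ({0..min \<delta> T} \<inter> space (I_on T))" by simp
  also have "{0..min \<delta> T} \<inter> space (I_on T) = {0..min \<delta> T}" by auto
  also have "measure (I_on T) {0..min \<delta> T} = min \<delta> T"
    using T \<delta> by (subst measure_restrict_space) auto
  also have "(norm d)\<^sup>2 * min \<delta> T \<le> (norm d)\<^sup>2 * \<delta>" by (intro mult_left_mono) auto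
  finally show ?thesis by (simp add: mult.commute)
qed

lemma cutoff_Lipschitz:
  fixes d :: "'b::real_normed_vector"
  assumes \<delta>: "0 < \<delta>"
  shows "norm (max 0 (1 - t / \<delta>) *\<^sub>R d - max 0 (1 - s / \<delta>) *\<^sub>R d) \<le> (norm d / \<delta>) * \<bar>t - s\<bar>"
proof -
  have "\<bar>max 0 (1 - t / \<delta>) - max 0 (1 - s / \<delta>)\<bar> \<le> \<bar>t / \<delta> - s / \<delta>\<bar>" by (auto simp: max_def)
  also have "\<dots> = \<bar>t - s\<bar> / \<delta>" using \<delta> by (simp add: diff_divide_distrib[symmetric])
  finally have "\<bar>max 0 (1 - t / \<delta>) - max 0 (1 - s / \<delta>)\<bar> * norm d \<le> (\<bar>t - s\<bar> / \<delta>) * norm d"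
    by (rule mult_right_mono) simp
  then show ?thesis unfolding scaleR_diff_left[symmetric] norm_scaleR by (simp add: mult.commute)
qed

text \<open>Through the Riesz map the data become a function \<open>z\<close> in \<open>V\<close>,
  approximable by Lipschitz functions. The Euler scheme starts at the value of the data at time 0,
  so this value is first moved to a vector whose image lies near \<xi>; such a vector exists by
  density.\<close>

theorem heat_solvable:
  assumes dense: "closure (range \<iota>) = UNIV" and f: "f \<in> bochner_L2 T"
  shows "\<exists>u y g. heat.evolves f u y g \<and> u 0 = \<xi>"
proof -
  define z where "z t = riesz (f t) /\<^sub>R c" for t
  have z: "z \<in> bochner_L2 T" unfolding z_def by (intro L2_scaleR L2_bounded_linear[OF f bounded_linear_riesz])
  have fz: "f t = c *\<^sub>R blinfun_inner_right (z t)" for t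
    unfolding z_def blinfun_inner_right_linear blinfun_inner_right_riesz using c by simp
  have approx: "\<exists>F L. L \<ge> 0 \<and> (\<forall>s t. norm (F t - F s) \<le> L * \<bar>t - s\<bar>) \<and> L2sq T (\<lambda>t. z t - F t) \<le> e \<and> norm (\<iota> (F 0) - \<xi>) \<le> e"
    if e: "e > 0" for e
  proof -
    obtain n \<sigma> x where p: "partition T n \<sigma>" "n > 0" "L2sq T (\<lambda>t. z t - partition.pl n \<sigma> x t) \<le> e / 4"
      using L2_pl_dense[OF T z, of "e / 4"] e by auto
    interpret partition T n \<sigma> by (rule p(1))
    obtain L where L: "L \<ge> 0" "\<And>s t. norm (pl x t - pl x s) \<le> L * \<bar>t - s\<bar>" using pl_lipschitz[of x] by blast
    have "\<xi> \<in> closure (range \<iota>)" using dense by simp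
    then obtain b where b: "dist (\<iota> b) \<xi> < e" using e unfolding closure_approachable by blast
    define d where "d = b - pl x 0"
    \<comment> \<open>The correction \<open>d\<close> may be large when \<xi> is poorly approximated
      in \<open>U\<close>; the width of the ramp is adapted to it.\<close>
    define \<delta> where "\<delta> = e / (4 * ((norm d)\<^sup>2 + 1))"
    have D: "0 < (norm d)\<^sup>2 + 1" using zero_le_power2[of "norm d"] by linarith
    have \<delta>: "\<delta> > 0" unfolding \<delta>_def using e D by simp
    have \<delta>d: "\<delta> * (norm d)\<^sup>2 \<le> e / 4"
    proof -
      have "\<delta> * (norm d)\<^sup>2 \<le> \<delta> * ((norm d)\<^sup>2 + 1)" using \<delta> by simp
      also have "\<dots> = e / 4" unfolding \<delta>_def using D by (simp add: field_simps)
      finally show ?thesis .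
    qed
    define F where "F t = pl x t + max 0 (1 - t / \<delta>) *\<^sub>R d" for t
    have cut: "(\<lambda>t. max 0 (1 - t / \<delta>) *\<^sub>R d) \<in> bochner_L2 T"
      by (intro continuous_bochner_L2 continuous_intros) (use \<delta> in auto)
    have FL: "norm (F t - F s) \<le> (L + norm d / \<delta>) * \<bar>t - s\<bar>" for s t
    proof -
      have "F t - F s = (pl x t - pl x s) + (max 0 (1 - t / \<delta>) *\<^sub>R d - max 0 (1 - s / \<delta>) *\<^sub>R d)" unfolding F_def by simp
      also have "norm \<dots> \<le> L * \<bar>t - s\<bar> + (norm d / \<delta>) * \<bar>t - s\<bar>"
        by (rule norm_triangle_le) (intro add_mono L(2) cutoff_Lipschitz \<delta>)
      finally show ?thesis by (simp add: distrib_right)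
    qed
    have pl2: "pl x \<in> bochner_L2 T" by (intro continuous_bochner_L2 continuous_pl)
    have "L2sq T (\<lambda>t. z t - F t) = L2sq T (\<lambda>t. (z t - pl x t) - max 0 (1 - t / \<delta>) *\<^sub>R d)"
      unfolding F_def by (simp add: algebra_simps)
    also have "\<dots> \<le> 2 * L2sq T (\<lambda>t. z t - pl x t) + 2 * L2sq T (\<lambda>t. max 0 (1 - t / \<delta>) *\<^sub>R d)"
      by (intro L2sq_diff_le L2_diff z pl2 cut)
    also have "\<dots> \<le> e" using p(3) cutoff_L2sq[OF \<delta>, of d] \<delta>d by linarith
    finally have "L2sq T (\<lambda>t. z t - F t) \<le> e" .
    moreover have "F 0 = b" unfolding F_def d_def by simp
    ultimately show ?thesis using FL L(1) \<delta> b by (intro exI[of _ F] exI[of _ "L + norm d / \<delta>"]) (auto simp: dist_norm)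
  qed
  have "\<exists>F u y g. heat.evolves (\<lambda>t. c *\<^sub>R blinfun_inner_right (F t)) u y g \<and> norm (u 0 - \<xi>) \<le> inverse (real (Suc i))
      \<and> L2sq T (\<lambda>t. z t - F t) \<le> inverse (real (Suc i))" for i
  proof -
    have "inverse (real (Suc i)) > 0" by simp
    from approx[OF this] obtain F L where F: "L \<ge> 0" "\<forall>s t. norm (F t - F s) \<le> L * \<bar>t - s\<bar>"
      "L2sq T (\<lambda>t. z t - F t) \<le> inverse (real (Suc i))" "norm (\<iota> (F 0) - \<xi>) \<le> inverse (real (Suc i))" by blast
    obtain u y g where "heat.evolves (\<lambda>t. c *\<^sub>R blinfun_inner_right (F t)) u y g" "u 0 = \<iota> (F 0)"
      using heat_Lipschitz_data[OF F(1), of F] F(2) by blast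
    then show ?thesis using F(3,4) by (intro exI[of _ F] exI[of _ u] exI[of _ y] exI[of _ g]) simp
  qed
  then have "\<forall>i. \<exists>F u y g. heat.evolves (\<lambda>t. c *\<^sub>R blinfun_inner_right (F t)) u y g \<and> norm (u 0 - \<xi>) \<le> inverse (real (Suc i))
      \<and> L2sq T (\<lambda>t. z t - F t) \<le> inverse (real (Suc i))" by (rule allI)
  then obtain F u y g where "\<forall>i. heat.evolves (\<lambda>t. c *\<^sub>R blinfun_inner_right (F i t)) (u i) (y i) (g i)
      \<and> norm (u i 0 - \<xi>) \<le> inverse (real (Suc i)) \<and> L2sq T (\<lambda>t. z t - F i t) \<le> inverse (real (Suc i))"
    unfolding choice_iff by (elim exE)
  then have ev: "heat.evolves (\<lambda>t. c *\<^sub>R blinfun_inner_right (F i t)) (u i) (y i) (g i)"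
    and u0: "norm (u i 0 - \<xi>) \<le> inverse (real (Suc i))"
    and Fz: "L2sq T (\<lambda>t. z t - F i t) \<le> inverse (real (Suc i))" for i by blast+
  show ?thesis
  proof (rule heat.evolves_limit[OF ev f])
    have "L2sq T (\<lambda>t. c *\<^sub>R blinfun_inner_right (F i t) - f t) \<le> c\<^sup>2 * inverse (real (Suc i))" for i
    proof -
      have "L2sq T (\<lambda>t. c *\<^sub>R blinfun_inner_right (F i t) - f t) = c\<^sup>2 * L2sq T (\<lambda>t. z t - F i t)"
        unfolding L2sq_def fz blinfun_inner_right_linear(2)[symmetric] blinfun_inner_right_linear(1)[symmetric] scaleR_diff_right[symmetric]
          norm_blinfun_inner_right norm_scaleR power_mult_distrib by (simp add: norm_minus_commute)
      then show ?thesis using Fz[of i] by (simp add: mult_left_mono)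
    qed
    note le = this
    show "(\<lambda>i. L2sq T (\<lambda>t. c *\<^sub>R blinfun_inner_right (F i t) - f t)) \<longlonglongrightarrow> 0"
      by (rule tendsto_sandwich[OF always_eventually always_eventually tendsto_const
            tendsto_mult_right_zero[OF LIMSEQ_inverse_real_of_nat, of "c\<^sup>2"]])
        (rule allI, rule L2sq_nonneg, rule allI, rule le)
    show "(\<lambda>i. u i 0) \<longlonglongrightarrow> \<xi>"
      by (rule LIM_zero_cancel, rule tendsto_norm_zero_cancel,
          rule tendsto_sandwich[OF always_eventually always_eventually tendsto_const LIMSEQ_inverse_real_of_nat])
        (rule allI, rule norm_ge_zero, rule allI, rule u0)
  qed
qed

end

section \<open>From the model equation to general forms and to the boundary condition\<close>

context evolution_form
begin

lemma energy_estimate_L2: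
  assumes "evolves f u y g"
  shows "\<alpha> * L2sq T y \<le> (norm (u 0))\<^sup>2 + L2sq T f / \<alpha>"
proof -
  have "T \<in> {0..T}" using T by simp
  then show ?thesis using energy_estimate[OF assms] add_increasing[OF zero_le_power2] by (meson add_le_imp_le_left le_add_same_cancel2 order_trans zero_le_power2)
qed

theorem initial_value_problem:
  assumes dense: "closure (range \<iota>) = UNIV" and f: "f \<in> bochner_L2 T"
  shows "\<exists>u y g. evolves f u y g \<and> u 0 = \<xi>"
proof -
  \<comment> \<open>This c minimises the contraction factor 1 - 2 \<alpha> / c + M^2 / c^2, whose
    value then is 1 - M^2 / c^2, that is 1 - \<alpha>^2 / M^2.\<close>
  define c where "c = M\<^sup>2 / \<alpha>"
  have c: "c > 0" unfolding c_def using M \<alpha> by simp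
  have c\<alpha>: "c * \<alpha> = M\<^sup>2" unfolding c_def using \<alpha> by simp
  interpret H: heat_form C \<iota> T c by unfold_locales (use T \<iota>_inj c in auto)
  define B where "B t x = AA t x - c *\<^sub>R blinfun_inner_right x" for t x
  \<comment> \<open>The maximum with 0 covers \<alpha> > M, which occurs only for trivial
    \<open>U\<close> and would make the expression negative.\<close>
  define \<rho> where "\<rho> = max 0 (1 - M\<^sup>2 / c\<^sup>2)"
  have \<rho>: "0 \<le> \<rho>" "\<rho> < 1" unfolding \<rho>_def using M c by auto
  have B_diff: "B t (x - y) = B t x - B t y" for t x y
    unfolding B_def AA_diff blinfun_inner_right_linear by (simp add: algebra_simps)
  have B_bound: "(norm (B t x))\<^sup>2 \<le> (c\<^sup>2 * \<rho>) * (norm x)\<^sup>2" if t: "regular_time t" for t x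
  proof -
    have "norm (B t x) = norm (riesz (AA t x) - c *\<^sub>R x)"
    proof -
      have "B t x = blinfun_inner_right (riesz (AA t x) - c *\<^sub>R x)"
        unfolding B_def blinfun_inner_right_linear blinfun_inner_right_riesz ..
      then show ?thesis by simp
    qed
    moreover have r: "(norm (z - c *\<^sub>R x))\<^sup>2 = (norm z)\<^sup>2 - 2 * c * (z \<bullet> x) + c\<^sup>2 * (norm x)\<^sup>2" for z
      unfolding power2_norm_eq_inner
      by (simp add: inner_diff_left inner_diff_right inner_commute[of x z] power2_eq_square algebra_simps)
    ultimately have "(norm (B t x))\<^sup>2 = (norm (AA t x))\<^sup>2 - 2 * c * (AA t x) x + c\<^sup>2 * (norm x)\<^sup>2"
      by (simp only: r norm_riesz riesz_inner)
    also have "\<dots> \<le> M\<^sup>2 * (norm x)\<^sup>2 - 2 * c * (\<alpha> * (norm x)\<^sup>2) + c\<^sup>2 * (norm x)\<^sup>2"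
    proof -
      have "(norm (AA t x))\<^sup>2 \<le> M\<^sup>2 * (norm x)\<^sup>2"
        using power_mono[OF norm_AA_le norm_ge_zero, of t x 2] by (simp add: power_mult_distrib)
      moreover have "2 * c * (\<alpha> * (norm x)\<^sup>2) \<le> 2 * c * (AA t x) x"
        using c by (intro mult_left_mono AA_coercive[OF t]) simp
      ultimately show ?thesis by simp
    qed
    also have "\<dots> = (c\<^sup>2 - M\<^sup>2) * (norm x)\<^sup>2" using c\<alpha> by (simp add: algebra_simps)
    also have "\<dots> \<le> (c\<^sup>2 * \<rho>) * (norm x)\<^sup>2"
    proof (rule mult_right_mono)
      have "c\<^sup>2 - M\<^sup>2 = c\<^sup>2 * (1 - M\<^sup>2 / c\<^sup>2)" using c by (simp add: algebra_simps)
      also have "\<dots> \<le> c\<^sup>2 * \<rho>" unfolding \<rho>_def by (intro mult_left_mono) auto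
      finally show "c\<^sup>2 - M\<^sup>2 \<le> c\<^sup>2 * \<rho>" .
    qed simp
    finally show ?thesis .
  qed
  have B_L2: "(\<lambda>t. B t (y t)) \<in> bochner_L2 T" if "y \<in> bochner_L2 T" for y
    unfolding B_def
    by (intro L2_diff AA_bochner_L2 L2_scaleR L2_bounded_linear[OF that bounded_linear_blinfun_inner_right] that)
  have B_sq: "L2sq T (\<lambda>t. B t (y t)) \<le> (c\<^sup>2 * \<rho>) * L2sq T y" if y: "y \<in> bochner_L2 T" for y
  proof (rule L2sq_mono_AE[OF B_L2[OF y] y])
    show "AE t in I_on T. (norm (B t (y t)))\<^sup>2 \<le> c\<^sup>2 * \<rho> * (norm (y t))\<^sup>2"
      using AE_regular by eventually_elim (rule B_bound)
  qed
  define good where "good s s' \<longleftrightarrow> H.heat.evolves (\<lambda>t. f t - B t (fst (snd s) t)) (fst s') (fst (snd s')) (snd (snd s')) \<and> fst s' 0 = \<xi>"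
    for s s' :: "(real \<Rightarrow> 'h) \<times> (real \<Rightarrow> 'u) \<times> (real \<Rightarrow> 'u \<Rightarrow>\<^sub>L real)"
  have "\<exists>S. \<forall>i. fst (snd (S i)) \<in> bochner_L2 T \<and> good (S i) (S (Suc i))"
  proof (rule dependent_nat_choice)
    show "\<exists>x::(real \<Rightarrow> 'h) \<times> (real \<Rightarrow> 'u) \<times> (real \<Rightarrow> 'u \<Rightarrow>\<^sub>L real). fst (snd x) \<in> bochner_L2 T"
      by (intro exI[of _ "(\<lambda>_. 0, \<lambda>_. 0, \<lambda>_. 0)"]) simp
    fix x :: "(real \<Rightarrow> 'h) \<times> (real \<Rightarrow> 'u) \<times> (real \<Rightarrow> 'u \<Rightarrow>\<^sub>L real)"
    assume x: "fst (snd x) \<in> bochner_L2 T"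
    obtain u' y' g' where "H.heat.evolves (\<lambda>t. f t - B t (fst (snd x) t)) u' y' g'" "u' 0 = \<xi>"
      using H.heat_solvable[OF dense L2_diff[OF f B_L2[OF x]]] by blast
    then show "\<exists>y. fst (snd y) \<in> bochner_L2 T \<and> good x y"
      unfolding good_def by (intro exI[of _ "(u', y', g')"]) (auto dest: H.heat.evolvesD(3))
  qed
  then obtain S where S: "\<And>i. good (S i) (S (Suc i))" by blast
  define u where "u i = fst (S i)" for i
  define y where "y i = fst (snd (S i))" for i
  define g where "g i = snd (snd (S i))" for i
  have ev: "H.heat.evolves (\<lambda>t. f t - B t (y i t)) (u (Suc i)) (y (Suc i)) (g (Suc i))" "u (Suc i) 0 = \<xi>" for i
    using S[of i] unfolding good_def u_def y_def g_def by blast+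
  note y2 = H.heat.evolvesD(3)[OF ev(1)]
  \<comment> \<open>The starting triple need not solve anything; from index 1 on all members are
    solutions with the same initial value, so the energy estimate of a difference has no initial
    term.\<close>
  define q where "q i = L2sq T (\<lambda>t. y (Suc (Suc i)) t - y (Suc i) t)" for i
  have contract: "q (Suc i) \<le> \<rho> * q i" for i
  proof -
    let ?d = "\<lambda>t. y (Suc (Suc i)) t - y (Suc i) t"
    have d2: "?d \<in> bochner_L2 T" by (rule L2_diff[OF y2 y2])
    note dv = H.heat.evolves_diff[OF ev(1)[of "Suc (Suc i)"] ev(1)[of "Suc i"]]
    have "c * q (Suc i) \<le> L2sq T (\<lambda>t. f t - B t (y (Suc (Suc i)) t) - (f t - B t (y (Suc i) t))) / c"
      using H.heat.energy_estimate_L2[OF dv] unfolding q_def ev(2) by simp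
    also have "L2sq T (\<lambda>t. f t - B t (y (Suc (Suc i)) t) - (f t - B t (y (Suc i) t))) = L2sq T (\<lambda>t. B t (?d t))"
      unfolding L2sq_def B_diff by (simp add: norm_minus_commute)
    also have "\<dots> / c \<le> ((c\<^sup>2 * \<rho>) * q i) / c"
      unfolding q_def using c by (intro divide_right_mono B_sq d2) simp
    also have "\<dots> = c * (\<rho> * q i)" using c by (simp add: power2_eq_square)
    finally show ?thesis using c by simp
  qed
  have q_le: "q i \<le> \<rho> ^ i * q 0" for i
  proof (induction i)
    case (Suc i)
    have "q (Suc i) \<le> \<rho> * (\<rho> ^ i * q 0)" by (rule order_trans[OF contract mult_left_mono[OF Suc \<rho>(1)]])
    then show ?case by simp
  qed simp
  have q0: "q \<longlonglongrightarrow> 0"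
    using tendsto_mult_left_zero[OF LIMSEQ_realpow_zero[OF \<rho>], of "q 0"] q_le
    by (intro tendsto_sandwich[of "\<lambda>_. 0" q _ "\<lambda>i. \<rho> ^ i * q 0"]) (auto simp: q_def)
  \<comment> \<open>Each iterate solves the original equation for the right-hand side it generates.
    This differs from \<open>f\<close> by \<open>B\<close> applied to the latest increment, so the
    closedness under limits applies.\<close>
  define F where "F i t = g (Suc (Suc i)) t + AA t (y (Suc (Suc i)) t)" for i t
  show ?thesis
  proof (rule evolves_limit[OF _ f])
    show "evolves (F i) (u (Suc (Suc i))) (y (Suc (Suc i))) (g (Suc (Suc i)))" for i
      unfolding evolves_def F_def using H.heat.evolvesD(1)[OF ev(1)] by simp
    show "(\<lambda>i. L2sq T (\<lambda>t. F i t - f t)) \<longlonglongrightarrow> 0"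
    proof (rule tendsto_sandwich[of "\<lambda>_. 0" _ _ "\<lambda>i. (c\<^sup>2 * \<rho>) * q i"])
      show "\<forall>\<^sub>F i in sequentially. L2sq T (\<lambda>t. F i t - f t) \<le> (c\<^sup>2 * \<rho>) * q i"
      proof (intro always_eventually allI)
        fix i
        let ?d = "\<lambda>t. y (Suc (Suc i)) t - y (Suc i) t"
        have d2: "?d \<in> bochner_L2 T" by (rule L2_diff[OF y2 y2])
        have "L2sq T (\<lambda>t. F i t - f t) = L2sq T (\<lambda>t. B t (?d t))"
        proof (rule L2sq_cong_AE)
          have "AE t in I_on T. t \<in> {0..T}" by (rule AE_I2) simp
          with H.heat.evolvesD(2)[OF ev(1)[of "Suc i"]]
          show "AE t in I_on T. norm (F i t - f t) = norm (B t (?d t))"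
          proof eventually_elim
            case (elim t)
            have "F i t - f t = B t (?d t)"
              using elim(1) unfolding H.heat_AA[OF elim(2)] F_def B_diff unfolding B_def by (simp add: algebra_simps)
            then show ?case by simp
          qed
          show "strongly_measurable (I_on T) (\<lambda>t. F i t - f t)"
            unfolding F_def by (intro L2_sm L2_diff L2_add f AA_bochner_L2 y2 H.heat.evolvesD(4)[OF ev(1)])
        qed (rule L2_sm[OF B_L2[OF d2]])
        also have "\<dots> \<le> (c\<^sup>2 * \<rho>) * q i" unfolding q_def by (rule B_sq[OF d2])
        finally show "L2sq T (\<lambda>t. F i t - f t) \<le> (c\<^sup>2 * \<rho>) * q i" .
      qed
      show "(\<lambda>i. c\<^sup>2 * \<rho> * q i) \<longlonglongrightarrow> 0" by (rule tendsto_mult_right_zero[OF q0])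
    qed auto
    show "(\<lambda>i. u (Suc (Suc i)) 0) \<longlonglongrightarrow> \<xi>" by (simp add: ev(2))
  qed
qed

text \<open>
  The \<open>H\<close>-norm of a solution of the homogeneous equation decreases, so \<open>T \<parallel>u(T)\<parallel>\<^sup>2\<close> is at most
  \<open>K\<^sup>2\<close> times the squared \<open>V\<close>-norm, which the energy estimate bounds by \<open>\<parallel>u(0)\<parallel>\<^sup>2 - \<parallel>u(T)\<parallel>\<^sup>2\<close>.
\<close>

lemma final_value_contraction:
  obtains r where "0 \<le> r" "r < 1" "\<And>f u1 y1 g1 u2 y2 g2. evolves f u1 y1 g1 \<Longrightarrow> evolves f u2 y2 g2 \<Longrightarrow>
     norm (u1 T - u2 T) \<le> r * norm (u1 0 - u2 0)"
proof -
  obtain K where K: "\<And>x. norm (\<iota> x) \<le> norm x * K" "K > 0" using \<iota>.pos_bounded by blast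
  define \<beta> where "\<beta> = \<alpha> * T / K\<^sup>2"
  have \<beta>: "\<beta> > 0" unfolding \<beta>_def using \<alpha> T K(2) by simp
  have main: "(1 + \<beta>) * (norm (u T))\<^sup>2 \<le> (norm (u 0))\<^sup>2" if ev: "evolves (\<lambda>t. 0) u y g" for u y g
  proof -
    note y = evolvesD(3)[OF ev] and g = evolvesD(4)[OF ev] and w = evolvesD(1)[OF ev]
    have gy: "AE t in I_on T. 0 \<le> - (g t) (y t)"
      using evolvesD(2)[OF ev] AE_regular
    proof eventually_elim
      case (elim t)
      have "0 \<le> \<alpha> * (norm (y t))\<^sup>2" using \<alpha> by simp
      also have "\<dots> \<le> (AA t (y t)) (y t)" by (rule AA_coercive[OF elim(2)])
      also have "AA t (y t) = - g t" using elim(1) by (simp add: eq_neg_iff_add_eq_0 add.commute)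
      finally show ?case by (simp add: blinfun.minus_left)
    qed
    have int: "integrable (I_on T) (\<lambda>t. - (g t) (y t))" using L2_integrable_pairing[OF g y] by simp
    have dec: "(norm (u T))\<^sup>2 \<le> (norm (u t))\<^sup>2" if t: "t \<in> {0..T}" for t
    proof -
      have t': "0 \<le> t" "t \<le> T" using t by auto
      have m: "(LINT s|I_on T. (g s) (y s)) \<le> (LINT s|I_on t. (g s) (y s))"
        using integral_time_mono[OF int gy t'] by simp
      show ?thesis
        using wtriple_energy[OF wtriple_restrict[OF w t'] t'(1)] wtriple_energy[OF w less_imp_le[OF T]] m by linarith
    qed
    have "AE t in I_on T. t \<in> {0..T}" by (rule AE_I2) simp
    moreover have "AE t in I_on T. \<iota> (y t) = u t" using w unfolding wtriple_def by blast
    ultimately have "AE t in I_on T. (norm (u T))\<^sup>2 \<le> K\<^sup>2 * (norm (y t))\<^sup>2"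
    proof eventually_elim
      case (elim t)
      have "(norm (u T))\<^sup>2 \<le> (norm (\<iota> (y t)))\<^sup>2" unfolding elim(2) by (rule dec[OF elim(1)])
      also have "\<dots> \<le> (norm (y t) * K)\<^sup>2" by (intro power_mono K(1)) simp
      finally show ?case by (simp add: power_mult_distrib mult.commute)
    qed
    from L2sq_mono_AE[OF L2_const y this]
    have "T * (norm (u T))\<^sup>2 \<le> K\<^sup>2 * L2sq T y" unfolding L2sq_def using T by simp
    then have "\<beta> * (norm (u T))\<^sup>2 \<le> \<alpha> * L2sq T y"
      unfolding \<beta>_def using K(2) \<alpha> by (simp add: field_simps)
    moreover have "(norm (u T))\<^sup>2 + \<alpha> * L2sq T y \<le> (norm (u 0))\<^sup>2"
      using energy_estimate[OF ev, of T] T unfolding L2sq_def by simp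
    ultimately show ?thesis by (simp add: distrib_right)
  qed
  show thesis
  proof (rule that[of "inverse (sqrt (1 + \<beta>))"])
    show "inverse (sqrt (1 + \<beta>)) < 1" using \<beta> by (simp add: inverse_less_1_iff)
    fix f u1 y1 g1 u2 y2 g2 assume "evolves f u1 y1 g1" "evolves f u2 y2 g2"
    then have "evolves (\<lambda>t. 0) (\<lambda>t. u1 t - u2 t) (\<lambda>t. y1 t - y2 t) (\<lambda>t. g1 t - g2 t)"
      using evolves_diff[of f u1 y1 g1 f u2 y2 g2] by simp
    from main[OF this] have "sqrt (1 + \<beta>) * norm (u1 T - u2 T) \<le> norm (u1 0 - u2 0)"
      by (metis norm_ge_zero real_sqrt_abs abs_of_nonneg real_sqrt_le_mono real_sqrt_mult)
    then show "norm (u1 T - u2 T) \<le> inverse (sqrt (1 + \<beta>)) * norm (u1 0 - u2 0)"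
      using \<beta> by (simp add: field_simps)
  qed (use \<beta> in simp)
qed

theorem boundary_value_problem:
  fixes \<Phi> :: "'h \<Rightarrow>\<^sub>L 'h"
  assumes dense: "closure (range \<iota>) = UNIV" and f: "f \<in> bochner_L2 T" and \<Phi>: "norm \<Phi> \<le> 1"
  shows "\<exists>u y g. evolves f u y g \<and> u 0 - blinfun_apply \<Phi> (u T) = \<xi>"
proof -
  obtain r where r: "0 \<le> r" "r < 1" "\<And>f u1 y1 g1 u2 y2 g2. evolves f u1 y1 g1 \<Longrightarrow> evolves f u2 y2 g2 \<Longrightarrow>
     norm (u1 T - u2 T) \<le> r * norm (u1 0 - u2 0)"
    using final_value_contraction by metis
  have "\<forall>\<eta>. \<exists>u y g. evolves f u y g \<and> u 0 = \<eta>" using initial_value_problem[OF dense f] by (rule allI)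
  then obtain U Y G where "\<forall>\<eta>. evolves f (U \<eta>) (Y \<eta>) (G \<eta>) \<and> U \<eta> 0 = \<eta>" unfolding choice_iff by (elim exE)
  then have S: "evolves f (U \<eta>) (Y \<eta>) (G \<eta>)" "U \<eta> 0 = \<eta>" for \<eta> by blast+
  have "\<exists>!\<eta>. \<xi> + \<Phi> (U \<eta> T) = \<eta>"
  proof (rule banach_fix_type[OF r(1,2)])
    show "\<forall>x y. dist (\<xi> + \<Phi> (U x T)) (\<xi> + \<Phi> (U y T)) \<le> r * dist x y"
    proof (intro allI)
      fix x y
      have "dist (\<xi> + \<Phi> (U x T)) (\<xi> + \<Phi> (U y T)) = norm (\<Phi> (U x T - U y T))"
        by (simp add: dist_norm blinfun.diff_right)
      also have "\<dots> \<le> norm \<Phi> * norm (U x T - U y T)" by (rule norm_blinfun)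
      also have "\<dots> \<le> 1 * norm (U x T - U y T)" by (intro mult_right_mono \<Phi>) simp
      also have "\<dots> \<le> r * dist x y" using r(3)[OF S(1) S(1), of x y] by (simp add: S(2) dist_norm)
      finally show "dist (\<xi> + \<Phi> (U x T)) (\<xi> + \<Phi> (U y T)) \<le> r * dist x y" .
    qed
  qed
  then obtain \<eta> where "\<xi> + \<Phi> (U \<eta> T) = \<eta>" by blast
  then have "U \<eta> 0 - \<Phi> (U \<eta> T) = \<xi>" by (simp add: S(2) eq_diff_eq diff_eq_eq)
  then show ?thesis using S(1) by blast
qed

end

section \<open>Weak derivatives\<close>

lemma DERIV_shift_minus:
  fixes f :: "real \<Rightarrow> real"
  shows "(f has_real_derivative D) (at (x - c)) \<Longrightarrow> ((\<lambda>r. f (r - c)) has_real_derivative D) (at x)"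
  using DERIV_shift[of f D x "- c"] by simp

lemma square_positive_part_has_derivative:
  "((\<lambda>r. (max 0 r)\<^sup>2) has_real_derivative 2 * max 0 x) (at (x::real))"
  unfolding has_field_derivative_iff
proof (rule LIM_zero_cancel, rule tendsto_rabs_zero_cancel, rule tendsto_sandwich[of "\<lambda>_. 0"])
  have bound: "\<bar>(max 0 y)\<^sup>2 - (max 0 x)\<^sup>2 - 2 * max 0 x * (y - x)\<bar> \<le> (y - x)\<^sup>2" for y
  proof (cases "0 \<le> x"; cases "0 \<le> y")
    assume "0 \<le> x" "0 \<le> y"
    moreover have "y\<^sup>2 - x\<^sup>2 - 2 * x * (y - x) = (y - x)\<^sup>2" by (simp add: power2_eq_square algebra_simps)
    ultimately show ?thesis by (simp add: max_def)
  next
    assume "0 \<le> x" "\<not> 0 \<le> y"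
    then have "x * y \<le> 0" by (simp add: mult_nonneg_nonpos)
    moreover have "0 \<le> x * x" "0 \<le> y * y" by simp_all
    ultimately have "x * (y * 2) + \<bar>x * x - x * (y * 2)\<bar> \<le> x * x + y * y" by linarith
    then show ?thesis using \<open>0 \<le> x\<close> \<open>\<not> 0 \<le> y\<close> by (simp add: power2_eq_square algebra_simps)
  next
    assume "\<not> 0 \<le> x" "0 \<le> y"
    then show ?thesis by (simp add: power_mono)
  qed simp_all
  show "\<forall>\<^sub>F y in at x. \<bar>((max 0 y)\<^sup>2 - (max 0 x)\<^sup>2) / (y - x) - 2 * max 0 x\<bar> \<le> \<bar>y - x\<bar>"
    unfolding eventually_at_filter
  proof (intro always_eventually allI impI)
    fix y assume y: "y \<noteq> x"
    then have "((max 0 y)\<^sup>2 - (max 0 x)\<^sup>2) / (y - x) - 2 * max 0 x = ((max 0 y)\<^sup>2 - (max 0 x)\<^sup>2 - 2 * max 0 x * (y - x)) / (y - x)"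
      by (simp add: field_simps)
    then have "\<bar>((max 0 y)\<^sup>2 - (max 0 x)\<^sup>2) / (y - x) - 2 * max 0 x\<bar> \<le> (y - x)\<^sup>2 / \<bar>y - x\<bar>"
      using bound[of y] y by (simp add: divide_right_mono)
    also have "(y - x)\<^sup>2 = \<bar>y - x\<bar> * \<bar>y - x\<bar>" by (simp add: power2_eq_square)
    also have "\<bar>y - x\<bar> * \<bar>y - x\<bar> / \<bar>y - x\<bar> = \<bar>y - x\<bar>"
      by (rule nonzero_mult_div_cancel_left) (use y in simp)
    finally show "\<bar>((max 0 y)\<^sup>2 - (max 0 x)\<^sup>2) / (y - x) - 2 * max 0 x\<bar> \<le> \<bar>y - x\<bar>" .
  qed
  show "((\<lambda>y. \<bar>y - x\<bar>) \<longlongrightarrow> 0) (at x)" by (rule tendsto_eq_intros | simp)+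
qed auto

text \<open>Test functions have to be continuously differentiable only once, so a quadratic spline
  suffices as a smooth step.\<close>

lemma C1_step:
  assumes \<epsilon>: "\<epsilon> > 0"
  obtains S D :: "real \<Rightarrow> real" where "\<And>r. (S has_real_derivative D r) (at r)" "continuous_on UNIV D"
    "\<And>r. 0 \<le> D r" "\<And>r. r \<le> 0 \<Longrightarrow> S r = 0" "\<And>r. r \<ge> \<epsilon> \<Longrightarrow> S r = 1" "\<And>r. r \<notin> {0..\<epsilon>} \<Longrightarrow> D r = 0"
    "\<And>r. S r \<in> {0..1}"
proof -
  \<comment> \<open>a second difference of the C1 function \<open>(max 0 r)\<^sup>2\<close>\<close>
  define S where "S r = 2 / \<epsilon>\<^sup>2 * ((max 0 r)\<^sup>2 - 2 * (max 0 (r - \<epsilon> / 2))\<^sup>2 + (max 0 (r - \<epsilon>))\<^sup>2)" for r :: real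
  define D where "D r = 2 / \<epsilon>\<^sup>2 * (2 * max 0 r - 2 * (2 * max 0 (r - \<epsilon> / 2)) + 2 * max 0 (r - \<epsilon>))" for r :: real
  have sh: "((\<lambda>r. (max 0 (r - c))\<^sup>2) has_real_derivative 2 * max 0 (x - c)) (at x)" for c x :: real
    by (rule DERIV_shift_minus[OF square_positive_part_has_derivative])
  have SD: "(S has_real_derivative D r) (at r)" for r
    unfolding S_def D_def by (intro DERIV_cmult DERIV_add DERIV_diff sh square_positive_part_has_derivative)
  have D0: "0 \<le> D r" for r unfolding D_def using \<epsilon> by (intro mult_nonneg_nonneg) (auto simp: max_def)
  have S0: "S r = 0" if "r \<le> 0" for r using that \<epsilon> unfolding S_def by (simp add: max_def)
  have S1: "S r = 1" if r: "r \<ge> \<epsilon>" for r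
  proof -
    have "r\<^sup>2 - 2 * (r - \<epsilon> / 2)\<^sup>2 + (r - \<epsilon>)\<^sup>2 = \<epsilon>\<^sup>2 / 2" by (simp add: power2_eq_square field_simps)
    moreover have "S r = 2 / \<epsilon>\<^sup>2 * (r\<^sup>2 - 2 * (r - \<epsilon> / 2)\<^sup>2 + (r - \<epsilon>)\<^sup>2)" using r \<epsilon> unfolding S_def by (simp add: max_def)
    ultimately show ?thesis using \<epsilon> by simp
  qed
  have mono: "S x \<le> S y" if "x \<le> y" for x y
    using DERIV_nonneg_imp_nondecreasing[OF that] SD D0 by blast
  have "S r \<in> {0..1}" for r
    using mono[of "min 0 r" r] mono[of r "max \<epsilon> r"] S0[of "min 0 r"] S1[of "max \<epsilon> r"] by auto
  moreover have "D r = 0" if "r \<notin> {0..\<epsilon>}" for r using that \<epsilon> unfolding D_def by (auto simp: max_def)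
  moreover have "continuous_on UNIV D" unfolding D_def by (intro continuous_intros)
  ultimately show thesis using that[of S D] SD D0 S0 S1 by blast
qed

text \<open>The derivative of the step is a nonnegative density of mass 1 concentrated on an
  interval of length \<epsilon>, so integrating against it averages p there.\<close>

lemma C1_step_mean:
  fixes p D S :: "real \<Rightarrow> real"
  assumes S: "\<And>r. (S has_real_derivative D r) (at r)" "continuous_on UNIV D" "\<And>r. 0 \<le> D r"
    "\<And>r. r \<le> 0 \<Longrightarrow> S r = 0" "\<And>r. r \<ge> \<epsilon> \<Longrightarrow> S r = 1" "\<And>r. r \<notin> {0..\<epsilon>} \<Longrightarrow> D r = 0"
    and c: "0 \<le> c" "c + \<epsilon> \<le> T" "0 \<le> \<epsilon>" and p: "continuous_on {0..T} p"
    and e: "\<And>r. r \<in> {c..c + \<epsilon>} \<Longrightarrow> \<bar>p r - z\<bar> \<le> e"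
  shows "\<bar>(LINT r|I_on T. p r * D (r - c)) - z\<bar> \<le> e"
proof -
  have Dc: "continuous_on A (\<lambda>r. D (r - c))" for A
    by (rule continuous_on_compose2[OF S(2)]) (auto intro: continuous_intros)
  have "((\<lambda>r. S (r - c)) has_real_derivative D (r - c)) (at r)" for r
    by (rule DERIV_shift_minus[OF S(1)])
  then have "(LINT r|I_on T. D (r - c)) = S (T - c) - S (0 - c)" using c by (intro integral_lebesgue_on_FTC Dc) auto
  then have one: "(LINT r|I_on T. D (r - c)) = 1" using S(4,5) c by simp
  have int: "integrable (I_on T) (\<lambda>r. p r * D (r - c))" "integrable (I_on T) (\<lambda>r. D (r - c))"
    by (intro continuous_imp_integrable_real continuous_intros p Dc)+
  have "(LINT r|I_on T. p r * D (r - c)) - z = (LINT r|I_on T. (p r - z) * D (r - c))"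
    using int one by (simp add: left_diff_distrib)
  also have "\<bar>\<dots>\<bar> \<le> (LINT r|I_on T. e * D (r - c))"
  proof (rule order_trans[OF integral_abs_bound integral_mono'])
    show "integrable (I_on T) (\<lambda>r. e * D (r - c))" using int by simp
    fix r
    show le: "\<bar>(p r - z) * D (r - c)\<bar> \<le> e * D (r - c)"
    proof (cases "r - c \<in> {0..\<epsilon>}")
      case True
      then show ?thesis unfolding abs_mult using e[of r] S(3)[of "r - c"] by (auto intro!: mult_mono)
    qed (simp add: S(6))
    show "0 \<le> e * D (r - c)" by (rule order_trans[OF abs_ge_zero le])
  qed
  finally show ?thesis using one by simp
qed

text \<open>The test functions approximate the indicator of the interval from 0 to t; their
  derivatives are densities near 0 minus densities near t and pick out the two values of the
  continuous p in the limit.\<close>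

lemma du_Bois_Reymond:
  fixes p q :: "real \<Rightarrow> real"
  assumes p: "continuous_on {0..T} p" and q: "integrable (I_on T) q"
    and test: "\<And>\<phi> D a b. (\<And>r. (\<phi> has_real_derivative D r) (at r)) \<Longrightarrow> continuous_on UNIV D \<Longrightarrow> 0 < a \<Longrightarrow> b < T \<Longrightarrow>
      (\<And>r. r \<notin> {a..b} \<Longrightarrow> \<phi> r = 0) \<Longrightarrow> (LINT r|I_on T. q r * \<phi> r) = - (LINT r|I_on T. p r * D r)"
    and t: "t \<in> {0..T}"
  shows "p t - p 0 = (LINT r|I_on t. q r)"
proof (cases "t = 0")
  case True
  have "(LINT r|lebesgue_on {0..0}. q r) = 0"
    using integral_lebesgue_on_const(1)[of 0 0 q 0] by simp
  then show ?thesis using True by simp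
next
  case False
  then have t0: "0 < t" "t \<le> T" "0 \<le> t" using t by auto
  \<comment> \<open>The factor 4 keeps the rising ramp on [\<epsilon>, 2 \<epsilon>] and the falling
    one on [t - 2 \<epsilon>, t - \<epsilon>] from overlapping; both stay away from 0 and T, as
    compact support requires.\<close>
  define \<epsilon> where "\<epsilon> i = t / (4 * real (Suc i))" for i
  have \<epsilon>: "\<epsilon> i > 0" "4 * \<epsilon> i \<le> t" for i
    unfolding \<epsilon>_def using t0 by (auto simp: field_simps)
  have \<epsilon>_lim: "\<epsilon> \<longlonglongrightarrow> 0"
    using tendsto_mult_right_zero[OF LIMSEQ_inverse_real_of_nat, of "t / 4"] unfolding \<epsilon>_def by (simp add: field_simps)
  have "\<forall>i. \<exists>S D. (\<forall>r. (S has_real_derivative D r) (at r)) \<and> continuous_on UNIV D \<and> (\<forall>r. 0 \<le> D r) \<and> (\<forall>r\<le>0. S r = 0) \<and>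
      (\<forall>r\<ge>\<epsilon> i. S r = 1) \<and> (\<forall>r. r \<notin> {0..\<epsilon> i} \<longrightarrow> D r = 0) \<and> (\<forall>r. S r \<in> {0..1::real})"
    using C1_step[OF \<epsilon>(1)] by metis
  then obtain S D where SD: "\<forall>i. (\<forall>r. (S i has_real_derivative D i r) (at r)) \<and> continuous_on UNIV (D i) \<and> (\<forall>r. 0 \<le> D i r) \<and> (\<forall>r\<le>0. S i r = 0) \<and>
      (\<forall>r\<ge>\<epsilon> i. S i r = 1) \<and> (\<forall>r. r \<notin> {0..\<epsilon> i} \<longrightarrow> D i r = 0) \<and> (\<forall>r. S i r \<in> {0..1})"
    unfolding choice_iff by (elim exE)
  have S: "(S i has_real_derivative D i r) (at r)" "continuous_on UNIV (D i)" "0 \<le> D i r" "r \<le> 0 \<Longrightarrow> S i r = 0"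
    "r \<ge> \<epsilon> i \<Longrightarrow> S i r = 1" "r \<notin> {0..\<epsilon> i} \<Longrightarrow> D i r = 0" "S i r \<in> {0..1}" for i r using SD by blast+
  define \<phi> where "\<phi> i r = S i (r - \<epsilon> i) - S i (r - (t - 2 * \<epsilon> i))" for i r
  define \<psi> where "\<psi> i r = D i (r - \<epsilon> i) - D i (r - (t - 2 * \<epsilon> i))" for i r
  have Dc: "continuous_on A (\<lambda>r. D i (r - c))" for A i c
    by (rule continuous_on_compose2[OF S(2)]) (auto intro: continuous_intros)
  have shift: "((\<lambda>r. S i (r - c)) has_real_derivative D i (r - c)) (at r)" for i c r
    by (rule DERIV_shift_minus[OF S(1)])
  have eq: "(LINT r|I_on T. q r * \<phi> i r) = - (LINT r|I_on T. p r * \<psi> i r)" for i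
  proof (rule test)
    show "(\<phi> i has_real_derivative \<psi> i r) (at r)" for r unfolding \<phi>_def \<psi>_def by (intro DERIV_diff shift)
    show "continuous_on UNIV (\<psi> i)" unfolding \<psi>_def by (intro continuous_intros Dc)
    show "0 < \<epsilon> i" "t - \<epsilon> i < T" using \<epsilon>[of i] t0 by auto
    fix r assume "r \<notin> {\<epsilon> i..t - \<epsilon> i}"
    then have "r < \<epsilon> i \<or> t - \<epsilon> i < r" by auto
    then show "\<phi> i r = 0" unfolding \<phi>_def using \<epsilon>[of i] by (auto simp: S(4,5))
  qed
  have ev: "\<forall>\<^sub>F i in sequentially. 2 * \<epsilon> i < d" if "d > 0" for d
    using order_tendstoD(2)[OF tendsto_mult_right_zero[OF \<epsilon>_lim, of 2] that] .
  have lim: "(\<lambda>i. LINT r|I_on T. q r * \<phi> i r) \<longlonglongrightarrow> (LINT r|I_on T. q r * indicator {0<..<t} r)"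
  proof (rule integral_dominated_convergence[where w="\<lambda>r. \<bar>q r\<bar>"])
    have \<phi>c: "continuous_on {0..T} (\<phi> i)" for i
      unfolding \<phi>_def by (intro continuous_intros DERIV_continuous_on[OF has_field_derivative_at_within[OF shift]])
    show "(\<lambda>r. q r * \<phi> i r) \<in> borel_measurable (I_on T)" for i
      by (intro borel_measurable_times borel_measurable_integrable[OF q]
          borel_measurable_integrable[OF continuous_imp_integrable_real[OF \<phi>c]])
    have A: "{0<..<t} \<in> sets (I_on T)" using t0 by (auto simp: sets_restrict_space_iff)
    show "(\<lambda>r. q r * indicator {0<..<t} r) \<in> borel_measurable (I_on T)"
      by (intro borel_measurable_times borel_measurable_integrable[OF q] borel_measurable_indicator A)
    show "integrable (I_on T) (\<lambda>r. \<bar>q r\<bar>)" using q by simp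
    show "AE r in I_on T. norm (q r * \<phi> i r) \<le> \<bar>q r\<bar>" for i
    proof (rule AE_I2)
      fix r
      have "\<bar>\<phi> i r\<bar> \<le> 1" unfolding \<phi>_def using S(7)[of i "r - \<epsilon> i"] S(7)[of i "r - (t - 2 * \<epsilon> i)"] by auto
      then show "norm (q r * \<phi> i r) \<le> \<bar>q r\<bar>" unfolding real_norm_def abs_mult by (intro mult_left_le) auto
    qed
    show "AE r in I_on T. (\<lambda>i. q r * \<phi> i r) \<longlonglongrightarrow> q r * indicator {0<..<t} r"
    proof (rule AE_I2)
      fix r assume "r \<in> space (I_on T)"
      then have r0: "0 \<le> r" by simp
      have "\<forall>\<^sub>F i in sequentially. \<phi> i r = indicator {0<..<t} r"
      proof (cases "r \<in> {0<..<t}")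
        case True
        then have "0 < r" "0 < t - r" by auto
        from ev[OF this(1)] ev[OF this(2)] show ?thesis
        proof eventually_elim
          case (elim i)
          then show ?case using True unfolding \<phi>_def by (simp add: S(4,5))
        qed
      next
        case False
        then have "r = 0 \<or> t \<le> r" using r0 by auto
        then have "\<phi> i r = 0" for i unfolding \<phi>_def using \<epsilon>[of i] by (auto simp: S(4,5))
        then show ?thesis using False by simp
      qed
      then show "(\<lambda>i. q r * \<phi> i r) \<longlonglongrightarrow> q r * indicator {0<..<t} r"
        by (intro tendsto_eventually) (auto elim: eventually_mono)
    qed
  qed
  have val: "(LINT r|I_on T. q r * indicator {0<..<t} r) = (LINT r|I_on t. q r)"
  proof -
    have A: "{0<..<t} \<in> sets (I_on T)" using t0 by (auto simp: sets_restrict_space_iff)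
    have qi: "integrable (I_on T) (\<lambda>r. q r * indicator {0<..<t} r)"
      using integrable_mult_indicator[OF A q] by (simp add: mult.commute)
    have "(LINT r|lebesgue_on {t..T}. q r * indicator {0<..<t} r) = (T - t) * 0"
      by (rule integral_lebesgue_on_const(1)) (use t0 in auto)
    moreover have "(LINT r|I_on t. q r * indicator {0<..<t} r) = (LINT r|I_on t. q r)"
    proof (rule integral_cong_AE_lebesgue_on)
      show "(\<lambda>r. q r * indicator {0<..<t} r) \<in> borel_measurable (I_on t)"
        by (rule borel_measurable_integrable[OF integrable_lebesgue_on_subset[OF qi]]) (use t0 in auto)
      show "AE r in I_on t. q r * indicator {0<..<t} r = q r"
        using AE_lebesgue_on_interior[of 0 t] by eventually_elim simp
    qed simp
    ultimately show ?thesis using integral_lebesgue_on_split[OF qi t0(3,2)] by simp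
  qed
  have "(\<lambda>i. LINT r|I_on T. p r * \<psi> i r) \<longlonglongrightarrow> p 0 - p t"
  proof -
    have near: "(\<lambda>i. LINT r|I_on T. p r * D i (r - c i)) \<longlonglongrightarrow> p z"
      if z: "z \<in> {0..T}" and c: "\<And>i. 0 \<le> c i" "\<And>i. c i + \<epsilon> i \<le> T" "\<And>i r. r \<in> {c i..c i + \<epsilon> i} \<Longrightarrow> \<bar>r - z\<bar> \<le> 2 * \<epsilon> i" for z c
    proof (rule LIMSEQ_I)
      fix e :: real assume e: "e > 0"
      then obtain d where d: "d > 0" "\<And>r. r \<in> {0..T} \<Longrightarrow> dist r z < d \<Longrightarrow> dist (p r) (p z) < e / 2"
        using p z unfolding continuous_on_iff by (metis half_gt_zero)
      obtain i0 where i0: "\<And>i. i \<ge> i0 \<Longrightarrow> 2 * \<epsilon> i < d" using ev[OF d(1)] unfolding eventually_sequentially by blast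
      have "norm ((LINT r|I_on T. p r * D i (r - c i)) - p z) < e" if i: "i \<ge> i0" for i
      proof -
        have "\<bar>(LINT r|I_on T. p r * D i (r - c i)) - p z\<bar> \<le> e / 2"
        proof (rule C1_step_mean[OF S(1,2,3,4,5,6) c(1,2) less_imp_le[OF \<epsilon>(1)] p])
          fix r assume r: "r \<in> {c i..c i + \<epsilon> i}"
          then have "r \<in> {0..T}" using c(1,2)[of i] by auto
          then show "\<bar>p r - p z\<bar> \<le> e / 2" using d(2)[of r] c(3)[OF r] i0[OF i] by (auto simp: dist_norm)
        qed
        then show ?thesis using e by simp
      qed
      then show "\<exists>no. \<forall>n\<ge>no. norm ((LINT r|I_on T. p r * D n (r - c n)) - p z) < e" by blast
    qed
    have 1: "(\<lambda>i. LINT r|I_on T. p r * D i (r - \<epsilon> i)) \<longlonglongrightarrow> p 0"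
      by (rule near) (use \<epsilon> t0 in \<open>auto simp: less_imp_le\<close>, (smt (verit) \<epsilon>)+)
    have 2: "(\<lambda>i. LINT r|I_on T. p r * D i (r - (t - 2 * \<epsilon> i))) \<longlonglongrightarrow> p t"
      by (rule near) (use \<epsilon> t0 in auto, (smt (verit) \<epsilon>)+)
    have "(LINT r|I_on T. p r * \<psi> i r) = (LINT r|I_on T. p r * D i (r - \<epsilon> i)) - (LINT r|I_on T. p r * D i (r - (t - 2 * \<epsilon> i)))" for i
    proof -
      have "integrable (I_on T) (\<lambda>r. p r * D i (r - c))" for c
        by (intro continuous_imp_integrable_real continuous_intros p Dc)
      then show ?thesis unfolding \<psi>_def by (simp add: right_diff_distrib)
    qed
    then show ?thesis using tendsto_diff[OF 1 2] by simp
  qed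
  from tendsto_minus[OF this] have "(\<lambda>i. LINT r|I_on T. q r * \<phi> i r) \<longlonglongrightarrow> - (p 0 - p t)" unfolding eq .
  from LIMSEQ_unique[OF lim this] show ?thesis unfolding val by simp
qed

context gelfand_triple
begin

text \<open>Integration by parts in \<open>W\<close>, obtained by polarising the energy
  identity.\<close>

lemma wtriple_bilinear:
  assumes T: "T \<ge> 0" and 1: "wtriple T u1 y1 g1" and 2: "wtriple T u2 y2 g2"
  shows "u1 T \<bullet> u2 T - u1 0 \<bullet> u2 0 = (LINT t|I_on T. blinfun_apply (g1 t) (y2 t)) + (LINT t|I_on T. blinfun_apply (g2 t) (y1 t))"
proof -
  have L: "y1 \<in> bochner_L2 T" "g1 \<in> bochner_L2 T" "y2 \<in> bochner_L2 T" "g2 \<in> bochner_L2 T"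
    using 1 2 unfolding wtriple_def by auto
  note I = L2_integrable_pairing[OF L(2) L(1)] L2_integrable_pairing[OF L(2) L(3)]
    L2_integrable_pairing[OF L(4) L(1)] L2_integrable_pairing[OF L(4) L(3)]
  have "(LINT t|I_on T. (g1 t - g2 t) (y1 t - y2 t)) =
     (LINT t|I_on T. ((g1 t) (y1 t) - (g1 t) (y2 t)) - ((g2 t) (y1 t) - (g2 t) (y2 t)))"
    by (rule Bochner_Integration.integral_cong) (simp_all add: blinfun.diff_left blinfun.diff_right)
  then have "(LINT t|I_on T. (g1 t - g2 t) (y1 t - y2 t)) = (LINT t|I_on T. (g1 t) (y1 t))
     - (LINT t|I_on T. (g1 t) (y2 t)) - ((LINT t|I_on T. (g2 t) (y1 t)) - (LINT t|I_on T. (g2 t) (y2 t)))"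
    using I by simp
  moreover have "(norm (x - z))\<^sup>2 = (norm x)\<^sup>2 + (norm z)\<^sup>2 - 2 * (x \<bullet> z)" for x z :: 'h
    by (simp add: power2_norm_eq_inner inner_diff_left inner_diff_right inner_commute)
  ultimately show ?thesis
    using wtriple_energy[OF 1 T] wtriple_energy[OF 2 T] wtriple_energy[OF wtriple_diff[OF 1 2] T] by simp
qed

lemma C1c_wtriple:
  assumes T: "T > 0" and v: "v \<in> C1c T"
  shows "wtriple T (\<lambda>t. \<iota> (v t)) v (\<lambda>t. emb (vector_derivative v (at t)))" "v 0 = 0" "v T = 0"
proof -
  from v obtain D where D: "\<And>t. (v has_vector_derivative D t) (at t)" "continuous_on UNIV D"
    unfolding C1c_def C1_differentiable_on_def by blast
  have vD: "vector_derivative v (at t) = D t" for t by (rule vector_derivative_at[OF D(1)])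
  have vc: "continuous_on A v" for A
    by (rule continuous_on_subset[of UNIV]) (auto simp: continuous_on_eq_continuous_at intro: has_vector_derivative_continuous[OF D(1)])
  have Dc: "continuous_on A D" for A using D(2) continuous_on_subset by blast
  from v obtain K where K: "K \<subseteq> {0<..<T}" "\<And>t. t \<notin> K \<Longrightarrow> v t = 0" unfolding C1c_def by blast
  have "0 \<notin> K" "T \<notin> K" using K(1) by auto
  then show "v 0 = 0" "v T = 0" using K(2) by blast+
  show "wtriple T (\<lambda>t. \<iota> (v t)) v (\<lambda>t. emb (vector_derivative v (at t)))"
    unfolding wtriple_def vD
  proof (intro conjI ballI allI)
    show "continuous_on {0..T} (\<lambda>t. \<iota> (v t))" by (intro \<iota>.continuous_on vc)
    show "v \<in> bochner_L2 T" by (intro continuous_bochner_L2 vc)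
    show "(\<lambda>t. emb (D t)) \<in> bochner_L2 T" by (rule L2_bounded_linear[OF continuous_bochner_L2[OF Dc] bounded_linear_emb])
    fix t x assume t: "t \<in> {0..T}"
    have bl: "bounded_linear (\<lambda>z. \<iota> z \<bullet> \<iota> x)"
      by (rule bounded_linear_compose[OF bounded_linear_inner_left \<iota>])
    have "((\<lambda>t. \<iota> (v t) \<bullet> \<iota> x) has_real_derivative \<iota> (D s) \<bullet> \<iota> x) (at s)" for s
      unfolding has_real_derivative_iff_has_vector_derivative by (rule bounded_linear.has_vector_derivative[OF bl D(1)])
    then have "(LINT s|I_on t. \<iota> (D s) \<bullet> \<iota> x) = \<iota> (v t) \<bullet> \<iota> x - \<iota> (v 0) \<bullet> \<iota> x"
      using t by (intro integral_lebesgue_on_FTC bounded_linear.continuous_on[OF bl] Dc) auto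
    then show "(\<iota> (v t) - \<iota> (v 0)) \<bullet> \<iota> x = (LINT s|I_on t. (emb (D s)) x)"
      by (simp add: inner_diff_left)
  qed auto
qed

lemma wtriple_weak_derivative:
  assumes T: "T > 0" and w: "wtriple T u y g"
  shows "is_weak_derivative T \<iota> y g"
  unfolding is_weak_derivative_def dual_pairing_def bochner_L2_inner_def
proof (intro conjI ballI)
  show "g \<in> bochner_L2 T" using w unfolding wtriple_def by blast
  fix v :: "real \<Rightarrow> 'u" assume v: "v \<in> C1c T"
  note vw = C1c_wtriple[OF T v]
  show "(LINT t|I_on T. (g t) (v t)) = - (LINT t|I_on T. \<iota> (y t) \<bullet> \<iota> (vector_derivative v (at t)))"
    using wtriple_bilinear[OF less_imp_le[OF T] w vw(1)] by (simp add: vw(2,3) inner_commute)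
qed

text \<open>Test functions of the form \<phi> x with scalar \<phi> and a fixed vector x reduce the
  weak formulation to the scalar case, applied to the inner product of \<open>u\<close> with the
  image of x.\<close>

lemma weak_derivative_wtriple:
  assumes T: "T > 0" and u: "continuous_on {0..T} u" and y: "y \<in> bochner_L2 T" "AE t in I_on T. \<iota> (y t) = u t"
    and g: "is_weak_derivative T \<iota> y g"
  shows "wtriple T u y g"
  unfolding wtriple_def
proof (intro conjI ballI allI)
  show g2: "g \<in> bochner_L2 T" using g unfolding is_weak_derivative_def by blast
  fix t x assume t: "t \<in> {0..T}"
  have pc: "continuous_on {0..T} (\<lambda>r. u r \<bullet> \<iota> x)" by (intro continuous_intros u)
  have "u t \<bullet> \<iota> x - u 0 \<bullet> \<iota> x = (LINT r|I_on t. (g r) x)"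
  proof (rule du_Bois_Reymond[OF pc _ _ t])
    show "integrable (I_on T) (\<lambda>r. (g r) x)" by (rule integrable_dual_apply[OF g2]) auto
    fix \<phi> D a b
    assume \<phi>: "\<And>r. (\<phi> has_real_derivative D r) (at r)" "continuous_on UNIV D" "0 < a" "b < T" "\<And>r. r \<notin> {a..b} \<Longrightarrow> \<phi> r = (0::real)"
    have vd: "((\<lambda>r. \<phi> r *\<^sub>R x) has_vector_derivative D r *\<^sub>R x) (at r)" for r
      using has_vector_derivative_scaleR[OF \<phi>(1) has_vector_derivative_const[of x]] by simp
    have "(\<lambda>r. \<phi> r *\<^sub>R x) \<in> C1c T"
      unfolding C1c_def C1_differentiable_on_def
    proof (intro CollectI conjI exI)
      show "\<forall>r\<in>UNIV. ((\<lambda>r. \<phi> r *\<^sub>R x) has_vector_derivative D r *\<^sub>R x) (at r)" using vd by blast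
      show "continuous_on UNIV (\<lambda>r. D r *\<^sub>R x)" by (intro continuous_intros \<phi>(2))
      show "compact {a..b}" "{a..b} \<subseteq> {0<..<T}" using \<phi>(3,4) by auto
      show "\<forall>t. t \<notin> {a..b} \<longrightarrow> \<phi> t *\<^sub>R x = 0" using \<phi>(5) by simp
    qed
    then have "(LINT r|I_on T. (g r) (\<phi> r *\<^sub>R x)) = - (LINT r|I_on T. \<iota> (y r) \<bullet> \<iota> (D r *\<^sub>R x))"
      using bspec[OF conjunct2[OF g[unfolded is_weak_derivative_def dual_pairing_def bochner_L2_inner_def]]]
      by (auto simp: vector_derivative_at[OF vd])
    also have "(LINT r|I_on T. \<iota> (y r) \<bullet> \<iota> (D r *\<^sub>R x)) = (LINT r|I_on T. (u r \<bullet> \<iota> x) * D r)"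
    proof (rule integral_cong_AE_lebesgue_on[symmetric])
      show "(\<lambda>r. (u r \<bullet> \<iota> x) * D r) \<in> borel_measurable (I_on T)"
        by (intro borel_measurable_integrable continuous_imp_integrable_real continuous_intros pc continuous_on_subset[OF \<phi>(2)]) auto
      show "AE r in I_on T. (u r \<bullet> \<iota> x) * D r = \<iota> (y r) \<bullet> \<iota> (D r *\<^sub>R x)"
        using y(2) by eventually_elim (simp add: \<iota>.scaleR)
    qed simp
    finally show "(LINT r|I_on T. (g r) x * \<phi> r) = - (LINT r|I_on T. (u r \<bullet> \<iota> x) * D r)"
      by (simp add: blinfun.scaleR_right mult.commute)
  qed
  then show "(u t - u 0) \<bullet> \<iota> x = (LINT r|I_on t. (g r) x)" by (simp add: inner_diff_left)
qed (use u y in auto)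

lemma L2sq_zero_AE:
  assumes "f \<in> bochner_L2 T" "L2sq T f = 0"
  shows "AE t in I_on T. f t = 0"
proof -
  have "AE t in I_on T. (norm (f t))\<^sup>2 = 0"
    using assms(2) integral_nonneg_eq_0_iff_AE[OF L2_integrable[OF assms(1)]] unfolding L2sq_def by simp
  then show ?thesis by simp
qed

text \<open>Testing with the Riesz representative of the difference yields its squared norm. This
  pins down, almost everywhere, the functionals that \<open>form_op\<close> and
  \<open>disc_deriv_hat\<close> choose by their pairings.\<close>

lemma dual_L2_eqI:
  fixes g h :: "real \<Rightarrow> 'u \<Rightarrow>\<^sub>L real"
  assumes g: "g \<in> bochner_L2 T" "h \<in> bochner_L2 T"
    and eq: "\<And>v. v \<in> bochner_L2 T \<Longrightarrow> (LINT t|I_on T. blinfun_apply (g t) (v t)) = (LINT t|I_on T. blinfun_apply (h t) (v t :: 'u))"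
  shows "AE t in I_on T. g t = h t"
proof -
  define d where "d t = g t - h t" for t
  have d: "d \<in> bochner_L2 T" unfolding d_def by (intro L2_diff g)
  have r: "(\<lambda>t. riesz (d t)) \<in> bochner_L2 T" by (rule L2_bounded_linear[OF d bounded_linear_riesz])
  have "L2sq T d = (LINT t|I_on T. (d t) (riesz (d t)))"
    unfolding L2sq_def riesz_inner[symmetric] power2_norm_eq_inner[symmetric] norm_riesz ..
  also have "\<dots> = 0"
    using eq[OF r] L2_integrable_pairing[OF g(1) r] L2_integrable_pairing[OF g(2) r]
    unfolding d_def by (simp add: blinfun.diff_left)
  finally show ?thesis using L2sq_zero_AE[OF d] unfolding d_def by simp
qed

text \<open>Integration by parts shows that the difference of the derivatives annihilates all
  piecewise linear functions, and these are dense in \<open>V\<close>.\<close>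

lemma wtriple_unique:
  assumes T: "T > 0" and 1: "wtriple T u1 y1 g1" and 2: "wtriple T u2 y2 g2" and u: "\<And>t. t \<in> {0..T} \<Longrightarrow> u1 t = u2 t"
    and y: "AE t in I_on T. y1 t = y2 t"
  shows "AE t in I_on T. g1 t = g2 t"
proof -
  define d where "d t = g1 t - g2 t" for t
  have g: "g1 \<in> bochner_L2 T" "g2 \<in> bochner_L2 T" and y2: "y1 \<in> bochner_L2 T" "y2 \<in> bochner_L2 T" using 1 2 unfolding wtriple_def by auto
  have d: "d \<in> bochner_L2 T" unfolding d_def by (intro L2_diff g)
  have w: "wtriple T (\<lambda>t. u1 t - u2 t) (\<lambda>t. y1 t - y2 t) d" unfolding d_def by (rule wtriple_diff[OF 1 2])
  have yd: "(\<lambda>t. y1 t - y2 t) \<in> bochner_L2 T" by (rule L2_diff[OF y2])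
  have pl0: "(LINT t|I_on T. (d t) (partition.pl n \<sigma> x t)) = 0" if p: "partition T n \<sigma>" "n > 0" for n \<sigma> x
  proof -
    have pw: "wtriple T (\<lambda>t. \<iota> (partition.pl n \<sigma> x t)) (partition.pl n \<sigma> x) (\<lambda>t. emb (partition.pd n \<sigma> x t))" by (rule pl_wtriple[OF p])
    have "(LINT t|I_on T. (emb (partition.pd n \<sigma> x t)) (y1 t - y2 t)) = (LINT t|I_on T. 0)"
    proof (rule integral_cong_AE_lebesgue_on)
      show "AE t in I_on T. (emb (partition.pd n \<sigma> x t)) (y1 t - y2 t) = 0" using y by eventually_elim simp
      show "(\<lambda>t. (emb (partition.pd n \<sigma> x t)) (y1 t - y2 t)) \<in> borel_measurable (I_on T)"
        using pw unfolding wtriple_def by (intro borel_measurable_integrable L2_integrable_pairing yd) blast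
    qed simp
    then show ?thesis using wtriple_bilinear[OF less_imp_le[OF T] w pw] u[of 0] u[of T] T by simp
  qed
  show ?thesis
  proof (rule dual_L2_eqI[OF g])
    fix v :: "real \<Rightarrow> 'u" assume v: "v \<in> bochner_L2 T"
    have "\<bar>LINT t|I_on T. (d t) (v t)\<bar> \<le> 0"
    proof (rule field_le_epsilon)
      fix e :: real assume e: "e > 0"
      define e' where "e' = (e / (sqrt (L2sq T d) + 1))\<^sup>2"
      have s: "0 < sqrt (L2sq T d) + 1" using real_sqrt_ge_zero[OF L2sq_nonneg[of T d]] by linarith
      have "e' > 0" unfolding e'_def using e s by simp
      then obtain n \<sigma> x where p: "partition T n \<sigma>" "n > 0" "L2sq T (\<lambda>t. v t - partition.pl n \<sigma> x t) \<le> e'"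
        using L2_pl_dense[OF T v] by blast
      have pl2: "partition.pl n \<sigma> x \<in> bochner_L2 T"
        by (intro continuous_bochner_L2 partition.continuous_pl[OF p(1)])
      have "(LINT t|I_on T. (d t) (v t)) = (LINT t|I_on T. (d t) (v t - partition.pl n \<sigma> x t))"
        using pl0[OF p(1,2), of x] L2_integrable_pairing[OF d v] L2_integrable_pairing[OF d pl2]
        by (simp add: blinfun.diff_right)
      also have "\<bar>\<dots>\<bar> \<le> sqrt (L2sq T d) * sqrt (L2sq T (\<lambda>t. v t - partition.pl n \<sigma> x t))"
        by (rule L2_pairing_bound[OF d L2_diff[OF v pl2]])
      also have "\<dots> \<le> sqrt (L2sq T d) * (e / (sqrt (L2sq T d) + 1))"
        using p(3) e s unfolding e'_def by (intro mult_left_mono real_le_lsqrt) auto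
      also have "\<dots> \<le> e" using e s by (simp add: field_simps)
      finally show "\<bar>LINT t|I_on T. (d t) (v t)\<bar> \<le> 0 + e" by simp
    qed
    then show "(LINT t|I_on T. (g1 t) (v t)) = (LINT t|I_on T. (g2 t) (v t))"
      using L2_integrable_pairing[OF g(1) v] L2_integrable_pairing[OF g(2) v]
      unfolding d_def by (simp add: blinfun.diff_left)
  qed
qed

end

section \<open>Orthonormal bases and projections onto step functions\<close>

lemma finite_orthonormal_basis:
  fixes B :: "'a::real_inner set"
  assumes "finite B"
  obtains C where "finite C" "pairwise orthogonal C" "\<And>c. c \<in> C \<Longrightarrow> norm c = 1" "span C = span B"
proof -
  obtain D where D: "finite D" "span D = span B" "pairwise orthogonal D" using basis_orthogonal[OF assms] by blast
  define C where "C = (\<lambda>c. inverse (norm c) *\<^sub>R c) ` (D - {0})"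
  have "span C = span (D - {0})" unfolding C_def by (rule span_image_scale) (use D(1) in auto)
  then have "span C = span B" using D(2) by (simp add: span_delete_0)
  moreover have "pairwise orthogonal C"
    unfolding C_def pairwise_image
  proof (rule pairwiseI)
    fix x y assume "x \<in> D - {0}" "y \<in> D - {0}" "x \<noteq> y"
    then have "x \<bullet> y = 0" using D(3) unfolding pairwise_def orthogonal_def by blast
    then show "inverse (norm x) *\<^sub>R x \<noteq> inverse (norm y) *\<^sub>R y \<longrightarrow> orthogonal (inverse (norm x) *\<^sub>R x) (inverse (norm y) *\<^sub>R y)"
      by (simp add: orthogonal_def)
  qed
  moreover have "norm c = 1" if c: "c \<in> C" for c
  proof -
    obtain d where "c = inverse (norm d) *\<^sub>R d" "d \<noteq> 0" using c unfolding C_def by blast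
    then show ?thesis by simp
  qed
  moreover have "finite C" unfolding C_def using D(1) by simp
  ultimately show thesis using that by blast
qed

lemma orthonormal_best_approximation:
  fixes C :: "'a::real_inner set"
  assumes C: "finite C" "pairwise orthogonal C" "\<And>c. c \<in> C \<Longrightarrow> norm c = 1" and s: "s \<in> span C"
  shows "norm (x - (\<Sum>c\<in>C. (x \<bullet> c) *\<^sub>R c)) \<le> norm (x - s)"
proof -
  define p where "p = (\<Sum>c\<in>C. (x \<bullet> c) *\<^sub>R c)"
  have "(x - p) \<bullet> d = 0" if d: "d \<in> C" for d
  proof -
    have "p \<bullet> d = (\<Sum>c\<in>C. if c = d then x \<bullet> d else 0)"
      unfolding p_def inner_sum_left
    proof (rule sum.cong)
      fix c assume c: "c \<in> C"
      show "(x \<bullet> c) *\<^sub>R c \<bullet> d = (if c = d then x \<bullet> d else 0)"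
      proof (cases "c = d")
        case True
        then show ?thesis using C(3)[OF d] by (simp add: power2_norm_eq_inner[symmetric])
      next
        case False
        then show ?thesis using C(2) c d unfolding pairwise_def orthogonal_def by simp
      qed
    qed simp
    then show ?thesis using C(1) d by (simp add: inner_diff_left)
  qed
  then have orth: "\<And>y. y \<in> C \<Longrightarrow> orthogonal (x - p) y" unfolding orthogonal_def .
  have "p - s \<in> span C" unfolding p_def by (intro span_diff span_sum span_scale span_base s)
  then have "orthogonal (x - p) (p - s)" by (rule orthogonal_to_span[OF _ orth])
  then have "(norm ((x - p) + (p - s)))\<^sup>2 = (norm (x - p))\<^sup>2 + (norm (p - s))\<^sup>2" by (rule norm_add_Pythagorean)
  then have "(norm (x - p))\<^sup>2 \<le> (norm (x - s))\<^sup>2" by simp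
  then show ?thesis unfolding p_def by (simp add: power2_le_iff_abs_le)
qed

lemma floor_V_step:
  assumes T: "T > 0" "N > 0" and F: "\<And>m. F m \<in> S"
  shows "(\<lambda>t. F (nat \<lfloor>t / (T / real N)\<rfloor>)) \<in> V_step T N S"
proof -
  have k: "T / real N > 0" using T by simp
  show ?thesis
    unfolding V_step_def constant_on_def
  proof (intro CollectI conjI allI impI ballI F)
    fix m :: nat
    show "\<exists>y. \<forall>x\<in>{real m * (T / real N)<..<real (Suc m) * (T / real N)}. F (nat \<lfloor>x / (T / real N)\<rfloor>) = y"
      using nat_floor_in_cell[OF k] by (intro exI[of _ "F m"] ballI) (metis greaterThanLessThan_iff)
  qed
qed

text \<open>Sampling at cell midpoints gives a representative through the floor function, which has
  the measurability and cellwise integration rules already established.\<close>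

lemma V_step_floor:
  assumes T: "T > 0" "N > 0" and S: "0 \<in> S" and q: "q \<in> V_step T N S"
  obtains F where "\<And>m. F m \<in> S" "AE t in I_on T. F (nat \<lfloor>t / (T / real N)\<rfloor>) = q t"
proof -
  define k where "k = T / real N"
  have k: "k > 0" "real N * k = T" unfolding k_def using T by auto
  interpret partition T N "\<lambda>m. real m * k" unfolding k_def by (rule uniform_partition[OF T])
  define F where "F m = (if m < N then q ((real m + 1/2) * k) else 0)" for m
  have mid: "real m * k < (real m + 1/2) * k" "(real m + 1/2) * k < real (Suc m) * k" for m
    using k(1) by (auto intro!: mult_strict_right_mono)
  have "F m \<in> S" for m
  proof (cases "m < N")
    case True
    then have "(real m + 1/2) * k \<in> {0<..<T}" using mid[of m] \<sigma>_bounds[of m] \<sigma>_bounds[of "Suc m"] by auto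
    then show ?thesis using q True unfolding F_def V_step_def by auto
  qed (simp add: F_def S)
  moreover have "AE t in I_on T. F (nat \<lfloor>t / k\<rfloor>) = q t"
    using AE_in_cell
  proof eventually_elim
    case (elim t)
    then obtain m where m: "m < N" "real m * k < t" "t < real (Suc m) * k" by blast
    have "q constant_on {real m * k<..<real (Suc m) * k}" using q m(1) unfolding V_step_def k_def by blast
    then have "q t = q ((real m + 1/2) * k)" unfolding constant_on_def using m mid[of m] by (metis greaterThanLessThan_iff)
    then show ?case using nat_floor_in_cell[OF k(1) m(2,3)] m(1) unfolding F_def by simp
  qed
  ultimately show thesis using that unfolding k_def by blast
qed

context orthonormal_approximation
begin

text \<open>On each cell the projection is \<open>P n\<close> applied to the mean of v. Writing it
  through the coordinates of v avoids integrating vector-valued functions.\<close>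

lemma V_proj_exists:
  assumes T: "T > 0" "N > 0" and v: "v \<in> bochner_L2 T"
  shows "\<exists>p\<in>V_step T N (span (C n)). \<forall>q\<in>V_step T N (span (C n)). bochner_L2_inner T (\<lambda>t. v t - p t) q = 0"
proof -
  define k where "k = T / real N"
  have k: "k > 0" "real N * k = T" unfolding k_def using T by auto
  interpret partition T N "\<lambda>m. real m * k" unfolding k_def by (rule uniform_partition[OF T])
  define p where "p m = (\<Sum>c\<in>C n. ((LINT r|lebesgue_on {real m * k..real (Suc m) * k}. v r \<bullet> c) / k) *\<^sub>R c)" for m
  have pS: "p m \<in> span (C n)" for m unfolding p_def by (intro span_sum span_scale span_base)
  let ?p = "\<lambda>t. p (nat \<lfloor>t / k\<rfloor>)"
  have p2: "?p \<in> bochner_L2 T" by (rule floor_bochner_L2[OF k(1)])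
  have vc: "integrable (I_on T) (\<lambda>r. v r \<bullet> x)" for x
    by (rule L2_integrable_bilinear[OF bounded_bilinear_inner v L2_const])
  show ?thesis
  proof (intro bexI[of _ ?p] ballI)
    show "?p \<in> V_step T N (span (C n))" unfolding k_def by (rule floor_V_step[OF T pS])
    fix q assume q: "q \<in> V_step T N (span (C n))"
    obtain F where F: "\<And>m. F m \<in> span (C n)" "AE t in I_on T. F (nat \<lfloor>t / k\<rfloor>) = q t"
      using V_step_floor[OF T span_zero q] unfolding k_def by blast
    let ?q = "\<lambda>t. F (nat \<lfloor>t / k\<rfloor>)"
    have q2: "?q \<in> bochner_L2 T" by (rule floor_bochner_L2[OF k(1)])
    note int = L2_integrable_bilinear[OF bounded_bilinear_inner v q2]
      L2_integrable_bilinear[OF bounded_bilinear_inner p2 q2]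
    have "bochner_L2_inner T (\<lambda>t. v t - ?p t) q = (LINT t|I_on T. v t \<bullet> ?q t - ?p t \<bullet> ?q t)"
      unfolding bochner_L2_inner_def
    proof (rule integral_cong_AE_lebesgue_on[symmetric])
      show "(\<lambda>t. v t \<bullet> ?q t - ?p t \<bullet> ?q t) \<in> borel_measurable (I_on T)"
        by (intro borel_measurable_integrable Bochner_Integration.integrable_diff int)
      show "AE t in I_on T. v t \<bullet> ?q t - ?p t \<bullet> ?q t = (v t - ?p t) \<bullet> q t"
        using F(2) by eventually_elim (simp add: inner_diff_left)
    qed simp
    also have "\<dots> = (LINT t|I_on T. v t \<bullet> ?q t) - (LINT t|I_on T. ?p t \<bullet> ?q t)" using int by simp
    also have "(LINT t|I_on T. ?p t \<bullet> ?q t) = (\<Sum>m<N. (real (Suc m) * k - real m * k) * (p m \<bullet> F m))"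
      by (rule integrable_cellwise_const(2)) (simp add: nat_floor_in_cell[OF k(1)])
    also have "(LINT t|I_on T. v t \<bullet> ?q t) = (\<Sum>m<N. (real (Suc m) * k - real m * k) * (p m \<bullet> F m))"
      unfolding integral_cells[OF int(1)]
    proof (rule sum.cong)
      fix m assume "m \<in> {..<N}"
      then have m: "m < N" by simp
      let ?L = "lebesgue_on {real m * k..real (Suc m) * k}"
      have "(LINT t|?L. v t \<bullet> ?q t) = (LINT t|?L. (\<Sum>c\<in>C n. (v t \<bullet> c) * (c \<bullet> F m)))"
      proof (rule integral_cong_AE_lebesgue_on)
        show "(\<lambda>t. v t \<bullet> ?q t) \<in> borel_measurable ?L"
          by (rule borel_measurable_integrable[OF integrable_cell[OF int(1) m]])
        show "AE t in ?L. v t \<bullet> ?q t = (\<Sum>c\<in>C n. (v t \<bullet> c) * (c \<bullet> F m))"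
          using AE_lebesgue_on_interior
        proof eventually_elim
          case (elim t)
          have "v t \<bullet> F m = P n (v t) \<bullet> F m" by (rule P_inner[OF F(1), symmetric])
          moreover have "nat \<lfloor>t / k\<rfloor> = m" by (rule nat_floor_in_cell[OF k(1)]) (use elim in auto)
          ultimately show ?case unfolding P_def by (simp add: inner_sum_left)
        qed
      qed simp
      also have "\<dots> = (\<Sum>c\<in>C n. (LINT t|?L. v t \<bullet> c) * (c \<bullet> F m))"
        using integrable_cell[OF vc m] by (simp add: Bochner_Integration.integral_sum del: of_nat_Suc)
      also have "\<dots> = k * (p m \<bullet> F m)" unfolding p_def inner_sum_left sum_distrib_left using k(1) by simp
      finally show "(LINT t|?L. v t \<bullet> ?q t) = (real (Suc m) * k - real m * k) * (p m \<bullet> F m)" by (simp add: algebra_simps)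
    qed simp
    finally show "bochner_L2_inner T (\<lambda>t. v t - ?p t) q = 0" by simp
  qed
qed

end

context gelfand_triple
begin

text \<open>The discrete derivative is constant on cells, so the pointwise projection in
  \<open>dd\<close> already yields the functional that the definition describes through
  \<open>V_proj\<close>; uniqueness of the representing functional identifies the two.\<close>

lemma disc_deriv_hat_dd:
  assumes T: "T > 0" "N > 0"
  shows "disc_deriv_hat T \<iota> N (span (C n)) w \<in> bochner_L2 T"
    "AE t in I_on T. disc_deriv_hat T \<iota> N (span (C n)) w t = dd n (T / real N) w t"
proof -
  let ?S = "span (C n)"
  define k where "k = T / real N"
  have k: "k > 0" unfolding k_def using T by simp
  \<comment> \<open>\<open>Q\<close> represents \<open>dd\<close> in \<open>V\<close> and lies in \<open>V_step\<close>, so \<open>V_proj\<close> can be removed when testing with it\<close>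
  define Q where "Q t = P n (riesz (emb (disc_deriv k w t)))" for t
  have QF: "Q = (\<lambda>t. (\<lambda>m. P n (riesz (emb ((w (Suc m) - w m) /\<^sub>R k)))) (nat \<lfloor>t / k\<rfloor>))"
    unfolding Q_def disc_deriv_def Let_def ..
  have Q: "Q \<in> bochner_L2 T" "Q \<in> V_step T N ?S"
    unfolding QF by (rule floor_bochner_L2[OF k]) (use floor_V_step[OF T P_in_span] in \<open>simp add: k_def\<close>)
  have dd: "(dd n k w t) x = x \<bullet> Q t" for t x
  proof -
    have "(dd n k w t) x = riesz (emb (disc_deriv k w t)) \<bullet> P n x" by simp
    also have "\<dots> = P n x \<bullet> riesz (emb (disc_deriv k w t))" by (rule inner_commute)
    also have "\<dots> = x \<bullet> Q t" unfolding Q_def by (rule P_sym)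
    finally show ?thesis .
  qed
  have spec: "dual_pairing T (dd n k w) v = bochner_L2_inner T (\<lambda>t. \<iota> (disc_deriv k w t)) (\<lambda>t. \<iota> (V_proj T N ?S v t))"
    if v: "v \<in> bochner_L2 T" for v
  proof -
    define p where "p = V_proj T N ?S v"
    have "p \<in> V_step T N ?S \<and> (\<forall>q\<in>V_step T N ?S. bochner_L2_inner T (\<lambda>t. v t - p t) q = 0)"
      unfolding p_def V_proj_def by (rule someI_ex[OF V_proj_exists[OF T v, unfolded Bex_def]])
    then have p: "p \<in> V_step T N ?S" "bochner_L2_inner T (\<lambda>t. v t - p t) Q = 0" using Q(2) by blast+
    obtain F where F: "\<And>m. F m \<in> ?S" "AE t in I_on T. F (nat \<lfloor>t / k\<rfloor>) = p t"
      using V_step_floor[OF T span_zero p(1)] unfolding k_def by blast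
    have p2: "p \<in> bochner_L2 T" by (rule L2_cong_AE[OF floor_bochner_L2[OF k] F(2)])
    note int = L2_integrable_bilinear[OF bounded_bilinear_inner v Q(1)]
      L2_integrable_bilinear[OF bounded_bilinear_inner p2 Q(1)]
    have "dual_pairing T (dd n k w) v = (LINT t|I_on T. v t \<bullet> Q t)" unfolding dual_pairing_def dd ..
    also have "\<dots> = (LINT t|I_on T. p t \<bullet> Q t)"
      using p(2) int unfolding bochner_L2_inner_def by (simp add: inner_diff_left)
    also have "\<dots> = (LINT t|I_on T. \<iota> (disc_deriv k w t) \<bullet> \<iota> (p t))"
    proof (rule integral_cong_AE_lebesgue_on[OF _ borel_measurable_integrable[OF int(2)]])
      show "AE t in I_on T. p t \<bullet> Q t = \<iota> (disc_deriv k w t) \<bullet> \<iota> (p t)"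
        using F(2)
      proof eventually_elim
        case (elim t)
        then have "p t \<in> ?S" using F(1) by metis
        then show ?case unfolding dd[symmetric] by (simp add: P_id)
      qed
    qed simp
    finally show ?thesis unfolding bochner_L2_inner_def p_def .
  qed
  have "disc_deriv_hat T \<iota> N ?S w \<in> bochner_L2 T \<and> (\<forall>v\<in>bochner_L2 T. dual_pairing T (disc_deriv_hat T \<iota> N ?S w) v =
        bochner_L2_inner T (\<lambda>t. \<iota> (disc_deriv k w t)) (\<lambda>t. \<iota> (V_proj T N ?S v t)))"
    unfolding disc_deriv_hat_def k_def
    by (rule someI[of _ "dd n k w"]) (use dd_bochner_L2[OF k] spec in \<open>simp add: k_def\<close>)
  then have hat: "disc_deriv_hat T \<iota> N ?S w \<in> bochner_L2 T" "\<And>v. v \<in> bochner_L2 T \<Longrightarrow> dual_pairing T (disc_deriv_hat T \<iota> N ?S w) v =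
        bochner_L2_inner T (\<lambda>t. \<iota> (disc_deriv k w t)) (\<lambda>t. \<iota> (V_proj T N ?S v t))" by blast+
  show "disc_deriv_hat T \<iota> N ?S w \<in> bochner_L2 T" by (rule hat(1))
  show "AE t in I_on T. disc_deriv_hat T \<iota> N ?S w t = dd n (T / real N) w t"
    unfolding k_def[symmetric]
    by (rule dual_L2_eqI[OF hat(1) dd_bochner_L2[OF k]])
      (use hat(2) spec in \<open>simp add: dual_pairing_def\<close>)
qed

end

context evolution_form
begin

section \<open>Solutions in \<open>W\<close>\<close>

lemma form_op_AA:
  assumes y: "y \<in> bochner_L2 T"
  shows "AE t in I_on T. form_op T a y t = AA t (y t)"
proof -
  have spec: "dual_pairing T (\<lambda>t. AA t (y t)) w = (LINT t|I_on T. a t (y t) (w t))" if w: "w \<in> bochner_L2 T" for w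
    unfolding dual_pairing_def
  proof (rule integral_cong_AE_lebesgue_on)
    show "(\<lambda>t. (AA t (y t)) (w t)) \<in> borel_measurable (I_on T)"
      by (rule borel_measurable_integrable[OF L2_integrable_pairing[OF AA_bochner_L2[OF y] w]])
    show "AE t in I_on T. (AA t (y t)) (w t) = a t (y t) (w t)"
      using AE_regular by eventually_elim (simp add: AA_apply)
  qed simp
  have "form_op T a y \<in> bochner_L2 T \<and> (\<forall>w\<in>bochner_L2 T. dual_pairing T (form_op T a y) w = (LINT t|I_on T. a t (y t) (w t)))"
    unfolding form_op_def by (rule someI[of _ "\<lambda>t. AA t (y t)"]) (use AA_bochner_L2[OF y] spec in blast)
  then show ?thesis
    by (intro dual_L2_eqI AA_bochner_L2[OF y]) (use spec in \<open>auto simp: dual_pairing_def\<close>)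
qed

lemma evolution_solution_evolves:
  fixes \<Phi> :: "'h \<Rightarrow>\<^sub>L 'h"
  assumes u: "evolution_solution T \<iota> a \<Phi> f \<xi> u"
  shows "evolves f u (U_part \<iota> u) (weak_deriv T \<iota> u)"
proof -
  have c: "continuous_on {0..T} u" and r: "AE t in I_on T. u t \<in> range \<iota>" and y: "U_part \<iota> u \<in> bochner_L2 T"
    and ex: "\<exists>g. is_weak_derivative T \<iota> (U_part \<iota> u) g"
    and eq: "AE t in I_on T. weak_deriv T \<iota> u t + form_op T a (U_part \<iota> u) t = f t"
    using u unfolding evolution_solution_def W_space_def by auto
  have "is_weak_derivative T \<iota> (U_part \<iota> u) (weak_deriv T \<iota> u)" unfolding weak_deriv_def by (rule someI_ex[OF ex])
  moreover have "AE t in I_on T. \<iota> (U_part \<iota> u t) = u t"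
    using r by eventually_elim (simp add: U_part_def f_inv_into_f)
  ultimately have "wtriple T u (U_part \<iota> u) (weak_deriv T \<iota> u)" by (intro weak_derivative_wtriple T c y)
  then show ?thesis
    unfolding evolves_def using eq form_op_AA[OF y] by (auto elim: eventually_elim2)
qed

text \<open>The representative is restricted because \<open>W_space\<close> consists of extensional
  functions, and the derivative chosen by \<open>weak_deriv\<close> is recognised as
  \<open>g\<close> by uniqueness.\<close>

lemma evolves_evolution_solution:
  fixes \<Phi> :: "'h \<Rightarrow>\<^sub>L 'h"
  assumes ev: "evolves f u y g" and bc: "u 0 - blinfun_apply \<Phi> (u T) = \<xi>"
  shows "evolution_solution T \<iota> a \<Phi> f \<xi> (restrict u {0..T})"
proof -
  let ?u = "restrict u {0..T}"
  have w: "continuous_on {0..T} u" "y \<in> bochner_L2 T" "AE t in I_on T. \<iota> (y t) = u t"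
    using evolvesD(1)[OF ev] unfolding wtriple_def by auto
  have tT: "AE t in I_on T. t \<in> {0..T}" by (rule AE_I2) simp
  have c: "continuous_on {0..T} ?u" using w(1) by (simp cong: continuous_on_cong_simp)
  have r: "AE t in I_on T. ?u t \<in> range \<iota>" using w(3) tT by eventually_elim (metis rangeI restrict_apply')
  have yU: "AE t in I_on T. y t = U_part \<iota> ?u t"
    using w(3) tT
  proof eventually_elim
    case (elim t)
    then show ?case unfolding U_part_def by (simp flip: elim(1) add: inv_f_f[OF \<iota>_inj])
  qed
  have y: "U_part \<iota> ?u \<in> bochner_L2 T" by (rule L2_cong_AE[OF w(2) yU])
  have yu: "AE t in I_on T. \<iota> (U_part \<iota> ?u t) = ?u t"
    using r by eventually_elim (simp add: U_part_def f_inv_into_f)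
  have wt: "wtriple T ?u (U_part \<iota> ?u) g"
    using evolvesD(1)[OF ev] c y yu T unfolding wtriple_def by auto
  then have ex: "\<exists>g. is_weak_derivative T \<iota> (U_part \<iota> ?u) g" using wtriple_weak_derivative[OF T] by blast
  have "is_weak_derivative T \<iota> (U_part \<iota> ?u) (weak_deriv T \<iota> ?u)" unfolding weak_deriv_def by (rule someI_ex[OF ex])
  then have "wtriple T ?u (U_part \<iota> ?u) (weak_deriv T \<iota> ?u)" by (rule weak_derivative_wtriple[OF T c y yu])
  then have "AE t in I_on T. weak_deriv T \<iota> ?u t = g t" by (rule wtriple_unique[OF T _ wt]) auto
  then have "AE t in I_on T. weak_deriv T \<iota> ?u t + form_op T a (U_part \<iota> ?u) t = f t"
    using form_op_AA[OF y] yU evolvesD(2)[OF ev]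
  proof eventually_elim
    case (elim t)
    show ?case unfolding elim(1,2) elim(3)[symmetric] by (rule elim(4))
  qed
  then show ?thesis
    unfolding evolution_solution_def W_space_def using c r y ex bc T by simp
qed

text \<open>For two solutions the strict contraction from initial to final value and the bound on
  \<Phi> force equal initial values; the energy estimate does the rest.\<close>

lemma evolution_solution_unique:
  fixes \<Phi> :: "'h \<Rightarrow>\<^sub>L 'h"
  assumes \<Phi>: "norm \<Phi> \<le> 1" and 1: "evolution_solution T \<iota> a \<Phi> f \<xi> u1" and 2: "evolution_solution T \<iota> a \<Phi> f \<xi> u2"
  shows "u1 = u2"
proof -
  note ev = evolution_solution_evolves[OF 1] evolution_solution_evolves[OF 2]
  obtain r where r: "r < 1" "norm (u1 T - u2 T) \<le> r * norm (u1 0 - u2 0)"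
    using final_value_contraction ev by metis
  have "u1 0 - u2 0 = \<Phi> (u1 T - u2 T)"
    using 1 2 unfolding evolution_solution_def by (auto simp: blinfun.diff_right algebra_simps)
  then have "norm (u1 0 - u2 0) \<le> norm \<Phi> * norm (u1 T - u2 T)" using norm_blinfun by metis
  also have "\<dots> \<le> 1 * norm (u1 T - u2 T)" by (intro mult_right_mono \<Phi>) simp
  finally have "(1 - r) * norm (u1 0 - u2 0) \<le> 0" using r(2) by (simp add: left_diff_distrib)
  then have zero: "norm (u1 0 - u2 0) = 0" using r(1) by (simp add: mult_le_0_iff)
  have "u1 t = u2 t" if t: "t \<in> {0..T}" for t
  proof -
    have "0 \<le> \<alpha> * L2sq t (\<lambda>t. U_part \<iota> u1 t - U_part \<iota> u2 t)" using \<alpha> by simp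
    moreover have "(norm (u1 t - u2 t))\<^sup>2 + \<alpha> * L2sq t (\<lambda>t. U_part \<iota> u1 t - U_part \<iota> u2 t) \<le> 0"
      using energy_estimate[OF evolves_diff[OF ev] t] unfolding zero by (simp add: L2sq_def)
    ultimately have "(norm (u1 t - u2 t))\<^sup>2 \<le> 0" by linarith
    then show ?thesis by simp
  qed
  moreover have "u1 \<in> extensional {0..T}" "u2 \<in> extensional {0..T}"
    using 1 2 unfolding evolution_solution_def W_space_def by auto
  ultimately show ?thesis by (intro extensionalityI[of _ "{0..T}"]) auto
qed

lemma scheme_ex1:
  fixes \<Phi> :: "'h \<Rightarrow>\<^sub>L 'h"
  assumes \<Phi>: "norm \<Phi> \<le> 1" and f: "f \<in> bochner_L2 T" and \<theta>: "0 \<le> \<theta>" "\<theta> \<le> 1" and N: "N > 0" and nz: "span (C n) \<noteq> {0}"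
    and cfl: "cfl \<theta> (norm \<Phi>) (T / real N) (inverse_const \<iota> (span (C n))) B"
  shows "\<exists>!w. theta_scheme T \<iota> a \<Phi> f \<xi> \<theta> N (span (C n)) w"
proof (rule uniform_stability[OF norm_ge_zero \<Phi> \<theta>, of B])
  interpret D: discrete_evolution C \<iota> T M \<alpha> a N \<theta> by unfold_locales (use N \<theta> in auto)
  fix G assume stab: "\<And>N n. N > 0 \<Longrightarrow> span (C n) \<noteq> {0} \<Longrightarrow>
     cfl \<theta> (norm \<Phi>) (T / real N) (inverse_const \<iota> (span (C n))) B \<Longrightarrow> discrete_evolution.stable \<iota> T a N \<theta> (norm \<Phi>) G (span (C n))"
  show ?thesis by (rule D.theta_scheme_ex1[OF stab[OF N nz cfl] f])
qed

lemma scheme_converges: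
  fixes \<Phi> :: "'h \<Rightarrow>\<^sub>L 'h" and N :: "nat \<Rightarrow> nat"
  assumes \<Phi>: "norm \<Phi> \<le> 1" and f: "f \<in> bochner_L2 T" and u: "evolution_solution T \<iota> a \<Phi> f \<xi> u"
    and N: "\<And>n. N n > 0" "filterlim N at_top sequentially" and \<theta>: "0 \<le> \<theta>" "\<theta> \<le> 1" and nz: "\<And>n. span (C n) \<noteq> {0}"
    and cfl: "\<And>n. cfl \<theta> (norm \<Phi>) (T / real (N n)) (inverse_const \<iota> (span (C n))) B"
    and w: "\<And>n. theta_scheme T \<iota> a \<Phi> f \<xi> \<theta> (N n) (span (C n)) (w n)"
  shows "(\<lambda>n. bochner_L2_norm T (\<lambda>t. weak_deriv T \<iota> u t - disc_deriv_hat T \<iota> (N n) (span (C n)) (w n) t)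
             + bochner_L2_norm T (\<lambda>t. U_part \<iota> u t - step_fun \<theta> (T / real (N n)) (w n) t)
             + (SUP t\<in>{0..T}. norm (u t - \<iota> (step_fun \<theta> (T / real (N n)) (w n) t)))) \<longlonglongrightarrow> 0"
proof (rule tendstoI)
  note ev = evolution_solution_evolves[OF u]
  have bc: "u 0 - \<Phi> (u T) = \<xi>" using u unfolding evolution_solution_def by blast
  fix e :: real assume e: "e > 0"
  \<comment> \<open>\<open>convergence\<close> bounds squares for the two L2 terms and the norm
    itself for the supremum; each of the three summands then is at most e / 4.\<close>
  define d where "d = min ((e / 4)\<^sup>2) (e / 4)"
  have d: "d > 0" "d \<le> (e / 4)\<^sup>2" "d \<le> e / 4" unfolding d_def using e by auto
  show "\<forall>\<^sub>F n in sequentially. dist (bochner_L2_norm T (\<lambda>t. weak_deriv T \<iota> u t - disc_deriv_hat T \<iota> (N n) (span (C n)) (w n) t)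
             + bochner_L2_norm T (\<lambda>t. U_part \<iota> u t - step_fun \<theta> (T / real (N n)) (w n) t)
             + (SUP t\<in>{0..T}. norm (u t - \<iota> (step_fun \<theta> (T / real (N n)) (w n) t)))) 0 < e"
    using convergence[OF \<Phi> f evolvesD(1)[OF ev] evolvesD(2)[OF ev] bc N \<theta> nz cfl w d(1)]
  proof eventually_elim
    case (elim n)
    have small: "sqrt x \<le> e / 4" if "x < d" for x
      using that d(2) e by (intro real_le_lsqrt) auto
    have k: "T / real (N n) > 0" using T N(1)[of n] by simp
    note hat = disc_deriv_hat_dd[OF T N(1)[of n], of n "w n"]
    have "L2sq T (\<lambda>t. weak_deriv T \<iota> u t - disc_deriv_hat T \<iota> (N n) (span (C n)) (w n) t)
        = L2sq T (\<lambda>t. weak_deriv T \<iota> u t - dd n (T / real (N n)) (w n) t)"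
    proof (rule L2sq_cong_AE)
      show "AE t in I_on T. norm (weak_deriv T \<iota> u t - disc_deriv_hat T \<iota> (N n) (span (C n)) (w n) t)
          = norm (weak_deriv T \<iota> u t - dd n (T / real (N n)) (w n) t)"
        using hat(2) by eventually_elim simp
    qed (intro L2_sm L2_diff evolvesD(4)[OF ev] hat(1) dd_bochner_L2[OF k])+
    then have 1: "bochner_L2_norm T (\<lambda>t. weak_deriv T \<iota> u t - disc_deriv_hat T \<iota> (N n) (span (C n)) (w n) t) \<le> e / 4"
      unfolding L2_norm_sqrt using elim small by simp
    have 2: "bochner_L2_norm T (\<lambda>t. U_part \<iota> u t - step_fun \<theta> (T / real (N n)) (w n) t) \<le> e / 4"
      unfolding L2_norm_sqrt using elim small by simp
    have le: "norm (u t - \<iota> (step_fun \<theta> (T / real (N n)) (w n) t)) \<le> e / 4" if "t \<in> {0..T}" for t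
      using elim that d(3) by force
    have 3: "(SUP t\<in>{0..T}. norm (u t - \<iota> (step_fun \<theta> (T / real (N n)) (w n) t))) \<le> e / 4"
      by (rule cSUP_least) (use T le in auto)
    have "0 \<le> norm (u 0 - \<iota> (step_fun \<theta> (T / real (N n)) (w n) 0))" by simp
    also have "\<dots> \<le> (SUP t\<in>{0..T}. norm (u t - \<iota> (step_fun \<theta> (T / real (N n)) (w n) t)))"
      by (rule cSUP_upper) (use T le in \<open>auto intro!: bdd_aboveI[of _ "e / 4"]\<close>)
    finally show ?case
      using 1 2 3 e by (simp add: L2_norm_sqrt)
  qed
qed

end

theorem theorem4p14:
  fixes T M \<alpha> :: real
    and \<iota> :: "'u::{real_inner,banach} \<Rightarrow> 'h::{real_inner,banach}"
    and a :: "real \<Rightarrow> 'u \<Rightarrow> 'u \<Rightarrow> real"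
    and \<Phi> :: "'h \<Rightarrow>\<^sub>L 'h"
    and U :: "nat \<Rightarrow> 'u set"
    and f :: "real \<Rightarrow> 'u \<Rightarrow>\<^sub>L real"
    and \<xi>\<^sub>0 :: 'h
  assumes "T > 0"
    and "bounded_linear \<iota>" "inj \<iota>" "closure (range \<iota>) = UNIV"
    and "\<And>t. t \<in> {0..T} \<Longrightarrow> bilinear (a t)"
    and "\<And>v w. (\<lambda>t. a t v w) \<in> borel_measurable (lebesgue_on {0..T})"
    and "M \<ge> 1"
    and "AE t in lebesgue_on {0..T}. \<forall>v w. \<bar>a t v w\<bar> \<le> M * norm v * norm w"
    and "\<alpha> > 0"
    and "\<And>t v. t \<in> {0..T} \<Longrightarrow> a t v v \<ge> \<alpha> * (norm v)\<^sup>2"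
    and "norm \<Phi> \<le> 1"
    and "\<And>n. subspace (U n)" "\<And>n. \<exists>B. finite B \<and> span B = U n" "\<And>n. U n \<noteq> {0}"
    and "lim_subspaces U"
    and "f \<in> bochner_L2 T"
  shows "(\<exists>!u. evolution_solution T \<iota> a \<Phi> f \<xi>\<^sub>0 u) \<and>
    (\<forall>\<theta> N k \<mu>.
       0 \<le> \<theta> \<and> \<theta> \<le> 1 \<and>
       (\<forall>n. N n > 0) \<and> filterlim N at_top sequentially \<and>
       k = (\<lambda>n. T / real (N n)) \<and> \<mu> = (\<lambda>n. inverse_const \<iota> (U n)) \<and>
       (\<theta> < 1/2 \<longrightarrow> (\<forall>n. k n \<le> \<alpha>\<^sup>2 / (24 * (\<mu> n)\<^sup>2 * M ^ 3 * (1/2 - \<theta>)))) \<and>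
       (\<theta> = 1/2 \<and> norm \<Phi> = 1 \<longrightarrow> bdd_above (range (\<lambda>n. \<mu> n / real (N n))))
       \<longrightarrow>
       (\<forall>n. \<exists>!w. theta_scheme T \<iota> a \<Phi> f \<xi>\<^sub>0 \<theta> (N n) (U n) w) \<and>
       (\<forall>u w. evolution_solution T \<iota> a \<Phi> f \<xi>\<^sub>0 u \<and>
              (\<forall>n. theta_scheme T \<iota> a \<Phi> f \<xi>\<^sub>0 \<theta> (N n) (U n) (w n)) \<longrightarrow>
          (\<lambda>n. bochner_L2_norm T
                 (\<lambda>t. weak_deriv T \<iota> u t - disc_deriv_hat T \<iota> (N n) (U n) (w n) t)
             + bochner_L2_norm T (\<lambda>t. U_part \<iota> u t - step_fun \<theta> (k n) (w n) t)
             + (SUP t\<in>{0..T}. norm (u t - \<iota> (step_fun \<theta> (k n) (w n) t))))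
          \<longlonglongrightarrow> 0))"
proof -
  \<comment> \<open>The locales work with orthonormal bases, so the given subspaces are first
    replaced by spans of such bases.\<close>
  have "\<exists>C. finite C \<and> pairwise orthogonal C \<and> (\<forall>c\<in>C. norm c = 1) \<and> span C = U n" for n
    using finite_orthonormal_basis assms(13)[of n] by metis
  then obtain C where C: "\<And>n. finite (C n)" "\<And>n. pairwise orthogonal (C n)" "\<And>n c. c \<in> C n \<Longrightarrow> norm c = 1"
    and span: "\<And>n. span (C n) = U n" by metis
  have lim: "(\<lambda>n. \<Sum>c\<in>C n. (x \<bullet> c) *\<^sub>R c) \<longlonglongrightarrow> x" for x
  proof -
    obtain y where y: "\<And>n. y n \<in> U n" "y \<longlonglongrightarrow> x" using assms(15) unfolding lim_subspaces_def by blast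
    have "(\<lambda>n. norm (x - (\<Sum>c\<in>C n. (x \<bullet> c) *\<^sub>R c))) \<longlonglongrightarrow> 0"
    proof (rule tendsto_sandwich[OF always_eventually always_eventually tendsto_const])
      \<comment> \<open>The orthogonal projection is the best approximation, hence at least as close
        to x as the sequence supplied by \<open>lim_subspaces\<close>.\<close>
      show "\<forall>n. norm (x - (\<Sum>c\<in>C n. (x \<bullet> c) *\<^sub>R c)) \<le> norm (x - y n)"
        using y(1) by (intro allI orthonormal_best_approximation C) (simp_all add: span)
      show "(\<lambda>n. norm (x - y n)) \<longlonglongrightarrow> 0" using tendsto_norm[OF tendsto_diff[OF tendsto_const y(2), of x]] by simp
    qed simp
    then have "(\<lambda>n. x - (\<Sum>c\<in>C n. (x \<bullet> c) *\<^sub>R c)) \<longlonglongrightarrow> 0" by (rule tendsto_norm_zero_cancel)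
    then show ?thesis using tendsto_diff[OF tendsto_const[of x]] by fastforce
  qed
  interpret evolution_form C \<iota> T M \<alpha> a
    by (intro evolution_form.intro gelfand_triple.intro orthonormal_approximation.intro gelfand_triple_axioms.intro
        evolution_form_axioms.intro C lim assms(1-3,5-10))
  have nz: "span (C n) \<noteq> {0}" for n unfolding span by (rule assms(14))
  have f: "f \<in> bochner_L2 T" and \<Phi>: "norm \<Phi> \<le> 1" using assms(16,11) by auto
  show ?thesis
  proof (intro conjI allI impI)
    obtain u y g where "evolves f u y g" "u 0 - \<Phi> (u T) = \<xi>\<^sub>0"
      using boundary_value_problem[OF assms(4) f \<Phi>] by blast
    then show "\<exists>!u. evolution_solution T \<iota> a \<Phi> f \<xi>\<^sub>0 u"
      using evolves_evolution_solution evolution_solution_unique[OF \<Phi>] by (intro ex1I) blast+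
  next
    fix \<theta> k \<mu> and N :: "nat \<Rightarrow> nat"
    assume H: "0 \<le> \<theta> \<and> \<theta> \<le> 1 \<and>
       (\<forall>n. N n > 0) \<and> filterlim N at_top sequentially \<and>
       k = (\<lambda>n. T / real (N n)) \<and> \<mu> = (\<lambda>n. inverse_const \<iota> (U n)) \<and>
       (\<theta> < 1/2 \<longrightarrow> (\<forall>n. k n \<le> \<alpha>\<^sup>2 / (24 * (\<mu> n)\<^sup>2 * M ^ 3 * (1/2 - \<theta>)))) \<and>
       (\<theta> = 1/2 \<and> norm \<Phi> = 1 \<longrightarrow> bdd_above (range (\<lambda>n. \<mu> n / real (N n))))"
    have \<theta>: "0 \<le> \<theta>" "\<theta> \<le> 1" and N: "\<And>n. N n > 0" "filterlim N at_top sequentially"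
      and k: "k = (\<lambda>n. T / real (N n))" and \<mu>: "\<mu> = (\<lambda>n. inverse_const \<iota> (span (C n)))" using H unfolding span by auto
    have \<mu>0: "\<mu> n > 0" for n unfolding \<mu> by (rule inverse_const_bound(2)[OF \<iota> \<iota>_inj nz])
    obtain b where b: "\<And>n. \<theta> = 1/2 \<Longrightarrow> norm \<Phi> = 1 \<Longrightarrow> \<mu> n / real (N n) \<le> b"
      using H unfolding bdd_above_def by (metis rangeI)
    \<comment> \<open>Positivity of the inverse constant, which rests on the discrete spaces being
      nonzero, permits multiplying out the quotient in the step size condition.\<close>
    have cfl: "cfl \<theta> (norm \<Phi>) (T / real (N n)) (inverse_const \<iota> (span (C n))) (T * b)" for n
      unfolding cfl_def
    proof (intro conjI impI)
      assume t: "\<theta> < 1/2"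
      have pos: "0 < 24 * (\<mu> n)\<^sup>2 * M ^ 3 * (1/2 - \<theta>)" using \<mu>0[of n] M t by simp
      have "k n \<le> \<alpha>\<^sup>2 / (24 * (\<mu> n)\<^sup>2 * M ^ 3 * (1/2 - \<theta>))" using H t by blast
      then have "k n * (24 * (\<mu> n)\<^sup>2 * M ^ 3 * (1/2 - \<theta>)) \<le> \<alpha>\<^sup>2" using pos by (simp only: pos_le_divide_eq)
      then show "T / real (N n) * (inverse_const \<iota> (span (C n)))\<^sup>2 * (24 * M ^ 3 * (1/2 - \<theta>)) \<le> \<alpha>\<^sup>2"
        unfolding k \<mu> by (simp only: mult_ac)
    next
      assume "\<theta> = 1/2 \<and> norm \<Phi> = 1"
      then have "T * (\<mu> n / real (N n)) \<le> T * b" using b T by (intro mult_left_mono) auto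
      then show "T / real (N n) * inverse_const \<iota> (span (C n)) \<le> T * b" unfolding \<mu> by simp
    qed
    show "\<exists>!w. theta_scheme T \<iota> a \<Phi> f \<xi>\<^sub>0 \<theta> (N n) (U n) w" for n
      using scheme_ex1[OF \<Phi> f \<theta> N(1) nz cfl] unfolding span .
    fix u w
    assume uw: "evolution_solution T \<iota> a \<Phi> f \<xi>\<^sub>0 u \<and> (\<forall>n. theta_scheme T \<iota> a \<Phi> f \<xi>\<^sub>0 \<theta> (N n) (U n) (w n))"
    have w: "theta_scheme T \<iota> a \<Phi> f \<xi>\<^sub>0 \<theta> (N n) (span (C n)) (w n)" for n using uw unfolding span by blast
    show "(\<lambda>n. bochner_L2_norm T
                 (\<lambda>t. weak_deriv T \<iota> u t - disc_deriv_hat T \<iota> (N n) (U n) (w n) t)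
             + bochner_L2_norm T (\<lambda>t. U_part \<iota> u t - step_fun \<theta> (k n) (w n) t)
             + (SUP t\<in>{0..T}. norm (u t - \<iota> (step_fun \<theta> (k n) (w n) t)))) \<longlonglongrightarrow> 0"
      using scheme_converges[OF \<Phi> f conjunct1[OF uw] N \<theta> nz cfl w] unfolding span k .
  qed
qed

end
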